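(* Let $(a_t)_{t\geq 0}$ be real numbers with $a_t=o(t)$ and $\lim_{t\to\infty}a_t=\infty$. Then, as $t\to\infty$, $$\mathbb P(M_t\le m_t-a_t)\sim C^{(1)}e^{-\sqrt2\gamma a_t}.$$ Moreover, conditioned on $\{M_t\le m_t-a_t\}$, as $t\to\infty$, $$\left(\frac{\tau-\frac12a_t}{\sqrt{a_t/8}},\ X_\emptyset(\tau)-(\sqrt2\tau-a_t),\ M_t-(m_t-a_t)\right)\Longrightarrow(\xi,-\chi,-E),$$ and jointly, $$\sum_{u\in N(t)}\delta_{X_u(t)-(m_t-a_t)}\Longrightarrow\mathcal E^-,$$ where: $\xi$ and $(\chi,E)$ are independent, $\xi$ is a standard Gaussian random variable, and $E$ is an exponential variable with parameter $\sqrt2\gamma$; the joint law of $(\chi,E)$ is given by $$\mathbb P(\chi\le x,E\ge y)=\frac{1}{2C^{(1)}}e^{-\sqrt2\gamma y}\int_{-\infty}^{x-y}e^{-\sqrt2\gamma z}w(z)^2\,dz,\qquad x\in\mathbb R,\ y\in\mathbb R_+;$$ and $\mathcal E^-:=\sum_{x\in\mathcal E_1\cup\mathcal E_2}\delta_{x-\chi}$ where, given $\chi$, $\mathcal E_1$ and $\mathcal E_2$ are i.i.d. point processes distributed as $\mathcal E$ conditioned on $\{\max\mathcal E\le\chi\}$.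
   Context: Standard binary branching Brownian motion on $\mathbb R$: at time $0$ there is one particle $\emptyset$ at the origin, moving as a standard Brownian motion; after an independent exponential time of parameter $1$ it dies and gives birth to $2$ children at its current position, which move and reproduce independently in the same way. $N(t)$ is the set of particles alive at time $t$; for $u\in N(t)$ and $s\le t$, $X_u(s)$ is the position at time $s$ of $u$ or of its ancestor alive at time $s$. $M_t:=\max\{X_u(t):u\in N(t)\}$. $\tau:=\inf\{t\ge0:\#N(t)\ge2\}$ is the first branching time and $X_\emptyset(\tau)$ is the position of the initial particle at that time. Constants and functions: $\gamma:=\sqrt2-1$; $m_t:=\sqrt2t-\frac{3}{2\sqrt2}\log t$ for $t>0$; $w(z):=\lim_{t\to\infty}\mathbb P(M_t\le m_t+z)$ for $z\in\mathbb R$ (the limit exists by Bramson's theorem); $C^{(1)}:=\frac12\int_{\mathbb R}e^{-\sqrt2\gamma z}w(z)^2\,dz\in(0,\infty)$. $\mathcal E$ is the limiting extremal process of the unconditioned branching Brownian motion, i.e. the point process such that $\left(\sum_{u\in N(t)}\delta_{X_u(t)-m_t},\,M_t-m_t\right)$ converges in law to $(\mathcal E,\max\mathcal E)$ as $t\to\infty$ (existence is known); in particular $\mathbb P(\max\mathcal E\le z)=w(z)$. Here $\max$ of a point process is the position of its largest atom, $\mathcal E_1\cup\mathcal E_2$ is taken with multiplicity, point processes carry the vague topology, $\Longrightarrow$ is convergence in distribution, $f(t)\sim g(t)$ means $f(t)/g(t)\to1$, $a_t=o(t)$ means $a_t/t\to0$ as $t\to\infty$, and $\mathbb R_+=[0,\infty)$.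 *)

theory Defs
  imports "HOL-Probability.Probability"
begin

section \<open>Independence and conditional laws\<close>

text \<open>
  The same notion as \<^const>\<open>prob_space.indep_var\<close>, which however forces both random elements
  to have the same value type.
\<close>

definition indep_rv ::
    "'w measure \<Rightarrow> 'a measure \<Rightarrow> ('w \<Rightarrow> 'a) \<Rightarrow> 'b measure \<Rightarrow> ('w \<Rightarrow> 'b) \<Rightarrow> bool" where
  "indep_rv P S X S' Y \<longleftrightarrow>
     X \<in> measurable P S \<and> Y \<in> measurable P S' \<and>
     prob_space.indep_set P {X -` A \<inter> space P | A. A \<in> sets S} {Y -` A \<inter> space P | A. A \<in> sets S'}"

text \<open>\<open>\<kappa>\<close> is a regular conditional law of \<open>Y\<close> given the real random variable \<open>Z\<close>.\<close>

definition has_conditional_law ::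
    "'w measure \<Rightarrow> ('w \<Rightarrow> real) \<Rightarrow> 'b measure \<Rightarrow> ('w \<Rightarrow> 'b) \<Rightarrow> (real \<Rightarrow> 'b measure) \<Rightarrow> bool" where
  "has_conditional_law Q Z S Y \<kappa> \<longleftrightarrow>
     Z \<in> borel_measurable Q \<and> Y \<in> measurable Q S \<and>
     (\<forall>A\<in>sets S. (\<lambda>z. emeasure (\<kappa> z) A) \<in> borel_measurable (distr Q borel Z)) \<and>
     (\<forall>C\<in>sets borel. \<forall>A\<in>sets S.
        emeasure Q {\<omega> \<in> space Q. Z \<omega> \<in> C \<and> Y \<omega> \<in> A} =
        (\<integral>\<^sup>+\<omega>. indicator C (Z \<omega>) * emeasure (\<kappa> (Z \<omega>)) A \<partial>Q))"


section \<open>Convergence in distribution\<close>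

definition borel_of :: "'a topology \<Rightarrow> 'a measure" where
  "borel_of X = sigma (topspace X) {U. openin X U}"

definition converges_in_law ::
    "'a topology \<Rightarrow> ('i \<Rightarrow> 'a measure) \<Rightarrow> 'a measure \<Rightarrow> 'i filter \<Rightarrow> bool" where
  "converges_in_law X \<mu> \<nu> F \<longleftrightarrow>
     (\<forall>\<^sub>F i in F. prob_space (\<mu> i) \<and> sets (\<mu> i) = sets (borel_of X)) \<and>
     prob_space \<nu> \<and> sets \<nu> = sets (borel_of X) \<and>
     (\<forall>g. continuous_map X euclideanreal g \<and> bounded (g ` topspace X) \<longrightarrow>
        ((\<lambda>i. \<integral>x. g x \<partial>\<mu> i) \<longlongrightarrow> (\<integral>x. g x \<partial>\<nu>)) F)"


section \<open>Point measures on the real line\<close>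

text \<open>Atoms may have multiplicity; every bounded set carries finitely many of them.\<close>

definition point_measures :: "real measure set" where
  "point_measures = {\<mu>. sets \<mu> = sets borel \<and>
     (\<forall>A\<in>sets borel. bounded A \<longrightarrow> emeasure \<mu> A \<in> range of_nat)}"

definition test_functions :: "(real \<Rightarrow> real) set" where
  "test_functions = {f. continuous_on UNIV f \<and> (\<exists>K. compact K \<and> (\<forall>x. x \<notin> K \<longrightarrow> f x = 0))}"

text \<open>The coarsest topology making \<open>\<mu> \<mapsto> \<integral> f d\<mu>\<close> continuous for every test function \<open>f\<close>.\<close>

definition vague_topology :: "real measure topology" where
  "vague_topology = pullback_topology point_measures
     (\<lambda>\<mu>. \<lambda>f\<in>test_functions. \<integral>x. f x \<partial>\<mu>)
     (product_topology (\<lambda>_. euclideanreal) test_functions)"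

definition max_atom :: "real measure \<Rightarrow> real" where
  "max_atom \<mu> = (GREATEST x. 0 < emeasure \<mu> {x})"

text \<open>
  The sum of the Dirac masses at \<open>x u\<close> for \<open>u \<in> I\<close>, as the image of the counting measure on \<open>I\<close>.
  The case of infinite \<open>I\<close> is a convention that keeps the value in \<^const>\<open>point_measures\<close>;
  the population of a branching Brownian motion is infinite only on a null set.
\<close>

definition dirac_sum :: "'u set \<Rightarrow> ('u \<Rightarrow> real) \<Rightarrow> real measure" where
  "dirac_sum I x = (if finite I then distr (count_space I) borel x else null_measure borel)"

definition superposition :: "real measure \<Rightarrow> real measure \<Rightarrow> real measure" where
  "superposition \<mu> \<nu> = measure_of UNIV (sets borel) (\<lambda>A. emeasure \<mu> A + emeasure \<nu> A)"

definition shift_left :: "real \<Rightarrow> real measure \<Rightarrow> real measure" where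
  "shift_left c \<mu> = distr \<mu> borel (\<lambda>x. x - c)"


section \<open>Branching Brownian motion\<close>

text \<open>Processes are indexed by times \<open>s \<ge> 0\<close>; values at negative times are irrelevant.\<close>

definition brownian_motion :: "'w measure \<Rightarrow> (real \<Rightarrow> 'w \<Rightarrow> real) \<Rightarrow> bool" where
  "brownian_motion P W \<longleftrightarrow>
     (\<forall>s\<ge>0. W s \<in> borel_measurable P) \<and>
     (\<forall>\<omega>\<in>space P. W 0 \<omega> = 0 \<and> continuous_on {0..} (\<lambda>s. W s \<omega>)) \<and>
     (\<forall>s t. 0 \<le> s \<and> s < t \<longrightarrow>
        distributed P lborel (\<lambda>\<omega>. W t \<omega> - W s \<omega>) (normal_density 0 (sqrt (t - s)))) \<and>
     (\<forall>n (t :: nat \<Rightarrow> real). 0 \<le> t 0 \<and> (\<forall>i<n. t i \<le> t (Suc i)) \<longrightarrow>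
        prob_space.indep_vars P (\<lambda>_. borel) (\<lambda>i \<omega>. W (t (Suc i)) \<omega> - W (t i) \<omega>) {..<n})"

text \<open>
  Particles carry Ulam--Harris labels, most recent generation first: \<open>[]\<close> is the initial particle
  and \<open>True # u\<close>, \<open>False # u\<close> are the two children of \<open>u\<close>. The lifetime of \<open>u\<close> is \<open>T u\<close> and
  \<open>B u s\<close> is its displacement since birth when it has age \<open>s\<close>.
\<close>

abbreviation path_space :: "(real \<Rightarrow> real) measure" where
  "path_space \<equiv> Pi\<^sub>M {0..} (\<lambda>_. borel)"

definition branching_brownian_motion ::
    "'w measure \<Rightarrow> (bool list \<Rightarrow> 'w \<Rightarrow> real) \<Rightarrow> (bool list \<Rightarrow> real \<Rightarrow> 'w \<Rightarrow> real) \<Rightarrow> bool" where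
  "branching_brownian_motion P T B \<longleftrightarrow>
     prob_space P \<and>
     (\<forall>u. \<forall>\<omega>\<in>space P. 0 < T u \<omega>) \<and>
     (\<forall>u. distributed P lborel (T u) (exponential_density 1)) \<and>
     (\<forall>u. brownian_motion P (B u)) \<and>
     (\<forall>u. indep_rv P borel (T u) path_space (\<lambda>\<omega>. \<lambda>s\<in>{0..}. B u s \<omega>)) \<and>
     prob_space.indep_vars P (\<lambda>_. borel \<Otimes>\<^sub>M path_space)
       (\<lambda>u \<omega>. (T u \<omega>, \<lambda>s\<in>{0..}. B u s \<omega>)) UNIV"

primrec birth_time :: "(bool list \<Rightarrow> 'w \<Rightarrow> real) \<Rightarrow> bool list \<Rightarrow> 'w \<Rightarrow> real" where
  "birth_time T [] \<omega> = 0"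
| "birth_time T (b # u) \<omega> = birth_time T u \<omega> + T u \<omega>"

definition alive :: "(bool list \<Rightarrow> 'w \<Rightarrow> real) \<Rightarrow> real \<Rightarrow> 'w \<Rightarrow> bool list set" where
  "alive T t \<omega> = {u. birth_time T u \<omega> \<le> t \<and> t < birth_time T u \<omega> + T u \<omega>}"

text \<open>
  Position at time \<open>s\<close> of \<open>u\<close> or of its ancestor alive at that time. The trajectory of \<open>u\<close> is
  continued up to and including its death time, where its children start.
\<close>

primrec position ::
    "(bool list \<Rightarrow> 'w \<Rightarrow> real) \<Rightarrow> (bool list \<Rightarrow> real \<Rightarrow> 'w \<Rightarrow> real) \<Rightarrow>
     bool list \<Rightarrow> real \<Rightarrow> 'w \<Rightarrow> real" where
  "position T B [] s \<omega> = B [] s \<omega>"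
| "position T B (b # u) s \<omega> =
     (let \<beta> = birth_time T (b # u) \<omega> in
      if s < \<beta> then position T B u s \<omega>
      else position T B u \<beta> \<omega> + B (b # u) (s - \<beta>) \<omega>)"

definition maximum ::
    "(bool list \<Rightarrow> 'w \<Rightarrow> real) \<Rightarrow> (bool list \<Rightarrow> real \<Rightarrow> 'w \<Rightarrow> real) \<Rightarrow> real \<Rightarrow> 'w \<Rightarrow> real" where
  "maximum T B t \<omega> = Max ((\<lambda>u. position T B u t \<omega>) ` alive T t \<omega>)"

definition first_branching :: "(bool list \<Rightarrow> 'w \<Rightarrow> real) \<Rightarrow> 'w \<Rightarrow> real" where
  "first_branching T \<omega> = Inf {t. 0 \<le> t \<and> 2 \<le> card (alive T t \<omega>)}"

text \<open>The particle configuration at time \<open>t\<close>, seen from \<open>c\<close>.\<close>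

definition particles_from ::
    "(bool list \<Rightarrow> 'w \<Rightarrow> real) \<Rightarrow> (bool list \<Rightarrow> real \<Rightarrow> 'w \<Rightarrow> real) \<Rightarrow>
     real \<Rightarrow> real \<Rightarrow> 'w \<Rightarrow> real measure" where
  "particles_from T B t c \<omega> = dirac_sum (alive T t \<omega>) (\<lambda>u. position T B u t \<omega> - c)"

definition \<gamma> :: real where
  "\<gamma> = sqrt 2 - 1"

definition m :: "real \<Rightarrow> real" where
  "m t = sqrt 2 * t - 3 / (2 * sqrt 2) * ln t"

definition w ::
    "'w measure \<Rightarrow> (bool list \<Rightarrow> 'w \<Rightarrow> real) \<Rightarrow> (bool list \<Rightarrow> real \<Rightarrow> 'w \<Rightarrow> real) \<Rightarrow> real \<Rightarrow> real" where
  "w P T B z = Lim at_top (\<lambda>t. measure P {\<omega> \<in> space P. maximum T B t \<omega> \<le> m t + z})"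

definition C1 ::
    "'w measure \<Rightarrow> (bool list \<Rightarrow> 'w \<Rightarrow> real) \<Rightarrow> (bool list \<Rightarrow> real \<Rightarrow> 'w \<Rightarrow> real) \<Rightarrow> real" where
  "C1 P T B = 1 / 2 * (\<integral>z. exp (- sqrt 2 * \<gamma> * z) * (w P T B z)\<^sup>2 \<partial>lborel)"

text \<open>
  \<open>\<L>\<close> is the law of the limiting extremal process; the convergence determines it uniquely.
\<close>

definition extremal_process_law ::
    "'w measure \<Rightarrow> (bool list \<Rightarrow> 'w \<Rightarrow> real) \<Rightarrow> (bool list \<Rightarrow> real \<Rightarrow> 'w \<Rightarrow> real) \<Rightarrow>
     real measure measure \<Rightarrow> bool" where
  "extremal_process_law P T B \<L> \<longleftrightarrow>
     (let X = prod_topology vague_topology euclideanreal in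
      prob_space \<L> \<and> sets \<L> = sets (borel_of vague_topology) \<and>
      converges_in_law X
        (\<lambda>t. distr P (borel_of X) (\<lambda>\<omega>. (particles_from T B t (m t) \<omega>, maximum T B t \<omega> - m t)))
        (distr \<L> (borel_of X) (\<lambda>\<mu>. (\<mu>, max_atom \<mu>)))
        at_top)"

definition extremal_law_below :: "real measure measure \<Rightarrow> real \<Rightarrow> real measure measure" where
  "extremal_law_below \<L> x = uniform_measure \<L> {\<mu> \<in> space \<L>. max_atom \<mu> \<le> x}"

text \<open>
  The description of the limiting variables. The last two conjuncts spell out their joint law:
  \<open>\<xi>\<close> is independent of everything else, and \<open>-E\<close>, being the limit of the recentred maximum,
  is the largest atom of the limiting point process.
\<close>

definition limit_variables ::
    "'w measure \<Rightarrow> (bool list \<Rightarrow> 'w \<Rightarrow> real) \<Rightarrow> (bool list \<Rightarrow> real \<Rightarrow> 'w \<Rightarrow> real) \<Rightarrow>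
     real measure measure \<Rightarrow> 'v measure \<Rightarrow> ('v \<Rightarrow> real) \<Rightarrow> ('v \<Rightarrow> real) \<Rightarrow> ('v \<Rightarrow> real) \<Rightarrow>
     ('v \<Rightarrow> real measure) \<Rightarrow> ('v \<Rightarrow> real measure) \<Rightarrow> bool" where
  "limit_variables P T B \<L> Q \<xi> chi E \<E>\<^sub>1 \<E>\<^sub>2 \<longleftrightarrow>
     (let V = borel_of vague_topology in
      prob_space Q \<and>
      distributed Q lborel \<xi> std_normal_density \<and>
      distributed Q lborel E (exponential_density (sqrt 2 * \<gamma>)) \<and>
      chi \<in> borel_measurable Q \<and>
      (\<forall>x y. 0 \<le> y \<longrightarrow>
         measure Q {\<omega> \<in> space Q. chi \<omega> \<le> x \<and> y \<le> E \<omega>} =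
         1 / (2 * C1 P T B) * exp (- sqrt 2 * \<gamma> * y) *
         (LINT z:{..x - y}|lborel. exp (- sqrt 2 * \<gamma> * z) * (w P T B z)\<^sup>2)) \<and>
      has_conditional_law Q chi (V \<Otimes>\<^sub>M V) (\<lambda>\<omega>. (\<E>\<^sub>1 \<omega>, \<E>\<^sub>2 \<omega>))
        (\<lambda>x. extremal_law_below \<L> x \<Otimes>\<^sub>M extremal_law_below \<L> x) \<and>
      indep_rv Q borel \<xi> (borel \<Otimes>\<^sub>M borel \<Otimes>\<^sub>M V \<Otimes>\<^sub>M V) (\<lambda>\<omega>. (chi \<omega>, E \<omega>, \<E>\<^sub>1 \<omega>, \<E>\<^sub>2 \<omega>)) \<and>
      (AE \<omega> in Q. - E \<omega> = max_atom (shift_left (chi \<omega>) (superposition (\<E>\<^sub>1 \<omega>) (\<E>\<^sub>2 \<omega>)))))"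

end

theory Submission
  imports Defs
begin

text \<open>
  Everything comes from conditioning on the first branching. Given \<open>\<tau> = s\<close> and
  \<open>X(\<tau>) = x\<close>, the two subtrees are independent copies run for time \<open>t - s\<close>, so up to the
  event \<open>\<tau> > t\<close>, of probability \<open>e\<^sup>-\<^sup>t\<close>, the probability of \<open>M\<^sub>t \<le> m\<^sub>t - a\<close> is the integral of
  \<open>P(M\<^sub>t\<^sub>-\<^sub>s \<le> m\<^sub>t - a - x)\<^sup>2\<close> against \<open>e\<^sup>-\<^sup>s\<close> times the heat kernel. Substituting
  \<open>s = a/2 + \<sigma> \<surd>(a/8)\<close> and \<open>x = \<surd>2 s - a - z\<close> extracts the factor \<open>exp (-\<surd>2 \<gamma> a)\<close>: the
  remaining kernel is the density \<open>(2\<pi>s)\<^sup>-\<^sup>1\<^sup>/\<^sup>2 exp (-(a + z - 2s)\<^sup>2 / (2s))\<close> in \<open>s\<close>, whose total mass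
  is \<open>1/2\<close> for \<open>a + z > 0\<close> and which becomes Gaussian in \<open>\<sigma>\<close>, times \<open>exp (-\<surd>2 \<gamma> z)\<close>. The rest of the integrand
  converges by the given convergence of the extremal process, and an a priori bound
  \<open>P(M\<^sub>t \<le> m\<^sub>t - y) \<le> A (e\<^sup>-\<^sup>y\<^sup>/\<^sup>2 + e\<^sup>-\<^sup>t\<^sup>/\<^sup>2)\<close>, itself obtained by iterating the same recursion,
  allows one to pass to the limit under the integral by the generalised (Pratt) dominated convergence theorem.
\<close>

section \<open>Topologies induced by a map into a metric space\<close>

text \<open>The data P, T, B are arbitrary, so nothing on the sample space expresses that a subtree
  is again such a process; laws are moved to the product space of marks, where a tree is a root mark
  with two grafted independent trees. The vague topology comes without a metric; describing it as
  induced by a map into a metric space gives access to Lipschitz test functions and to product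
  sigma-algebras. A low maximum is not a continuity event a priori, as the limit law of the maximum
  might have atoms; the recursion excludes them because its right-hand side averages over the
  threshold. The rate 1/2 in the a priori bound meets two constraints. Squared,
  \<open>exp (z / 2)\<close> must beat the tilt \<open>exp (- sqrt 2 * \<gamma> * z)\<close> at
  minus infinity, and \<open>sqrt 2 * \<gamma>\<close> = 2 - sqrt 2 is below 1; and the mean of exp
  (sqrt 2 / 2 \<tau> - X / 2) at the branching must be finite, which holds as 1 - sqrt 2 / 2 - 1/8
  is positive. The majorant moves with t in the passage to the limit, because it is the mass of the
  kernel in s that is known exactly, rather than an envelope in s.\<close>

definition induced_by :: "'a topology \<Rightarrow> ('a \<Rightarrow> 'm::topological_space) \<Rightarrow> bool" where
  "induced_by X e \<longleftrightarrow> (\<forall>U. openin X U \<longleftrightarrow> (\<exists>V. open V \<and> U = e -` V \<inter> topspace X))"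

lemma induced_by_euclidean: "induced_by euclidean (\<lambda>x. x)"
  by (auto simp: induced_by_def)

lemma induced_by_continuous_map:
  assumes "induced_by X e"
  shows "continuous_map X euclidean e"
  using assms unfolding induced_by_def continuous_map_alt by (auto simp: open_openin[symmetric])

lemma induced_by_prod:
  assumes X: "induced_by X e" and Y: "induced_by Y f"
  shows "induced_by (prod_topology X Y) (map_prod e f)"
  unfolding induced_by_def
proof (intro allI iffI)
  fix U assume U: "openin (prod_topology X Y) U"
  \<comment> \<open>All boxes with preimage inside U are collected at once, so no box has to be
    chosen for each point of U.\<close>
  define V where "V = \<Union>{A \<times> B |A B. open A \<and> open B \<and>
     (e -` A \<inter> topspace X) \<times> (f -` B \<inter> topspace Y) \<subseteq> U}"
  have "open V"
    unfolding V_def by (rule open_Union) (auto intro: open_Times)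
  moreover have "U = map_prod e f -` V \<inter> topspace (prod_topology X Y)"
  proof (intro set_eqI iffI)
    fix p assume p: "p \<in> U"
    obtain x y where xy: "p = (x, y)" by (cases p)
    from U p obtain A B where AB: "openin X A" "openin Y B" "x \<in> A" "y \<in> B" "A \<times> B \<subseteq> U"
      unfolding openin_prod_topology_alt xy by (elim allE[of _ x] allE[of _ y]) auto
    obtain A' where "open A'" "A = e -` A' \<inter> topspace X" using X AB(1) unfolding induced_by_def by auto
    moreover obtain B' where "open B'" "B = f -` B' \<inter> topspace Y"
      using Y AB(2) unfolding induced_by_def by auto
    ultimately have "(e x, f y) \<in> A' \<times> B'" "A' \<times> B' \<subseteq> V" "x \<in> topspace X" "y \<in> topspace Y"
      using AB unfolding V_def by auto
    then show "p \<in> map_prod e f -` V \<inter> topspace (prod_topology X Y)"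
      using xy by auto
  next
    fix p assume "p \<in> map_prod e f -` V \<inter> topspace (prod_topology X Y)"
    then show "p \<in> U" unfolding V_def by auto
  qed
  ultimately show "\<exists>V. open V \<and> U = map_prod e f -` V \<inter> topspace (prod_topology X Y)" by blast
next
  fix U assume "\<exists>V. open V \<and> U = map_prod e f -` V \<inter> topspace (prod_topology X Y)"
  then obtain V where V: "open V" "U = map_prod e f -` V \<inter> topspace (prod_topology X Y)" by blast
  show "openin (prod_topology X Y) U"
    unfolding openin_prod_topology_alt
  proof (intro allI impI)
    fix x y assume xy: "(x, y) \<in> U"
    then have exy: "(e x, f y) \<in> V" "x \<in> topspace X" "y \<in> topspace Y" unfolding V(2) by simp_all
    obtain A B where AB: "open A" "open B" "(e x, f y) \<in> A \<times> B" "A \<times> B \<subseteq> V"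
      by (rule open_prod_elim[OF V(1) exy(1)])
    show "\<exists>U' V'. openin X U' \<and> openin Y V' \<and> x \<in> U' \<and> y \<in> V' \<and> U' \<times> V' \<subseteq> U"
    proof (intro exI conjI)
      show "openin X (e -` A \<inter> topspace X)" using X AB(1) unfolding induced_by_def by auto
      show "openin Y (f -` B \<inter> topspace Y)" using Y AB(2) unfolding induced_by_def by auto
    qed (use AB exy in \<open>auto simp: V(2)\<close>)
  qed
qed

section \<open>Borel sigma-algebras of induced topologies\<close>

lemma space_borel_of: "space (borel_of X) = topspace X"
  unfolding borel_of_def by (auto simp: space_measure_of_conv)

lemma sets_borel_of: "sets (borel_of X) = sigma_sets (topspace X) {U. openin X U}"
  unfolding borel_of_def by (rule sets_measure_of) (auto dest: openin_subset)

lemma sets_borel_of_euclidean: "sets (borel_of (euclidean :: 'a::topological_space topology)) = sets borel"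
  unfolding sets_borel_of borel_def by (simp add: sets_measure_of open_openin[symmetric])

text \<open>The open sets of X are exactly the preimages of open sets, and these generate; so
  measurability into X reduces to measurability into an ordinary topological type.\<close>

lemma measurable_borel_of_iff:
  fixes e :: "'a \<Rightarrow> 'm::topological_space"
  assumes X: "induced_by X e"
  shows "f \<in> measurable M (borel_of X) \<longleftrightarrow>
    f \<in> space M \<rightarrow> topspace X \<and> (\<lambda>x. e (f x)) \<in> borel_measurable M"
proof safe
  assume f: "f \<in> measurable M (borel_of X)"
  show "f x \<in> topspace X" if "x \<in> space M" for x
    using measurable_space[OF f that] by (simp add: space_borel_of)
  have "e \<in> measurable (borel_of X) borel"
  proof (rule borel_measurableI)
    fix S :: "'m set" assume "open S"
    then have "openin X (e -` S \<inter> topspace X)" using X unfolding induced_by_def by blast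
    then show "e -` S \<inter> space (borel_of X) \<in> sets (borel_of X)"
      unfolding space_borel_of sets_borel_of by auto
  qed
  then show "(\<lambda>x. e (f x)) \<in> borel_measurable M"
    using f by (rule measurable_compose[rotated])
next
  assume f: "f \<in> space M \<rightarrow> topspace X" and m: "(\<lambda>x. e (f x)) \<in> borel_measurable M"
  show "f \<in> measurable M (borel_of X)"
    unfolding borel_of_def
  proof (rule measurable_measure_of)
    show "{U. openin X U} \<subseteq> Pow (topspace X)" by (auto dest: openin_subset)
    fix U assume "U \<in> {U. openin X U}"
    then obtain V where V: "open V" "U = e -` V \<inter> topspace X" using X unfolding induced_by_def by blast
    have "f -` U \<inter> space M = (\<lambda>x. e (f x)) -` V \<inter> space M" using V f by auto
    also have "\<dots> \<in> sets M" using V by (intro measurable_sets[OF m]) auto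
    finally show "f -` U \<inter> space M \<in> sets M" .
  qed (fact f)
qed

lemma continuous_map_borel_of:
  assumes "continuous_map X Y f"
  shows "f \<in> measurable (borel_of X) (borel_of Y)"
  unfolding borel_of_def[of Y]
proof (rule measurable_measure_of)
  show "{U. openin Y U} \<subseteq> Pow (topspace Y)" by (auto dest: openin_subset)
  show "f \<in> space (borel_of X) \<rightarrow> topspace Y"
    using assms by (auto simp: space_borel_of continuous_map_def)
  fix U assume "U \<in> {U. openin Y U}"
  then have "openin X (f -` U \<inter> topspace X)"
    using assms unfolding continuous_map_alt by auto
  then show "f -` U \<inter> space (borel_of X) \<in> sets (borel_of X)"
    unfolding space_borel_of sets_borel_of by auto
qed

lemma continuous_map_borel_measurable:
  fixes f :: "'a \<Rightarrow> 'b::topological_space"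
  assumes "continuous_map X euclidean f"
  shows "f \<in> borel_measurable (borel_of X)"
  using continuous_map_borel_of[OF assms]
  by (simp add: measurable_cong_sets[OF refl sets_borel_of_euclidean])

text \<open>Second countability of the two target types makes a pair of Borel maps Borel into the
  product type. With it both inclusions become measurability of the identity, written once as p and
  once as (fst p, snd p).\<close>

lemma sets_borel_of_prod:
  fixes e :: "'a \<Rightarrow> 'm::second_countable_topology" and f :: "'b \<Rightarrow> 'n::second_countable_topology"
  assumes X: "induced_by X e" and Y: "induced_by Y f"
  shows "sets (borel_of (prod_topology X Y)) = sets (borel_of X \<Otimes>\<^sub>M borel_of Y)"
proof -
  note XY = induced_by_prod[OF X Y]
  have sp: "space (borel_of (prod_topology X Y)) = space (borel_of X \<Otimes>\<^sub>M borel_of Y)"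
    by (simp add: space_borel_of space_pair_measure)
  have 1: "(\<lambda>p. p) \<in> measurable (borel_of X \<Otimes>\<^sub>M borel_of Y) (borel_of (prod_topology X Y))"
  proof -
    have m1: "(\<lambda>p. e (fst p)) \<in> borel_measurable (borel_of X \<Otimes>\<^sub>M borel_of Y)"
      using measurable_borel_of_iff[OF X, of fst "borel_of X \<Otimes>\<^sub>M borel_of Y"] by auto
    have m2: "(\<lambda>p. f (snd p)) \<in> borel_measurable (borel_of X \<Otimes>\<^sub>M borel_of Y)"
      using measurable_borel_of_iff[OF Y, of snd "borel_of X \<Otimes>\<^sub>M borel_of Y"] by auto
    have "(\<lambda>p. (e (fst p), f (snd p))) \<in> borel_measurable (borel_of X \<Otimes>\<^sub>M borel_of Y)"
      using m1 m2 by measurable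
    moreover have "(\<lambda>p. (e (fst p), f (snd p))) = (\<lambda>p. map_prod e f p)" by (auto simp: map_prod_def)
    ultimately show ?thesis
      unfolding measurable_borel_of_iff[OF XY] by (auto simp: space_pair_measure space_borel_of)
  qed
  have "continuous_map (prod_topology X Y) X fst" "continuous_map (prod_topology X Y) Y snd"
    by (auto intro: continuous_map_fst continuous_map_snd)
  from this[THEN continuous_map_borel_of]
  have 2: "(\<lambda>p. (fst p, snd p)) \<in> measurable (borel_of (prod_topology X Y)) (borel_of X \<Otimes>\<^sub>M borel_of Y)"
    by measurable
  show ?thesis
  proof (rule antisym; rule subsetI)
    fix A assume A: "A \<in> sets (borel_of (prod_topology X Y))"
    have "(\<lambda>p. p) -` A \<inter> space (borel_of X \<Otimes>\<^sub>M borel_of Y) = A"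
      using sets.sets_into_space[OF A] sp by auto
    with measurable_sets[OF 1 A] show "A \<in> sets (borel_of X \<Otimes>\<^sub>M borel_of Y)" by simp
  next
    fix A assume A: "A \<in> sets (borel_of X \<Otimes>\<^sub>M borel_of Y)"
    have "(\<lambda>p. (fst p, snd p)) -` A \<inter> space (borel_of (prod_topology X Y)) = A"
      using sets.sets_into_space[OF A] sp by auto
    with measurable_sets[OF 2 A] show "A \<in> sets (borel_of (prod_topology X Y))" by simp
  qed
qed

section \<open>Weak convergence\<close>

definition lipschitz_bdd :: "('m::metric_space \<Rightarrow> real) \<Rightarrow> bool" where
  "lipschitz_bdd h \<longleftrightarrow> bounded (range h) \<and> (\<exists>L\<ge>0. \<forall>x y. \<bar>h x - h y\<bar> \<le> L * dist x y)"

lemma lipschitz_bdd_continuous: "lipschitz_bdd h \<Longrightarrow> continuous_on UNIV h"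
proof -
  assume "lipschitz_bdd h"
  then obtain L where "L \<ge> 0" "\<And>x y. \<bar>h x - h y\<bar> \<le> L * dist x y"
    unfolding lipschitz_bdd_def by blast
  then have "L-lipschitz_on UNIV h"
    by (auto simp: lipschitz_on_def dist_real_def)
  then show ?thesis by (rule lipschitz_on_continuous_on)
qed

lemma lipschitz_bdd_continuous_map:
  assumes "induced_by X e" "lipschitz_bdd h"
  shows "continuous_map X euclideanreal (\<lambda>x. h (e x))"
  using continuous_map_compose[OF induced_by_continuous_map[OF assms(1)], of euclideanreal h]
    lipschitz_bdd_continuous[OF assms(2)] by (simp add: comp_def)

lemma integrable_continuous_map:
  assumes "prob_space \<mu>" "sets \<mu> = sets (borel_of X)"
    "continuous_map X euclideanreal g" "bounded (g ` topspace X)"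
  shows "integrable \<mu> g"
proof -
  interpret prob_space \<mu> by fact
  have sp: "space \<mu> = topspace X"
    using sets_eq_imp_space_eq[OF assms(2)] by (simp add: space_borel_of)
  obtain C where C: "\<And>x. x \<in> topspace X \<Longrightarrow> \<bar>g x\<bar> \<le> C"
    using assms(4) by (auto simp: bounded_iff)
  have "g \<in> borel_measurable \<mu>"
    using continuous_map_borel_measurable[OF assms(3)] by (simp add: measurable_cong_sets[OF assms(2) refl])
  then show ?thesis
    by (intro integrable_const_bound[where B=C]) (auto simp: sp C)
qed

text \<open>
  A bounded continuous function is the increasing limit of its Lipschitz regularisations
  \<open>x \<mapsto> inf\<^sub>y (g y + k d(x, y))\<close>, so Lipschitz test functions give the lower half of the
  convergence; the upper half follows by passing to \<open>-g\<close>.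
\<close>

lemma lipschitz_regularisation:
  fixes e :: "'a \<Rightarrow> 'm::metric_space"
  assumes X: "induced_by X e" and g: "continuous_map X euclideanreal g"
    and C: "\<And>x. x \<in> topspace X \<Longrightarrow> \<bar>g x\<bar> \<le> C" and ne: "topspace X \<noteq> {}"
  shows "\<exists>h. (\<forall>k::nat. lipschitz_bdd (h k) \<and> (\<forall>x. \<bar>h k x\<bar> \<le> C) \<and> (\<forall>x\<in>topspace X. h k (e x) \<le> g x)) \<and>
      (\<forall>x\<in>topspace X. (\<lambda>k. h k (e x)) \<longlonglongrightarrow> g x)"
proof -
  \<comment> \<open>The infimum is bounded above by C on the image of \<open>e\<close> only; the
    minimum with C keeps it bounded at points far from that image.\<close>
  define h where "h = (\<lambda>(k::nat) x. min C (INF y\<in>topspace X. g y + real k * dist x (e y)))"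
  have C0: "0 \<le> C" using C ne by fastforce
  have bd: "bdd_below ((\<lambda>y. g y + real k * dist x (e y)) ` topspace X)" for k x
    by (rule bdd_belowI2[where m="-C"]) (use C in \<open>fastforce intro: add_increasing2\<close>)
  have inf_ge: "- C \<le> (INF y\<in>topspace X. g y + real k * dist x (e y))" for k x
    by (rule cINF_greatest[OF ne]) (use C in \<open>fastforce intro: add_increasing2\<close>)
  have inf_le: "(INF y\<in>topspace X. g y + real k * dist x (e y)) \<le> g y + real k * dist x (e y)"
    if "y \<in> topspace X" for k x y
    using bd that by (rule cINF_lower)
  have hb: "\<bar>h k x\<bar> \<le> C" for k x
    using inf_ge[of k x] C0 by (auto simp: h_def abs_le_iff min_def)
  have lip1: "(INF y\<in>topspace X. g y + real k * dist x (e y)) - real k * dist x x'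
       \<le> (INF y\<in>topspace X. g y + real k * dist x' (e y))" for k x x'
  proof (rule cINF_greatest[OF ne])
    fix y assume y: "y \<in> topspace X"
    have "dist x (e y) \<le> dist x x' + dist x' (e y)" by (rule dist_triangle)
    then have "real k * dist x (e y) \<le> real k * (dist x x' + dist x' (e y))"
      by (rule mult_left_mono) simp
    with inf_le[OF y, of k x]
    show "(INF y\<in>topspace X. g y + real k * dist x (e y)) - real k * dist x x' \<le> g y + real k * dist x' (e y)"
      by (simp add: algebra_simps)
  qed
  have lip: "\<bar>h k x - h k x'\<bar> \<le> real k * dist x x'" for k x x'
    using lip1[of k x x'] lip1[of k x' x] unfolding h_def dist_commute[of x' x]
    by (smt (verit) zero_le_dist mult_nonneg_nonneg of_nat_0_le_iff)
  have le: "h k (e x) \<le> g x" if "x \<in> topspace X" for k x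
    using inf_le[OF that, of k "e x"] unfolding h_def by simp
  have lim: "(\<lambda>k. h k (e x)) \<longlonglongrightarrow> g x" if x: "x \<in> topspace X" for x
    proof (rule LIMSEQ_I)
      fix \<epsilon> :: real assume \<epsilon>: "0 < \<epsilon>"
      have "openin X {y \<in> topspace X. g y \<in> {g x - \<epsilon>/2<..}}"
        using g by (intro openin_continuous_map_preimage[OF g]) auto
      then obtain V where V: "open V" "{y \<in> topspace X. g y \<in> {g x - \<epsilon>/2<..}} = e -` V \<inter> topspace X"
        using X unfolding induced_by_def by blast
      then have "e x \<in> V" using x \<epsilon> by auto
      with \<open>open V\<close> obtain \<delta> where \<delta>: "\<delta> > 0" "\<And>y. dist (e x) y < \<delta> \<Longrightarrow> y \<in> V"
        by (metis open_dist dist_commute)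
      \<comment> \<open>Outside the \<delta>-ball the penalty is at least 2 C, the largest possible
        oscillation of g, so points there cannot push the infimum below g x.\<close>
      obtain K where K: "real K > 2 * C / \<delta>" using reals_Archimedean2 by blast
      show "\<exists>K. \<forall>k\<ge>K. norm (h k (e x) - g x) < \<epsilon>"
      proof (intro exI allI impI)
        fix k assume "k \<ge> K"
        then have k: "real k * \<delta> \<ge> 2 * C" using K \<delta>
          by (smt (verit) divide_less_eq mult_right_mono of_nat_mono)
        have "g x - \<epsilon>/2 \<le> (INF y\<in>topspace X. g y + real k * dist (e x) (e y))"
        proof (rule cINF_greatest[OF ne])
          fix y assume y: "y \<in> topspace X"
          show "g x - \<epsilon>/2 \<le> g y + real k * dist (e x) (e y)"
          proof (cases "dist (e x) (e y) < \<delta>")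
            case True
            then have "g y > g x - \<epsilon>/2" using \<delta> V y by auto
            then show ?thesis by (smt (verit) zero_le_dist mult_nonneg_nonneg of_nat_0_le_iff)
          next
            case False
            then have "real k * \<delta> \<le> real k * dist (e x) (e y)" by (intro mult_left_mono) auto
            with k C[OF x] C[OF y] \<epsilon> show ?thesis by linarith
          qed
        qed
        moreover have "g x \<le> C" using C[OF x] by auto
        ultimately have "g x - \<epsilon>/2 \<le> h k (e x)" unfolding h_def using \<epsilon> by auto
        then show "norm (h k (e x) - g x) < \<epsilon>" using le[OF x, of k] \<epsilon> by auto
      qed
    qed
  have "lipschitz_bdd (h k)" for k
    unfolding lipschitz_bdd_def
  proof (intro conjI)
    show "bounded (range (h k))" using hb by (auto simp: bounded_iff intro!: exI[of _ C])
    show "\<exists>L\<ge>0. \<forall>x y. \<bar>h k x - h k y\<bar> \<le> L * dist x y" using lip by (intro exI[of _ "real k"]) auto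
  qed
  with hb le lim show ?thesis by blast
qed

lemma converges_in_lawI_lipschitz:
  fixes e :: "'a \<Rightarrow> 'm::metric_space"
  assumes X: "induced_by X e"
    and \<mu>: "\<forall>\<^sub>F i in F. prob_space (\<mu> i) \<and> sets (\<mu> i) = sets (borel_of X)"
    and \<nu>: "prob_space \<nu>" "sets \<nu> = sets (borel_of X)"
    and lim: "\<And>h. lipschitz_bdd h \<Longrightarrow> ((\<lambda>i. \<integral>x. h (e x) \<partial>\<mu> i) \<longlongrightarrow> (\<integral>x. h (e x) \<partial>\<nu>)) F"
  shows "converges_in_law X \<mu> \<nu> F"
proof -
  interpret \<nu>: prob_space \<nu> by fact
  have sp\<nu>: "space \<nu> = topspace X"
    using sets_eq_imp_space_eq[OF \<nu>(2)] by (simp add: space_borel_of)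
  then have ne: "topspace X \<noteq> {}" using \<nu>.not_empty by simp
  \<comment> \<open>One Lipschitz minorant, chosen from the limit measure alone, serves for all i at
    once.\<close>
  have lower: "\<forall>\<^sub>F i in F. (\<integral>x. g x \<partial>\<mu> i) > (\<integral>x. g x \<partial>\<nu>) - \<epsilon>"
    if g: "continuous_map X euclideanreal g" and bg: "bounded (g ` topspace X)" and \<epsilon>: "\<epsilon> > 0" for g and \<epsilon> :: real
  proof -
    obtain C where C: "\<And>x. x \<in> topspace X \<Longrightarrow> \<bar>g x\<bar> \<le> C"
      using bg by (auto simp: bounded_iff)
    obtain h where h: "\<And>k::nat. lipschitz_bdd (h k)" "\<And>k x. \<bar>h k x\<bar> \<le> C"
      "\<And>k x. x \<in> topspace X \<Longrightarrow> h k (e x) \<le> g x"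
      "\<And>x. x \<in> topspace X \<Longrightarrow> (\<lambda>k. h k (e x)) \<longlonglongrightarrow> g x"
      using lipschitz_regularisation[OF X g C ne] by metis
    have cont: "continuous_map X euclideanreal (\<lambda>x. h k (e x))" for k
      by (rule lipschitz_bdd_continuous_map[OF X h(1)])
    have bdh: "bounded ((\<lambda>x. h k (e x)) ` topspace X)" for k
      using h(2) by (auto simp: bounded_iff)
    have "(\<lambda>k. \<integral>x. h k (e x) \<partial>\<nu>) \<longlonglongrightarrow> (\<integral>x. g x \<partial>\<nu>)"
    proof (rule integral_dominated_convergence[where w="\<lambda>_. C"])
      show "g \<in> borel_measurable \<nu>"
        using borel_measurable_integrable[OF integrable_continuous_map[OF \<nu> g bg]] .
      show "(\<lambda>x. h k (e x)) \<in> borel_measurable \<nu>" for k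
        using borel_measurable_integrable[OF integrable_continuous_map[OF \<nu> cont bdh]] .
    qed (use h sp\<nu> in auto)
    then have "\<forall>\<^sub>F k in sequentially. (\<integral>x. h k (e x) \<partial>\<nu>) > (\<integral>x. g x \<partial>\<nu>) - \<epsilon>"
      using \<epsilon> by (intro order_tendstoD) auto
    then obtain k where k: "(\<integral>x. h k (e x) \<partial>\<nu>) > (\<integral>x. g x \<partial>\<nu>) - \<epsilon>"
      by (auto simp: eventually_sequentially)
    from order_tendstoD(1)[OF lim[OF h(1)[of k]] k]
    have "\<forall>\<^sub>F i in F. (\<integral>x. h k (e x) \<partial>\<mu> i) > (\<integral>x. g x \<partial>\<nu>) - \<epsilon>" .
    then show ?thesis
      using \<mu>
    proof eventually_elim
      case (elim i)
      then have i: "prob_space (\<mu> i)" "sets (\<mu> i) = sets (borel_of X)" by auto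
      have "(\<integral>x. h k (e x) \<partial>\<mu> i) \<le> (\<integral>x. g x \<partial>\<mu> i)"
      proof (rule integral_mono)
        fix x assume "x \<in> space (\<mu> i)"
        then show "h k (e x) \<le> g x" using h(3)
          by (simp add: sets_eq_imp_space_eq[OF i(2)] space_borel_of)
      qed (intro integrable_continuous_map[OF i] cont bdh g bg)+
      with elim show ?case by linarith
    qed
  qed
  have "((\<lambda>i. \<integral>x. g x \<partial>\<mu> i) \<longlongrightarrow> (\<integral>x. g x \<partial>\<nu>)) F"
    if g: "continuous_map X euclideanreal g" and bg: "bounded (g ` topspace X)" for g
  proof (rule tendstoI)
    fix \<epsilon> :: real assume \<epsilon>: "0 < \<epsilon>"
    have g': "continuous_map X euclideanreal (\<lambda>x. - g x)"
      using g by (intro continuous_intros) auto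
    have bg': "bounded ((\<lambda>x. - g x) ` topspace X)"
      using bg by (auto simp: bounded_iff)
    show "\<forall>\<^sub>F i in F. dist (\<integral>x. g x \<partial>\<mu> i) (\<integral>x. g x \<partial>\<nu>) < \<epsilon>"
      using lower[OF g bg \<epsilon>] lower[OF g' bg' \<epsilon>]
      by eventually_elim (auto simp: dist_real_def)
  qed
  with \<mu> \<nu> show ?thesis unfolding converges_in_law_def by blast
qed

lemma converges_in_lawD:
  "converges_in_law X \<mu> \<nu> F \<Longrightarrow> continuous_map X euclideanreal g \<Longrightarrow> bounded (g ` topspace X) \<Longrightarrow>
    ((\<lambda>i. \<integral>x. g x \<partial>\<mu> i) \<longlongrightarrow> (\<integral>x. g x \<partial>\<nu>)) F"
  unfolding converges_in_law_def by blast

lemma converges_in_law_compose: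
  assumes "converges_in_law X \<mu> \<nu> F" "filterlim r F G"
  shows "converges_in_law X (\<lambda>i. \<mu> (r i)) \<nu> G"
  using assms unfolding converges_in_law_def
  by (auto intro: filterlim_compose eventually_compose_filterlim)

text \<open>
  For a bounded Lipschitz \<open>h\<close> the sections integrated against \<open>\<mu>'\<^sub>n\<close> are equi-Lipschitz, so the
  suprema of their distances to the limit over \<open>n \<ge> N\<close> are again continuous test functions,
  decreasing to \<open>0\<close> with \<open>N\<close>.
\<close>

lemma converges_in_law_pair:
  fixes e :: "'a \<Rightarrow> 'm::{metric_space, second_countable_topology}"
    and f :: "'b \<Rightarrow> 'n::{metric_space, second_countable_topology}"
  assumes X: "induced_by X e" and Y: "induced_by Y f"
    and \<mu>: "converges_in_law X \<mu> \<nu> sequentially" and \<mu>': "converges_in_law Y \<mu>' \<nu>' sequentially"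
  shows "converges_in_law (prod_topology X Y) (\<lambda>n. \<mu> n \<Otimes>\<^sub>M \<mu>' n) (\<nu> \<Otimes>\<^sub>M \<nu>') sequentially"
proof (rule converges_in_lawI_lipschitz[OF induced_by_prod[OF X Y]])
  have setsP: "sets (M \<Otimes>\<^sub>M N) = sets (borel_of (prod_topology X Y))"
    if "sets M = sets (borel_of X)" "sets N = sets (borel_of Y)" for M N
    using sets_pair_measure_cong[OF that] sets_borel_of_prod[OF X Y] by simp
  have ev: "\<forall>\<^sub>F n in sequentially. prob_space (\<mu> n) \<and> sets (\<mu> n) = sets (borel_of X) \<and>
     prob_space (\<mu>' n) \<and> sets (\<mu>' n) = sets (borel_of Y)"
    using \<mu> \<mu>' unfolding converges_in_law_def by (auto elim: eventually_elim2)
  have \<nu>: "prob_space \<nu>" "sets \<nu> = sets (borel_of X)" and \<nu>': "prob_space \<nu>'" "sets \<nu>' = sets (borel_of Y)"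
    using \<mu> \<mu>' unfolding converges_in_law_def by auto
  show "\<forall>\<^sub>F n in sequentially. prob_space (\<mu> n \<Otimes>\<^sub>M \<mu>' n) \<and>
      sets (\<mu> n \<Otimes>\<^sub>M \<mu>' n) = sets (borel_of (prod_topology X Y))"
    using ev by eventually_elim (simp add: prob_space_pair setsP)
  show "prob_space (\<nu> \<Otimes>\<^sub>M \<nu>')" "sets (\<nu> \<Otimes>\<^sub>M \<nu>') = sets (borel_of (prod_topology X Y))"
    using \<nu> \<nu>' by (simp_all add: prob_space_pair setsP)
  fix h :: "'m \<times> 'n \<Rightarrow> real" assume h: "lipschitz_bdd h"
  obtain N0 where N0: "\<And>n. n \<ge> N0 \<Longrightarrow> prob_space (\<mu> n) \<and> sets (\<mu> n) = sets (borel_of X) \<and>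
     prob_space (\<mu>' n) \<and> sets (\<mu>' n) = sets (borel_of Y)"
    using ev by (auto simp: eventually_sequentially)
  obtain C where C: "\<And>p. \<bar>h p\<bar> \<le> C" using h by (auto simp: lipschitz_bdd_def bounded_iff)
  obtain L where L: "L \<ge> 0" "\<And>p q. \<bar>h p - h q\<bar> \<le> L * dist p q" using h by (auto simp: lipschitz_bdd_def)
  have sec: "lipschitz_bdd (\<lambda>y. h (x, y))" for x
    unfolding lipschitz_bdd_def
  proof (intro conjI exI[of _ L] allI)
    show "bounded (range (\<lambda>y. h (x, y)))" using C by (auto simp: bounded_iff)
    show "\<bar>h (x, y) - h (x, z)\<bar> \<le> L * dist y z" for y z using L(2)[of "(x,y)" "(x,z)"] by (simp add: dist_Pair_Pair)
  qed (fact L)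
  have bsec: "bounded ((\<lambda>y. h (x, f y)) ` topspace Y)" for x using C by (auto simp: bounded_iff)
  have intsec: "integrable M (\<lambda>y. h (x, f y))" if "prob_space M" "sets M = sets (borel_of Y)" for M x
    by (intro integrable_continuous_map[OF that] lipschitz_bdd_continuous_map[OF Y sec] bsec)
  define H where "H = (\<lambda>M x. \<integral>y. h (x, f y) \<partial>M)"
  have HC: "\<bar>H M x\<bar> \<le> C" if "prob_space M" "sets M = sets (borel_of Y)" for M x
  proof -
    interpret prob_space M by fact
    have "\<bar>H M x\<bar> \<le> (\<integral>y. \<bar>h (x, f y)\<bar> \<partial>M)" unfolding H_def by (rule integral_abs_bound)
    also have "\<dots> \<le> (\<integral>y. C \<partial>M)"
      by (intro integral_mono integrable_abs intsec[OF that]) (auto simp: C)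
    finally show ?thesis by (simp add: prob_space)
  qed
  have HL: "\<bar>H M x - H M x'\<bar> \<le> L * dist x x'" if "prob_space M" "sets M = sets (borel_of Y)" for M x x'
  proof -
    interpret prob_space M by fact
    have "H M x - H M x' = (\<integral>y. h (x, f y) - h (x', f y) \<partial>M)"
      unfolding H_def by (rule Bochner_Integration.integral_diff[symmetric]; rule intsec[OF that])
    also have "\<bar>\<dots>\<bar> \<le> (\<integral>y. \<bar>h (x, f y) - h (x', f y)\<bar> \<partial>M)" by (rule integral_abs_bound)
    also have "\<dots> \<le> (\<integral>y. L * dist x x' \<partial>M)"
    proof (intro integral_mono integrable_abs Bochner_Integration.integrable_diff intsec[OF that])
      show "\<bar>h (x, f y) - h (x', f y)\<bar> \<le> L * dist x x'" for y
        using L(2)[of "(x, f y)" "(x', f y)"] by (simp add: dist_Pair_Pair)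
    qed auto
    finally show ?thesis by (simp add: prob_space)
  qed
  \<comment> \<open>Indices below N0 are left out, as the measures need not be probabilities there.
    A supremum of equi-Lipschitz functions is again Lipschitz, which makes G N a test function on
    the first factor.\<close>
  define G where "G = (\<lambda>N x. SUP n\<in>{max N N0..}. \<bar>H (\<mu>' n) x - H \<nu>' x\<bar>)"
  have Gbd: "bdd_above ((\<lambda>n. \<bar>H (\<mu>' n) x - H \<nu>' x\<bar>) ` {max N N0..})" for N x
  proof (rule bdd_aboveI2[where M="C + C"])
    fix n assume "n \<in> {max N N0..}"
    with N0[of n] HC[of "\<mu>' n" x] HC[OF \<nu>', of x]
    show "\<bar>H (\<mu>' n) x - H \<nu>' x\<bar> \<le> C + C" by simp
  qed
  have Gge: "\<bar>H (\<mu>' n) x - H \<nu>' x\<bar> \<le> G N x" if "n \<ge> N" "n \<ge> N0" for n N x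
    unfolding G_def by (rule cSUP_upper[OF _ Gbd]) (use that in auto)
  have Gle: "G N x \<le> c" if "\<And>n. n \<ge> N \<Longrightarrow> n \<ge> N0 \<Longrightarrow> \<bar>H (\<mu>' n) x - H \<nu>' x\<bar> \<le> c" for N x c
    unfolding G_def by (rule cSUP_least) (use that in auto)
  have G0: "0 \<le> G N x" for N x using Gge[of N "max N N0" x] by simp
  have GC: "\<bar>G N x\<bar> \<le> C + C" for N x
  proof -
    have "G N x \<le> C + C"
    proof (rule Gle)
      fix n assume "n \<ge> N" "n \<ge> N0"
      with N0[of n] HC[of "\<mu>' n" x] HC[OF \<nu>', of x]
      show "\<bar>H (\<mu>' n) x - H \<nu>' x\<bar> \<le> C + C" by linarith
    qed
    with G0[of N x] show ?thesis by simp
  qed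
  have GL: "G N x - G N x' \<le> (L + L) * dist x x'" for N x x'
  proof -
    have "G N x \<le> G N x' + (L + L) * dist x x'"
    proof (rule Gle)
      fix n assume n: "n \<ge> N" "n \<ge> N0"
      show "\<bar>H (\<mu>' n) x - H \<nu>' x\<bar> \<le> G N x' + (L + L) * dist x x'"
        using Gge[OF n, of x'] HL[of "\<mu>' n" x x'] HL[OF \<nu>', of x x'] N0[OF n(2)]
        by (simp add: algebra_simps)
    qed
    then show ?thesis by simp
  qed
  have lipG: "lipschitz_bdd (G N)" for N
    unfolding lipschitz_bdd_def
  proof (intro conjI exI[of _ "L + L"] allI)
    show "bounded (range (G N))" using GC by (auto simp: bounded_iff intro!: exI[of _ "C + C"])
    show "\<bar>G N x - G N y\<bar> \<le> (L + L) * dist x y" for x y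
      using GL[of N x y] GL[of N y x] by (simp add: dist_commute)
  qed (use L in simp)
  have lipH: "lipschitz_bdd (H \<nu>')"
    unfolding lipschitz_bdd_def using HC[OF \<nu>'] HL[OF \<nu>'] L(1) by (auto simp: bounded_iff)
  have lipHn: "lipschitz_bdd (H (\<mu>' n))" if "n \<ge> N0" for n
    unfolding lipschitz_bdd_def using HC[of "\<mu>' n"] HL[of "\<mu>' n"] L(1) N0[OF that] by (auto simp: bounded_iff)
  have intl: "integrable M (\<lambda>x. k (e x))" if "prob_space M" "sets M = sets (borel_of X)" "lipschitz_bdd k" for M k
    by (intro integrable_continuous_map[OF that(1,2)] lipschitz_bdd_continuous_map[OF X that(3)])
      (use that(3) in \<open>auto simp: lipschitz_bdd_def bounded_iff\<close>)
  have liml: "(\<lambda>n. \<integral>x. k (e x) \<partial>\<mu> n) \<longlonglongrightarrow> (\<integral>x. k (e x) \<partial>\<nu>)" if "lipschitz_bdd k" for k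
    by (intro converges_in_lawD[OF \<mu>] lipschitz_bdd_continuous_map[OF X that])
      (use that in \<open>auto simp: lipschitz_bdd_def bounded_iff\<close>)
  have G_lim: "(\<lambda>N. G N x) \<longlonglongrightarrow> 0" for x
  proof (rule LIMSEQ_I)
    fix \<epsilon> :: real assume \<epsilon>: "0 < \<epsilon>"
    have "(\<lambda>n. H (\<mu>' n) x) \<longlonglongrightarrow> H \<nu>' x"
      unfolding H_def by (intro converges_in_lawD[OF \<mu>'] lipschitz_bdd_continuous_map[OF Y sec] bsec)
    then obtain N where N: "\<And>n. n \<ge> N \<Longrightarrow> \<bar>H (\<mu>' n) x - H \<nu>' x\<bar> < \<epsilon>/2"
      using \<epsilon> by (metis LIMSEQ_D half_gt_zero real_norm_def)
    show "\<exists>N. \<forall>n\<ge>N. norm (G n x - 0) < \<epsilon>"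
    proof (intro exI[of _ N] allI impI)
      fix n assume "n \<ge> N"
      then have "G n x \<le> \<epsilon>/2" by (intro Gle) (use N in \<open>auto intro: less_imp_le\<close>)
      then show "norm (G n x - 0) < \<epsilon>" using G0[of n x] \<epsilon> by simp
    qed
  qed
  have intG: "(\<lambda>N. \<integral>x. G N (e x) \<partial>\<nu>) \<longlonglongrightarrow> (\<integral>x. 0 \<partial>\<nu>)"
  proof (rule integral_dominated_convergence[where w="\<lambda>_. C + C"])
    interpret \<nu>: prob_space \<nu> by (rule \<nu>)
    show "integrable \<nu> (\<lambda>_. C + C)" by simp
    show "(\<lambda>x. G N (e x)) \<in> borel_measurable \<nu>" for N
      by (rule borel_measurable_integrable[OF intl[OF \<nu> lipG]])
  qed (use GC G_lim in auto)
  have iter: "(\<integral>p. h (map_prod e f p) \<partial>(M \<Otimes>\<^sub>M N)) = (\<integral>x. H N (e x) \<partial>M)"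
    if M: "prob_space M" "sets M = sets (borel_of X)" and N: "prob_space N" "sets N = sets (borel_of Y)" for M N
  proof -
    interpret M: prob_space M by fact
    interpret N: prob_space N by fact
    interpret pair_sigma_finite M N ..
    have "integrable (M \<Otimes>\<^sub>M N) (\<lambda>p. h (map_prod e f p))"
      by (intro integrable_continuous_map[OF prob_space_pair[OF M(1) N(1)] setsP[OF M(2) N(2)]]
          lipschitz_bdd_continuous_map[OF induced_by_prod[OF X Y] h])
        (use C in \<open>auto simp: bounded_iff\<close>)
    from integral_fst'[OF this] show ?thesis by (simp add: H_def)
  qed
  have main: "\<bar>(\<integral>x. H (\<mu>' n) (e x) \<partial>\<mu> n) - (\<integral>x. H \<nu>' (e x) \<partial>\<nu>)\<bar> \<le>
      (\<integral>x. G N (e x) \<partial>\<mu> n) + \<bar>(\<integral>x. H \<nu>' (e x) \<partial>\<mu> n) - (\<integral>x. H \<nu>' (e x) \<partial>\<nu>)\<bar>"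
    if n: "n \<ge> N" "n \<ge> N0" for n N
  proof -
    have m: "prob_space (\<mu> n)" "sets (\<mu> n) = sets (borel_of X)" using N0[OF n(2)] by auto
    have "\<bar>(\<integral>x. H (\<mu>' n) (e x) \<partial>\<mu> n) - (\<integral>x. H \<nu>' (e x) \<partial>\<mu> n)\<bar>
       = \<bar>\<integral>x. H (\<mu>' n) (e x) - H \<nu>' (e x) \<partial>\<mu> n\<bar>"
      using intl[OF m lipHn[OF n(2)]] intl[OF m lipH] by simp
    also have "\<dots> \<le> (\<integral>x. \<bar>H (\<mu>' n) (e x) - H \<nu>' (e x)\<bar> \<partial>\<mu> n)" by (rule integral_abs_bound)
    also have "\<dots> \<le> (\<integral>x. G N (e x) \<partial>\<mu> n)"
      by (intro integral_mono integrable_abs Bochner_Integration.integrable_diff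
          intl[OF m lipHn[OF n(2)]] intl[OF m lipH] intl[OF m lipG] Gge n)
    finally show ?thesis by linarith
  qed
  have "(\<lambda>n. \<integral>x. H (\<mu>' n) (e x) \<partial>\<mu> n) \<longlonglongrightarrow> (\<integral>x. H \<nu>' (e x) \<partial>\<nu>)"
  proof (rule tendstoI)
    fix \<epsilon> :: real assume \<epsilon>: "0 < \<epsilon>"
    from intG have "\<forall>\<^sub>F N in sequentially. (\<integral>x. G N (e x) \<partial>\<nu>) < \<epsilon>/2"
      using \<epsilon> by (intro order_tendstoD) auto
    then obtain N where N: "(\<integral>x. G N (e x) \<partial>\<nu>) < \<epsilon>/2" by (auto simp: eventually_sequentially)
    have 1: "\<forall>\<^sub>F n in sequentially. (\<integral>x. G N (e x) \<partial>\<mu> n) < \<epsilon>/2"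
      using order_tendstoD(2)[OF liml[OF lipG] N] .
    have 2: "\<forall>\<^sub>F n in sequentially. dist (\<integral>x. H \<nu>' (e x) \<partial>\<mu> n) (\<integral>x. H \<nu>' (e x) \<partial>\<nu>) < \<epsilon>/2"
      using tendstoD[OF liml[OF lipH], of "\<epsilon>/2"] \<epsilon> by simp
    show "\<forall>\<^sub>F n in sequentially. dist (\<integral>x. H (\<mu>' n) (e x) \<partial>\<mu> n) (\<integral>x. H \<nu>' (e x) \<partial>\<nu>) < \<epsilon>"
      using 1 2 eventually_ge_at_top[of N] eventually_ge_at_top[of N0]
    proof eventually_elim
      case (elim n)
      with main[of N n] show ?case by (simp add: dist_real_def)
    qed
  qed
  moreover have "\<forall>\<^sub>F n in sequentially. (\<integral>x. H (\<mu>' n) (e x) \<partial>\<mu> n) =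
      (\<integral>p. h (map_prod e f p) \<partial>(\<mu> n \<Otimes>\<^sub>M \<mu>' n))"
    using ev by eventually_elim (simp add: iter)
  ultimately show "(\<lambda>n. \<integral>p. h (map_prod e f p) \<partial>(\<mu> n \<Otimes>\<^sub>M \<mu>' n)) \<longlonglongrightarrow> (\<integral>p. h (map_prod e f p) \<partial>(\<nu> \<Otimes>\<^sub>M \<nu>'))"
    unfolding iter[OF \<nu> \<nu>'] by (rule Lim_transform_eventually)
qed

text \<open>A mapping theorem for one discontinuous factor: the indicator can jump on c = 0 only, a
  null set of the limit. It is replaced by a ramp, and the error is bounded by a bump around c = 0
  that is itself a test function, so that its integral under \<mu> i is controlled by the one under
  the limit.\<close>

lemma converges_in_law_integral_le0:
  assumes \<mu>: "converges_in_law X \<mu> \<nu> F"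
    and H: "continuous_map X euclideanreal H" "bounded (H ` topspace X)"
    and c: "continuous_map X euclideanreal c" and c0: "AE x in \<nu>. c x \<noteq> 0"
  shows "((\<lambda>i. \<integral>x. H x * of_bool (c x \<le> 0) \<partial>\<mu> i) \<longlongrightarrow> (\<integral>x. H x * of_bool (c x \<le> (0::real)) \<partial>\<nu>)) F"
proof -
  have ev: "\<forall>\<^sub>F i in F. prob_space (\<mu> i) \<and> sets (\<mu> i) = sets (borel_of X)"
    and \<nu>: "prob_space \<nu>" "sets \<nu> = sets (borel_of X)"
    using \<mu> unfolding converges_in_law_def by auto
  interpret \<nu>: prob_space \<nu> by (rule \<nu>)
  obtain C where C: "\<And>x. x \<in> topspace X \<Longrightarrow> \<bar>H x\<bar> \<le> C" using H(2) by (auto simp: bounded_iff)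
  have C0: "C \<ge> 0"
    using C \<nu>.not_empty sets_eq_imp_space_eq[OF \<nu>(2)] unfolding space_borel_of by fastforce
  \<comment> \<open>For n > 0 the ramp k n falls from 1 to 0 as c passes from 0 to 1/n, and the tent
    b n of half-width 1/n around c = 0 bounds its distance to the indicator.\<close>
  define k where "k = (\<lambda>(n::nat) x. max 0 (min 1 (1 - real n * c x)))"
  define b where "b = (\<lambda>(n::nat) x. max 0 (1 - real n * \<bar>c x\<bar>))"
  have kcont: "continuous_map X euclideanreal (k n)" "bounded (k n ` topspace X)" for n
    unfolding k_def using c by (auto intro!: continuous_intros simp: bounded_iff intro!: exI[of _ 1])
  have bcont: "continuous_map X euclideanreal (b n)" for n
    unfolding b_def using c by (auto intro!: continuous_intros)
  have b01: "0 \<le> b n x" "b n x \<le> 1" for n x unfolding b_def by auto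
  have bbd: "bounded (b n ` topspace X)" for n
    using b01 by (auto simp: bounded_iff intro!: exI[of _ 1])
  have Hk: "continuous_map X euclideanreal (\<lambda>x. H x * k n x)" "bounded ((\<lambda>x. H x * k n x) ` topspace X)" for n
  proof -
    show "continuous_map X euclideanreal (\<lambda>x. H x * k n x)" using H kcont by (intro continuous_intros)
    have "\<bar>H x * k n x\<bar> \<le> C * 1" if "x \<in> topspace X" for x
      unfolding abs_mult using C[OF that] C0 by (intro mult_mono) (auto simp: k_def)
    then show "bounded ((\<lambda>x. H x * k n x) ` topspace X)" by (auto simp: bounded_iff intro!: exI[of _ C])
  qed
  have diff: "\<bar>H x * k n x - H x * of_bool (c x \<le> 0)\<bar> \<le> C * b n x" if "x \<in> topspace X" for n x
  proof -
    have "\<bar>k n x - of_bool (c x \<le> 0)\<bar> \<le> b n x"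
      unfolding k_def b_def using mult_nonneg_nonpos[of "real n" "c x"]
      by (cases "c x \<le> 0") auto
    then have "\<bar>H x\<bar> * \<bar>k n x - of_bool (c x \<le> 0)\<bar> \<le> C * b n x"
      using C[OF that] C0 by (intro mult_mono) auto
    then show ?thesis by (simp add: abs_mult[symmetric] algebra_simps)
  qed
  have meas: "(\<lambda>x. H x * of_bool (c x \<le> 0)) \<in> borel_measurable M" if "sets M = sets (borel_of X)" for M
  proof -
    have [measurable]: "H \<in> borel_measurable M" "c \<in> borel_measurable M"
      using continuous_map_borel_measurable[OF H(1)] continuous_map_borel_measurable[OF c]
      by (simp_all add: measurable_cong_sets[OF that refl])
    show ?thesis by measurable
  qed
  have int: "integrable M (\<lambda>x. H x * of_bool (c x \<le> 0))" if M: "prob_space M" "sets M = sets (borel_of X)" for M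
  proof -
    interpret prob_space M by fact
    show ?thesis
    proof (rule integrable_const_bound[where B=C])
      show "AE x in M. norm (H x * of_bool (c x \<le> 0)) \<le> C"
        using C C0 sets_eq_imp_space_eq[OF M(2)] by (auto simp: space_borel_of)
    qed (rule meas[OF M(2)])
  qed
  have approx: "\<bar>(\<integral>x. H x * k n x \<partial>M) - (\<integral>x. H x * of_bool (c x \<le> 0) \<partial>M)\<bar> \<le> C * (\<integral>x. b n x \<partial>M)"
    if M: "prob_space M" "sets M = sets (borel_of X)" for M n
  proof -
    have ib: "integrable M (b n)" by (rule integrable_continuous_map[OF M bcont bbd])
    have iH: "integrable M (\<lambda>x. H x * k n x)" by (rule integrable_continuous_map[OF M Hk])
    have "\<bar>(\<integral>x. H x * k n x \<partial>M) - (\<integral>x. H x * of_bool (c x \<le> 0) \<partial>M)\<bar>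
       = \<bar>\<integral>x. H x * k n x - H x * of_bool (c x \<le> 0) \<partial>M\<bar>" using iH int[OF M] by simp
    also have "\<dots> \<le> (\<integral>x. \<bar>H x * k n x - H x * of_bool (c x \<le> 0)\<bar> \<partial>M)" by (rule integral_abs_bound)
    also have "\<dots> \<le> (\<integral>x. C * b n x \<partial>M)"
      using ib iH int[OF M] diff sets_eq_imp_space_eq[OF M(2)]
      by (intro integral_mono integrable_abs) (auto simp: space_borel_of)
    finally show ?thesis using ib by simp
  qed
  have "(\<lambda>n. \<integral>x. b n x \<partial>\<nu>) \<longlonglongrightarrow> (\<integral>x. 0 \<partial>\<nu>)"
  proof (rule integral_dominated_convergence[where w="\<lambda>_. 1"])
    show "b n \<in> borel_measurable \<nu>" for n
      by (rule borel_measurable_integrable[OF integrable_continuous_map[OF \<nu> bcont bbd]])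
    show "AE x in \<nu>. (\<lambda>n. b n x) \<longlonglongrightarrow> 0"
      using c0
    proof eventually_elim
      case (elim x)
      obtain N where N: "real N * \<bar>c x\<bar> > 1" using reals_Archimedean3[of "\<bar>c x\<bar>"] elim by auto
      have "b n x = 0" if "n \<ge> N" for n
      proof -
        have "real N * \<bar>c x\<bar> \<le> real n * \<bar>c x\<bar>" using that by (intro mult_right_mono) auto
        with N show ?thesis unfolding b_def by simp
      qed
      then show ?case by (intro tendsto_eventually eventually_sequentiallyI[of N])
    qed
  qed (use b01 in auto)
  then have b_lim: "(\<lambda>n. C * (\<integral>x. b n x \<partial>\<nu>)) \<longlonglongrightarrow> 0" by (auto intro: tendsto_mult_right_zero)
  show ?thesis
  proof (rule tendstoI)
    fix \<epsilon> :: real assume \<epsilon>: "0 < \<epsilon>"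
    from b_lim have "\<forall>\<^sub>F n in sequentially. C * (\<integral>x. b n x \<partial>\<nu>) < \<epsilon>/4"
      using \<epsilon> by (intro order_tendstoD) auto
    then obtain n where n: "C * (\<integral>x. b n x \<partial>\<nu>) < \<epsilon>/4" by (auto simp: eventually_sequentially)
    have 1: "\<forall>\<^sub>F i in F. C * (\<integral>x. b n x \<partial>\<mu> i) < \<epsilon>/4"
      using order_tendstoD(2)[OF tendsto_mult_left[OF converges_in_lawD[OF \<mu> bcont bbd]] n] .
    have 2: "\<forall>\<^sub>F i in F. dist (\<integral>x. H x * k n x \<partial>\<mu> i) (\<integral>x. H x * k n x \<partial>\<nu>) < \<epsilon>/4"
      using tendstoD[OF converges_in_lawD[OF \<mu> Hk], of "\<epsilon>/4"] \<epsilon> by simp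
    show "\<forall>\<^sub>F i in F. dist (\<integral>x. H x * of_bool (c x \<le> 0) \<partial>\<mu> i) (\<integral>x. H x * of_bool (c x \<le> 0) \<partial>\<nu>) < \<epsilon>"
      using 1 2 ev
    proof eventually_elim
      case (elim i)
      with approx[of "\<mu> i" n] approx[OF \<nu>, of n] n show ?case unfolding dist_real_def by linarith
    qed
  qed
qed

section \<open>The vague topology on point measures\<close>

text \<open>Hat function at the dyadic point \<open>snd i / 2 ^ fst i\<close>. The hats of one level
  form a partition of unity and interpolate linearly.\<close>

definition tent :: "nat \<times> int \<Rightarrow> real \<Rightarrow> real" where
  "tent i x = max 0 (1 - \<bar>2 ^ fst i * x - real_of_int (snd i)\<bar>)"

text \<open>The index set is countable, so the target
  \<open>nat \<times> int \<Rightarrow> real\<close> is a second countable metric space; this map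
  supplies all metric arguments about point measures.\<close>

definition tents :: "real measure \<Rightarrow> (nat \<times> int) \<Rightarrow> real" where
  "tents \<mu> i = (\<integral>x. tent i x \<partial>\<mu>)"

lemma tent_nonneg: "0 \<le> tent i x" and tent_le_1: "tent i x \<le> 1"
  by (auto simp: tent_def)

lemma tent_continuous [continuous_intros]: "continuous_on S (tent i)"
  unfolding tent_def by (intro continuous_intros)

lemma tent_measurable [measurable]: "tent i \<in> borel_measurable borel"
  by (intro borel_measurable_continuous_onI continuous_intros)

lemma tent_eq_0:
  assumes "x \<notin> {(real_of_int (snd i) - 1) / 2 ^ fst i .. (real_of_int (snd i) + 1) / 2 ^ fst i}"
  shows "tent i x = 0"
proof -
  have "x * 2 ^ fst i < real_of_int (snd i) - 1 \<or> x * 2 ^ fst i > real_of_int (snd i) + 1"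
    using assms by (auto simp: field_simps)
  then show ?thesis unfolding tent_def by (auto simp: mult.commute)
qed

lemma tent_test_function: "tent i \<in> test_functions"
  unfolding test_functions_def
  using tent_eq_0[of _ i] by (auto intro!: continuous_intros exI[of _ "{(real_of_int (snd i) - 1) / 2 ^ fst i .. (real_of_int (snd i) + 1) / 2 ^ fst i}"])

lemma tent_lipschitz: "\<bar>tent i x - tent i y\<bar> \<le> 2 ^ fst i * \<bar>x - y\<bar>"
proof -
  have "\<bar>tent i x - tent i y\<bar> \<le> \<bar>2 ^ fst i * x - 2 ^ fst i * y\<bar>" unfolding tent_def by linarith
  also have "\<dots> = 2 ^ fst i * \<bar>x - y\<bar>" by (simp add: right_diff_distrib[symmetric] abs_mult)
  finally show ?thesis .
qed

text \<open>Only the hats at the two grid points around x are nonzero at x, so every finite K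
  containing both gives the same value, the linear interpolation of c.\<close>

lemma tent_sum_interp:
  assumes "finite K" "\<lfloor>2 ^ n * x\<rfloor> \<in> K" "\<lfloor>2 ^ n * x\<rfloor> + 1 \<in> K"
  shows "(\<Sum>k\<in>K. c k * tent (n, k) x) =
    c \<lfloor>2 ^ n * x\<rfloor> * (1 - frac (2 ^ n * x)) + c (\<lfloor>2 ^ n * x\<rfloor> + 1) * frac (2 ^ n * x)"
proof -
  let ?y = "2 ^ n * x" and ?k = "\<lfloor>2 ^ n * x\<rfloor>"
  have t0: "tent (n, k) x = 0" if "k \<noteq> ?k" "k \<noteq> ?k + 1" for k
  proof -
    have "k \<le> ?k - 1 \<or> k \<ge> ?k + 2" using that by linarith
    then have "\<bar>?y - real_of_int k\<bar> \<ge> 1" by linarith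
    then show ?thesis by (simp add: tent_def)
  qed
  have "(\<Sum>k\<in>K. c k * tent (n, k) x) = (\<Sum>k\<in>{?k, ?k + 1}. c k * tent (n, k) x)"
    using assms t0 by (intro sum.mono_neutral_right) auto
  also have "\<dots> = c ?k * tent (n, ?k) x + c (?k + 1) * tent (n, ?k + 1) x" by simp
  also have "tent (n, ?k) x = 1 - frac ?y" unfolding tent_def frac_def by simp linarith
  also have "tent (n, ?k + 1) x = frac ?y" unfolding tent_def frac_def by simp
  finally show ?thesis .
qed

lemma point_measures_integrable:
  assumes \<mu>: "\<mu> \<in> point_measures" and f: "f \<in> borel_measurable borel"
    and b: "\<And>x. \<bar>f x\<bar> \<le> C" and 0: "\<And>x. x \<notin> {a..b} \<Longrightarrow> f x = (0::real)"
  shows "integrable \<mu> f"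
proof -
  have s: "sets \<mu> = sets borel" using \<mu> by (simp add: point_measures_def)
  obtain n :: nat where n: "emeasure \<mu> {a..b} = of_nat n"
    using \<mu> unfolding point_measures_def by (auto dest!: bspec[where x="{a..b}"])
  have "integrable \<mu> (\<lambda>x. C * indicator {a..b} x)"
    using n s by (intro integrable_mult_right integrable_real_indicator) (auto simp: of_nat_less_top)
  then show ?thesis
  proof (rule Bochner_Integration.integrable_bound)
    show "f \<in> borel_measurable \<mu>" using f by (simp add: measurable_cong_sets[OF s refl])
    show "AE x in \<mu>. norm (f x) \<le> norm (C * indicator {a..b} x)"
    proof (intro AE_I2)
      fix x
      show "norm (f x) \<le> norm (C * indicator {a..b} x)"
        using b[of x] 0[of x] by (cases "x \<in> {a..b}") auto
    qed
  qed
qed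

lemma test_functionE:
  assumes "f \<in> test_functions"
  obtains N :: nat and C where "f \<in> borel_measurable borel" "continuous_on UNIV f" "\<And>x. \<bar>f x\<bar> \<le> C"
    "\<And>x. x \<notin> {- real N..real N} \<Longrightarrow> f x = 0"
proof -
  obtain K where f: "continuous_on UNIV f" "compact K" "\<And>x. x \<notin> K \<Longrightarrow> f x = 0"
    using assms unfolding test_functions_def by auto
  obtain r where r: "\<And>x. x \<in> K \<Longrightarrow> \<bar>x\<bar> \<le> r"
    using compact_imp_bounded[OF f(2)] by (auto simp: bounded_iff)
  obtain N :: nat where N: "r \<le> real N" using real_arch_simple by blast
  have "compact (f ` {- real N..real N})"
    using f by (intro compact_continuous_image) (auto intro: continuous_on_subset)
  then obtain C where C: "\<And>x. x \<in> {- real N..real N} \<Longrightarrow> \<bar>f x\<bar> \<le> C"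
    using compact_imp_bounded by (force simp: bounded_iff)
  have z: "f x = 0" if "x \<notin> {- real N..real N}" for x
    using that r[of x] N f(3)[of x] by (cases "x \<in> K") (auto simp: abs_le_iff)
  have "\<bar>f x\<bar> \<le> C" for x
    using C[of x] C[of 0] z[of x] by (cases "x \<in> {- real N..real N}") auto
  then show thesis
    using f z by (intro that[of C N] borel_measurable_continuous_onI) auto
qed

lemma test_function_integrable:
  assumes "\<mu> \<in> point_measures" "f \<in> test_functions"
  shows "integrable \<mu> f"
  using test_functionE[OF assms(2)] point_measures_integrable[OF assms(1)] by metis

lemma topspace_vague: "topspace vague_topology = point_measures"
  unfolding vague_topology_def topspace_pullback_topology by auto

lemma continuous_map_vague_test:
  assumes "f \<in> test_functions"
  shows "continuous_map vague_topology euclideanreal (\<lambda>\<mu>. \<integral>x. f x \<partial>\<mu>)"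
proof -
  have "continuous_map vague_topology euclideanreal ((\<lambda>h. h f) \<circ> (\<lambda>\<mu>. \<lambda>f\<in>test_functions. \<integral>x. f x \<partial>\<mu>))"
    unfolding vague_topology_def
    by (intro continuous_map_pullback continuous_map_product_projection assms)
  then show ?thesis using assms by (simp add: comp_def)
qed

lemma continuous_map_into_vague:
  assumes "\<And>x. x \<in> topspace Z \<Longrightarrow> g x \<in> point_measures"
    and "\<And>f. f \<in> test_functions \<Longrightarrow> continuous_map Z euclideanreal (\<lambda>x. \<integral>y. f y \<partial>g x)"
  shows "continuous_map Z vague_topology g"
  unfolding vague_topology_def
proof (rule continuous_map_pullback')
  show "topspace Z \<subseteq> g -` point_measures" using assms(1) by auto
  show "continuous_map Z (product_topology (\<lambda>_. euclideanreal) test_functions)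
     ((\<lambda>\<mu>. \<lambda>f\<in>test_functions. \<integral>x. f x \<partial>\<mu>) \<circ> g)"
    unfolding continuous_map_componentwise using assms(2) by (auto simp: comp_def)
qed

lemma continuous_map_realI:
  assumes "\<And>x \<epsilon>. x \<in> topspace Z \<Longrightarrow> 0 < \<epsilon> \<Longrightarrow>
    \<exists>U. openin Z U \<and> x \<in> U \<and> (\<forall>y\<in>U. \<bar>F y - F x\<bar> < (\<epsilon>::real))"
  shows "continuous_map Z euclideanreal F"
  unfolding continuous_map_alt
proof (intro conjI strip)
  fix V :: "real set" assume "openin euclideanreal V"
  then have V: "open V" by simp
  show "openin Z (F -` V \<inter> topspace Z)"
  proof (subst openin_subopen, intro ballI)
    fix x assume x: "x \<in> F -` V \<inter> topspace Z"
    then obtain \<epsilon> where \<epsilon>: "\<epsilon> > 0" "\<And>y. \<bar>y - F x\<bar> < \<epsilon> \<Longrightarrow> y \<in> V"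
      using V unfolding open_dist dist_real_def by blast
    obtain U where U: "openin Z U" "x \<in> U" "\<And>y. y \<in> U \<Longrightarrow> \<bar>F y - F x\<bar> < \<epsilon>"
      using assms[of x \<epsilon>] x \<epsilon> by auto
    moreover have "U \<subseteq> F -` V \<inter> topspace Z" using U \<epsilon> openin_subset[OF U(1)] by auto
    ultimately show "\<exists>T. openin Z T \<and> x \<in> T \<and> T \<subseteq> F -` V \<inter> topspace Z" by blast
  qed
qed auto

lemma continuous_map_real_nbhd:
  assumes "continuous_map Z euclideanreal F" "x \<in> topspace Z" "0 < \<epsilon>"
  shows "\<exists>U. openin Z U \<and> x \<in> U \<and> (\<forall>y\<in>U. \<bar>F y - F x\<bar> < (\<epsilon>::real))"
proof (intro exI conjI)
  show "openin Z {y \<in> topspace Z. F y \<in> ball (F x) \<epsilon>}"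
    by (rule openin_continuous_map_preimage[OF assms(1)]) auto
qed (use assms in \<open>auto simp: dist_real_def abs_minus_commute\<close>)

text \<open>
  A test function is uniformly approximated, on a fixed compact set, by its piecewise linear
  interpolations at dyadic points, so the countably many tents already generate the topology.
\<close>

lemma tents_continuous_imp_test_continuous:
  assumes Z: "\<And>i. continuous_map Z euclideanreal (\<lambda>x. tents (g x) i)"
    and g: "\<And>x. x \<in> topspace Z \<Longrightarrow> g x \<in> point_measures" and f: "f \<in> test_functions"
  shows "continuous_map Z euclideanreal (\<lambda>x. \<integral>y. f y \<partial>g x)"
proof (rule continuous_map_realI)
  fix z and \<epsilon> :: real assume z: "z \<in> topspace Z" and \<epsilon>: "0 < \<epsilon>"
  from f obtain N :: nat and C where fm: "f \<in> borel_measurable borel" and fc: "continuous_on UNIV f"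
    and fC: "\<And>x. \<bar>f x\<bar> \<le> C" and f0: "\<And>x. x \<notin> {- real N..real N} \<Longrightarrow> f x = 0"
    using test_functionE[OF f] by metis
  \<comment> \<open>Unit hats around the support of f: their sum is at least 1 on [-N - 1, N + 1],
    so their integral A controls the mass met by the interpolation error.\<close>
  define KN where "KN = {- int N - 2 .. int N + 2}"
  define A where "A = (\<lambda>x. \<Sum>k\<in>KN. tents (g x) (0, k))"
  have Acont: "continuous_map Z euclideanreal A"
    unfolding A_def using Z by (intro continuous_map_sum) (auto simp: KN_def)
  have hN1: "1 \<le> (\<Sum>k\<in>KN. tent (0, k) x)" if "x \<in> {- real N - 1..real N + 1}" for x
  proof -
    have "(\<Sum>k\<in>KN. 1 * tent (0, k) x) = 1 * (1 - frac (2 ^ 0 * x)) + 1 * frac (2 ^ 0 * x)"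
      by (rule tent_sum_interp[where c="\<lambda>_. 1"]) (use that in \<open>auto simp: KN_def; linarith\<close>)+
    then show ?thesis by simp
  qed
  have A0: "0 \<le> A x" for x
    unfolding A_def tents_def by (intro sum_nonneg integral_nonneg_AE) (auto simp: tent_nonneg)
  \<comment> \<open>With A y < A z + 1 near z, the two interpolation errors add up to at most 2/3 of
    \<epsilon>; the remaining third is left for the interpolants.\<close>
  define \<eta> where "\<eta> = \<epsilon> / (6 * (A z + 1))"
  have \<eta>: "\<eta> > 0" unfolding \<eta>_def using \<epsilon> A0[of z] by (auto intro!: divide_pos_pos)
  have "uniformly_continuous_on {- real N - 3..real N + 3} f"
    using fc by (intro compact_uniformly_continuous) (auto intro: continuous_on_subset)
  then obtain d where d: "d > 0" "\<And>x y. x \<in> {- real N - 3..real N + 3} \<Longrightarrow> y \<in> {- real N - 3..real N + 3} \<Longrightarrow>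
     \<bar>x - y\<bar> < d \<Longrightarrow> \<bar>f x - f y\<bar> < \<eta>"
    unfolding uniformly_continuous_on_def dist_real_def using \<eta> by metis
  obtain n where n: "(1/2) ^ n < d" using d(1) real_arch_pow_inv[of d "1/2"] by auto
  \<comment> \<open>Nodes up to N + 2 in modulus, so that both neighbours of every x in
    [-N - 1, N + 1] are included.\<close>
  define K where "K = {- int ((N + 2) * 2 ^ n) .. int ((N + 2) * 2 ^ n)}"
  define fn where "fn = (\<lambda>x. \<Sum>k\<in>K. f (real_of_int k / 2 ^ n) * tent (n, k) x)"
  have fn_approx: "\<bar>f x - fn x\<bar> \<le> \<eta> * (\<Sum>k\<in>KN. tent (0, k) x)" for x
  proof (cases "x \<in> {- real N - 1..real N + 1}")
    case True
    let ?k = "\<lfloor>2 ^ n * x\<rfloor>"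
    have kx: "real_of_int ?k \<le> 2 ^ n * x" "2 ^ n * x < real_of_int ?k + 1" by linarith+
    have p: "(2::real) ^ n \<ge> 1" by simp
    have x1: "2 ^ n * x \<le> 2 ^ n * (real N + 1)" "2 ^ n * x \<ge> 2 ^ n * (- real N - 1)"
      using True by auto
    have x2: "2 ^ n * (real N + 1) = 2 ^ n * real N + 2 ^ n" "2 ^ n * (- real N - 1) = - (2 ^ n * real N) - 2 ^ n"
      "real_of_int (int ((N + 2) * 2 ^ n)) = 2 ^ n * real N + 2 * 2 ^ n"
      by (simp_all add: algebra_simps)
    have "real_of_int ?k + 1 \<le> real_of_int (int ((N + 2) * 2 ^ n))"
      using x1 kx p unfolding x2 by linarith
    then have kK1: "?k + 1 \<le> int ((N + 2) * 2 ^ n)" by linarith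
    have "real_of_int ?k \<ge> - real_of_int (int ((N + 2) * 2 ^ n))"
      using x1 kx p unfolding x2 by linarith
    then have kK2: "?k \<ge> - int ((N + 2) * 2 ^ n)" by linarith
    have fnx: "fn x = f (real_of_int ?k / 2 ^ n) * (1 - frac (2 ^ n * x)) + f (real_of_int (?k + 1) / 2 ^ n) * frac (2 ^ n * x)"
      unfolding fn_def by (rule tent_sum_interp) (use kK1 kK2 in \<open>auto simp: K_def\<close>)
    have near: "\<bar>f x - f (real_of_int j / 2 ^ n)\<bar> < \<eta>" if j: "j = ?k \<or> j = ?k + 1" for j
    proof -
      have "\<bar>2 ^ n * x - real_of_int j\<bar> \<le> 1" using j kx unfolding abs_le_iff by (elim disjE; hypsubst; simp only: of_int_add of_int_1; linarith)
      then have "\<bar>2 ^ n * (x - real_of_int j / 2 ^ n)\<bar> \<le> 1" by (simp add: algebra_simps)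
      then have "2 ^ n * \<bar>x - real_of_int j / 2 ^ n\<bar> \<le> 1" unfolding abs_mult by simp
      then have "\<bar>x - real_of_int j / 2 ^ n\<bar> \<le> 1 / 2 ^ n" by (subst pos_le_divide_eq) (auto simp: mult.commute)
      then have le: "\<bar>x - real_of_int j / 2 ^ n\<bar> \<le> (1/2) ^ n" by (simp add: power_divide)
      have "(1/2::real) ^ n \<le> 1" by (rule power_le_one) auto
      with le True have "real_of_int j / 2 ^ n \<in> {- real N - 3..real N + 3}" by auto
      with True le n show ?thesis by (intro d(2)) auto
    qed
    let ?t = "frac (2 ^ n * x)"
    have t: "0 \<le> ?t" "?t \<le> 1" using frac_lt_1[of "2 ^ n * x"] by auto
    have "f x - fn x = (f x - f (real_of_int ?k / 2 ^ n)) * (1 - ?t) + (f x - f (real_of_int (?k + 1) / 2 ^ n)) * ?t"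
      unfolding fnx by (simp add: algebra_simps)
    also have "\<bar>\<dots>\<bar> \<le> \<bar>f x - f (real_of_int ?k / 2 ^ n)\<bar> * (1 - ?t) + \<bar>f x - f (real_of_int (?k + 1) / 2 ^ n)\<bar> * ?t"
      using t by (intro order_trans[OF abs_triangle_ineq]) (simp add: abs_mult)
    also have "\<dots> \<le> \<eta> * (1 - ?t) + \<eta> * ?t"
      using t near[of ?k] near[of "?k + 1"] by (intro add_mono mult_right_mono) auto
    also have "\<dots> = \<eta> * 1" by (simp add: algebra_simps)
    also have "\<dots> \<le> \<eta> * (\<Sum>k\<in>KN. tent (0, k) x)" using hN1[OF True] \<eta> by (intro mult_left_mono) auto
    finally show ?thesis .
  next
    case False
    have "f (real_of_int k / 2 ^ n) * tent (n, k) x = 0" for k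
    proof (cases "real_of_int k / 2 ^ n \<in> {- real N..real N}")
      case True
      have "tent (n, k) x = 0"
      proof (rule tent_eq_0)
        have "(1::real) / 2 ^ n \<le> 1" by simp
        moreover have "- real N \<le> real_of_int k / 2 ^ n" "real_of_int k / 2 ^ n \<le> real N" using True by auto
        ultimately show "x \<notin> {(real_of_int (snd (n, k)) - 1) / 2 ^ fst (n, k)..(real_of_int (snd (n, k)) + 1) / 2 ^ fst (n, k)}"
          using False unfolding atLeastAtMost_iff fst_conv snd_conv diff_divide_distrib add_divide_distrib
          by linarith
      qed
      then show ?thesis by simp
    qed (simp add: f0)
    then have "fn x = 0" unfolding fn_def by (intro sum.neutral ballI)
    moreover have "f x = 0" using False by (intro f0) auto
    ultimately show ?thesis using \<eta> by (auto intro!: mult_nonneg_nonneg sum_nonneg tent_nonneg)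
  qed
  define B where "B = (\<lambda>x. \<Sum>k\<in>K. f (real_of_int k / 2 ^ n) * tents (g x) (n, k))"
  have Bcont: "continuous_map Z euclideanreal B"
    unfolding B_def using Z by (intro continuous_map_sum continuous_map_real_mult_left) (auto simp: K_def)
  have est: "\<bar>(\<integral>y. f y \<partial>g x) - B x\<bar> \<le> \<eta> * A x" if x: "x \<in> topspace Z" for x
  proof -
    note ti = test_function_integrable[OF g[OF x] tent_test_function]
    note fi = test_function_integrable[OF g[OF x] f]
    have "B x = (\<integral>y. fn y \<partial>g x)"
      unfolding B_def fn_def tents_def using ti by (subst Bochner_Integration.integral_sum) auto
    then have "\<bar>(\<integral>y. f y \<partial>g x) - B x\<bar> = \<bar>\<integral>y. f y - fn y \<partial>g x\<bar>"
      using fi ti unfolding fn_def by (subst Bochner_Integration.integral_diff) auto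
    also have "\<dots> \<le> (\<integral>y. \<bar>f y - fn y\<bar> \<partial>g x)" by (rule integral_abs_bound)
    also have "\<dots> \<le> (\<integral>y. \<eta> * (\<Sum>k\<in>KN. tent (0, k) y) \<partial>g x)"
      using fi ti fn_approx unfolding fn_def by (intro integral_mono integrable_abs) auto
    also have "\<dots> = \<eta> * A x" unfolding A_def tents_def using ti by (subst Bochner_Integration.integral_mult_right_zero) simp
    finally show ?thesis .
  qed
  obtain U1 where U1: "openin Z U1" "z \<in> U1" "\<And>y. y \<in> U1 \<Longrightarrow> \<bar>A y - A z\<bar> < 1"
    using continuous_map_real_nbhd[OF Acont z, of 1] by auto
  obtain U2 where U2: "openin Z U2" "z \<in> U2" "\<And>y. y \<in> U2 \<Longrightarrow> \<bar>B y - B z\<bar> < \<epsilon>/3"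
    using continuous_map_real_nbhd[OF Bcont z, of "\<epsilon>/3"] \<epsilon> by auto
  show "\<exists>U. openin Z U \<and> z \<in> U \<and> (\<forall>y\<in>U. \<bar>(\<integral>x. f x \<partial>g y) - (\<integral>x. f x \<partial>g z)\<bar> < \<epsilon>)"
  proof (intro exI conjI ballI)
    show "openin Z (U1 \<inter> U2)" "z \<in> U1 \<inter> U2" using U1 U2 by auto
    fix y assume y: "y \<in> U1 \<inter> U2"
    then have yZ: "y \<in> topspace Z" using openin_subset[OF U1(1)] by auto
    have "\<eta> * A z + \<eta> * A y \<le> \<eta> * (4 * (A z + 1)) - \<eta>"
    proof -
      have "\<eta> * (A z + A y) \<le> \<eta> * (4 * (A z + 1) - 1)"
        using U1(3)[of y] y \<eta> A0[of z] by (intro mult_left_mono) auto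
      then show ?thesis by (simp add: algebra_simps)
    qed
    also have "\<eta> * (4 * (A z + 1)) = 2/3 * \<epsilon>" unfolding \<eta>_def using A0[of z] by (simp add: field_simps)
    finally show "\<bar>(\<integral>x. f x \<partial>g y) - (\<integral>x. f x \<partial>g z)\<bar> < \<epsilon>"
      using est[OF yZ] est[OF z] U2(3)[OF IntD2[OF y]] \<eta> unfolding abs_le_iff abs_less_iff by linarith
  qed
qed

text \<open>The topology pulled back along \<open>tents\<close> is compared with the vague one in
  both directions: hats are test functions, and integrals of test functions are continuous as soon
  as those of the hats are.\<close>

lemma induced_by_vague: "induced_by vague_topology tents"
proof -
  define Z where "Z = pullback_topology point_measures tents euclidean"
  have topZ: "topspace Z = point_measures" unfolding Z_def topspace_pullback_topology by simp
  have openZ: "openin Z U \<longleftrightarrow> (\<exists>V. open V \<and> U = tents -` V \<inter> point_measures)" for U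
    unfolding Z_def openin_pullback_topology by simp
  have ct: "continuous_map Z euclidean tents"
    unfolding continuous_map_alt by (auto simp: openZ topZ)
  have "continuous_map Z euclideanreal (\<lambda>\<mu>. tents \<mu> i)" for i
    using continuous_map_compose[OF ct, of euclideanreal "\<lambda>h. h i"]
    by (simp add: comp_def)
  then have 1: "continuous_map Z vague_topology (\<lambda>\<mu>. \<mu>)"
    by (intro continuous_map_into_vague tents_continuous_imp_test_continuous) (auto simp: topZ)
  have "continuous_map vague_topology (product_topology (\<lambda>_. euclideanreal) UNIV) tents"
    unfolding continuous_map_componentwise_UNIV tents_def
    by (intro allI continuous_map_vague_test tent_test_function)
  then have 2: "continuous_map vague_topology euclidean tents" by (simp add: euclidean_product_topology)
  show ?thesis
    unfolding induced_by_def
  proof (intro allI iffI)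
    fix U assume U: "openin vague_topology U"
    then have "openin Z {x \<in> topspace Z. x \<in> U}" by (rule openin_continuous_map_preimage[OF 1])
    moreover have "{x \<in> topspace Z. x \<in> U} = U" using openin_subset[OF U] by (auto simp: topZ topspace_vague)
    ultimately show "\<exists>V. open V \<and> U = tents -` V \<inter> topspace vague_topology"
      by (simp add: openZ topspace_vague)
  next
    fix U assume "\<exists>V. open V \<and> U = tents -` V \<inter> topspace vague_topology"
    then obtain V where "open V" "U = tents -` V \<inter> topspace vague_topology" by blast
    then show "openin vague_topology U"
      using 2 unfolding continuous_map_alt by auto
  qed
qed

lemma measurable_tents_iff:
  "(f :: 'a \<Rightarrow> nat \<times> int \<Rightarrow> real) \<in> borel_measurable M \<longleftrightarrow> (\<forall>i. (\<lambda>x. f x i) \<in> borel_measurable M)"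
proof
  assume f: "f \<in> borel_measurable M"
  show "\<forall>i. (\<lambda>x. f x i) \<in> borel_measurable M"
  proof
    fix i
    have "(\<lambda>h :: nat \<times> int \<Rightarrow> real. h i) \<in> borel_measurable borel"
      by (intro borel_measurable_continuous_onI continuous_on_product_coordinates)
    from measurable_compose[OF f this] show "(\<lambda>x. f x i) \<in> borel_measurable M" .
  qed
next
  assume "\<forall>i. (\<lambda>x. f x i) \<in> borel_measurable M"
  then show "f \<in> borel_measurable M" by (intro measurable_coordinatewise_then_product) auto
qed

lemma measurable_into_vague_iff:
  "f \<in> measurable M (borel_of vague_topology) \<longleftrightarrow>
    f \<in> space M \<rightarrow> point_measures \<and> (\<forall>i. (\<lambda>x. \<integral>y. tent i y \<partial>f x) \<in> borel_measurable M)"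
  unfolding measurable_borel_of_iff[OF induced_by_vague] topspace_vague measurable_tents_iff
  by (simp add: tents_def)

lemma continuous_map_into_vague_tents:
  assumes "\<And>x. x \<in> topspace Z \<Longrightarrow> g x \<in> point_measures"
    and "\<And>i. continuous_map Z euclideanreal (\<lambda>x. \<integral>y. tent i y \<partial>g x)"
  shows "continuous_map Z vague_topology g"
  using assms tents_continuous_imp_test_continuous[of Z g]
  by (intro continuous_map_into_vague) (auto simp: tents_def)

section \<open>Operations on point measures\<close>

lemma sets_point_measure: "\<mu> \<in> point_measures \<Longrightarrow> sets \<mu> = sets borel"
  by (simp add: point_measures_def)

lemma space_point_measure: "\<mu> \<in> point_measures \<Longrightarrow> space \<mu> = UNIV"
  using sets_eq_imp_space_eq[OF sets_point_measure, of \<mu>] by simp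

lemma emeasure_point_measure:
  assumes "\<mu> \<in> point_measures" "A \<in> sets borel" "bounded A"
  obtains n :: nat where "emeasure \<mu> A = of_nat n"
proof -
  have "emeasure \<mu> A \<in> range of_nat" using assms by (simp add: point_measures_def)
  then show ?thesis using that by auto
qed

lemma dirac_sum_point_measures: "dirac_sum I x \<in> point_measures"
proof (cases "finite I")
  case True
  have "emeasure (distr (count_space I) borel x) A \<in> range of_nat" if "A \<in> sets borel" for A
    using that True by (simp add: emeasure_distr emeasure_count_space_finite)
  with True show ?thesis by (simp add: dirac_sum_def point_measures_def)
next
  case False
  then show ?thesis by (auto simp: dirac_sum_def point_measures_def intro!: range_eqI[of _ _ 0])
qed

lemma integral_dirac_sum:
  assumes "f \<in> borel_measurable borel"
  shows "(\<integral>y. f y \<partial>dirac_sum I x) = (if finite I then \<Sum>u\<in>I. f (x u) else (0::real))"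
  using assms by (simp add: dirac_sum_def integral_distr lebesgue_integral_count_space_finite integral_null_measure)

lemma emeasure_superposition:
  assumes \<mu>: "sets \<mu> = sets borel" and \<nu>: "sets \<nu> = sets borel" and A: "A \<in> sets borel"
  shows "emeasure (superposition \<mu> \<nu>) A = emeasure \<mu> A + emeasure \<nu> A"
proof (rule emeasure_measure_of[OF superposition_def])
  show "sets borel \<subseteq> Pow UNIV" by simp
  show "A \<in> sets (superposition \<mu> \<nu>)" using A unfolding superposition_def
    by (simp add: sets_measure_of_conv sets.sigma_sets_eq[of borel, simplified])
  show "positive (sets (superposition \<mu> \<nu>)) (\<lambda>A. emeasure \<mu> A + emeasure \<nu> A)"
    by (auto simp: positive_def)
  show "countably_additive (sets (superposition \<mu> \<nu>)) (\<lambda>A. emeasure \<mu> A + emeasure \<nu> A)"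
    unfolding countably_additive_def
  proof (intro allI impI)
    fix B :: "nat \<Rightarrow> real set"
    assume B: "range B \<subseteq> sets (superposition \<mu> \<nu>)" "disjoint_family B"
    have "range B \<subseteq> sets borel" using B(1) unfolding superposition_def
      by (simp add: sets_measure_of_conv sets.sigma_sets_eq[of borel, simplified])
    then have "(\<Sum>i. emeasure \<mu> (B i)) = emeasure \<mu> (\<Union>i. B i)" "(\<Sum>i. emeasure \<nu> (B i)) = emeasure \<nu> (\<Union>i. B i)"
      using B(2) \<mu> \<nu> by (auto intro!: suminf_emeasure)
    then show "(\<Sum>i. emeasure \<mu> (B i) + emeasure \<nu> (B i)) = emeasure \<mu> (\<Union>i. B i) + emeasure \<nu> (\<Union>i. B i)"
      by (simp add: suminf_add[symmetric])
  qed
qed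

lemma sets_superposition: "sets (superposition \<mu> \<nu>) = sets borel"
  unfolding superposition_def by (simp add: sets_measure_of_conv sets.sigma_sets_eq[of borel, simplified])

lemma superposition_point_measures:
  assumes \<mu>: "\<mu> \<in> point_measures" and \<nu>: "\<nu> \<in> point_measures"
  shows "superposition \<mu> \<nu> \<in> point_measures"
  unfolding point_measures_def
proof (intro CollectI conjI ballI impI sets_superposition)
  fix A :: "real set" assume A: "A \<in> sets borel" "bounded A"
  obtain n k :: nat where "emeasure \<mu> A = of_nat n" "emeasure \<nu> A = of_nat k"
    using emeasure_point_measure[OF \<mu> A] emeasure_point_measure[OF \<nu> A] by metis
  then have "emeasure (superposition \<mu> \<nu>) A = of_nat (n + k)"
    using A \<mu> \<nu> by (simp add: emeasure_superposition sets_point_measure)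
  then show "emeasure (superposition \<mu> \<nu>) A \<in> range of_nat" by blast
qed

lemma nn_integral_superposition:
  assumes \<mu>: "sets \<mu> = sets borel" and \<nu>: "sets \<nu> = sets borel" and f: "f \<in> borel_measurable borel"
  shows "(\<integral>\<^sup>+x. f x \<partial>superposition \<mu> \<nu>) = (\<integral>\<^sup>+x. f x \<partial>\<mu>) + (\<integral>\<^sup>+x. f x \<partial>\<nu>)"
  using f
proof (induction f rule: borel_measurable_induct)
  case (cong f g)
  then have "f = g" by auto
  with cong show ?case by simp
next
  case (set A)
  then show ?case by (simp add: \<mu> \<nu> sets_superposition emeasure_superposition)
next
  case (mult u c)
  have "u \<in> borel_measurable \<mu>" "u \<in> borel_measurable \<nu>" "u \<in> borel_measurable (superposition \<mu> \<nu>)"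
    using mult by (simp_all add: measurable_cong_sets[OF \<mu> refl] measurable_cong_sets[OF \<nu> refl]
        measurable_cong_sets[OF sets_superposition refl])
  with mult show ?case by (simp add: nn_integral_cmult distrib_left)
next
  case (add u v)
  have "u \<in> borel_measurable \<mu>" "u \<in> borel_measurable \<nu>" "u \<in> borel_measurable (superposition \<mu> \<nu>)"
     "v \<in> borel_measurable \<mu>" "v \<in> borel_measurable \<nu>" "v \<in> borel_measurable (superposition \<mu> \<nu>)"
    using add by (simp_all add: measurable_cong_sets[OF \<mu> refl] measurable_cong_sets[OF \<nu> refl]
        measurable_cong_sets[OF sets_superposition refl])
  with add show ?case by (simp add: nn_integral_add ac_simps)
next
  case (seq U)
  have m: "U i \<in> borel_measurable \<mu>" "U i \<in> borel_measurable \<nu>" "U i \<in> borel_measurable (superposition \<mu> \<nu>)" for i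
    using seq by (simp_all add: measurable_cong_sets[OF \<mu> refl] measurable_cong_sets[OF \<nu> refl]
        measurable_cong_sets[OF sets_superposition refl])
  have inc: "incseq (\<lambda>i. \<integral>\<^sup>+x. U i x \<partial>M)" for M
    using seq(3) by (auto simp: incseq_def le_fun_def intro!: nn_integral_mono)
  have "(\<integral>\<^sup>+x. (SUP i. U i) x \<partial>superposition \<mu> \<nu>) = (SUP i. \<integral>\<^sup>+x. U i x \<partial>superposition \<mu> \<nu>)"
    unfolding SUP_apply by (rule nn_integral_monotone_convergence_SUP) (use seq m in auto)
  also have "\<dots> = (SUP i. (\<integral>\<^sup>+x. U i x \<partial>\<mu>) + (\<integral>\<^sup>+x. U i x \<partial>\<nu>))" by (simp add: seq)
  also have "\<dots> = (SUP i. \<integral>\<^sup>+x. U i x \<partial>\<mu>) + (SUP i. \<integral>\<^sup>+x. U i x \<partial>\<nu>)"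
    by (rule ennreal_SUP_add) (rule inc)+
  also have "(SUP i. \<integral>\<^sup>+x. U i x \<partial>\<mu>) = (\<integral>\<^sup>+x. (SUP i. U i) x \<partial>\<mu>)"
    unfolding SUP_apply by (rule nn_integral_monotone_convergence_SUP[symmetric]) (use seq m in auto)
  also have "(SUP i. \<integral>\<^sup>+x. U i x \<partial>\<nu>) = (\<integral>\<^sup>+x. (SUP i. U i) x \<partial>\<nu>)"
    unfolding SUP_apply by (rule nn_integral_monotone_convergence_SUP[symmetric]) (use seq m in auto)
  finally show ?case by simp
qed

lemma integral_superposition:
  fixes f :: "real \<Rightarrow> real"
  assumes \<mu>: "\<mu> \<in> point_measures" and \<nu>: "\<nu> \<in> point_measures" and f: "f \<in> test_functions"
    and f0: "\<And>x. 0 \<le> f x"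
  shows "(\<integral>x. f x \<partial>superposition \<mu> \<nu>) = (\<integral>x. f x \<partial>\<mu>) + (\<integral>x. f x \<partial>\<nu>)"
proof -
  have fb: "f \<in> borel_measurable borel" using test_functionE[OF f] by metis
  have i: "integrable \<mu> f" "integrable \<nu> f" "integrable (superposition \<mu> \<nu>) f"
    using test_function_integrable[OF \<mu> f] test_function_integrable[OF \<nu> f]
      test_function_integrable[OF superposition_point_measures[OF \<mu> \<nu>] f] by auto
  have "ennreal (\<integral>x. f x \<partial>superposition \<mu> \<nu>) = ennreal ((\<integral>x. f x \<partial>\<mu>) + (\<integral>x. f x \<partial>\<nu>))"
    using nn_integral_superposition[OF sets_point_measure[OF \<mu>] sets_point_measure[OF \<nu>], of "\<lambda>x. ennreal (f x)"] fb
      nn_integral_eq_integral[OF i(1)] nn_integral_eq_integral[OF i(2)] nn_integral_eq_integral[OF i(3)] f0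
    by (simp add: ennreal_plus[symmetric] integral_nonneg_AE del: ennreal_plus)
  then show ?thesis using f0 by (subst (asm) ennreal_inj) (auto intro!: add_nonneg_nonneg integral_nonneg_AE)
qed

lemma continuous_map_superposition:
  "continuous_map (prod_topology vague_topology vague_topology) vague_topology (\<lambda>(\<mu>, \<nu>). superposition \<mu> \<nu>)"
proof (rule continuous_map_into_vague_tents)
  let ?Z = "prod_topology vague_topology vague_topology"
  show "(case p of (\<mu>, \<nu>) \<Rightarrow> superposition \<mu> \<nu>) \<in> point_measures" if "p \<in> topspace ?Z" for p
    using that by (auto simp: topspace_vague superposition_point_measures)
  fix i
  have 1: "continuous_map ?Z euclideanreal (\<lambda>p. (\<integral>x. tent i x \<partial>fst p) + (\<integral>x. tent i x \<partial>snd p))"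
    using continuous_map_compose[OF continuous_map_fst continuous_map_vague_test[OF tent_test_function]]
      continuous_map_compose[OF continuous_map_snd continuous_map_vague_test[OF tent_test_function]]
    by (intro continuous_map_add) (simp_all add: comp_def)
  show "continuous_map ?Z euclideanreal (\<lambda>p. \<integral>x. tent i x \<partial>(case p of (\<mu>, \<nu>) \<Rightarrow> superposition \<mu> \<nu>))"
    by (rule continuous_map_eq[OF 1])
      (auto simp: topspace_vague integral_superposition tent_test_function tent_nonneg)
qed

lemma bounded_shift_vimage: "bounded A \<Longrightarrow> bounded ((\<lambda>x::real. x - c) -` A)"
proof -
  assume "bounded A"
  then have "bounded ((+) c ` A)" by (rule bounded_translation)
  moreover have "(\<lambda>x. x - c) -` A \<subseteq> (+) c ` A" by (auto simp: image_iff intro!: bexI[of _ "_ - c"])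
  ultimately show ?thesis by (rule bounded_subset)
qed

lemma shift_left_point_measures:
  assumes \<mu>: "\<mu> \<in> point_measures"
  shows "shift_left c \<mu> \<in> point_measures"
  unfolding point_measures_def
proof (intro CollectI conjI ballI impI)
  show "sets (shift_left c \<mu>) = sets borel" by (simp add: shift_left_def)
  fix A :: "real set" assume A: "A \<in> sets borel" "bounded A"
  have m: "(\<lambda>x. x - c) \<in> measurable \<mu> borel" by (simp add: measurable_cong_sets[OF sets_point_measure[OF \<mu>] refl])
  have "(\<lambda>x. x - c) -` A \<in> sets borel" using A(1) measurable_sets[of "\<lambda>x. x - c" borel borel A] by simp
  then obtain n :: nat where "emeasure \<mu> ((\<lambda>x. x - c) -` A) = of_nat n"
    using emeasure_point_measure[OF \<mu> _ bounded_shift_vimage[OF A(2)]] by metis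
  then have "emeasure (shift_left c \<mu>) A = of_nat n"
    unfolding shift_left_def using A m by (simp add: emeasure_distr space_point_measure[OF \<mu>])
  then show "emeasure (shift_left c \<mu>) A \<in> range of_nat" by simp
qed

lemma integral_shift_left:
  assumes "\<mu> \<in> point_measures" "f \<in> borel_measurable borel"
  shows "(\<integral>x. f x \<partial>shift_left c \<mu>) = (\<integral>x. f (x - c) \<partial>\<mu> :: real)"
  unfolding shift_left_def using assms
  by (intro integral_distr) (simp_all add: measurable_cong_sets[OF sets_point_measure refl])

lemma test_function_shift:
  assumes "f \<in> test_functions"
  shows "(\<lambda>x. f (x - c)) \<in> test_functions"
proof -
  obtain K where f: "continuous_on UNIV f" "compact K" "\<And>x. x \<notin> K \<Longrightarrow> f x = 0"
    using assms unfolding test_functions_def by auto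
  show ?thesis unfolding test_functions_def
  proof (intro CollectI conjI exI[of _ "(+) c ` K"] allI impI)
    show "continuous_on UNIV (\<lambda>x. f (x - c))"
      by (intro continuous_on_compose2[OF f(1)] continuous_intros) auto
    show "compact ((+) c ` K)" using f(2) by (rule compact_translation)
    fix x assume "x \<notin> (+) c ` K"
    then have "x - c \<notin> K" by (auto simp: image_iff)
    then show "f (x - c) = 0" by (rule f(3))
  qed
qed

text \<open>Joint continuity is wanted because the shift is a coordinate in \<open>observe\<close>,
  not a constant. For c near c0 all shifted hats live on one bounded set and differ from the hat
  shifted by c0 by at most a Lipschitz constant times the distance of c and c0; a bump b on that set
  bounds the mass involved, locally uniformly in \<mu>.\<close>

lemma continuous_map_shift_left:
  "continuous_map (prod_topology euclideanreal vague_topology) vague_topology (\<lambda>(c, \<mu>). shift_left c \<mu>)"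
proof (rule continuous_map_into_vague_tents)
  let ?Z = "prod_topology euclideanreal vague_topology"
  show "(case p of (c, \<mu>) \<Rightarrow> shift_left c \<mu>) \<in> point_measures" if "p \<in> topspace ?Z" for p
    using that by (auto simp: topspace_vague shift_left_point_measures)
  fix i
  show "continuous_map ?Z euclideanreal (\<lambda>p. \<integral>x. tent i x \<partial>(case p of (c, \<mu>) \<Rightarrow> shift_left c \<mu>))"
  proof (rule continuous_map_realI)
    fix p0 and \<epsilon> :: real assume p0: "p0 \<in> topspace ?Z" and \<epsilon>: "0 < \<epsilon>"
    obtain c0 \<mu>0 where p: "p0 = (c0, \<mu>0)" by (cases p0)
    have \<mu>0: "\<mu>0 \<in> point_measures" using p0 by (simp add: p topspace_vague)
    obtain M :: nat where M: "\<And>x. x \<notin> {- real M..real M} \<Longrightarrow> tent i x = 0"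
      using test_functionE[OF tent_test_function[of i]] by metis
    define b where "b = (\<lambda>x. max 0 (min 1 (real M + \<bar>c0\<bar> + 2 - \<bar>x\<bar>)))"
    have bt: "b \<in> test_functions"
      unfolding test_functions_def b_def
      by (auto intro!: continuous_intros exI[of _ "{- (real M + \<bar>c0\<bar> + 2)..real M + \<bar>c0\<bar> + 2}"])
    have b01: "0 \<le> b x" for x by (simp add: b_def)
    define B where "B = (\<lambda>\<mu>. \<integral>x. b x \<partial>\<mu> :: real)"
    have B0: "0 \<le> B \<mu>" for \<mu> unfolding B_def using b01 by (intro integral_nonneg_AE) auto
    define \<delta> where "\<delta> = min 1 (\<epsilon> / (2 * 2 ^ fst i * (B \<mu>0 + 1)))"
    have \<delta>: "\<delta> > 0" unfolding \<delta>_def using \<epsilon> B0[of \<mu>0] by (auto intro!: divide_pos_pos mult_pos_pos)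
    define t where "t = (\<lambda>x. tent i (x - c0))"
    have tt: "t \<in> test_functions" unfolding t_def by (intro test_function_shift tent_test_function)
    have cB: "continuous_map ?Z euclideanreal (\<lambda>p. B (snd p))"
      unfolding B_def using continuous_map_compose[OF continuous_map_snd continuous_map_vague_test[OF bt]]
      by (simp add: comp_def)
    have cT: "continuous_map ?Z euclideanreal (\<lambda>p. \<integral>x. t x \<partial>snd p)"
      using continuous_map_compose[OF continuous_map_snd continuous_map_vague_test[OF tt]]
      by (simp add: comp_def)
    have cc: "continuous_map ?Z euclideanreal fst" by (rule continuous_map_fst)
    obtain U1 where U1: "openin ?Z U1" "p0 \<in> U1" "\<And>q. q \<in> U1 \<Longrightarrow> \<bar>B (snd q) - B \<mu>0\<bar> < 1"
      using continuous_map_real_nbhd[OF cB p0, of 1] by (auto simp: p)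
    obtain U2 where U2: "openin ?Z U2" "p0 \<in> U2" "\<And>q. q \<in> U2 \<Longrightarrow> \<bar>(\<integral>x. t x \<partial>snd q) - (\<integral>x. t x \<partial>\<mu>0)\<bar> < \<epsilon>/2"
      using continuous_map_real_nbhd[OF cT p0, of "\<epsilon>/2"] \<epsilon> by (auto simp: p)
    obtain U3 where U3: "openin ?Z U3" "p0 \<in> U3" "\<And>q. q \<in> U3 \<Longrightarrow> \<bar>fst q - c0\<bar> < \<delta>"
      using continuous_map_real_nbhd[OF cc p0 \<delta>] by (auto simp: p)
    show "\<exists>U. openin ?Z U \<and> p0 \<in> U \<and> (\<forall>q\<in>U. \<bar>(\<integral>x. tent i x \<partial>(case q of (c, \<mu>) \<Rightarrow> shift_left c \<mu>)) -
        (\<integral>x. tent i x \<partial>(case p0 of (c, \<mu>) \<Rightarrow> shift_left c \<mu>))\<bar> < \<epsilon>)"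
    proof (intro exI conjI ballI)
      show "openin ?Z (U1 \<inter> U2 \<inter> U3)" "p0 \<in> U1 \<inter> U2 \<inter> U3" using U1 U2 U3 by auto
      fix q assume q: "q \<in> U1 \<inter> U2 \<inter> U3"
      obtain c \<mu> where qq: "q = (c, \<mu>)" by (cases q)
      have \<mu>: "\<mu> \<in> point_measures" using q openin_subset[OF U1(1)] by (auto simp: qq topspace_vague)
      have c\<delta>: "\<bar>c - c0\<bar> < \<delta>" and B1: "B \<mu> < B \<mu>0 + 1" and T: "\<bar>(\<integral>x. t x \<partial>\<mu>) - (\<integral>x. t x \<partial>\<mu>0)\<bar> < \<epsilon>/2"
        using U1(3)[of q] U2(3)[of q] U3(3)[of q] q by (auto simp: qq)
      have pw: "\<bar>tent i (x - c) - t x\<bar> \<le> 2 ^ fst i * \<delta> * b x" for x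
      proof (cases "\<bar>x\<bar> \<le> real M + \<bar>c0\<bar> + 1")
        case True
        then have bx: "b x = 1" by (simp add: b_def)
        have "\<bar>tent i (x - c) - t x\<bar> \<le> 2 ^ fst i * \<bar>(x - c) - (x - c0)\<bar>" unfolding t_def by (rule tent_lipschitz)
        moreover have "2 ^ fst i * \<bar>(x - c) - (x - c0)\<bar> \<le> 2 ^ fst i * \<delta>" using c\<delta> by (intro mult_left_mono) auto
        ultimately show ?thesis unfolding bx mult_1_right by (rule order_trans)
      next
        case False
        have "\<delta> \<le> 1" by (simp add: \<delta>_def)
        then have "\<bar>x - c\<bar> > real M" "\<bar>x - c0\<bar> > real M" using False c\<delta> by linarith+
        then have "tent i (x - c) = 0" "t x = 0" unfolding t_def by (auto intro!: M)
        then show ?thesis using \<delta> b01[of x] by (auto intro!: mult_nonneg_nonneg)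
      qed
      have i1: "integrable \<mu> (\<lambda>x. tent i (x - c))" "integrable \<mu> t" "integrable \<mu> b"
        by (intro test_function_integrable[OF \<mu>] test_function_shift tent_test_function tt bt)+
      have "\<bar>(\<integral>x. tent i (x - c) \<partial>\<mu>) - (\<integral>x. t x \<partial>\<mu>)\<bar> = \<bar>\<integral>x. tent i (x - c) - t x \<partial>\<mu>\<bar>" using i1 by simp
      also have "\<dots> \<le> (\<integral>x. \<bar>tent i (x - c) - t x\<bar> \<partial>\<mu>)" by (rule integral_abs_bound)
      also have "\<dots> \<le> (\<integral>x. 2 ^ fst i * \<delta> * b x \<partial>\<mu>)"
        using i1 pw by (intro integral_mono integrable_abs) auto
      also have "\<dots> = 2 ^ fst i * \<delta> * B \<mu>" unfolding B_def by simp
      also have "\<dots> \<le> 2 ^ fst i * \<delta> * (B \<mu>0 + 1)" using B1 \<delta> by (intro mult_left_mono) auto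
      also have "\<dots> \<le> 2 ^ fst i * (\<epsilon> / (2 * 2 ^ fst i * (B \<mu>0 + 1))) * (B \<mu>0 + 1)"
        using B0[of \<mu>0] by (intro mult_left_mono mult_right_mono) (auto simp: \<delta>_def)
      also have "\<dots> = \<epsilon> / 2"
      proof -
        have "k * (\<epsilon> / (2 * k * l)) * l = \<epsilon> / 2" if "k > 0" "l > 0" for k l :: real
          using that by (simp add: field_simps)
        then show ?thesis by this (use B0[of \<mu>0] in auto)
      qed
      finally have "\<bar>(\<integral>x. tent i (x - c) \<partial>\<mu>) - (\<integral>x. t x \<partial>\<mu>)\<bar> \<le> \<epsilon>/2" .
      then have "\<bar>(\<integral>x. tent i (x - c) \<partial>\<mu>) - (\<integral>x. t x \<partial>\<mu>0)\<bar> < \<epsilon>" using T by linarith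
      then show "\<bar>(\<integral>x. tent i x \<partial>(case q of (c, \<mu>) \<Rightarrow> shift_left c \<mu>)) -
        (\<integral>x. tent i x \<partial>(case p0 of (c, \<mu>) \<Rightarrow> shift_left c \<mu>))\<bar> < \<epsilon>"
        by (simp add: qq p integral_shift_left \<mu> \<mu>0 t_def)
    qed
  qed
qed

lemma dirac_sum_shift_left:
  "dirac_sum I (\<lambda>u. x u - c) = shift_left c (dirac_sum I x)"
proof (cases "finite I")
  case True
  then show ?thesis by (simp add: dirac_sum_def shift_left_def distr_distr comp_def)
next
  case False
  have "null_measure borel = distr (null_measure borel) borel (\<lambda>x::real. x - c)"
    by (rule measure_eqI) (auto simp: emeasure_distr)
  with False show ?thesis by (simp add: dirac_sum_def shift_left_def)
qed

lemma dirac_sum_Un: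
  assumes "finite I" "finite J" "I \<inter> J = {}"
  shows "dirac_sum (I \<union> J) x = superposition (dirac_sum I x) (dirac_sum J x)"
proof (rule measure_eqI)
  show "sets (dirac_sum (I \<union> J) x) = sets (superposition (dirac_sum I x) (dirac_sum J x))"
    by (simp add: dirac_sum_def sets_superposition assms)
  fix A assume "A \<in> sets (dirac_sum (I \<union> J) x)"
  then have A: "A \<in> sets borel" by (simp add: dirac_sum_def assms)
  have d: "emeasure (dirac_sum S x) A = of_nat (card (x -` A \<inter> S))" if "finite S" for S
    using that A by (simp add: dirac_sum_def emeasure_distr emeasure_count_space_finite)
  have "card (x -` A \<inter> (I \<union> J)) = card (x -` A \<inter> I) + card (x -` A \<inter> J)"
    unfolding Int_Un_distrib using assms by (intro card_Un_disjoint) auto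
  then show "emeasure (dirac_sum (I \<union> J) x) A = emeasure (superposition (dirac_sum I x) (dirac_sum J x)) A"
    using A assms by (simp add: emeasure_superposition d sets_point_measure[OF dirac_sum_point_measures])
qed

lemma dirac_sum_image:
  assumes "inj_on h I" shows "dirac_sum (h ` I) x = dirac_sum I (\<lambda>u. x (h u))"
proof (cases "finite I")
  case True
  show ?thesis
  proof (rule measure_eqI)
    show "sets (dirac_sum (h ` I) x) = sets (dirac_sum I (\<lambda>u. x (h u)))" using True by (simp add: dirac_sum_def)
    fix A assume "A \<in> sets (dirac_sum (h ` I) x)"
    then have A: "A \<in> sets borel" using True by (simp add: dirac_sum_def)
    have "x -` A \<inter> h ` I = h ` ((\<lambda>u. x (h u)) -` A \<inter> I)" by auto
    then have "card (x -` A \<inter> h ` I) = card ((\<lambda>u. x (h u)) -` A \<inter> I)"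
      using card_image[OF inj_on_subset[OF assms]] by (metis Int_lower2)
    then show "emeasure (dirac_sum (h ` I) x) A = emeasure (dirac_sum I (\<lambda>u. x (h u))) A"
      using True A by (simp add: dirac_sum_def emeasure_distr emeasure_count_space_finite)
  qed
next
  case False
  then show ?thesis using finite_imageD[OF _ assms] by (auto simp: dirac_sum_def)
qed

lemma dirac_sum_cong: "(\<And>u. u \<in> I \<Longrightarrow> x u = y u) \<Longrightarrow> dirac_sum I x = dirac_sum I y"
  by (auto simp: dirac_sum_def intro!: distr_cong)

definition greatest_atom :: "real measure \<Rightarrow> real \<Rightarrow> bool" where
  "greatest_atom \<mu> x \<longleftrightarrow> 0 < emeasure \<mu> {x} \<and> (\<forall>y. 0 < emeasure \<mu> {y} \<longrightarrow> y \<le> x)"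

lemma max_atom_eq: "greatest_atom \<mu> x \<Longrightarrow> max_atom \<mu> = x"
  unfolding max_atom_def greatest_atom_def by (rule Greatest_equality) auto

text \<open>Without a greatest atom the defining description has no solution, so all such measures
  share one default value. A law of \<open>max_atom\<close> without atoms therefore charges no
  measure of this kind; almost sure existence of the greatest atom is obtained in this way.\<close>

lemma max_atom_no_greatest: "\<nexists>x. greatest_atom \<mu> x \<Longrightarrow> max_atom \<mu> = (THE x. False)"
proof -
  assume "\<nexists>x. greatest_atom \<mu> x"
  then have f: "(\<lambda>x. greatest_atom \<mu> x) = (\<lambda>_. False)" by auto
  have "max_atom \<mu> = (THE x. greatest_atom \<mu> x)"
    unfolding max_atom_def Greatest_def greatest_atom_def by (rule refl)
  then show ?thesis unfolding f .
qed

lemma greatest_atom_superposition: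
  assumes "\<mu> \<in> point_measures" "\<nu> \<in> point_measures" "greatest_atom \<mu> x" "greatest_atom \<nu> y"
  shows "greatest_atom (superposition \<mu> \<nu>) (max x y)"
  using assms unfolding greatest_atom_def
  by (auto simp: emeasure_superposition sets_point_measure add_pos_nonneg max_def zero_less_iff_neq_zero)

lemma greatest_atom_shift_left:
  assumes "\<mu> \<in> point_measures" "greatest_atom \<mu> x"
  shows "greatest_atom (shift_left c \<mu>) (x - c)"
proof -
  have "emeasure (shift_left c \<mu>) {y} = emeasure \<mu> {y + c}" for y
  proof -
    have m: "(\<lambda>x. x - c) \<in> measurable \<mu> borel" by (simp add: measurable_cong_sets[OF sets_point_measure[OF assms(1)] refl])
    have "(\<lambda>x. x - c) -` {y} = {y + c}" by auto
    then show ?thesis unfolding shift_left_def using m by (simp add: emeasure_distr space_point_measure[OF assms(1)])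
  qed
  then show ?thesis using assms(2) unfolding greatest_atom_def by force
qed

text \<open>The image under a non-measurable map is not a probability measure: \<open>emeasure\<close> vanishes on
  the complement of a non-measurable set as well.\<close>

lemma measurable_of_prob_space_distr:
  assumes M: "prob_space M" and D: "prob_space (distr M N f)" and f: "f \<in> space M \<rightarrow> space N"
  shows "f \<in> measurable M N"
proof (rule measurableI)
  fix A assume A: "A \<in> sets N"
  define \<mu>' where "\<mu>' = (\<lambda>A. emeasure M (f -` A \<inter> space M))"
  have dist: "distr M N f = measure_of (space N) (sets N) \<mu>'" by (simp add: distr_def \<mu>'_def)
  \<comment> \<open>Otherwise \<open>distr\<close> collapses to the zero measure and could not have
    total mass 1.\<close>
  have ms: "measure_space (space N) (sets N) \<mu>'"
  proof (rule ccontr)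
    assume n: "\<not> measure_space (space N) (sets N) \<mu>'"
    then have "\<not> measure_space (space N) (sigma_sets (space N) (sets N)) \<mu>'" by (simp add: sets.sigma_sets_eq)
    then have "emeasure (distr M N f) = (\<lambda>_. 0)" unfolding dist by (simp add: emeasure_measure_of_conv)
    then show False using prob_space.emeasure_space_1[OF D] by simp
  qed
  have em: "emeasure (distr M N f) B = \<mu>' B" if "B \<in> sets N" for B
    unfolding dist using ms that by (simp add: emeasure_measure_of_sigma measure_space_def)
  have "emeasure (distr M N f) A + emeasure (distr M N f) (space N - A) = 1"
    using prob_space.emeasure_space_1[OF D] A
    by (subst plus_emeasure) (auto simp: Un_absorb1[OF sets.sets_into_space])
  then have s: "\<mu>' A + \<mu>' (space N - A) = 1" using A by (simp add: em)
  show "f -` A \<inter> space M \<in> sets M"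
  proof (rule ccontr)
    assume n: "f -` A \<inter> space M \<notin> sets M"
    have "f -` (space N - A) \<inter> space M = space M - (f -` A \<inter> space M)" using f by auto
    then have "f -` (space N - A) \<inter> space M \<notin> sets M"
      using n sets.compl_sets[of "f -` (space N - A) \<inter> space M" M]
      by (metis Diff_Diff_Int Int_absorb1 Int_commute inf_le2)
    then have "\<mu>' A = 0" "\<mu>' (space N - A) = 0" using n by (simp_all add: \<mu>'_def emeasure_notin_sets)
    with s show False by simp
  qed
qed (use f in auto)

section \<open>Evaluation of continuous paths at random times\<close>

text \<open>
  The coordinate \<open>p s\<close> is not jointly measurable in \<open>(p, s)\<close> on \<^const>\<open>PiM\<close>; the limit
  along dyadic times is, and it agrees with \<open>p s\<close> for continuous \<open>p\<close>.
\<close>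

definition ev :: "(real \<Rightarrow> real) \<Rightarrow> real \<Rightarrow> real" where
  "ev p s = lim (\<lambda>n. p (real (nat \<lceil>s * 2 ^ n\<rceil>) / 2 ^ n))"

lemma ev_continuous:
  assumes p: "continuous_on {0..} p" and s: "0 \<le> s"
  shows "ev p s = p s"
proof -
  define c where "c = (\<lambda>n. real (nat \<lceil>s * 2 ^ n\<rceil>) / 2 ^ n)"
  have c: "s \<le> c n" "c n \<le> s + (1/2) ^ n" for n
  proof -
    have "0 \<le> s * 2 ^ n" using s by simp
    then have e: "real (nat \<lceil>s * 2 ^ n\<rceil>) = real_of_int \<lceil>s * 2 ^ n\<rceil>" by simp
    have b: "s * 2 ^ n \<le> real (nat \<lceil>s * 2 ^ n\<rceil>)" "real (nat \<lceil>s * 2 ^ n\<rceil>) \<le> s * 2 ^ n + 1" unfolding e by linarith+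
    show "s \<le> c n" using b(1) unfolding c_def by (simp add: field_simps)
    have "c n \<le> (s * 2 ^ n + 1) / 2 ^ n" unfolding c_def by (intro divide_right_mono b) simp
    then show "c n \<le> s + (1/2) ^ n" by (simp add: add_divide_distrib power_divide)
  qed
  have "(\<lambda>n. s + (1/2) ^ n) \<longlonglongrightarrow> s + 0" by (intro tendsto_intros LIMSEQ_power_zero) auto
  then have "c \<longlonglongrightarrow> s"
    using tendsto_sandwich[of "\<lambda>_. s" c sequentially "\<lambda>n. s + (1/2) ^ n" s] c by simp
  moreover have "continuous (at s within {0..}) p"
    using p s by (simp add: continuous_on_eq_continuous_within)
  ultimately have "(\<lambda>n. p (c n)) \<longlonglongrightarrow> p s"
    using c s by (intro continuous_within_tendsto_compose'[of s "{0..}" p c]) (auto intro: order_trans)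
  then show ?thesis unfolding ev_def c_def by (rule limI)
qed

lemma ev_restrict:
  assumes "continuous_on {0..} W" "0 \<le> s"
  shows "ev (\<lambda>s\<in>{0..}. W s) s = W s"
proof -
  have "continuous_on {0..} (\<lambda>s\<in>{0..}. W s)"
    using assms(1) by (rule continuous_on_cong[THEN iffD1, rotated -1]) auto
  from ev_continuous[OF this assms(2)] assms(2) show ?thesis by simp
qed

lemma ev_measurable: "(\<lambda>q. ev (fst q) (snd q)) \<in> borel_measurable (path_space \<Otimes>\<^sub>M borel)"
  unfolding ev_def
proof (rule borel_measurable_lim_metric)
  fix n :: nat
  have 1: "(\<lambda>q :: (real \<Rightarrow> real) \<times> real. nat \<lceil>snd q * 2 ^ n\<rceil>) \<in> measurable (path_space \<Otimes>\<^sub>M borel) (count_space UNIV)" by measurable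
  show "(\<lambda>q :: (real \<Rightarrow> real) \<times> real. fst q (real (nat \<lceil>snd q * 2 ^ n\<rceil>) / 2 ^ n)) \<in> borel_measurable (path_space \<Otimes>\<^sub>M borel)"
  proof (rule measurable_compose_countable[OF _ 1])
    fix k :: nat
    have "(\<lambda>p. p (real k / 2 ^ n)) \<in> borel_measurable path_space" by (rule measurable_component_singleton) auto
    from measurable_compose[OF measurable_fst this]
    show "(\<lambda>q. fst q (real k / 2 ^ n)) \<in> borel_measurable (path_space \<Otimes>\<^sub>M borel)" .
  qed
qed

lemma measurable_ev [measurable (raw)]:
  assumes "f \<in> measurable M path_space" "g \<in> borel_measurable M"
  shows "(\<lambda>x. ev (f x) (g x)) \<in> borel_measurable M"
  using measurable_compose[OF measurable_Pair[OF assms] ev_measurable] by simp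

section \<open>Uniqueness of the law of Brownian motion\<close>

lemma brownian_motion_path_measurable:
  assumes "brownian_motion P W"
  shows "(\<lambda>\<omega>. \<lambda>s\<in>{0..}. W s \<omega>) \<in> measurable P path_space"
  using assms by (intro measurable_restrict) (auto simp: brownian_motion_def)

lemma brownian_motion_increments:
  assumes P: "prob_space P" and W: "brownian_motion P W"
    and t: "0 \<le> t 0" "\<And>i. i < n \<Longrightarrow> t i < t (Suc i)" and n: "0 < n"
  shows "distr P (PiM {..<n} (\<lambda>_. borel)) (\<lambda>\<omega>. \<lambda>i\<in>{..<n}. W (t (Suc i)) \<omega> - W (t i) \<omega>) =
    PiM {..<n} (\<lambda>i. density lborel (normal_density 0 (sqrt (t (Suc i) - t i))))"
proof -
  interpret prob_space P by fact
  have t0: "0 \<le> t i" if "i \<le> n" for i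
    using that
  proof (induction i)
    case (Suc i)
    then show ?case using t(2)[of i] by simp
  qed (simp add: t)
  have ind: "indep_vars (\<lambda>_. borel) (\<lambda>i \<omega>. W (t (Suc i)) \<omega> - W (t i) \<omega>) {..<n}"
    using W t less_imp_le[OF t(2)] unfolding brownian_motion_def by blast
  have rv: "random_variable borel (\<lambda>\<omega>. W (t (Suc i)) \<omega> - W (t i) \<omega>)" if "i \<in> {..<n}" for i
    using W t0[of i] t0[of "Suc i"] that unfolding brownian_motion_def
    by (intro borel_measurable_diff) auto
  have d: "distr P borel (\<lambda>\<omega>. W (t (Suc i)) \<omega> - W (t i) \<omega>) = density lborel (normal_density 0 (sqrt (t (Suc i) - t i)))"
    if "i \<in> {..<n}" for i
  proof -
    have "distributed P lborel (\<lambda>\<omega>. W (t (Suc i)) \<omega> - W (t i) \<omega>) (normal_density 0 (sqrt (t (Suc i) - t i)))"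
      using W t0[of i] t(2)[of i] that unfolding brownian_motion_def by auto
    then have "distr P lborel (\<lambda>\<omega>. W (t (Suc i)) \<omega> - W (t i) \<omega>) = density lborel (normal_density 0 (sqrt (t (Suc i) - t i)))"
      by (rule distributed_distr_eq_density)
    then show ?thesis by (simp cong: distr_cong)
  qed
  have "distr P (PiM {..<n} (\<lambda>_. borel)) (\<lambda>\<omega>. \<lambda>i\<in>{..<n}. W (t (Suc i)) \<omega> - W (t i) \<omega>) =
     PiM {..<n} (\<lambda>i. distr P borel (\<lambda>\<omega>. W (t (Suc i)) \<omega> - W (t i) \<omega>))"
    using ind rv n by (subst indep_vars_iff_distr_eq_PiM'[symmetric]) auto
  also have "\<dots> = PiM {..<n} (\<lambda>i. density lborel (normal_density 0 (sqrt (t (Suc i) - t i))))"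
    using d by (intro PiM_cong) auto
  finally show ?thesis .
qed

lemma finite_times_enumeration:
  assumes "finite J" "J \<subseteq> {0::real..}"
  obtains n :: nat and t where "0 < n" "t 0 = 0" "\<And>i. i < n \<Longrightarrow> t i < t (Suc i)" "J \<subseteq> t ` {..n}"
proof -
  \<comment> \<open>Time 0 is added because a Brownian motion vanishes there, so that increments sum
    up to values; time 1 is added so that there are at least two times and n is positive.\<close>
  define L where "L = sorted_list_of_set (insert 0 (insert 1 J))"
  have fin: "finite (insert 0 (insert 1 J))" using assms by simp
  have set: "set L = insert 0 (insert 1 J)" unfolding L_def by (rule set_sorted_list_of_set[OF fin])
  have sw: "sorted_wrt (<) L" unfolding L_def by simp
  define n where "n = length L - 1"
  have len: "length L = card (insert 0 (insert 1 J))" unfolding L_def by simp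
  have "card {0, 1::real} \<le> card (insert 0 (insert 1 J))" using fin by (intro card_mono) auto
  then have len2: "2 \<le> length L" by (simp add: len)
  show thesis
  proof (rule that[of n "\<lambda>i. L ! i"])
    show "0 < n" using len2 by (simp add: n_def)
    show lt: "L ! i < L ! Suc i" if "i < n" for i
      using that len2 unfolding n_def by (intro sorted_wrt_nth_less[OF sw]) auto
    obtain k where k: "k < length L" "L ! k = 0" using set by (metis in_set_conv_nth insertI1)
    have "L ! 0 \<in> set L" using len2 by (intro nth_mem) auto
    then have "0 \<le> L ! 0" using assms(2) set by auto
    moreover have "L ! 0 \<le> L ! k"
      using sorted_wrt_nth_less[OF sw, of 0 k] k by (cases "k = 0") auto
    ultimately show "L ! 0 = 0" using k by simp
    show "J \<subseteq> (\<lambda>i. L ! i) ` {..n}"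
    proof
      fix x assume "x \<in> J"
      then obtain i where "i < length L" "L ! i = x" using set by (metis in_set_conv_nth insertCI)
      then show "x \<in> (\<lambda>i. L ! i) ` {..n}" by (auto simp: n_def)
    qed
  qed
qed

text \<open>Cylinder events generate, and a cylinder event over J is an event about partial sums of
  the increments along an enumeration of J. The law of these increments is the same product of
  normal laws for every Brownian motion.\<close>

lemma brownian_motion_law_unique:
  assumes P: "prob_space P" and W: "brownian_motion P W" and P': "prob_space P'" and W': "brownian_motion P' W'"
  shows "distr P path_space (\<lambda>\<omega>. \<lambda>s\<in>{0..}. W s \<omega>) = distr P' path_space (\<lambda>\<omega>. \<lambda>s\<in>{0..}. W' s \<omega>)"
proof (rule measure_eqI_PiM_infinite)
  interpret P: prob_space P by fact
  show "finite_measure (distr P path_space (\<lambda>\<omega>. \<lambda>s\<in>{0..}. W s \<omega>))"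
    by (intro prob_space.finite_measure P.prob_space_distr brownian_motion_path_measurable W)
  fix A :: "real \<Rightarrow> real set" and J :: "real set"
  assume J: "finite J" "J \<subseteq> {0..}" and A: "\<And>i. i \<in> J \<Longrightarrow> A i \<in> sets borel"
  obtain n :: nat and t where n: "0 < n" and t: "t 0 = 0" "\<And>i. i < n \<Longrightarrow> t i < t (Suc i)" and Jt: "J \<subseteq> t ` {..n}"
    using finite_times_enumeration[OF J] by metis
  define I where "I = {i. i \<le> n \<and> t i \<in> J}"
  \<comment> \<open>S involves the times and the sets A only, hence it is the same event for both
    motions.\<close>
  define S where "S = {d \<in> space (PiM {..<n} (\<lambda>_. borel :: real measure)). \<forall>i\<in>I. (\<Sum>k<i. d k) \<in> A (t i)}"
  have fI: "finite I" "\<And>i. i \<in> I \<Longrightarrow> i \<le> n \<and> t i \<in> J" by (auto simp: I_def)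
  have S: "S \<in> sets (PiM {..<n} (\<lambda>_. borel))"
    unfolding S_def
  proof (rule sets.sets_Collect_finite_All[OF _ fI(1)])
    fix i assume i: "i \<in> I"
    have "(\<lambda>d. \<Sum>k<i. d k) \<in> borel_measurable (PiM {..<n} (\<lambda>_. borel :: real measure))"
      using fI(2)[OF i] by (intro borel_measurable_sum measurable_component_singleton) auto
    from measurable_sets[OF this, of "A (t i)"] A[of "t i"] fI(2)[OF i]
    show "{d \<in> space (PiM {..<n} (\<lambda>_. borel :: real measure)). (\<Sum>k<i. d k) \<in> A (t i)} \<in> sets (PiM {..<n} (\<lambda>_. borel))"
      by (simp add: vimage_def Int_def conj_commute)
  qed
  have key: "emeasure (distr Q path_space (\<lambda>\<omega>. \<lambda>s\<in>{0..}. V s \<omega>)) (prod_emb {0..} (\<lambda>_. borel) J (Pi\<^sub>E J A)) =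
     emeasure (PiM {..<n} (\<lambda>i. density lborel (normal_density 0 (sqrt (t (Suc i) - t i))))) S"
    if Q: "prob_space Q" and V: "brownian_motion Q V" for Q :: "'c measure" and V
  proof -
    let ?D = "\<lambda>\<omega>. \<lambda>i\<in>{..<n}. V (t (Suc i)) \<omega> - V (t i) \<omega>"
    have t0: "0 \<le> t i" if "i \<le> n" for i
      using that
    proof (induction i)
      case (Suc i)
      then show ?case using t(2)[of i] by simp
    qed (simp add: t)
    have mV: "V (t i) \<in> borel_measurable Q" if "i \<le> n" for i
      using V t0[OF that] by (auto simp: brownian_motion_def)
    have D: "?D \<in> measurable Q (PiM {..<n} (\<lambda>_. borel))"
      using mV by (intro measurable_restrict borel_measurable_diff) auto
    have sum: "(\<Sum>k<i. ?D \<omega> k) = V (t i) \<omega>" if "i \<le> n" "\<omega> \<in> space Q" for i \<omega>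
    proof -
      have "(\<Sum>k<i. ?D \<omega> k) = (\<Sum>k<i. V (t (Suc k)) \<omega> - V (t k) \<omega>)" using that by (intro sum.cong) auto
      also have "\<dots> = V (t i) \<omega> - V (t 0) \<omega>" by (rule sum_lessThan_telescope)
      finally show ?thesis using V that by (simp add: t brownian_motion_def)
    qed
    have emb: "prod_emb {0..} (\<lambda>_. borel) J (Pi\<^sub>E J A) \<in> sets path_space"
      using J A by (intro sets_PiM_I) auto
    have "(\<lambda>\<omega>. \<lambda>s\<in>{0..}. V s \<omega>) -` prod_emb {0..} (\<lambda>_. borel) J (Pi\<^sub>E J A) \<inter> space Q = {\<omega> \<in> space Q. \<forall>j\<in>J. V j \<omega> \<in> A j}"
    proof -
      have "(\<lambda>s\<in>{0..}. V s \<omega>) \<in> prod_emb {0..} (\<lambda>_. borel) J (Pi\<^sub>E J A) \<longleftrightarrow> (\<forall>j\<in>J. V j \<omega> \<in> A j)" for \<omega>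
      proof -
        have "(\<lambda>s\<in>{0..}. V s \<omega>) \<in> prod_emb {0..} (\<lambda>_. borel) J (Pi\<^sub>E J A) \<longleftrightarrow> (\<forall>j\<in>J. (\<lambda>s\<in>{0..}. V s \<omega>) j \<in> A j)"
          by (auto simp: prod_emb_def PiE_iff)
        also have "\<dots> \<longleftrightarrow> (\<forall>j\<in>J. V j \<omega> \<in> A j)" using J by (intro ball_cong) auto
        finally show ?thesis .
      qed
      then show ?thesis by auto
    qed
    also have "\<dots> = {\<omega> \<in> space Q. \<forall>i\<in>I. V (t i) \<omega> \<in> A (t i)}"
      using Jt by (fastforce simp: I_def)
    also have "\<dots> = ?D -` S \<inter> space Q"
    proof -
      have "?D \<omega> \<in> S \<longleftrightarrow> (\<forall>i\<in>I. V (t i) \<omega> \<in> A (t i))" if \<omega>: "\<omega> \<in> space Q" for \<omega>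
      proof -
        have "?D \<omega> \<in> S \<longleftrightarrow> (\<forall>i\<in>I. (\<Sum>k<i. ?D \<omega> k) \<in> A (t i))"
          using measurable_space[OF D \<omega>] by (simp only: S_def mem_Collect_eq simp_thms)
        also have "\<dots> \<longleftrightarrow> (\<forall>i\<in>I. V (t i) \<omega> \<in> A (t i))"
          using fI(2) sum[OF _ \<omega>] by (intro ball_cong) (simp_all only:)
        finally show ?thesis .
      qed
      then show ?thesis by auto
    qed
    finally have "emeasure (distr Q path_space (\<lambda>\<omega>. \<lambda>s\<in>{0..}. V s \<omega>)) (prod_emb {0..} (\<lambda>_. borel) J (Pi\<^sub>E J A))
       = emeasure (distr Q (PiM {..<n} (\<lambda>_. borel)) ?D) S"
      using S D emb brownian_motion_path_measurable[OF V] by (simp add: emeasure_distr)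
    also have "distr Q (PiM {..<n} (\<lambda>_. borel)) ?D =
      PiM {..<n} (\<lambda>i. density lborel (normal_density 0 (sqrt (t (Suc i) - t i))))"
      using t n by (intro brownian_motion_increments[OF Q V]) auto
    finally show ?thesis .
  qed
  show "emeasure (distr P path_space (\<lambda>\<omega>. \<lambda>s\<in>{0..}. W s \<omega>)) (prod_emb {0..} (\<lambda>_. borel) J (Pi\<^sub>E J A)) =
     emeasure (distr P' path_space (\<lambda>\<omega>. \<lambda>s\<in>{0..}. W' s \<omega>)) (prod_emb {0..} (\<lambda>_. borel) J (Pi\<^sub>E J A))"
    using key[OF P W] key[OF P' W'] by simp
qed simp_all

section \<open>Canonical branching Brownian motion\<close>

abbreviation mark_space :: "(real \<times> (real \<Rightarrow> real)) measure" where
  "mark_space \<equiv> borel \<Otimes>\<^sub>M path_space"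

abbreviation tree_space :: "(bool list \<Rightarrow> real \<times> (real \<Rightarrow> real)) measure" where
  "tree_space \<equiv> Pi\<^sub>M UNIV (\<lambda>_. mark_space)"

definition life :: "bool list \<Rightarrow> (bool list \<Rightarrow> real \<times> (real \<Rightarrow> real)) \<Rightarrow> real" where
  "life u \<eta> = fst (\<eta> u)"

text \<open>Evaluation goes through \<open>ev\<close>, so that the displacement is jointly
  measurable in age and tree. Together with \<open>life\<close> it makes \<open>birth_time\<close>,
  \<open>alive\<close>, \<open>position\<close> and \<open>maximum\<close> applicable to a tree of
  marks.\<close>

definition disp :: "bool list \<Rightarrow> real \<Rightarrow> (bool list \<Rightarrow> real \<times> (real \<Rightarrow> real)) \<Rightarrow> real" where
  "disp u s \<eta> = ev (snd (\<eta> u)) s"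

definition encode :: "(bool list \<Rightarrow> 'w \<Rightarrow> real) \<Rightarrow> (bool list \<Rightarrow> real \<Rightarrow> 'w \<Rightarrow> real) \<Rightarrow> 'w \<Rightarrow>
    bool list \<Rightarrow> real \<times> (real \<Rightarrow> real)" where
  "encode T B \<omega> u = (T u \<omega>, \<lambda>s\<in>{0..}. B u s \<omega>)"

lemma measurable_life [measurable]: "life u \<in> borel_measurable tree_space"
  unfolding life_def
  by (rule measurable_compose[of "\<lambda>\<eta>. \<eta> u" _ mark_space, OF measurable_component_singleton[OF UNIV_I] measurable_fst])

lemma measurable_disp [measurable (raw)]:
  assumes f: "f \<in> borel_measurable M" and g: "g \<in> measurable M tree_space"
  shows "(\<lambda>x. disp u (f x) (g x)) \<in> borel_measurable M"
proof -
  have "(\<lambda>x. snd (g x u)) \<in> measurable M path_space"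
    by (rule measurable_compose[OF measurable_compose[OF g measurable_component_singleton[OF UNIV_I]] measurable_snd])
  then show ?thesis unfolding disp_def using f by (intro measurable_ev)
qed

lemma measurable_birth_time [measurable]: "birth_time life u \<in> borel_measurable tree_space"
proof (induction u)
  case (Cons b u)
  then have [measurable]: "birth_time life u \<in> borel_measurable tree_space" .
  show ?case unfolding birth_time.simps by measurable
qed simp

lemma measurable_position [measurable (raw)]:
  assumes f: "f \<in> borel_measurable M" and g [measurable]: "g \<in> measurable M tree_space"
  shows "(\<lambda>x. position life disp u (f x) (g x)) \<in> borel_measurable M"
  using f
proof (induction u arbitrary: f)
  case Nil
  then show ?case by (simp add: measurable_disp g)
next
  case (Cons b u)
  have bt: "(\<lambda>x. birth_time life (b # u) (g x)) \<in> borel_measurable M" by measurable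
  note [measurable] = Cons.IH[OF Cons.prems] Cons.IH[OF bt] bt Cons.prems
  show ?case
    unfolding position.simps Let_def
    by (intro measurable_If borel_measurable_add measurable_disp borel_measurable_diff g Cons.IH bt Cons.prems)
      measurable
qed

lemma measurable_alive [measurable]:
  assumes [measurable]: "f \<in> borel_measurable M" "g \<in> measurable M tree_space"
  shows "Measurable.pred M (\<lambda>x. u \<in> alive life (f x) (g x))"
  unfolding alive_def mem_Collect_eq by measurable

lemma birth_time_encode: "birth_time life u (encode T B \<omega>) = birth_time T u \<omega>"
  by (induction u) (auto simp: life_def encode_def)

lemma alive_encode: "alive life t (encode T B \<omega>) = alive T t \<omega>"
  by (simp add: alive_def birth_time_encode) (simp add: life_def encode_def)

lemma birth_time_nonneg: "(\<And>u. 0 < T u \<omega>) \<Longrightarrow> 0 \<le> birth_time T u \<omega>"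
  by (induction u) (auto intro: add_nonneg_nonneg less_imp_le)

lemma disp_encode:
  assumes "continuous_on {0..} (\<lambda>s. B u s \<omega>)" "0 \<le> s"
  shows "disp u s (encode T B \<omega>) = B u s \<omega>"
  using ev_restrict[OF assms] by (simp add: disp_def encode_def)

lemma position_encode:
  assumes c: "\<And>u. continuous_on {0..} (\<lambda>s. B u s \<omega>)" and p: "\<And>u. 0 < T u \<omega>" and "0 \<le> s"
  shows "position life disp u s (encode T B \<omega>) = position T B u s \<omega>"
  using \<open>0 \<le> s\<close>
proof (induction u arbitrary: s)
  case Nil
  then show ?case by (simp add: disp_encode c)
next
  case (Cons b u)
  have bb: "birth_time life (b # u) (encode T B \<omega>) = birth_time T (b # u) \<omega>" by (rule birth_time_encode)
  have "0 \<le> birth_time T (b # u) \<omega>" by (rule birth_time_nonneg) (rule p)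
  then show ?case unfolding position.simps bb Let_def using Cons by (auto simp: disp_encode c)
qed

lemma maximum_encode:
  assumes "\<And>u. continuous_on {0..} (\<lambda>s. B u s \<omega>)" "\<And>u. 0 < T u \<omega>" "0 \<le> t"
  shows "maximum life disp t (encode T B \<omega>) = maximum T B t \<omega>"
  unfolding maximum_def alive_encode by (intro arg_cong[where f=Max] image_cong refl position_encode assms)

lemma particles_from_encode:
  assumes "\<And>u. continuous_on {0..} (\<lambda>s. B u s \<omega>)" "\<And>u. 0 < T u \<omega>" "0 \<le> t"
  shows "particles_from life disp t c (encode T B \<omega>) = particles_from T B t c \<omega>"
  unfolding particles_from_def alive_encode by (simp add: position_encode[where \<omega>=\<omega>] assms)

section \<open>Measurability of the population\<close>

text \<open>Finiteness of a set of labels becomes a bound on their lengths, a countable condition to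
  which measurability applies.\<close>

lemma finite_bool_lists_iff: "finite (A :: bool list set) \<longleftrightarrow> (\<exists>n. \<forall>u\<in>A. length u \<le> n)"
proof
  assume "finite A"
  then have "finite (length ` A)" by simp
  then obtain n where "\<And>k. k \<in> length ` A \<Longrightarrow> k \<le> n" by (meson finite_nat_set_iff_bounded_le)
  then show "\<exists>n. \<forall>u\<in>A. length u \<le> n" by auto
next
  assume "\<exists>n. \<forall>u\<in>A. length u \<le> n"
  then obtain n where "A \<subseteq> {u. set u \<subseteq> UNIV \<and> length u \<le> n}" by auto
  then show "finite A" by (rule finite_subset) (rule finite_lists_length_le, simp)
qed

lemma measurable_finite_alive [measurable (raw)]:
  assumes [measurable]: "f \<in> borel_measurable M" "g \<in> measurable M tree_space"
  shows "Measurable.pred M (\<lambda>x. finite (alive life (f x) (g x)))"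
proof -
  have "(\<lambda>x. finite (alive life (f x) (g x))) = (\<lambda>x. \<exists>n. \<forall>u. length u \<le> n \<or> u \<notin> alive life (f x) (g x))"
    unfolding finite_bool_lists_iff by auto
  also have "Measurable.pred M \<dots>" by measurable
  finally show ?thesis .
qed

lemma Max_infinite: "infinite A \<Longrightarrow> Max A = Max {}" for A :: "real set"
  unfolding Max.eq_fold' by simp

lemma measurable_maximum [measurable (raw)]:
  assumes f [measurable]: "f \<in> borel_measurable M" and g [measurable]: "g \<in> measurable M tree_space"
  shows "(\<lambda>x. maximum life disp (f x) (g x)) \<in> borel_measurable M"
proof -
  let ?A = "\<lambda>x. alive life (f x) (g x)" and ?p = "\<lambda>u x. position life disp u (f x) (g x)"
  \<comment> \<open>\<open>Max\<close> is taken over positions, and an infinite population could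
    occupy finitely many of them; so F asks that labels of bounded length already realise every
    position. Where F fails, the maximum has the constant value \<open>Max {}\<close>.\<close>
  define F where "F = (\<lambda>x. (\<exists>u. u \<in> ?A x) \<and> (\<exists>n. \<forall>u. u \<in> ?A x \<longrightarrow> (\<exists>v. length v \<le> n \<and> v \<in> ?A x \<and> ?p v x = ?p u x)))"
  have F: "F x \<longleftrightarrow> ?A x \<noteq> {} \<and> finite ((\<lambda>u. ?p u x) ` ?A x)" for x
  proof -
    have "finite ((\<lambda>u. ?p u x) ` ?A x) \<longleftrightarrow> (\<exists>n. \<forall>u. u \<in> ?A x \<longrightarrow> (\<exists>v. length v \<le> n \<and> v \<in> ?A x \<and> ?p v x = ?p u x))"
    proof
      assume "finite ((\<lambda>u. ?p u x) ` ?A x)"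
      then obtain C where C: "C \<subseteq> ?A x" "finite C" "(\<lambda>u. ?p u x) ` ?A x = (\<lambda>u. ?p u x) ` C"
        by (meson finite_subset_image order_refl)
      then obtain n where n: "\<forall>u\<in>C. length u \<le> n" using finite_bool_lists_iff by auto
      have "\<exists>v. length v \<le> n \<and> v \<in> ?A x \<and> ?p v x = ?p u x" if "u \<in> ?A x" for u
      proof -
        have "?p u x \<in> (\<lambda>u. ?p u x) ` C" using that C(3) by blast
        then obtain v where "v \<in> C" "?p u x = ?p v x" by blast
        then show ?thesis using C n by auto
      qed
      then show "\<exists>n. \<forall>u. u \<in> ?A x \<longrightarrow> (\<exists>v. length v \<le> n \<and> v \<in> ?A x \<and> ?p v x = ?p u x)" by blast
    next
      assume "\<exists>n. \<forall>u. u \<in> ?A x \<longrightarrow> (\<exists>v. length v \<le> n \<and> v \<in> ?A x \<and> ?p v x = ?p u x)"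
      then obtain n where n: "\<And>u. u \<in> ?A x \<Longrightarrow> \<exists>v. length v \<le> n \<and> v \<in> ?A x \<and> ?p v x = ?p u x" by blast
      have "(\<lambda>u. ?p u x) ` ?A x \<subseteq> (\<lambda>u. ?p u x) ` {v. length v \<le> n}"
      proof (rule image_subsetI)
        fix u assume "u \<in> ?A x"
        from n[OF this] obtain v where v: "length v \<le> n" "?p v x = ?p u x" by blast
        show "?p u x \<in> (\<lambda>u. ?p u x) ` {v. length v \<le> n}"
          by (rule image_eqI[of _ _ v]) (simp_all add: v)
      qed
      moreover have "finite {v :: bool list. length v \<le> n}" unfolding finite_bool_lists_iff by auto
      ultimately show "finite ((\<lambda>u. ?p u x) ` ?A x)" by (rule finite_surj[rotated])
    qed
    then show ?thesis unfolding F_def by auto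
  qed
  have [measurable]: "Measurable.pred M F" unfolding F_def by measurable
  show ?thesis
  proof (rule borel_measurableI_le)
    fix a :: real
    have "maximum life disp (f x) (g x) \<le> a \<longleftrightarrow>
        (if F x then (\<forall>u. u \<in> ?A x \<longrightarrow> ?p u x \<le> a) else Max {} \<le> a)" for x
    proof (cases "F x")
      case True
      then show ?thesis unfolding maximum_def using F[of x] by simp blast
    next
      case False
      then have "maximum life disp (f x) (g x) = Max {}"
        unfolding maximum_def using F[of x] Max_infinite by (cases "?A x = {}") auto
      with False show ?thesis by simp
    qed
    then show "{x \<in> space M. maximum life disp (f x) (g x) \<le> a} \<in> sets M" by simp
  qed
qed

lemma measurable_particles_from [measurable (raw)]:
  assumes f [measurable]: "f \<in> borel_measurable M" and c [measurable]: "c \<in> borel_measurable M"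
    and g [measurable]: "g \<in> measurable M tree_space"
  shows "(\<lambda>x. particles_from life disp (f x) (c x) (g x)) \<in> measurable M (borel_of vague_topology)"
  unfolding measurable_into_vague_iff
proof (intro conjI allI)
  show "(\<lambda>x. particles_from life disp (f x) (c x) (g x)) \<in> space M \<rightarrow> point_measures"
    by (simp add: particles_from_def dirac_sum_point_measures)
  fix i
  let ?A = "\<lambda>x. alive life (f x) (g x)" and ?p = "\<lambda>u x. position life disp u (f x) (g x) - c x"
  \<comment> \<open>Sums over labels of bounded length are measurable and become stationary when the
    population is finite, so their limit is the sum over the population.\<close>
  define S where "S = (\<lambda>n x. \<Sum>u\<in>{u. length u \<le> n}. (if u \<in> ?A x then tent i (?p u x) else 0))"
  have fin: "finite {v :: bool list. length v \<le> n}" for n unfolding finite_bool_lists_iff by auto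
  have "(\<lambda>x. lim (\<lambda>n. S n x)) \<in> borel_measurable M"
    unfolding S_def by (intro borel_measurable_lim_metric borel_measurable_sum) measurable
  then have "(\<lambda>x. if finite (?A x) then lim (\<lambda>n. S n x) else 0) \<in> borel_measurable M" by measurable
  also have "(\<lambda>x. if finite (?A x) then lim (\<lambda>n. S n x) else 0) =
    (\<lambda>x. \<integral>y. tent i y \<partial>particles_from life disp (f x) (c x) (g x))"
  proof
    fix x
    show "(if finite (?A x) then lim (\<lambda>n. S n x) else 0) = (\<integral>y. tent i y \<partial>particles_from life disp (f x) (c x) (g x))"
    proof (cases "finite (?A x)")
      case True
      then obtain n where n: "\<forall>u\<in>?A x. length u \<le> n" unfolding finite_bool_lists_iff by auto
      have "S k x = (\<Sum>u\<in>?A x. tent i (?p u x))" if "k \<ge> n" for k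
        unfolding S_def using n that True
        by (intro sum.mono_neutral_cong_right fin) (auto intro: order_trans)
      then have "(\<lambda>k. S k x) \<longlonglongrightarrow> (\<Sum>u\<in>?A x. tent i (?p u x))"
        by (intro tendsto_eventually eventually_sequentiallyI)
      then show ?thesis using True by (simp add: limI particles_from_def integral_dirac_sum)
    next
      case False
      then show ?thesis by (simp add: particles_from_def integral_dirac_sum)
    qed
  qed
  finally show "(\<lambda>x. \<integral>y. tent i y \<partial>particles_from life disp (f x) (c x) (g x)) \<in> borel_measurable M" .
qed

section \<open>The branching property\<close>

text \<open>
  Of the law \<open>W\<close> of Brownian motion only its one-dimensional marginals are used from here on.
\<close>

locale canonical_bbm =
  fixes W :: "(real \<Rightarrow> real) measure"
  assumes W_prob: "prob_space W"
    and W_sets: "sets W = sets path_space"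
    and W_marginal: "\<And>s. 0 < s \<Longrightarrow> distr W borel (\<lambda>p. ev p s) = density lborel (normal_density 0 (sqrt s))"
begin

definition mark_law :: "(real \<times> (real \<Rightarrow> real)) measure" where
  "mark_law = density lborel (exponential_density 1) \<Otimes>\<^sub>M W"

definition tree_law :: "(bool list \<Rightarrow> real \<times> (real \<Rightarrow> real)) measure" where
  "tree_law = Pi\<^sub>M UNIV (\<lambda>_. mark_law)"

lemma exponential_prob: "prob_space (density lborel (exponential_density 1))"
  by (rule prob_space_exponential_density) simp

lemma mark_law_prob: "prob_space mark_law"
  unfolding mark_law_def by (intro prob_space_pair exponential_prob W_prob)

lemma sets_mark_law [measurable_cong]: "sets mark_law = sets mark_space"
  unfolding mark_law_def by (intro sets_pair_measure_cong) (simp_all add: W_sets)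

lemma tree_law_prob: "prob_space tree_law"
  unfolding tree_law_def by (intro prob_space_PiM mark_law_prob)

lemma sets_tree_law [measurable_cong]: "sets tree_law = sets tree_space"
  unfolding tree_law_def by (intro sets_PiM_cong) (simp_all add: sets_mark_law)

end

text \<open>Independence of the marks turns their joint law into a product, independence of lifetime
  and path makes each factor a product, and uniqueness of the Brownian law makes all factors equal.
  What remains of P, T, B is the law W of one path.\<close>

lemma bbm_canonical:
  assumes "branching_brownian_motion P T B"
  shows "\<exists>W. canonical_bbm W \<and> encode T B \<in> measurable P tree_space \<and>
    distr P tree_space (encode T B) = canonical_bbm.tree_law W"
proof -
  from assms have P: "prob_space P"
    and T: "\<And>u. distributed P lborel (T u) (exponential_density 1)"
    and B: "\<And>u. brownian_motion P (B u)"
    and TB: "\<And>u. indep_rv P borel (T u) path_space (\<lambda>\<omega>. \<lambda>s\<in>{0..}. B u s \<omega>)"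
    and ind: "prob_space.indep_vars P (\<lambda>_. borel \<Otimes>\<^sub>M path_space) (\<lambda>u \<omega>. (T u \<omega>, \<lambda>s\<in>{0..}. B u s \<omega>)) UNIV"
    unfolding branching_brownian_motion_def by auto
  interpret prob_space P by fact
  note path_m [measurable] = brownian_motion_path_measurable[OF B]
  have T_m [measurable]: "T u \<in> borel_measurable P" for u
    using T[of u] by (simp add: distributed_def)
  define W where "W = distr P path_space (\<lambda>\<omega>. \<lambda>s\<in>{0..}. B [] s \<omega>)"
  have W: "distr P path_space (\<lambda>\<omega>. \<lambda>s\<in>{0..}. B u s \<omega>) = W" for u
    unfolding W_def by (rule brownian_motion_law_unique[OF P B P B])
  interpret canonical_bbm W
  proof (rule canonical_bbm.intro)
    show "prob_space W" unfolding W_def by (rule prob_space_distr[OF path_m])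
    show "sets W = sets path_space" by (simp add: W_def)
    fix s assume s: "0 < (s :: real)"
    have "distr W borel (\<lambda>p. ev p s) = distr P borel (\<lambda>\<omega>. ev (\<lambda>s\<in>{0..}. B [] s \<omega>) s)"
      unfolding W_def by (subst distr_distr) (simp_all add: comp_def path_m measurable_ev)
    also have "\<dots> = distr P borel (\<lambda>\<omega>. B [] s \<omega> - B [] 0 \<omega>)"
    proof (rule distr_cong)
      fix \<omega> assume "\<omega> \<in> space P"
      then have "continuous_on {0..} (\<lambda>s. B [] s \<omega>)" "B [] 0 \<omega> = 0" using B[of "[]"] by (auto simp: brownian_motion_def)
      then show "ev (\<lambda>s\<in>{0..}. B [] s \<omega>) s = B [] s \<omega> - B [] 0 \<omega>" using ev_restrict[of "\<lambda>s. B [] s \<omega>" s] s by simp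
    qed simp_all
    also have "\<dots> = distr P lborel (\<lambda>\<omega>. B [] s \<omega> - B [] 0 \<omega>)" by (rule distr_cong) simp_all
    also have "\<dots> = density lborel (normal_density 0 (sqrt (s - 0)))"
    proof (rule distributed_distr_eq_density)
      show "distributed P lborel (\<lambda>\<omega>. B [] s \<omega> - B [] 0 \<omega>) (normal_density 0 (sqrt (s - 0)))"
        using B[of "[]"] s order_refl unfolding brownian_motion_def by blast
    qed
    finally show "distr W borel (\<lambda>p. ev p s) = density lborel (\<lambda>x. ennreal (normal_density 0 (sqrt s) x))" by simp
  qed
  have mark: "distr P mark_space (\<lambda>\<omega>. (T u \<omega>, \<lambda>s\<in>{0..}. B u s \<omega>)) = mark_law" for u
  proof -
    have "mark_law = distr P borel (T u) \<Otimes>\<^sub>M distr P path_space (\<lambda>\<omega>. \<lambda>s\<in>{0..}. B u s \<omega>)"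
    proof -
      have "distr P lborel (T u) = density lborel (exponential_density 1)" by (rule distributed_distr_eq_density[OF T])
      then have "distr P borel (T u) = density lborel (exponential_density 1)" by (simp cong: distr_cong)
      then show ?thesis unfolding mark_law_def W by simp
    qed
    also have "\<dots> = distr P mark_space (\<lambda>\<omega>. (T u \<omega>, \<lambda>s\<in>{0..}. B u s \<omega>))"
    proof (rule pair_measure_eqI)
      interpret D1: prob_space "distr P borel (T u)" by (rule prob_space_distr) simp
      interpret D2: prob_space "distr P path_space (\<lambda>\<omega>. \<lambda>s\<in>{0..}. B u s \<omega>)" by (rule prob_space_distr[OF path_m])
      show "sigma_finite_measure (distr P borel (T u))" "sigma_finite_measure (distr P path_space (\<lambda>\<omega>. \<lambda>s\<in>{0..}. B u s \<omega>))"
        by unfold_locales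
      show "sets (distr P borel (T u) \<Otimes>\<^sub>M distr P path_space (\<lambda>\<omega>. \<lambda>s\<in>{0..}. B u s \<omega>)) =
          sets (distr P mark_space (\<lambda>\<omega>. (T u \<omega>, \<lambda>s\<in>{0..}. B u s \<omega>)))"
        unfolding sets_distr by (intro sets_pair_measure_cong) simp_all
      fix A C assume "A \<in> sets (distr P borel (T u))" "C \<in> sets (distr P path_space (\<lambda>\<omega>. \<lambda>s\<in>{0..}. B u s \<omega>))"
      then have A: "A \<in> sets borel" and C: "C \<in> sets path_space" by simp_all
      have "prob ((T u -` A \<inter> space P) \<inter> ((\<lambda>\<omega>. \<lambda>s\<in>{0..}. B u s \<omega>) -` C \<inter> space P)) =
         prob (T u -` A \<inter> space P) * prob ((\<lambda>\<omega>. \<lambda>s\<in>{0..}. B u s \<omega>) -` C \<inter> space P)"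
        using TB[of u] A C unfolding indep_rv_def by (intro indep_setD[of "{T u -` A \<inter> space P | A. A \<in> sets borel}"
          "{(\<lambda>\<omega>. \<lambda>s\<in>{0..}. B u s \<omega>) -` A \<inter> space P | A. A \<in> sets path_space}"]) auto
      moreover have "(T u -` A \<inter> space P) \<inter> ((\<lambda>\<omega>. \<lambda>s\<in>{0..}. B u s \<omega>) -` C \<inter> space P) =
          (\<lambda>\<omega>. (T u \<omega>, \<lambda>s\<in>{0..}. B u s \<omega>)) -` (A \<times> C) \<inter> space P" by auto
      ultimately show "emeasure (distr P borel (T u)) A * emeasure (distr P path_space (\<lambda>\<omega>. \<lambda>s\<in>{0..}. B u s \<omega>)) C =
          emeasure (distr P mark_space (\<lambda>\<omega>. (T u \<omega>, \<lambda>s\<in>{0..}. B u s \<omega>))) (A \<times> C)"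
        using A C by (simp add: emeasure_distr path_m emeasure_eq_measure ennreal_mult)
    qed
    finally show ?thesis ..
  qed
  have enc: "encode T B = (\<lambda>\<omega>. \<lambda>u\<in>UNIV. (T u \<omega>, \<lambda>s\<in>{0..}. B u s \<omega>))"
    by (simp add: encode_def fun_eq_iff)
  have enc_m: "encode T B \<in> measurable P tree_space"
    unfolding enc by (intro measurable_restrict) measurable
  have "distr P tree_space (encode T B) = Pi\<^sub>M UNIV (\<lambda>u. distr P mark_space (\<lambda>\<omega>. (T u \<omega>, \<lambda>s\<in>{0..}. B u s \<omega>)))"
    unfolding enc using ind by (subst indep_vars_iff_distr_eq_PiM[symmetric]) auto
  also have "\<dots> = tree_law" unfolding mark tree_law_def ..
  finally show ?thesis using enc_m canonical_bbm_axioms by blast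
qed

text \<open>Labels list the most recent generation first, so the child of the root from which a
  particle descends is the last entry of its label: \<open>last\<close> chooses the subtree and
  \<open>butlast\<close> is the label within it.\<close>

definition graft :: "'m \<Rightarrow> (bool list \<Rightarrow> 'm) \<Rightarrow> (bool list \<Rightarrow> 'm) \<Rightarrow> bool list \<Rightarrow> 'm" where
  "graft x \<eta>1 \<eta>2 u = (if u = [] then x else if last u then \<eta>1 (butlast u) else \<eta>2 (butlast u))"

lemma graft_simps [simp]: "graft x \<eta>1 \<eta>2 [] = x" "graft x \<eta>1 \<eta>2 (u @ [b]) = (if b then \<eta>1 u else \<eta>2 u)"
  by (auto simp: graft_def)

lemma measurable_graft [measurable (raw)]:
  assumes f: "f \<in> measurable M mark_space" and g: "g \<in> measurable M tree_space" "h \<in> measurable M tree_space"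
  shows "(\<lambda>x. graft (f x) (g x) (h x)) \<in> measurable M tree_space"
proof (rule measurable_PiM_single')
  fix u :: "bool list"
  have *: "(\<lambda>x. g x v) \<in> measurable M mark_space" "(\<lambda>x. h x v) \<in> measurable M mark_space" for v
    using g[THEN measurable_compose, OF measurable_component_singleton[OF UNIV_I, of v]] by auto
  show "(\<lambda>x. graft (f x) (g x) (h x) u) \<in> measurable M mark_space"
    unfolding graft_def using f * by auto
next
  show "(\<lambda>x. graft (f x) (g x) (h x)) \<in> space M \<rightarrow> (\<Pi>\<^sub>E i\<in>UNIV. space mark_space)"
    using measurable_space[OF f] measurable_space[OF g(1)] measurable_space[OF g(2)]
    by (fastforce simp: graft_def space_PiM PiE_iff)
qed

context canonical_bbm
begin

text \<open>The branching property at the level of marks: an infinite product of equal factors is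
  unchanged when the factors are regrouped into the root and the two subtrees. On a cylinder event
  the finite product over J splits accordingly.\<close>

lemma tree_law_graft:
  "distr (mark_law \<Otimes>\<^sub>M (tree_law \<Otimes>\<^sub>M tree_law)) tree_space (\<lambda>(x, \<eta>1, \<eta>2). graft x \<eta>1 \<eta>2) = tree_law"
proof -
  interpret mark: prob_space mark_law by (rule mark_law_prob)
  interpret tree: prob_space tree_law by (rule tree_law_prob)
  interpret tt: pair_prob_space tree_law tree_law ..
  interpret mtt: pair_prob_space mark_law "tree_law \<Otimes>\<^sub>M tree_law" ..
  interpret pp: product_prob_space "\<lambda>_::bool list. mark_law" UNIV ..
  have m: "(\<lambda>(x, \<eta>1, \<eta>2). graft x \<eta>1 \<eta>2) \<in> measurable (mark_law \<Otimes>\<^sub>M (tree_law \<Otimes>\<^sub>M tree_law)) tree_space"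
    by measurable
  have sp: "space tree_law = UNIV \<rightarrow>\<^sub>E space mark_law" by (simp add: tree_law_def space_PiM)
  have box: "emeasure tree_law {\<eta> \<in> space tree_law. \<forall>u\<in>J. \<eta> u \<in> F u} = (\<Prod>u\<in>J. emeasure mark_law (F u))"
    if "finite J" "\<And>u. u \<in> J \<Longrightarrow> F u \<in> sets mark_law" for J :: "bool list set" and F
    unfolding tree_law_def using that by (intro pp.emeasure_PiM_Collect) auto
  have box_sets: "{\<eta> \<in> space tree_law. \<forall>u\<in>J. \<eta> u \<in> F u} \<in> sets tree_law"
    if "finite J" "\<And>u. u \<in> J \<Longrightarrow> F u \<in> sets mark_law" for J :: "bool list set" and F
    unfolding tree_law_def using that by measurable
  show ?thesis
    unfolding tree_law_def[of] 
  proof (fold tree_law_def, subst (2) tree_law_def, rule pp.PiM_eq)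
    show "sets (distr (mark_law \<Otimes>\<^sub>M tree_law \<Otimes>\<^sub>M tree_law) tree_space (\<lambda>(x, \<eta>1, \<eta>2). graft x \<eta>1 \<eta>2)) =
      sets (Pi\<^sub>M UNIV (\<lambda>_. mark_law))" using sets_tree_law by (simp add: tree_law_def)
    fix J :: "bool list set" and F
    assume J: "finite J" and F: "\<And>j. j \<in> J \<Longrightarrow> F j \<in> sets mark_law"
    define J1 where "J1 = (\<lambda>b. {u. u @ [b] \<in> J})"
    have fJ1: "finite (J1 b)" for b
      unfolding J1_def by (rule finite_subset[of _ "butlast ` J"]) (use J in \<open>force simp: image_iff\<close>)+
    have Jdec: "J = (J \<inter> {[]}) \<union> (\<lambda>u. u @ [True]) ` J1 True \<union> (\<lambda>u. u @ [False]) ` J1 False"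
    proof (rule set_eqI)
      fix u show "u \<in> J \<longleftrightarrow> u \<in> (J \<inter> {[]}) \<union> (\<lambda>u. u @ [True]) ` J1 True \<union> (\<lambda>u. u @ [False]) ` J1 False"
      proof (cases u rule: rev_cases)
        case (snoc v b)
        then show ?thesis by (cases b) (auto simp: J1_def)
      qed auto
    qed
    define X where "X = {x \<in> space mark_law. [] \<in> J \<longrightarrow> x \<in> F []}"
    define Y where "Y = (\<lambda>b. {\<eta> \<in> space tree_law. \<forall>u\<in>J1 b. \<eta> u \<in> F (u @ [b])})"
    have Ys: "Y b \<in> sets tree_law" for b unfolding Y_def by (rule box_sets[OF fJ1]) (auto simp: J1_def F)
    have Xs: "X \<in> sets mark_law"
      unfolding X_def using F[of "[]"] sets.sets_into_space[OF F[of "[]"]] by (cases "[] \<in> J") (auto simp: Int_def[symmetric] Collect_conj_eq Int_absorb1)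
    have emb: "prod_emb UNIV (\<lambda>_. mark_law) J (Pi\<^sub>E J F) = {\<eta> \<in> space tree_law. \<forall>u\<in>J. \<eta> u \<in> F u}"
      unfolding sp prod_emb_def by (auto simp: PiE_iff)
    have pre: "(\<lambda>(x, \<eta>1, \<eta>2). graft x \<eta>1 \<eta>2) -` {\<eta> \<in> space tree_law. \<forall>u\<in>J. \<eta> u \<in> F u} \<inter>
       space (mark_law \<Otimes>\<^sub>M tree_law \<Otimes>\<^sub>M tree_law) = X \<times> (Y True \<times> Y False)"
    proof -
      have g1: "(\<forall>u\<in>J. graft x \<eta>1 \<eta>2 u \<in> F u) \<longleftrightarrow> ([] \<in> J \<longrightarrow> x \<in> F []) \<and> (\<forall>u\<in>J1 True. \<eta>1 u \<in> F (u @ [True])) \<and>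
        (\<forall>u\<in>J1 False. \<eta>2 u \<in> F (u @ [False]))" for x \<eta>1 \<eta>2
        by (subst Jdec) (auto simp: ball_Un)
      have g2: "graft x \<eta>1 \<eta>2 \<in> space tree_law" if "x \<in> space mark_law" "\<eta>1 \<in> space tree_law" "\<eta>2 \<in> space tree_law" for x \<eta>1 \<eta>2
        using that by (auto simp: sp graft_def PiE_iff)
      have "(\<lambda>(x, \<eta>1, \<eta>2). graft x \<eta>1 \<eta>2) -` {\<eta> \<in> space tree_law. \<forall>u\<in>J. \<eta> u \<in> F u} \<inter>
          space (mark_law \<Otimes>\<^sub>M tree_law \<Otimes>\<^sub>M tree_law) = {(x, \<eta>1, \<eta>2). x \<in> space mark_law \<and> \<eta>1 \<in> space tree_law \<and> \<eta>2 \<in> space tree_law \<and>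
           ([] \<in> J \<longrightarrow> x \<in> F []) \<and> (\<forall>u\<in>J1 True. \<eta>1 u \<in> F (u @ [True])) \<and> (\<forall>u\<in>J1 False. \<eta>2 u \<in> F (u @ [False]))}"
        unfolding space_pair_measure g1[symmetric] using g2 by auto
      also have "\<dots> = X \<times> (Y True \<times> Y False)" unfolding X_def Y_def by auto
      finally show ?thesis .
    qed
    have YY: "emeasure tree_law (Y b) = (\<Prod>u\<in>(\<lambda>u. u @ [b]) ` J1 b. emeasure mark_law (F u))" for b
    proof -
      have "emeasure tree_law (Y b) = (\<Prod>u\<in>J1 b. emeasure mark_law (F (u @ [b])))"
        unfolding Y_def by (rule box[OF fJ1]) (auto simp: J1_def F)
      then show ?thesis by (subst prod.reindex) (auto simp: inj_on_def)
    qed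
    have "emeasure (distr (mark_law \<Otimes>\<^sub>M tree_law \<Otimes>\<^sub>M tree_law) tree_space (\<lambda>(x, \<eta>1, \<eta>2). graft x \<eta>1 \<eta>2))
       (prod_emb UNIV (\<lambda>_. mark_law) J (Pi\<^sub>E J F)) = emeasure (mark_law \<Otimes>\<^sub>M tree_law \<Otimes>\<^sub>M tree_law) (X \<times> (Y True \<times> Y False))"
      unfolding emb pre[symmetric] using m box_sets[OF J F] by (intro emeasure_distr) (simp_all add: sets_tree_law)
    also have "\<dots> = emeasure mark_law X * (emeasure tree_law (Y True) * emeasure tree_law (Y False))"
      using Xs Ys by (simp add: tt.emeasure_pair_measure_Times mtt.emeasure_pair_measure_Times tree.emeasure_pair_measure_Times tt.P.emeasure_pair_measure_Times)
    also have "emeasure mark_law X = (\<Prod>u\<in>J \<inter> {[]}. emeasure mark_law (F u))"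
    proof (cases "[] \<in> J")
      case True
      then have "X = F []" "J \<inter> {[]} = {[]}" using sets.sets_into_space[OF F] by (auto simp: X_def)
      then show ?thesis by simp
    next
      case False
      then have "X = space mark_law" "J \<inter> {[]} = {}" by (auto simp: X_def)
      then show ?thesis by (simp add: mark.emeasure_space_1)
    qed
    also note YY[of True]
    also note YY[of False]
    also have "(\<Prod>u\<in>J \<inter> {[]}. emeasure mark_law (F u)) * ((\<Prod>u\<in>(\<lambda>u. u @ [True]) ` J1 True. emeasure mark_law (F u)) *
        (\<Prod>u\<in>(\<lambda>u. u @ [False]) ` J1 False. emeasure mark_law (F u))) = (\<Prod>u\<in>J. emeasure mark_law (F u))"
    proof -
      define S0 S1 S2 where "S0 = J \<inter> {[]}" "S1 = (\<lambda>u. u @ [True]) ` J1 True" "S2 = (\<lambda>u. u @ [False]) ` J1 False"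
      have fin: "finite S0" "finite S1" "finite S2" using fJ1 J by (auto simp: S0_S1_S2_def)
      have disj: "S0 \<inter> (S1 \<union> S2) = {}" "S1 \<inter> S2 = {}" by (auto simp: S0_S1_S2_def)
      have "(\<Prod>u\<in>J. emeasure mark_law (F u)) = (\<Prod>u\<in>S0 \<union> (S1 \<union> S2). emeasure mark_law (F u))"
        using Jdec unfolding S0_S1_S2_def by (intro prod.cong) (simp_all only: Un_assoc)
      also have "\<dots> = (\<Prod>u\<in>S0. emeasure mark_law (F u)) * ((\<Prod>u\<in>S1. emeasure mark_law (F u)) * (\<Prod>u\<in>S2. emeasure mark_law (F u)))"
        using fin disj by (simp add: prod.union_disjoint)
      finally show ?thesis unfolding S0_S1_S2_def ..
    qed
    finally show "emeasure (distr (mark_law \<Otimes>\<^sub>M tree_law \<Otimes>\<^sub>M tree_law) tree_space (\<lambda>(x, \<eta>1, \<eta>2). graft x \<eta>1 \<eta>2))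
       (prod_emb UNIV (\<lambda>_. mark_law) J (Pi\<^sub>E J F)) = (\<Prod>j\<in>J. emeasure mark_law (F j))" .
  qed
qed

end

section \<open>Genealogy, positions and maximum of a grafted tree\<close>

lemma birth_time_graft:
  "birth_time life (u @ [b]) (graft x \<eta>1 \<eta>2) = fst x + birth_time life u (if b then \<eta>1 else \<eta>2)"
proof (induction u)
  case (Cons c u)
  have "life (u @ [b]) (graft x \<eta>1 \<eta>2) = life u (if b then \<eta>1 else \<eta>2)" by (simp add: life_def)
  with Cons show ?case by simp
qed (simp add: life_def)

text \<open>Positive lifetimes keep the birth times of the subtree nonnegative, so the recursive
  call of \<open>position\<close> at a birth time is again at a time not before
  \<open>fst x\<close>, where the induction hypothesis applies.\<close>

lemma position_graft:
  assumes pos: "\<And>u. 0 < life u (if b then \<eta>1 else \<eta>2)" and t: "fst x \<le> t"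
  shows "position life disp (u @ [b]) t (graft x \<eta>1 \<eta>2) =
    ev (snd x) (fst x) + position life disp u (t - fst x) (if b then \<eta>1 else \<eta>2)"
  using t
proof (induction u arbitrary: t)
  case Nil
  have l: "life [] (graft x \<eta>1 \<eta>2) = fst x" by (simp add: life_def)
  have "disp [b] s (graft x \<eta>1 \<eta>2) = disp [] s (if b then \<eta>1 else \<eta>2)" for s
    using graft_simps(2)[of x \<eta>1 \<eta>2 "[]" b] by (simp add: disp_def del: graft_simps)
  with l Nil show ?case by (simp add: Let_def) (simp add: disp_def)
next
  case (Cons c u)
  let ?\<eta> = "if b then \<eta>1 else \<eta>2"
  have bt: "birth_time life (c # u @ [b]) (graft x \<eta>1 \<eta>2) = fst x + birth_time life (c # u) ?\<eta>"
    using birth_time_graft[of "c # u" b x \<eta>1 \<eta>2] by (simp only: append_Cons)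
  have "0 \<le> birth_time life (c # u) ?\<eta>" by (rule birth_time_nonneg) (rule pos)
  then have ge: "fst x \<le> fst x + birth_time life (c # u) ?\<eta>" by simp
  have d: "disp (c # u @ [b]) s (graft x \<eta>1 \<eta>2) = disp (c # u) s ?\<eta>" for s
    using graft_simps(2)[of x \<eta>1 \<eta>2 "c # u" b] unfolding disp_def append_Cons by (cases b) simp_all
  show ?case
    unfolding append_Cons position.simps bt Let_def d
    using Cons.IH[OF Cons.prems] Cons.IH[OF ge] by (auto simp: algebra_simps simp del: birth_time.simps)
qed

text \<open>Positive lifetimes and non-explosion. They ensure a finite nonempty population at every
  nonnegative time, and thereby meaningful maxima.\<close>

definition regular :: "(bool list \<Rightarrow> real \<times> (real \<Rightarrow> real)) \<Rightarrow> bool" where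
  "regular \<eta> \<longleftrightarrow> (\<forall>u. 0 < life u \<eta>) \<and> (\<forall>t. finite {u. birth_time life u \<eta> \<le> t})"

lemma regular_alive:
  assumes \<eta>: "regular \<eta>" and t: "0 \<le> t"
  shows "finite (alive life t \<eta>)" "alive life t \<eta> \<noteq> {}"
proof -
  have fin: "finite {u. birth_time life u \<eta> \<le> t}" using \<eta> by (simp add: regular_def)
  show "finite (alive life t \<eta>)" by (rule finite_subset[OF _ fin]) (auto simp: alive_def)
  have ne: "[] \<in> {u. birth_time life u \<eta> \<le> t}" using t by simp
  \<comment> \<open>A particle of greatest generation among those born by time t: its children are
    born later, so it is still alive.\<close>
  obtain u where u: "birth_time life u \<eta> \<le> t" "\<And>v. birth_time life v \<eta> \<le> t \<Longrightarrow> length v \<le> length u"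
  proof -
    define n where "n = Max (length ` {u. birth_time life u \<eta> \<le> t})"
    have "n \<in> length ` {u. birth_time life u \<eta> \<le> t}" unfolding n_def using fin ne by (intro Max_in finite_imageI) blast+
    then obtain u where "birth_time life u \<eta> \<le> t" "length u = n" by auto
    moreover have "length v \<le> n" if "birth_time life v \<eta> \<le> t" for v
      unfolding n_def by (rule Max_ge) (use fin that in auto)
    ultimately show thesis using that by auto
  qed
  have "t < birth_time life (True # u) \<eta>" using u(2)[of "True # u"] by (simp add: not_le[symmetric] del: birth_time.simps) fastforce
  then have "u \<in> alive life t \<eta>" using u(1) by (simp add: alive_def)
  then show "alive life t \<eta> \<noteq> {}" by auto
qed

lemma alive_graft:
  assumes t: "fst x \<le> t"
  shows "alive life t (graft x \<eta>1 \<eta>2) =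
    (\<lambda>u. u @ [True]) ` alive life (t - fst x) \<eta>1 \<union> (\<lambda>u. u @ [False]) ` alive life (t - fst x) \<eta>2"
proof (rule set_eqI)
  fix u
  show "u \<in> alive life t (graft x \<eta>1 \<eta>2) \<longleftrightarrow>
    u \<in> (\<lambda>u. u @ [True]) ` alive life (t - fst x) \<eta>1 \<union> (\<lambda>u. u @ [False]) ` alive life (t - fst x) \<eta>2"
  proof (cases u rule: rev_cases)
    case Nil
    then show ?thesis using t by (auto simp: alive_def life_def)
  next
    case (snoc v b)
    have "v @ [b] \<in> alive life t (graft x \<eta>1 \<eta>2) \<longleftrightarrow> v \<in> alive life (t - fst x) (if b then \<eta>1 else \<eta>2)"
      unfolding alive_def mem_Collect_eq birth_time_graft by (auto simp: life_def)
    then show ?thesis using snoc by (cases b) auto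
  qed
qed

lemma Max_Un_image:
  fixes f g :: "'a \<Rightarrow> real"
  assumes "finite A" "A \<noteq> {}" "finite C" "C \<noteq> {}"
  shows "Max ((\<lambda>u. y + f u) ` A \<union> (\<lambda>u. y + g u) ` C) = y + max (Max (f ` A)) (Max (g ` C))"
proof -
  have "Max ((\<lambda>u. y + h u) ` S) = y + Max (h ` S)" if "finite S" "S \<noteq> {}" for h :: "'a \<Rightarrow> real" and S
    using mono_Max_commute[of "\<lambda>z. y + z" "h ` S"] that by (simp add: image_image mono_def)
  then show ?thesis using assms by (simp add: Max_Un max_add_distrib_right)
qed

lemma maximum_graft:
  assumes r: "regular \<eta>1" "regular \<eta>2" and t: "fst x \<le> t"
  shows "maximum life disp t (graft x \<eta>1 \<eta>2) =
    ev (snd x) (fst x) + max (maximum life disp (t - fst x) \<eta>1) (maximum life disp (t - fst x) \<eta>2)"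
proof -
  have p: "position life disp (u @ [b]) t (graft x \<eta>1 \<eta>2) =
    ev (snd x) (fst x) + position life disp u (t - fst x) (if b then \<eta>1 else \<eta>2)" for u b
    using r t by (intro position_graft) (auto simp: regular_def)
  have "(\<lambda>u. position life disp u t (graft x \<eta>1 \<eta>2)) ` alive life t (graft x \<eta>1 \<eta>2) =
     (\<lambda>u. ev (snd x) (fst x) + position life disp u (t - fst x) \<eta>1) ` alive life (t - fst x) \<eta>1 \<union>
     (\<lambda>u. ev (snd x) (fst x) + position life disp u (t - fst x) \<eta>2) ` alive life (t - fst x) \<eta>2"
    unfolding alive_graft[OF t] image_Un image_image p by simp
  then show ?thesis
    unfolding maximum_def using regular_alive[OF r(1), of "t - fst x"] regular_alive[OF r(2), of "t - fst x"] t
    by (simp add: Max_Un_image)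
qed

text \<open>The centre k of the two sub-configurations is free; with k = m (t - s), for a branching
  at time s, they become the configurations whose convergence is given.\<close>

lemma particles_graft:
  assumes r: "regular \<eta>1" "regular \<eta>2" and t: "fst x \<le> t"
  shows "particles_from life disp t c (graft x \<eta>1 \<eta>2) =
    shift_left (c - k - ev (snd x) (fst x)) (superposition
      (particles_from life disp (t - fst x) k \<eta>1) (particles_from life disp (t - fst x) k \<eta>2))"
proof -
  let ?y = "ev (snd x) (fst x)" and ?G = "graft x \<eta>1 \<eta>2"
  have p: "position life disp (u @ [b]) t ?G = ?y + position life disp u (t - fst x) (if b then \<eta>1 else \<eta>2)" for u b
    using r t by (intro position_graft) (auto simp: regular_def)
  note f1 = regular_alive[OF r(1), of "t - fst x"] and f2 = regular_alive[OF r(2), of "t - fst x"]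
  define q where "q = (\<lambda>u. position life disp u t ?G - ?y - k)"
  have "particles_from life disp t c ?G = dirac_sum (alive life t ?G) (\<lambda>u. q u - (c - k - ?y))"
    unfolding particles_from_def q_def by simp
  also have "\<dots> = shift_left (c - k - ?y) (dirac_sum (alive life t ?G) q)" by (rule dirac_sum_shift_left)
  also have "dirac_sum (alive life t ?G) q = superposition
     (dirac_sum ((\<lambda>u. u @ [True]) ` alive life (t - fst x) \<eta>1) q)
     (dirac_sum ((\<lambda>u. u @ [False]) ` alive life (t - fst x) \<eta>2) q)"
    unfolding alive_graft[OF t] using f1 f2 t by (intro dirac_sum_Un) auto
  also have "dirac_sum ((\<lambda>u. u @ [True]) ` alive life (t - fst x) \<eta>1) q = particles_from life disp (t - fst x) k \<eta>1"
    unfolding particles_from_def by (subst dirac_sum_image) (auto simp: inj_on_def q_def p intro!: dirac_sum_cong)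
  also have "dirac_sum ((\<lambda>u. u @ [False]) ` alive life (t - fst x) \<eta>2) q = particles_from life disp (t - fst x) k \<eta>2"
    unfolding particles_from_def by (subst dirac_sum_image) (auto simp: inj_on_def q_def p intro!: dirac_sum_cong)
  finally show ?thesis .
qed

text \<open>Lifetimes are half-open intervals, so at time \<open>T []\<close> exactly the two
  children are alive and the infimum is attained; before that time nobody but the root can be
  alive.\<close>

lemma first_branching_eq:
  assumes pos: "\<And>u. 0 < T u \<omega>"
  shows "first_branching T \<omega> = T [] \<omega>"
proof -
  have ge: "T [] \<omega> \<le> birth_time T (b # u) \<omega>" for b u
  proof (induction u arbitrary: b)
    case (Cons c u)
    then show ?case using Cons[of c] pos[of "c # u"] by simp
  qed simp
  have "alive T (T [] \<omega>) \<omega> = {[True], [False]}"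
  proof (intro set_eqI iffI)
    fix u assume u: "u \<in> alive T (T [] \<omega>) \<omega>"
    show "u \<in> {[True], [False]}"
    proof (cases u)
      case Nil
      with u show ?thesis by (simp add: alive_def)
    next
      case (Cons b v)
      show ?thesis
      proof (cases v)
        case Nil
        with Cons show ?thesis by (cases b) auto
      next
        case (Cons c v')
        with \<open>u = b # v\<close> u have "birth_time T (c # v') \<omega> + T (c # v') \<omega> \<le> T [] \<omega>" by (simp add: alive_def)
        with ge[of c v'] pos[of "c # v'"] show ?thesis by linarith
      qed
    qed
  next
    fix u assume "u \<in> {[True], [False]}"
    then show "u \<in> alive T (T [] \<omega>) \<omega>" using pos by (auto simp: alive_def)
  qed
  then have 1: "T [] \<omega> \<in> {t. 0 \<le> t \<and> 2 \<le> card (alive T t \<omega>)}" using pos[of "[]"] by simp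
  have 2: "T [] \<omega> \<le> t" if "t \<in> {t. 0 \<le> t \<and> 2 \<le> card (alive T t \<omega>)}" for t
  proof (rule ccontr)
    assume n: "\<not> T [] \<omega> \<le> t"
    have "alive T t \<omega> \<subseteq> {[]}"
    proof
      fix u assume u: "u \<in> alive T t \<omega>"
      show "u \<in> {[]}"
      proof (cases u)
        case (Cons b v)
        with u have "birth_time T (b # v) \<omega> \<le> t" by (simp add: alive_def)
        with ge[of b v] n show ?thesis by linarith
      qed simp
    qed
    then have "card (alive T t \<omega>) \<le> card {[] :: bool list}" by (intro card_mono) auto
    with that show False by simp
  qed
  show ?thesis unfolding first_branching_def
    using 1 2 by (intro antisym cInf_lower cInf_greatest bdd_belowI[of _ "T [] \<omega>"]) blast+
qed

section \<open>Non-explosion\<close>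

context canonical_bbm
begin

text \<open>A birth time in generation n is a sum of n independent standard exponential lifetimes,
  each with Laplace transform 1 / (1 + 3) at 3. The value 3 makes the resulting 1/4 beat the growth
  2 ^ n of the number of labels.\<close>

lemma birth_time_exp_moment:
  "(\<integral>\<^sup>+\<eta>. ennreal (exp (- 3 * birth_time life u \<eta>)) \<partial>tree_law) = ennreal ((1/4) ^ length u)"
proof (induction u rule: rev_induct)
  case Nil
  interpret prob_space tree_law by (rule tree_law_prob)
  show ?case by (simp add: emeasure_space_1)
next
  case (snoc b u)
  interpret mark: prob_space mark_law by (rule mark_law_prob)
  interpret tree: prob_space tree_law by (rule tree_law_prob)
  interpret tt: pair_prob_space tree_law tree_law ..
  interpret W: prob_space W by (rule W_prob)
  interpret ex: prob_space "density lborel (exponential_density 1)" by (rule exponential_prob)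
  interpret exW: pair_prob_space "density lborel (exponential_density 1)" W ..
  define E where "E = (\<integral>\<^sup>+\<eta>. ennreal (exp (- 3 * birth_time life u \<eta>)) \<partial>tree_law)"
  let ?f = "\<lambda>\<eta>. ennreal (exp (- 3 * birth_time life (u @ [b]) \<eta>))"
  have "(\<integral>\<^sup>+\<eta>. ?f \<eta> \<partial>tree_law) = (\<integral>\<^sup>+p. ?f ((\<lambda>(x, \<eta>1, \<eta>2). graft x \<eta>1 \<eta>2) p) \<partial>(mark_law \<Otimes>\<^sub>M (tree_law \<Otimes>\<^sub>M tree_law)))"
    by (subst tree_law_graft[symmetric], subst nn_integral_distr) measurable
  also have "\<dots> = (\<integral>\<^sup>+x. (\<integral>\<^sup>+q. ?f (graft x (fst q) (snd q)) \<partial>(tree_law \<Otimes>\<^sub>M tree_law)) \<partial>mark_law)"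
    by (subst tt.nn_integral_fst[symmetric]) (simp_all add: split_beta')
  also have "\<dots> = (\<integral>\<^sup>+x. ennreal (exp (- 3 * fst x)) * E \<partial>mark_law)"
  proof (rule nn_integral_cong)
    fix x
    have "(\<integral>\<^sup>+q. ?f (graft x (fst q) (snd q)) \<partial>(tree_law \<Otimes>\<^sub>M tree_law)) =
       (\<integral>\<^sup>+q. ennreal (exp (- 3 * fst x)) * ennreal (exp (- 3 * birth_time life u (if b then fst q else snd q))) \<partial>(tree_law \<Otimes>\<^sub>M tree_law))"
      by (intro nn_integral_cong) (simp add: birth_time_graft ennreal_mult[symmetric] exp_add[symmetric] algebra_simps)
    also have "\<dots> = ennreal (exp (- 3 * fst x)) * (\<integral>\<^sup>+q. ennreal (exp (- 3 * birth_time life u (if b then fst q else snd q))) \<partial>(tree_law \<Otimes>\<^sub>M tree_law))"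
      by (rule nn_integral_cmult) (cases b; simp; measurable)
    also have "(\<integral>\<^sup>+q. ennreal (exp (- 3 * birth_time life u (if b then fst q else snd q))) \<partial>(tree_law \<Otimes>\<^sub>M tree_law)) = E"
    proof (cases b)
      case True
      then show ?thesis unfolding E_def
        by (simp, subst tree.nn_integral_fst[symmetric]) (measurable, simp add: tree.emeasure_space_1)
    next
      case False
      then show ?thesis unfolding E_def
        by (simp, subst tree.nn_integral_fst[symmetric]) (measurable, simp add: tree.emeasure_space_1)
    qed
    finally show "(\<integral>\<^sup>+q. ?f (graft x (fst q) (snd q)) \<partial>(tree_law \<Otimes>\<^sub>M tree_law)) = ennreal (exp (- 3 * fst x)) * E" .
  qed
  also have "\<dots> = (\<integral>\<^sup>+x. ennreal (exp (- 3 * fst x)) \<partial>mark_law) * E"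
    by (rule nn_integral_multc) measurable
  also have "(\<integral>\<^sup>+x. ennreal (exp (- 3 * fst x)) \<partial>mark_law) = (\<integral>\<^sup>+s. ennreal (exp (- 3 * s)) \<partial>density lborel (exponential_density 1))"
    unfolding mark_law_def by (subst W.nn_integral_fst[symmetric]) (simp_all add: W.emeasure_space_1)
  also have "\<dots> = (\<integral>\<^sup>+s. ennreal (1/4) * ennreal (exponential_density 4 s) \<partial>lborel)"
    by (subst nn_integral_density)
      (auto intro!: nn_integral_cong simp: exponential_density_def ennreal_mult[symmetric] exp_add[symmetric])
  also have "\<dots> = ennreal (1/4) * (\<integral>\<^sup>+s. ennreal (exponential_density 4 s) \<partial>lborel)"
    by (rule nn_integral_cmult) simp
  also have "(\<integral>\<^sup>+s. ennreal (exponential_density 4 s) \<partial>lborel) = 1"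
    using prob_space.emeasure_space_1[OF prob_space_exponential_density[of 4]] by (simp add: emeasure_density)
  also have "ennreal (1/4) * 1 * E = ennreal ((1/4) ^ length (u @ [b]))"
    unfolding E_def snoc by (simp add: ennreal_mult[symmetric])
  finally show ?case .
qed

text \<open>By the exponential moment a label of length n is born by time k with probability at most
  \<open>exp (3 * real k) * (1/4) ^ n\<close>. Multiplied by the 2 ^ n labels this is still
  summable, so by Borel-Cantelli finitely many generations have births by time k.\<close>

lemma AE_regular: "AE \<eta> in tree_law. regular \<eta>"
proof -
  interpret tree: prob_space tree_law by (rule tree_law_prob)
  interpret mark: prob_space mark_law by (rule mark_law_prob)
  interpret W: prob_space W by (rule W_prob)
  interpret ex: prob_space "density lborel (exponential_density 1)" by (rule exponential_prob)
  interpret exW: pair_prob_space "density lborel (exponential_density 1)" W ..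
  interpret pp: product_prob_space "\<lambda>_::bool list. mark_law" UNIV ..
  have ex0: "AE s in density lborel (exponential_density 1). 0 < s"
  proof -
    have "AE s in lborel. s \<noteq> (0::real)" by (rule AE_lborel_singleton)
    then show ?thesis by (subst AE_density) (auto simp: exponential_density_def elim!: eventually_mono)
  qed
  have "Measurable.pred (density lborel (exponential_density 1) \<Otimes>\<^sub>M W) (\<lambda>x. 0 < fst x)"
    by measurable
  then have "AE x in mark_law. 0 < fst x"
    unfolding mark_law_def using ex0 by (intro exW.AE_pair_measure) (simp_all add: pred_def)
  then have "AE \<eta> in tree_law. 0 < fst (\<eta> u)" for u
    unfolding tree_law_def by (intro pp.AE_component) auto
  then have pos: "AE \<eta> in tree_law. \<forall>u. 0 < life u \<eta>" by (simp add: AE_all_countable life_def)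
  have "AE \<eta> in tree_law. finite {u. birth_time life u \<eta> \<le> real k}" for k
  proof -
    define A where "A = (\<lambda>n. {\<eta> \<in> space tree_law. \<exists>u. length u = n \<and> birth_time life u \<eta> \<le> real k})"
    have As: "A n \<in> sets tree_law" for n unfolding A_def by measurable
    have fin: "finite {u :: bool list. length u = n}" for n
      using finite_lists_length_eq[of "UNIV :: bool set" n] by simp
    have bound: "emeasure tree_law (A n) \<le> ennreal (exp (3 * real k) * (1/2) ^ n)" for n
    proof -
      have one: "emeasure tree_law {\<eta> \<in> space tree_law. birth_time life u \<eta> \<le> real k} \<le> ennreal (exp (3 * real k) * (1/4) ^ length u)" for u
      proof -
        have "emeasure tree_law {\<eta> \<in> space tree_law. birth_time life u \<eta> \<le> real k} =
           (\<integral>\<^sup>+\<eta>. indicator {\<eta> \<in> space tree_law. birth_time life u \<eta> \<le> real k} \<eta> \<partial>tree_law)"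
          by (intro nn_integral_indicator[symmetric]) measurable
        also have "\<dots> \<le> (\<integral>\<^sup>+\<eta>. ennreal (exp (3 * real k)) * ennreal (exp (- 3 * birth_time life u \<eta>)) \<partial>tree_law)"
          by (intro nn_integral_mono) (auto simp: indicator_def ennreal_mult[symmetric] exp_add[symmetric])
        also have "\<dots> = ennreal (exp (3 * real k)) * ennreal ((1/4) ^ length u)"
          by (subst nn_integral_cmult) (simp_all add: birth_time_exp_moment[simplified])
        finally show ?thesis by (simp add: ennreal_mult)
      qed
      have "A n = (\<Union>u\<in>{u. length u = n}. {\<eta> \<in> space tree_law. birth_time life u \<eta> \<le> real k})"
        unfolding A_def by auto
      then have "emeasure tree_law (A n) \<le> (\<Sum>u\<in>{u. length u = n}. emeasure tree_law {\<eta> \<in> space tree_law. birth_time life u \<eta> \<le> real k})"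
        using fin by (simp only:) (intro emeasure_subadditive_finite; auto)
      also have "\<dots> \<le> (\<Sum>u\<in>{u :: bool list. length u = n}. ennreal (exp (3 * real k) * (1/4) ^ n))"
        using one by (intro sum_mono) auto
      also have "\<dots> = of_nat (2 ^ n) * ennreal (exp (3 * real k) * (1/4) ^ n)"
        using card_lists_length_eq[of "UNIV :: bool set" n] by simp
      also have "\<dots> = ennreal (exp (3 * real k) * (1/2) ^ n)"
      proof -
        have "real (2 ^ n) * (exp (3 * real k) * (1/4) ^ n) = exp (3 * real k) * (2 ^ n * (1/4) ^ n)" by simp
        also have "(2::real) ^ n * (1/4) ^ n = (1/2) ^ n" by (simp add: power_mult_distrib[symmetric])
        finally show ?thesis by (simp add: ennreal_of_nat_eq_real_of_nat ennreal_mult[symmetric] del: of_nat_power)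
      qed
      finally show ?thesis .
    qed
    have "AE \<eta> in tree_law. eventually (\<lambda>n. \<eta> \<in> space tree_law - A n) sequentially"
    proof (rule borel_cantelli_AE1[OF As])
      show "emeasure tree_law (A n) < \<infinity>" for n by (simp add: tree.emeasure_eq_measure)
      show "summable (\<lambda>n. measure tree_law (A n))"
      proof (rule summable_comparison_test')
        show "summable (\<lambda>n. exp (3 * real k) * (1/2) ^ n)" by (intro summable_mult summable_geometric) simp
        show "norm (measure tree_law (A n)) \<le> exp (3 * real k) * (1/2) ^ n" if "n \<ge> 0" for n
          using bound[of n] by (simp add: tree.emeasure_eq_measure ennreal_le_iff)
      qed
    qed
    then show ?thesis
    proof eventually_elim
      case (elim \<eta>)
      then obtain N where N: "\<And>n. n \<ge> N \<Longrightarrow> \<eta> \<in> space tree_law - A n" by (auto simp: eventually_sequentially)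
      have "length u \<le> N" if "birth_time life u \<eta> \<le> real k" for u
        using N[of "length u"] that unfolding A_def by (cases "length u \<le> N") auto
      then show ?case unfolding finite_bool_lists_iff by auto
    qed
  qed
  then have "AE \<eta> in tree_law. \<forall>k. finite {u. birth_time life u \<eta> \<le> real k}" by (simp add: AE_all_countable)
  with pos show ?thesis
  proof eventually_elim
    case (elim \<eta>)
    have "finite {u. birth_time life u \<eta> \<le> t}" for t
    proof -
      obtain k :: nat where "t \<le> real k" using real_arch_simple by blast
      then show ?thesis by (intro finite_subset[OF _ elim(2)[rule_format, of k]]) auto
    qed
    with elim show ?case by (simp add: regular_def)
  qed
qed

end

section \<open>States, their laws and the decomposition at the first branching\<close>

abbreviation vague_borel :: "real measure measure" where
  "vague_borel \<equiv> borel_of vague_topology"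

abbreviation state_space :: "(real measure \<times> real) measure" where
  "state_space \<equiv> vague_borel \<Otimes>\<^sub>M borel"

lemma space_vague_borel: "space vague_borel = point_measures"
  by (simp add: space_borel_of topspace_vague)

lemma measurable_superposition [measurable (raw)]:
  assumes "f \<in> measurable M vague_borel" "g \<in> measurable M vague_borel"
  shows "(\<lambda>x. superposition (f x) (g x)) \<in> measurable M vague_borel"
proof -
  have "(\<lambda>(\<mu>, \<nu>). superposition \<mu> \<nu>) \<in> measurable (vague_borel \<Otimes>\<^sub>M vague_borel) vague_borel"
    using continuous_map_borel_of[OF continuous_map_superposition]
    by (simp add: measurable_cong_sets[OF sets_borel_of_prod[OF induced_by_vague induced_by_vague] refl])
  from measurable_compose[OF measurable_Pair[OF assms] this] show ?thesis by simp
qed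

lemma measurable_shift_left [measurable (raw)]:
  assumes "f \<in> borel_measurable M" "g \<in> measurable M vague_borel"
  shows "(\<lambda>x. shift_left (f x) (g x)) \<in> measurable M vague_borel"
proof -
  have "sets (borel_of (prod_topology euclideanreal vague_topology)) = sets (borel_of euclideanreal \<Otimes>\<^sub>M vague_borel)"
    by (rule sets_borel_of_prod[OF induced_by_euclidean induced_by_vague])
  also have "\<dots> = sets (borel \<Otimes>\<^sub>M vague_borel)"
    by (intro sets_pair_measure_cong sets_borel_of_euclidean refl)
  finally have "(\<lambda>(c, \<mu>). shift_left c \<mu>) \<in> measurable (borel \<Otimes>\<^sub>M vague_borel) vague_borel"
    using continuous_map_borel_of[OF continuous_map_shift_left] by (simp cong: measurable_cong_sets)
  from measurable_compose[OF measurable_Pair[OF assms] this] show ?thesis by simp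
qed

lemma measurable_m [measurable]: "m \<in> borel_measurable borel"
  unfolding m_def by measurable

text \<open>The recentred maximum is kept as a separate coordinate, because the largest atom is not
  a continuous function for the vague topology.\<close>

definition state :: "real \<Rightarrow> (bool list \<Rightarrow> real \<times> (real \<Rightarrow> real)) \<Rightarrow> real measure \<times> real" where
  "state r \<eta> = (particles_from life disp r (m r) \<eta>, maximum life disp r \<eta> - m r)"

lemma measurable_state [measurable (raw)]:
  assumes [measurable]: "f \<in> borel_measurable M" "g \<in> measurable M tree_space"
  shows "(\<lambda>x. state (f x) (g x)) \<in> measurable M state_space"
  unfolding state_def by measurable

text \<open>The configuration seen from \<open>c\<close>, and the recentred maximum, when the first particle has
  moved to \<open>y\<close> and its two descendants have evolved for a time \<open>r\<close> into the states \<open>p\<close>.\<close>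

definition merge :: "real \<Rightarrow> real \<Rightarrow> real \<Rightarrow> (real measure \<times> real) \<times> (real measure \<times> real) \<Rightarrow> real measure \<times> real" where
  "merge c r y p = (shift_left (c - m r - y) (superposition (fst (fst p)) (fst (snd p))),
     max (snd (fst p)) (snd (snd p)) + m r + y - c)"

lemma measurable_merge [measurable (raw)]:
  assumes [measurable]: "c \<in> borel_measurable M" "r \<in> borel_measurable M" "y \<in> borel_measurable M"
    "p \<in> measurable M (state_space \<Otimes>\<^sub>M state_space)"
  shows "(\<lambda>x. merge (c x) (r x) (y x) (p x)) \<in> measurable M state_space"
  unfolding merge_def by measurable

text \<open>Joint density of the time and the place of the first branching.\<close>

definition branch_density :: "real \<times> real \<Rightarrow> real" where
  "branch_density q = exponential_density 1 (fst q) * normal_density 0 (sqrt (fst q)) (snd q)"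

lemma branch_density_nonneg: "0 \<le> branch_density q"
  unfolding branch_density_def by (auto simp: exponential_density_def)

lemma measurable_branch_density [measurable]: "branch_density \<in> borel_measurable (borel \<Otimes>\<^sub>M borel)"
  unfolding branch_density_def normal_density_def exponential_density_def by measurable

context canonical_bbm
begin

sublocale mark: prob_space mark_law by (rule mark_law_prob)
sublocale tree: prob_space tree_law by (rule tree_law_prob)
sublocale tt: pair_prob_space tree_law tree_law ..
sublocale mtt: pair_prob_space mark_law "tree_law \<Otimes>\<^sub>M tree_law" ..

definition law :: "real \<Rightarrow> (real measure \<times> real) measure" where
  "law r = distr tree_law state_space (state r)"

lemma law_prob: "prob_space (law r)"
  unfolding law_def by (rule tree.prob_space_distr) measurable

lemma sets_law [measurable_cong]: "sets (law r) = sets state_space"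
  by (simp add: law_def)

lemma law_pair: "law r \<Otimes>\<^sub>M law r = distr (tree_law \<Otimes>\<^sub>M tree_law) (state_space \<Otimes>\<^sub>M state_space) (\<lambda>q. (state r (fst q), state r (snd q)))"
proof -
  have "sigma_finite_measure (distr tree_law state_space (state r))"
    using law_prob[of r] unfolding law_def
    by (intro finite_measure.axioms prob_space.axioms)
  then have "law r \<Otimes>\<^sub>M law r = distr (tree_law \<Otimes>\<^sub>M tree_law) (state_space \<Otimes>\<^sub>M state_space) (\<lambda>(x, y). (state r x, state r y))"
    unfolding law_def by (intro pair_measure_distr) measurable
  then show ?thesis by (simp add: split_beta')
qed

lemma integral_law_pair:
  fixes g :: "_ \<Rightarrow> real"
  assumes "g \<in> borel_measurable (state_space \<Otimes>\<^sub>M state_space)"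
  shows "(\<integral>p. g p \<partial>(law r \<Otimes>\<^sub>M law r)) = (\<integral>q. g (state r (fst q), state r (snd q)) \<partial>(tree_law \<Otimes>\<^sub>M tree_law))"
  unfolding law_pair using assms by (intro integral_distr) measurable

text \<open>The measure depends on x through r. Written over the fixed measure
  \<open>tree_law \<Otimes>\<^sub>M tree_law\<close>, only the integrand depends on x and Fubini's
  theorem applies.\<close>

lemma measurable_integral_law_pair:
  fixes g :: "_ \<Rightarrow> _ \<Rightarrow> real"
  assumes g [measurable]: "(\<lambda>z. g (fst z) (snd z)) \<in> borel_measurable (N \<Otimes>\<^sub>M (state_space \<Otimes>\<^sub>M state_space))"
    and r [measurable]: "r \<in> borel_measurable N"
  shows "(\<lambda>x. \<integral>p. g x p \<partial>(law (r x) \<Otimes>\<^sub>M law (r x))) \<in> borel_measurable N"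
proof -
  have gx: "g x \<in> borel_measurable (state_space \<Otimes>\<^sub>M state_space)" if "x \<in> space N" for x
    using measurable_compose[OF measurable_Pair1'[OF that] g] by simp
  have f: "(\<lambda>z. (fst z, (state (r (fst z)) (fst (snd z)), state (r (fst z)) (snd (snd z))))) \<in>
      measurable (N \<Otimes>\<^sub>M (tree_law \<Otimes>\<^sub>M tree_law)) (N \<Otimes>\<^sub>M (state_space \<Otimes>\<^sub>M state_space))" by measurable
  have "(\<lambda>(x, q). g x (state (r x) (fst q), state (r x) (snd q))) \<in> borel_measurable (N \<Otimes>\<^sub>M (tree_law \<Otimes>\<^sub>M tree_law))"
    using measurable_compose[OF f g] by (simp add: split_beta')
  then have "(\<lambda>x. \<integral>q. g x (state (r x) (fst q), state (r x) (snd q)) \<partial>(tree_law \<Otimes>\<^sub>M tree_law)) \<in> borel_measurable N"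
    by (rule tt.borel_measurable_lebesgue_integral)
  then show ?thesis
    by (rule measurable_cong[THEN iffD1, rotated]) (simp add: integral_law_pair gx)
qed

lemma integral_law_pair_bound:
  fixes g :: "_ \<Rightarrow> real"
  assumes g: "g \<in> borel_measurable (state_space \<Otimes>\<^sub>M state_space)" and C: "\<And>p. \<bar>g p\<bar> \<le> C"
  shows "\<bar>\<integral>p. g p \<partial>(law r \<Otimes>\<^sub>M law r)\<bar> \<le> C"
proof -
  interpret L: prob_space "law r" by (rule law_prob)
  interpret LL: pair_prob_space "law r" "law r" ..
  have i: "integrable (law r \<Otimes>\<^sub>M law r) g"
    using C g by (intro LL.P.integrable_const_bound[where B=C]) auto
  have "\<bar>\<integral>p. g p \<partial>(law r \<Otimes>\<^sub>M law r)\<bar> \<le> (\<integral>p. \<bar>g p\<bar> \<partial>(law r \<Otimes>\<^sub>M law r))" by (rule integral_abs_bound)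
  also have "\<dots> \<le> (\<integral>p. C \<partial>(law r \<Otimes>\<^sub>M law r))" using i C by (intro integral_mono) auto
  finally show ?thesis by (simp add: LL.P.prob_space)
qed

text \<open>The path is independent of the lifetime, so it may be evaluated at a fixed time s, where
  its marginal is normal. For s < 0 the exponential density vanishes, and s = 0 is a null
  set.\<close>

lemma mark_law_distr:
  "distr mark_law (borel \<Otimes>\<^sub>M borel) (\<lambda>x. (fst x, ev (snd x) (fst x))) = density (lborel \<Otimes>\<^sub>M lborel) branch_density"
proof (rule measure_eqI)
  show "sets (distr mark_law (borel \<Otimes>\<^sub>M borel) (\<lambda>x. (fst x, ev (snd x) (fst x)))) =
     sets (density (lborel \<Otimes>\<^sub>M lborel) branch_density)"
    by (simp cong: sets_pair_measure_cong)
  interpret W: prob_space W by (rule W_prob)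
  note W_sets [measurable_cong]
  fix A assume "A \<in> sets (distr mark_law (borel \<Otimes>\<^sub>M borel) (\<lambda>x. (fst x, ev (snd x) (fst x))))"
  then have A [measurable]: "A \<in> sets (borel \<Otimes>\<^sub>M borel)" by simp
  have [measurable]: "A \<in> sets (lborel \<Otimes>\<^sub>M lborel)" using A by (simp cong: sets_pair_measure_cong)
  let ?F = "\<lambda>s. \<integral>\<^sup>+y. ennreal (normal_density 0 (sqrt s) y) * indicator A (s, y) \<partial>lborel"
  have m1: "(\<lambda>x. (fst x, ev (snd x) (fst x))) \<in> measurable mark_law (borel \<Otimes>\<^sub>M borel)" by measurable
  have "emeasure (distr mark_law (borel \<Otimes>\<^sub>M borel) (\<lambda>x. (fst x, ev (snd x) (fst x)))) A
     = (\<integral>\<^sup>+x. indicator A (fst x, ev (snd x) (fst x)) \<partial>mark_law)"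
    using nn_integral_distr[OF m1, of "indicator A"] A by simp
  also have "\<dots> = (\<integral>\<^sup>+s. (\<integral>\<^sup>+p. indicator A (s, ev p s) \<partial>W) \<partial>density lborel (exponential_density 1))"
    using measurable_compose[OF m1 borel_measurable_indicator[OF A, where 'b=ennreal]]
    unfolding mark_law_def by (subst W.nn_integral_fst[symmetric]) auto
  also have "\<dots> = (\<integral>\<^sup>+s. ennreal (exponential_density 1 s) * (\<integral>\<^sup>+p. indicator A (s, ev p s) \<partial>W) \<partial>lborel)"
    by (subst nn_integral_density) measurable
  also have "\<dots> = (\<integral>\<^sup>+s. ennreal (exponential_density 1 s) * ?F s \<partial>lborel)"
  proof (rule nn_integral_cong_AE)
    have "AE s in lborel. s \<noteq> (0::real)" by (rule AE_lborel_singleton)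
    then show "AE s in lborel. ennreal (exponential_density 1 s) * (\<integral>\<^sup>+p. indicator A (s, ev p s) \<partial>W) =
       ennreal (exponential_density 1 s) * ?F s"
    proof eventually_elim
      case (elim s)
      show ?case
      proof (cases "s > 0")
        case True
        have As: "{y. (s, y) \<in> A} \<in> sets borel" using sets_Pair1[OF A, of s] by (simp add: vimage_def)
        have ind: "indicator A (s, y) = indicator {y. (s, y) \<in> A} y" for y by (simp add: indicator_def)
        have "(\<integral>\<^sup>+p. indicator A (s, ev p s) \<partial>W) = (\<integral>\<^sup>+y. indicator {y. (s, y) \<in> A} y \<partial>distr W borel (\<lambda>p. ev p s))"
          unfolding ind using As by (subst nn_integral_distr) measurable
        also have "\<dots> = ?F s" unfolding W_marginal[OF True] ind using As by (subst nn_integral_density) measurable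
        finally show ?thesis by simp
      next
        case False
        with elim show ?thesis by (simp add: exponential_density_def)
      qed
    qed
  qed
  also have "\<dots> = (\<integral>\<^sup>+s. (\<integral>\<^sup>+y. ennreal (branch_density (s, y)) * indicator A (s, y) \<partial>lborel) \<partial>lborel)"
    by (intro nn_integral_cong)
      (simp add: nn_integral_cmult[symmetric] branch_density_def ennreal_mult exponential_density_def mult.assoc[symmetric])
  also have "\<dots> = (\<integral>\<^sup>+q. ennreal (branch_density q) * indicator A q \<partial>(lborel \<Otimes>\<^sub>M lborel))"
    by (subst lborel.nn_integral_fst[symmetric]) measurable
  also have "\<dots> = emeasure (density (lborel \<Otimes>\<^sub>M lborel) branch_density) A"
    by (subst emeasure_density) measurable
  finally show "emeasure (distr mark_law (borel \<Otimes>\<^sub>M borel) (\<lambda>x. (fst x, ev (snd x) (fst x)))) A = 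
    emeasure (density (lborel \<Otimes>\<^sub>M lborel) branch_density) A" .
qed

lemma mark_law_tail:
  assumes t: "0 \<le> t"
  shows "measure mark_law {x \<in> space mark_law. t < fst x} = exp (- t)"
proof -
  interpret W: prob_space W by (rule W_prob)
  have "distr mark_law lborel fst = density lborel (exponential_density 1)"
  proof (rule measure_eqI)
    fix A assume "A \<in> sets (distr mark_law lborel fst)"
    then have A: "A \<in> sets borel" by simp
    have "emeasure (distr mark_law lborel fst) A = emeasure mark_law (A \<times> space W)"
      using A sets.sets_into_space[OF A] unfolding mark_law_def
      by (subst emeasure_distr) (auto simp: space_pair_measure intro!: arg_cong2[where f=emeasure])
    also have "\<dots> = emeasure (density lborel (exponential_density 1)) A"
      unfolding mark_law_def using A by (simp add: W.emeasure_pair_measure_Times W.emeasure_space_1)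
    finally show "emeasure (distr mark_law lborel fst) A = emeasure (density lborel (exponential_density 1)) A" .
  qed simp
  then have "distributed mark_law lborel fst (exponential_density 1)"
    by (auto simp: distributed_def)
  from mark.exponential_distributedD_gt[OF this t] show ?thesis by simp
qed

text \<open>The decomposition for an arbitrary bounded observable of the first branching and of the
  state at time t. The conditional integral H is correct if the branching happens by time t; the
  opposite event has probability \<open>exp (- t)\<close> and contributes at most C times
  that.\<close>

lemma graft_formula:
  fixes g :: "real \<Rightarrow> real \<Rightarrow> real measure \<times> real \<Rightarrow> real" and t c :: real
  assumes g [measurable]: "(\<lambda>z. g (fst z) (fst (snd z)) (snd (snd z))) \<in> borel_measurable (borel \<Otimes>\<^sub>M (borel \<Otimes>\<^sub>M state_space))"
    and C: "\<And>s y p. \<bar>g s y p\<bar> \<le> C" and t: "0 \<le> t"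
  defines "G \<equiv> \<lambda>\<eta>. g (life [] \<eta>) (disp [] (life [] \<eta>) \<eta>)
       (particles_from life disp t c \<eta>, maximum life disp t \<eta> - c)"
    and "H \<equiv> \<lambda>q. \<integral>p. g (fst q) (snd q) (merge c (t - fst q) (snd q) p) \<partial>(law (t - fst q) \<Otimes>\<^sub>M law (t - fst q))"
  shows "H \<in> borel_measurable (borel \<Otimes>\<^sub>M borel)"
    and "\<bar>H q\<bar> \<le> C"
    and "\<bar>(\<integral>\<eta>. G \<eta> \<partial>tree_law) - (\<integral>q. branch_density q * (of_bool (fst q \<le> t) * H q) \<partial>(lborel \<Otimes>\<^sub>M lborel))\<bar> \<le> C * exp (- t)"
proof -
  have gm: "(\<lambda>x. g (a x) (b x) (d x)) \<in> borel_measurable M"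
    if "a \<in> borel_measurable M" "b \<in> borel_measurable M" "d \<in> measurable M state_space" for a b d and M :: "'z measure"
    using measurable_compose[OF measurable_Pair[OF that(1) measurable_Pair[OF that(2,3)]] g] by simp
  have C0: "0 \<le> C" using C[of 0 0 undefined] by linarith
  have Gm [measurable]: "G \<in> borel_measurable tree_space" unfolding G_def by (intro gm) measurable
  have gint: "(\<lambda>p. g (fst q) (snd q) (merge c (t - fst q) (snd q) p)) \<in> borel_measurable (state_space \<Otimes>\<^sub>M state_space)" for q
    by (intro gm) measurable
  show Hm [measurable]: "H \<in> borel_measurable (borel \<Otimes>\<^sub>M borel)"
    unfolding H_def by (intro measurable_integral_law_pair gm) measurable
  show HC: "\<bar>H q\<bar> \<le> C" for q
    unfolding H_def by (intro integral_law_pair_bound gint C)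
  define K where "K = (\<lambda>x. \<integral>q. G (graft x (fst q) (snd q)) \<partial>(tree_law \<Otimes>\<^sub>M tree_law))"
  have GC: "\<bar>G \<eta>\<bar> \<le> C" for \<eta> unfolding G_def by (rule C)
  have Gg: "(\<lambda>z. G (graft (fst z) (fst (snd z)) (snd (snd z)))) \<in> borel_measurable (mark_law \<Otimes>\<^sub>M (tree_law \<Otimes>\<^sub>M tree_law))"
    by (intro measurable_compose[OF _ Gm]) measurable
  have Gi: "integrable (mark_law \<Otimes>\<^sub>M (tree_law \<Otimes>\<^sub>M tree_law)) (\<lambda>z. G (graft (fst z) (fst (snd z)) (snd (snd z))))"
    using GC by (intro mtt.P.integrable_const_bound[where B=C] Gg) auto
  have "(\<integral>\<eta>. G \<eta> \<partial>tree_law) = (\<integral>z. G (graft (fst z) (fst (snd z)) (snd (snd z))) \<partial>(mark_law \<Otimes>\<^sub>M (tree_law \<Otimes>\<^sub>M tree_law)))"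
    by (subst tree_law_graft[symmetric], subst integral_distr) (measurable, simp add: split_beta')
  also have "\<dots> = (\<integral>x. K x \<partial>mark_law)"
    unfolding K_def using mtt.integral_fst'[OF Gi] by simp
  finally have GK: "(\<integral>\<eta>. G \<eta> \<partial>tree_law) = (\<integral>x. K x \<partial>mark_law)" .
  have Km [measurable]: "K \<in> borel_measurable mark_law"
    unfolding K_def using Gg by (intro tt.borel_measurable_lebesgue_integral) (simp add: split_beta')
  have KC: "\<bar>K x\<bar> \<le> C" if "x \<in> space mark_law" for x
  proof -
    have "(\<lambda>q. G (graft x (fst q) (snd q))) \<in> borel_measurable (tree_law \<Otimes>\<^sub>M tree_law)"
      using measurable_compose[OF measurable_Pair1'[OF that] Gg] by simp
    then have i: "integrable (tree_law \<Otimes>\<^sub>M tree_law) (\<lambda>q. G (graft x (fst q) (snd q)))"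
      using GC by (intro tt.P.integrable_const_bound[where B=C]) auto
    have "\<bar>K x\<bar> \<le> (\<integral>q. \<bar>G (graft x (fst q) (snd q))\<bar> \<partial>(tree_law \<Otimes>\<^sub>M tree_law))" unfolding K_def by (rule integral_abs_bound)
    also have "\<dots> \<le> (\<integral>q. C \<partial>(tree_law \<Otimes>\<^sub>M tree_law))" using i GC by (intro integral_mono) auto
    finally show ?thesis by (simp add: tt.P.prob_space)
  qed
  have KH: "K x = H (fst x, ev (snd x) (fst x))" if x: "x \<in> space mark_law" "fst x \<le> t" for x
  proof -
    let ?s = "fst x" and ?y = "ev (snd x) (fst x)"
    have reg: "AE q in tree_law \<Otimes>\<^sub>M tree_law. regular (fst q) \<and> regular (snd q)"
    proof -
      \<comment> \<open>\<open>regular\<close> quantifies over all real times; a measurable null set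
        covering its complement is used to pass to pairs of trees.\<close>
      obtain N where N: "{\<eta> \<in> space tree_law. \<not> regular \<eta>} \<subseteq> N" "N \<in> null_sets tree_law"
        using AE_E2[OF AE_regular] AE_regular unfolding eventually_ae_filter by blast
      have "AE q in tree_law \<Otimes>\<^sub>M tree_law. fst q \<in> space tree_law - N \<and> snd q \<in> space tree_law - N"
      proof (rule tt.AE_pair_measure)
        show "{q \<in> space (tree_law \<Otimes>\<^sub>M tree_law). fst q \<in> space tree_law - N \<and> snd q \<in> space tree_law - N} \<in> sets (tree_law \<Otimes>\<^sub>M tree_law)"
          using N(2) by (auto simp: null_sets_def)
        have "AE x in tree_law. x \<notin> N" using N(2) by (rule AE_not_in)
        then show "AE x in tree_law. AE y in tree_law. fst (x, y) \<in> space tree_law - N \<and> snd (x, y) \<in> space tree_law - N"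
          by (auto elim!: eventually_elim2[OF _ AE_space] eventually_mono)
      qed
      then show ?thesis by eventually_elim (use N(1) in auto)
    qed
    have "K x = (\<integral>q. g ?s ?y (merge c (t - ?s) ?y (state (t - ?s) (fst q), state (t - ?s) (snd q))) \<partial>(tree_law \<Otimes>\<^sub>M tree_law))"
      unfolding K_def
    proof (rule integral_cong_AE)
      show "(\<lambda>q. G (graft x (fst q) (snd q))) \<in> borel_measurable (tree_law \<Otimes>\<^sub>M tree_law)"
        using measurable_compose[OF measurable_Pair1'[OF x(1)] Gg] by simp
      show "(\<lambda>q. g ?s ?y (merge c (t - ?s) ?y (state (t - ?s) (fst q), state (t - ?s) (snd q)))) \<in> borel_measurable (tree_law \<Otimes>\<^sub>M tree_law)"
        by (intro gm) measurable
      show "AE q in tree_law \<Otimes>\<^sub>M tree_law. G (graft x (fst q) (snd q)) =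
          g ?s ?y (merge c (t - ?s) ?y (state (t - ?s) (fst q), state (t - ?s) (snd q)))"
        using reg
      proof eventually_elim
        case (elim q)
        show ?case unfolding G_def
          using elim by (simp add: life_def disp_def particles_graft[OF _ _ x(2), of _ _ _ "m (t - ?s)"]
              maximum_graft[OF _ _ x(2)] merge_def state_def max_def algebra_simps)
      qed
    qed
    also have "\<dots> = H (?s, ?y)" unfolding H_def using gint[of "(?s, ?y)"] by (simp add: integral_law_pair)
    finally show ?thesis .
  qed
  have pm [measurable]: "(\<lambda>x. (fst x, ev (snd x) (fst x))) \<in> measurable mark_law (borel \<Otimes>\<^sub>M borel)" by measurable
  have Hp [measurable]: "(\<lambda>x. H (fst x, ev (snd x) (fst x))) \<in> borel_measurable mark_law"
    by (rule measurable_compose[OF pm Hm])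
  have e: "(\<integral>x. of_bool (fst x \<le> t) * H (fst x, ev (snd x) (fst x)) \<partial>mark_law) =
      (\<integral>q. branch_density q * (of_bool (fst q \<le> t) * H q) \<partial>(lborel \<Otimes>\<^sub>M lborel))"
  proof -
    have q: "(\<lambda>q. of_bool (fst q \<le> t) * H q) \<in> borel_measurable (borel \<Otimes>\<^sub>M borel)" by measurable
    have "(\<integral>x. of_bool (fst x \<le> t) * H (fst x, ev (snd x) (fst x)) \<partial>mark_law) =
        (\<integral>q. of_bool (fst q \<le> t) * H q \<partial>density (lborel \<Otimes>\<^sub>M lborel) branch_density)"
      unfolding mark_law_distr[symmetric] using integral_distr[OF pm q] by simp
    also have "\<dots> = (\<integral>q. branch_density q * (of_bool (fst q \<le> t) * H q) \<partial>(lborel \<Otimes>\<^sub>M lborel))"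
      by (subst integral_density) (measurable, simp_all add: branch_density_nonneg)
    finally show ?thesis .
  qed
  have i1: "integrable mark_law K" using KC by (intro mark.integrable_const_bound[where B=C]) auto
  have i2: "integrable mark_law (\<lambda>x. of_bool (fst x \<le> t) * H (fst x, ev (snd x) (fst x)))"
    using HC C0 by (intro mark.integrable_const_bound[where B=C]) (auto simp: of_bool_def)
  have [measurable]: "{x \<in> space mark_law. t < fst x} \<in> sets mark_law" by measurable
  have "\<bar>(\<integral>x. K x \<partial>mark_law) - (\<integral>x. of_bool (fst x \<le> t) * H (fst x, ev (snd x) (fst x)) \<partial>mark_law)\<bar> =
      \<bar>\<integral>x. K x - of_bool (fst x \<le> t) * H (fst x, ev (snd x) (fst x)) \<partial>mark_law\<bar>"
    using i1 i2 by simp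
  also have "\<dots> \<le> (\<integral>x. \<bar>K x - of_bool (fst x \<le> t) * H (fst x, ev (snd x) (fst x))\<bar> \<partial>mark_law)" by (rule integral_abs_bound)
  also have "\<dots> \<le> (\<integral>x. C * indicator {x \<in> space mark_law. t < fst x} x \<partial>mark_law)"
  proof (intro integral_mono integrable_abs Bochner_Integration.integrable_diff i1 i2)
    show "integrable mark_law (\<lambda>x. C * indicator {x \<in> space mark_law. t < fst x} x)"
      by (intro integrable_mult_right integrable_real_indicator) (simp_all add: mark.emeasure_eq_measure)
    fix x assume x: "x \<in> space mark_law"
    show "\<bar>K x - of_bool (fst x \<le> t) * H (fst x, ev (snd x) (fst x))\<bar> \<le> C * indicator {x \<in> space mark_law. t < fst x} x"
      using KH[OF x] KC[OF x] x by (cases "fst x \<le> t") auto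
  qed
  also have "\<dots> = C * exp (- t)"
  proof -
    have "{x \<in> space mark_law. t < fst x} \<inter> space mark_law = {x \<in> space mark_law. t < fst x}" by auto
    then show ?thesis by (simp add: mark_law_tail[OF t])
  qed
  finally show "\<bar>(\<integral>\<eta>. G \<eta> \<partial>tree_law) - (\<integral>q. branch_density q * (of_bool (fst q \<le> t) * H q) \<partial>(lborel \<Otimes>\<^sub>M lborel))\<bar> \<le> C * exp (- t)"
    unfolding GK e[symmetric] .
qed

end

section \<open>Integrals of the branching density\<close>

text \<open>The functions f n, truncated at G', converge by dominated convergence. What is cut off
  is at most the positive part of G n - G'; its integral vanishes in the limit, since the negative
  part is dominated by G' and the integrals of G n tend to that of G'.\<close>

lemma generalized_dominated_convergence:
  fixes f :: "nat \<Rightarrow> 'a \<Rightarrow> real" and G :: "nat \<Rightarrow> 'a \<Rightarrow> real"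
  assumes f: "\<And>n. f n \<in> borel_measurable M" "f' \<in> borel_measurable M"
    and G: "\<And>n. integrable M (G n)" "integrable M G'"
    and bound: "\<And>n. AE x in M. \<bar>f n x\<bar> \<le> G n x"
    and lim: "AE x in M. (\<lambda>n. f n x) \<longlonglongrightarrow> f' x" "AE x in M. (\<lambda>n. G n x) \<longlonglongrightarrow> G' x"
    and int: "(\<lambda>n. \<integral>x. G n x \<partial>M) \<longlonglongrightarrow> (\<integral>x. G' x \<partial>M)"
  shows "(\<lambda>n. \<integral>x. f n x \<partial>M) \<longlonglongrightarrow> (\<integral>x. f' x \<partial>M)"
proof -
  note [measurable] = f borel_measurable_integrable[OF G(1)] borel_measurable_integrable[OF G(2)]
  have "AE x in M. 0 \<le> G n x" for n using bound[of n] by eventually_elim linarith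
  then have G0: "AE x in M. \<forall>n. 0 \<le> G n x" by (simp add: AE_all_countable)
  have G'0: "AE x in M. 0 \<le> G' x" using G0 lim(2)
    by eventually_elim (auto intro: LIMSEQ_le_const)
  have 1: "(\<lambda>n. \<integral>x. max 0 (G' x - G n x) \<partial>M) \<longlonglongrightarrow> (\<integral>x. 0 \<partial>M)"
  proof (rule integral_dominated_convergence[where w=G'])
    show "AE x in M. (\<lambda>n. max 0 (G' x - G n x)) \<longlonglongrightarrow> 0"
      using lim(2)
    proof eventually_elim
      case (elim x)
      have "(\<lambda>n. max 0 (G' x - G n x)) \<longlonglongrightarrow> max 0 (G' x - G' x)" by (intro tendsto_intros elim)
      then show ?case by simp
    qed
    show "AE x in M. norm (max 0 (G' x - G n x)) \<le> G' x" for n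
      using G0 G'0
    proof eventually_elim
      case (elim x)
      then have "0 \<le> G n x" by blast
      with elim show ?case by auto
    qed
  qed (use G in auto)
  have iG: "integrable M (\<lambda>x. max 0 (G n x - G' x))" "integrable M (\<lambda>x. max 0 (G' x - G n x))" for n
    using G by (auto intro!: integrable_max)
  have "(\<integral>x. max 0 (G n x - G' x) \<partial>M) = (\<integral>x. G n x \<partial>M) - (\<integral>x. G' x \<partial>M) + (\<integral>x. max 0 (G' x - G n x) \<partial>M)" for n
  proof -
    have "(\<integral>x. max 0 (G n x - G' x) \<partial>M) = (\<integral>x. (G n x - G' x) + max 0 (G' x - G n x) \<partial>M)"
      by (intro Bochner_Integration.integral_cong) auto
    then show ?thesis using G iG by simp
  qed
  moreover have "(\<lambda>n. (\<integral>x. G n x \<partial>M) - (\<integral>x. G' x \<partial>M) + (\<integral>x. max 0 (G' x - G n x) \<partial>M)) \<longlonglongrightarrow> (\<integral>x. G' x \<partial>M) - (\<integral>x. G' x \<partial>M) + 0"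
    using 1 int by (intro tendsto_intros) auto
  ultimately have 2: "(\<lambda>n. \<integral>x. max 0 (G n x - G' x) \<partial>M) \<longlonglongrightarrow> 0" by simp
  define h where "h = (\<lambda>n x. max (- G' x) (min (G' x) (f n x)))"
  have hm [measurable]: "h n \<in> borel_measurable M" for n unfolding h_def by measurable
  have f'G: "AE x in M. \<bar>f' x\<bar> \<le> G' x"
  proof -
    have "AE x in M. \<forall>n. \<bar>f n x\<bar> \<le> G n x" using bound by (subst AE_all_countable) auto
    with lim show ?thesis
    proof eventually_elim
      case (elim x)
      have "(\<lambda>n. \<bar>f n x\<bar>) \<longlonglongrightarrow> \<bar>f' x\<bar>" by (intro tendsto_intros elim)
      then show ?case using elim by (intro LIMSEQ_le[of "\<lambda>n. \<bar>f n x\<bar>" _ "\<lambda>n. G n x"]) auto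
    qed
  qed
  have 3: "(\<lambda>n. \<integral>x. h n x \<partial>M) \<longlonglongrightarrow> (\<integral>x. f' x \<partial>M)"
  proof (rule integral_dominated_convergence[where w=G'])
    show "AE x in M. (\<lambda>n. h n x) \<longlonglongrightarrow> f' x"
      using lim(1) f'G
    proof eventually_elim
      case (elim x)
      have "(\<lambda>n. h n x) \<longlonglongrightarrow> max (- G' x) (min (G' x) (f' x))" unfolding h_def by (intro tendsto_intros elim)
      then show ?case using elim by (auto simp: abs_le_iff min_def max_def split: if_splits)
    qed
    show "AE x in M. norm (h n x) \<le> G' x" for n
      using G'0 by eventually_elim (auto simp: h_def)
  qed (use G f in auto)
  have fi: "integrable M (f n)" for n
    by (rule Bochner_Integration.integrable_bound[OF G(1)[of n] f(1)]) (use bound[of n] in \<open>auto elim!: eventually_mono\<close>)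
  have hi: "integrable M (h n)" for n
    by (rule Bochner_Integration.integrable_bound[OF G(2) hm]) (use G'0 in \<open>auto elim!: eventually_mono simp: h_def\<close>)
  have 4: "\<bar>(\<integral>x. f n x \<partial>M) - (\<integral>x. h n x \<partial>M)\<bar> \<le> (\<integral>x. max 0 (G n x - G' x) \<partial>M)" for n
  proof -
    have "\<bar>(\<integral>x. f n x \<partial>M) - (\<integral>x. h n x \<partial>M)\<bar> = \<bar>\<integral>x. f n x - h n x \<partial>M\<bar>" using fi hi by simp
    also have "\<dots> \<le> (\<integral>x. \<bar>f n x - h n x\<bar> \<partial>M)" by (rule integral_abs_bound)
    also have "\<dots> \<le> (\<integral>x. max 0 (G n x - G' x) \<partial>M)"
    proof (intro integral_mono_AE integrable_abs Bochner_Integration.integrable_diff fi hi iG)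
      show "AE x in M. \<bar>f n x - h n x\<bar> \<le> max 0 (G n x - G' x)"
        using bound[of n] G'0 by eventually_elim (auto simp: h_def abs_le_iff min_def max_def)
    qed
    finally show ?thesis .
  qed
  have "(\<lambda>n. (\<integral>x. f n x \<partial>M) - (\<integral>x. h n x \<partial>M)) \<longlonglongrightarrow> 0"
    by (rule Lim_null_comparison[OF _ 2]) (use 4 in auto)
  from tendsto_add[OF this 3] show ?thesis by simp
qed

section \<open>The kernel with drift 2 and its mass in time\<close>

lemma cdf_std_normal_deriv:
  "(cdf std_normal_distribution has_real_derivative std_normal_density x) (at x)"
proof -
  interpret N: real_distribution std_normal_distribution by (rule real_dist_normal_dist)
  have "\<exists>F. \<forall>x::real. - \<infinity> < ereal x \<longrightarrow> ereal x < \<infinity> \<longrightarrow> (F has_vector_derivative std_normal_density x) (at x)"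
    by (rule einterval_antiderivative) (auto simp: normal_density_def intro!: continuous_intros)
  then obtain F where "\<And>x. (F has_vector_derivative std_normal_density x) (at x)" by auto
  then have F: "(F has_real_derivative std_normal_density x) (at x)" for x
    by (simp add: has_real_derivative_iff_has_vector_derivative)
  \<comment> \<open>Equal increments mean that F and the distribution function differ by a constant,
    hence share the derivative.\<close>
  have d: "cdf std_normal_distribution b - cdf std_normal_distribution a = F b - F a" if "a < b" for a b
  proof -
    have Fm: "F a \<le> F b"
      using that by (intro DERIV_nonneg_imp_nondecreasing[of a b F]) (auto intro: F normal_density_nonneg)
    have "emeasure std_normal_distribution {a<..b} = (\<integral>\<^sup>+x. ennreal (std_normal_density x) * indicator {a<..b} x \<partial>lborel)"
      by (subst emeasure_density) auto
    also have "\<dots> = (\<integral>\<^sup>+x. ennreal (std_normal_density x) * indicator {a..b} x \<partial>lborel)"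
      by (rule nn_integral_cong_AE) (use AE_lborel_singleton[of a] in \<open>auto elim!: eventually_mono simp: indicator_def\<close>)
    also have "\<dots> = ennreal (F b - F a)"
      using that by (intro nn_integral_FTC_Icc) (auto intro: has_field_derivative_at_within F normal_density_nonneg)
    finally have "measure std_normal_distribution {a<..b} = F b - F a" using Fm by (simp add: measure_def)
    then show ?thesis using N.cdf_diff_eq[OF that] by simp
  qed
  have "cdf std_normal_distribution y = F y + (cdf std_normal_distribution 0 - F 0)" for y
    using d[of 0 y] d[of y 0] by (cases y "0::real" rule: linorder_cases) auto
  then have "cdf std_normal_distribution = (\<lambda>y. F y + (cdf std_normal_distribution 0 - F 0))" by blast
  then show ?thesis using F[of x] by (metis DERIV_shift add.commute field_differentiable_diff DERIV_cmult_Id has_field_derivative_transform_within DERIV_add[OF F[of x] DERIV_const, simplified])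
qed

text \<open>The antiderivative is read off the first passage law of Brownian motion with drift.\<close>

lemma inverse_gaussian_integral:
  fixes b :: real
  assumes b: "0 < b"
  defines "f \<equiv> \<lambda>s. 1 / sqrt (2 * pi * s) * exp (- (b - 2 * s)\<^sup>2 / (2 * s))"
  shows "(\<integral>\<^sup>+s. ennreal (f s) * indicator {0<..} s \<partial>lborel) = ennreal (1/2)"
proof -
  interpret N: real_distribution std_normal_distribution by (rule real_dist_normal_dist)
  define \<Phi> where "\<Phi> = cdf std_normal_distribution"
  have \<Phi>: "(\<Phi> has_real_derivative std_normal_density x) (at x)" for x unfolding \<Phi>_def by (rule cdf_std_normal_deriv)
  \<comment> \<open>The passage time of level b under drift 2 has distribution function \<Phi>(2
    sqrt s - b / sqrt s) + e^(4b) \<Phi>(- 2 sqrt s - b / sqrt s). Reversing the sign of the second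
    term cancels the parts b / (2 q^3) of the two derivatives and keeps the parts 1 / q.\<close>
  define F where "F = (\<lambda>s. (\<Phi> (2 * sqrt s - b / sqrt s) - exp (4 * b) * \<Phi> (- 2 * sqrt s - b / sqrt s)) / 2)"
  have DF: "(F has_real_derivative f s) (at s)" if s: "0 < s" for s
  proof -
    define q where "q = sqrt s"
    have q: "q > 0" "q * q = s" "sqrt s = q" using s by (auto simp: q_def)
    have "((\<lambda>s. 2 * sqrt s - b / sqrt s) has_real_derivative (1 / q + b / (2 * q ^ 3))) (at s)"
      using s q by (auto intro!: derivative_eq_intros simp: field_simps power3_eq_cube)
    from DERIV_chain2[OF \<Phi> this]
    have D1: "((\<lambda>s. \<Phi> (2 * sqrt s - b / sqrt s)) has_real_derivative
      std_normal_density (2 * q - b / q) * (1 / q + b / (2 * q ^ 3))) (at s)" by (simp add: q)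
    have "((\<lambda>s. - 2 * sqrt s - b / sqrt s) has_real_derivative (- 1 / q + b / (2 * q ^ 3))) (at s)"
      using s q by (auto intro!: derivative_eq_intros simp: field_simps power3_eq_cube)
    from DERIV_chain2[OF \<Phi> this]
    have D2: "((\<lambda>s. \<Phi> (- 2 * sqrt s - b / sqrt s)) has_real_derivative
      std_normal_density (- 2 * q - b / q) * (- 1 / q + b / (2 * q ^ 3))) (at s)" by (simp add: q)
    define r where "r = b / q"
    have r: "b / q = r" "b = q * r" using q by (auto simp: r_def)
    \<comment> \<open>The squares of 2 q + b / q and 2 q - b / q differ by 8 b, which is where the
      factor e^(4b) comes from.\<close>
    have e: "exp (4 * b) * std_normal_density (- 2 * q - b / q) = std_normal_density (2 * q - b / q)"
    proof -
      have "4 * b - (- 2 * q - b / q)\<^sup>2 / 2 = - (2 * q - b / q)\<^sup>2 / 2"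
        unfolding r(1) unfolding r(2) by (simp add: power2_eq_square field_simps)
      then show ?thesis by (simp add: std_normal_density_def exp_add[symmetric])
    qed
    have fs: "f s = std_normal_density (2 * q - b / q) / q"
    proof -
      have "(b - 2 * s)\<^sup>2 = (q * (2 * q - r))\<^sup>2" unfolding r(2) q(2)[symmetric] by (simp add: algebra_simps power2_eq_square)
      moreover have "(q * k)\<^sup>2 / (2 * s) = k\<^sup>2 / 2" for k unfolding q(2)[symmetric] using q(1) by (simp add: power2_eq_square)
      ultimately have "(b - 2 * s)\<^sup>2 / (2 * s) = (2 * q - b / q)\<^sup>2 / 2" unfolding r(1) by simp
      then show ?thesis by (simp add: f_def std_normal_density_def real_sqrt_mult q)
    qed
    have "(F has_real_derivative ((std_normal_density (2 * q - b / q) * (1 / q + b / (2 * q ^ 3)) -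
       exp (4 * b) * (std_normal_density (- 2 * q - b / q) * (- 1 / q + b / (2 * q ^ 3)))) / 2)) (at s)"
      unfolding F_def by (intro DERIV_cdivide DERIV_diff D1 DERIV_cmult D2)
    also have "(std_normal_density (2 * q - b / q) * (1 / q + b / (2 * q ^ 3)) -
       exp (4 * b) * (std_normal_density (- 2 * q - b / q) * (- 1 / q + b / (2 * q ^ 3)))) / 2 = f s"
      unfolding mult.assoc[symmetric] e fs by (simp add: algebra_simps add_divide_distrib)
    finally show ?thesis .
  qed
  have Fbot: "(\<Phi> \<longlongrightarrow> 0) at_bot" unfolding \<Phi>_def by (rule N.cdf_lim_at_bot)
  have Ftop: "(\<Phi> \<longlongrightarrow> 1) at_top" unfolding \<Phi>_def by (rule N.cdf_lim_at_top_prob)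
  have l1: "filterlim (\<lambda>s. 2 * sqrt s - b / sqrt s) at_bot (at_right 0)" using b by real_asymp
  have l2: "filterlim (\<lambda>s. - 2 * sqrt s - b / sqrt s) at_bot (at_right 0)" using b by real_asymp
  have l3: "filterlim (\<lambda>s. 2 * sqrt s - b / sqrt s) at_top at_top" by real_asymp
  have l4: "filterlim (\<lambda>s. - 2 * sqrt s - b / sqrt s) at_bot at_top" by real_asymp
  have "(F \<longlongrightarrow> (0 - exp (4 * b) * 0) / 2) (at_right 0)" unfolding F_def
    by (intro tendsto_intros filterlim_compose[OF Fbot l1] filterlim_compose[OF Fbot l2]) simp
  then have A: "((F \<circ> real_of_ereal) \<longlongrightarrow> 0) (at_right (ereal 0))" by (simp add: ereal_tendsto_simps)
  have "(F \<longlongrightarrow> (1 - exp (4 * b) * 0) / 2) at_top" unfolding F_def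
    by (intro tendsto_intros filterlim_compose[OF Ftop l3] filterlim_compose[OF Fbot l4]) simp
  then have B: "((F \<circ> real_of_ereal) \<longlongrightarrow> 1/2) (at_left \<infinity>)" by (simp add: ereal_tendsto_simps)
  have cf: "isCont f s" if "0 < s" for s using that unfolding f_def by (auto intro!: continuous_intros)
  have f0: "0 \<le> f s" if "0 < s" for s using that unfolding f_def by auto
  have I: "set_integrable lborel (einterval (ereal 0) \<infinity>) f" "(LBINT x=ereal 0..\<infinity>. f x) = 1/2 - 0"
    using interval_integral_FTC_nonneg[of "ereal 0" \<infinity> F f 0 "1/2"] DF cf f0 A B by auto
  have ei: "einterval (ereal 0) \<infinity> = {0<..}" by (auto simp: einterval_def)
  have int: "integrable lborel (\<lambda>s. indicator {0<..} s * f s)"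
    using I(1) unfolding ei set_integrable_def by simp
  have "(\<integral>\<^sup>+s. ennreal (f s) * indicator {0<..} s \<partial>lborel) = (\<integral>\<^sup>+s. ennreal (indicator {0<..} s * f s) \<partial>lborel)"
    by (intro nn_integral_cong) (auto simp: indicator_def)
  also have "\<dots> = ennreal (\<integral>s. indicator {0<..} s * f s \<partial>lborel)"
    using f0 by (intro nn_integral_eq_integral int) (auto simp: indicator_def)
  also have "(\<integral>s. indicator {0<..} s * f s \<partial>lborel) = 1/2"
    using I(2) by (simp add: interval_lebesgue_integral_def ei set_lebesgue_integral_def)
  finally show ?thesis .
qed

lemma borel_measurable_lborel_pair:
  "borel_measurable (lborel \<Otimes>\<^sub>M lborel) = borel_measurable (borel \<Otimes>\<^sub>M borel)"
  by (intro measurable_cong_sets sets_pair_measure_cong) simp_all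

text \<open>Density at b, for fixed s, of Brownian motion with drift 2 at time s. Its integral over
  s, \<open>passage_mass\<close>, is the Green function, equal to the inverse drift 1/2 at points in
  the direction of the drift.\<close>

definition passage_density :: "real \<Rightarrow> real \<Rightarrow> real" where
  "passage_density b s = 1 / sqrt (2 * pi * s) * exp (- (b - 2 * s)\<^sup>2 / (2 * s))"

lemma measurable_passage_density [measurable]:
  "(\<lambda>q. passage_density (fst q) (snd q)) \<in> borel_measurable (borel \<Otimes>\<^sub>M borel)"
  unfolding passage_density_def by measurable

definition passage_mass :: "real \<Rightarrow> ennreal" where
  "passage_mass b = (\<integral>\<^sup>+s. ennreal (passage_density b s) * indicator {0<..} s \<partial>lborel)"

lemma passage_mass_pos: "0 < b \<Longrightarrow> passage_mass b = ennreal (1/2)"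
  unfolding passage_mass_def passage_density_def by (rule inverse_gaussian_integral)

text \<open>For negative b, passing to - b increases the kernel at every s. The value b = 0 is a
  null set wherever the bound is applied.\<close>

lemma passage_mass_le: "b \<noteq> 0 \<Longrightarrow> passage_mass b \<le> ennreal (1/2)"
proof (cases "0 < b")
  case False
  assume "b \<noteq> 0"
  with False have b: "b < 0" by simp
  have "passage_mass b \<le> passage_mass (- b)"
    unfolding passage_mass_def
  proof (intro nn_integral_mono)
    fix s :: real
    show "ennreal (passage_density b s) * indicator {0<..} s \<le> ennreal (passage_density (- b) s) * indicator {0<..} s"
    proof (cases "0 < s")
      case True
      have "(- b - 2 * s)\<^sup>2 \<le> (b - 2 * s)\<^sup>2"
        using mult_neg_pos[OF b True] by (simp add: power2_eq_square algebra_simps)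
      then have "- (b - 2 * s)\<^sup>2 / (2 * s) \<le> - (- b - 2 * s)\<^sup>2 / (2 * s)" using True by (intro divide_right_mono) auto
      then have "passage_density b s \<le> passage_density (- b) s"
        unfolding passage_density_def using True by (intro mult_left_mono) auto
      then show ?thesis using True by (simp add: ennreal_leI)
    qed simp
  qed
  with passage_mass_pos[of "- b"] b show ?thesis by simp
qed (simp add: passage_mass_pos)

lemma sqrt2_gamma: "sqrt 2 * \<gamma> = 2 - sqrt 2"
  by (simp add: \<gamma>_def right_diff_distrib)

text \<open>Completing the square: with y = sqrt 2 s - b one has - s - y^2 / (2 s) = - (2 - sqrt 2)
  b - (b - 2 s)^2 / (2 s). This is the origin both of the rate \<open>sqrt 2 * \<gamma>\<close> and
  of the drift 2.\<close>

lemma branch_density_passage: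
  assumes s: "0 < s"
  shows "branch_density (s, sqrt 2 * s - b) = exp (- sqrt 2 * \<gamma> * b) * passage_density b s"
proof -
  have "- s + (- (sqrt 2 * s - b)\<^sup>2 / (2 * s)) = - (2 - sqrt 2) * b + (- (b - 2 * s)\<^sup>2 / (2 * s))"
  proof -
    have 1: "(sqrt 2 * s - b)\<^sup>2 = 2 * s * s - 2 * sqrt 2 * s * b + b * b" by (simp add: power2_eq_square algebra_simps)
    have 2: "(b - 2 * s)\<^sup>2 = b * b - 4 * s * b + 4 * s * s" by (simp add: power2_eq_square algebra_simps)
    show ?thesis unfolding 1 2 using s by (simp add: field_simps)
  qed
  then have e: "exp (- s) * exp (- (sqrt 2 * s - b)\<^sup>2 / (2 * s)) = exp (- sqrt 2 * \<gamma> * b) * exp (- (b - 2 * s)\<^sup>2 / (2 * s))"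
    unfolding exp_add[symmetric] by (simp add: sqrt2_gamma)
  have "branch_density (s, sqrt 2 * s - b) = (exp (- s) * exp (- (sqrt 2 * s - b)\<^sup>2 / (2 * s))) / sqrt (2 * pi * s)"
    using s by (simp add: branch_density_def exponential_density_def normal_density_def)
  then show ?thesis unfolding e by (simp add: passage_density_def)
qed

text \<open>After the substitution z = sqrt 2 s - a - y the tilt depends on z alone, so integrating
  over s for fixed z leaves the Green function at a + z.\<close>

lemma branch_density_spatial:
  assumes D [measurable]: "D \<in> borel_measurable borel" and D0: "\<And>z. 0 \<le> D z"
  shows "(\<integral>\<^sup>+q. ennreal (branch_density q * D (sqrt 2 * fst q - a - snd q)) \<partial>(lborel \<Otimes>\<^sub>M lborel)) =
    (\<integral>\<^sup>+z. ennreal (exp (- sqrt 2 * \<gamma> * (a + z)) * D z) * passage_mass (a + z) \<partial>lborel)"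
proof -
  have "(\<integral>\<^sup>+q. ennreal (branch_density q * D (sqrt 2 * fst q - a - snd q)) \<partial>(lborel \<Otimes>\<^sub>M lborel)) =
     (\<integral>\<^sup>+s. (\<integral>\<^sup>+y. ennreal (branch_density (s, y) * D (sqrt 2 * s - a - y)) \<partial>lborel) \<partial>lborel)"
    by (subst lborel.nn_integral_fst[symmetric]) (simp_all add: borel_measurable_lborel_pair)
  also have "\<dots> = (\<integral>\<^sup>+s. (\<integral>\<^sup>+z. ennreal (branch_density (s, sqrt 2 * s - (a + z)) * D z) \<partial>lborel) \<partial>lborel)"
  proof (rule nn_integral_cong)
    fix s :: real
    show "(\<integral>\<^sup>+y. ennreal (branch_density (s, y) * D (sqrt 2 * s - a - y)) \<partial>lborel) =
      (\<integral>\<^sup>+z. ennreal (branch_density (s, sqrt 2 * s - (a + z)) * D z) \<partial>lborel)"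
      by (subst nn_integral_real_affine[where c="-1" and t="sqrt 2 * s - a"]) (simp_all add: algebra_simps)
  qed
  also have "\<dots> = (\<integral>\<^sup>+z. (\<integral>\<^sup>+s. ennreal (branch_density (s, sqrt 2 * s - (a + z)) * D z) \<partial>lborel) \<partial>lborel)"
    by (rule lborel_pair.Fubini'[symmetric]) measurable
  also have "\<dots> = (\<integral>\<^sup>+z. ennreal (exp (- sqrt 2 * \<gamma> * (a + z)) * D z) * passage_mass (a + z) \<partial>lborel)"
  proof (rule nn_integral_cong)
    fix z :: real
    have "(\<integral>\<^sup>+s. ennreal (branch_density (s, sqrt 2 * s - (a + z)) * D z) \<partial>lborel) =
      (\<integral>\<^sup>+s. ennreal (exp (- sqrt 2 * \<gamma> * (a + z)) * D z) * (ennreal (passage_density (a + z) s) * indicator {0<..} s) \<partial>lborel)"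
    proof (rule nn_integral_cong_AE)
      have "AE s in lborel. s \<noteq> (0::real)" by (rule AE_lborel_singleton)
      then show "AE s in lborel. ennreal (branch_density (s, sqrt 2 * s - (a + z)) * D z) =
         ennreal (exp (- sqrt 2 * \<gamma> * (a + z)) * D z) * (ennreal (passage_density (a + z) s) * indicator {0<..} s)"
      proof eventually_elim
        case (elim s)
        show ?case
        proof (cases "0 < s")
          case True
          then have "0 \<le> passage_density (a + z) s" by (simp add: passage_density_def)
          with True D0 show ?thesis
            unfolding branch_density_passage[OF True] by (simp add: ennreal_mult[symmetric] ac_simps)
        next
          case False
          with elim show ?thesis by (simp add: branch_density_def exponential_density_def)
        qed
      qed
    qed
    also have "\<dots> = ennreal (exp (- sqrt 2 * \<gamma> * (a + z)) * D z) * passage_mass (a + z)"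
      unfolding passage_mass_def
      by (rule nn_integral_cmult) (simp add: passage_density_def)
    finally show "(\<integral>\<^sup>+s. ennreal (branch_density (s, sqrt 2 * s - (a + z)) * D z) \<partial>lborel) =
      ennreal (exp (- sqrt 2 * \<gamma> * (a + z)) * D z) * passage_mass (a + z)" .
  qed
  finally show ?thesis .
qed

lemma measurable_passage_mass [measurable]: "passage_mass \<in> borel_measurable borel"
  unfolding passage_mass_def
  by (intro lborel.borel_measurable_nn_integral) (simp add: split_beta' passage_density_def)

text \<open>Given the time s the place is centred normal with variance s, so its exponential moment
  is explicit. The integrals of the branching density below are instances for particular h and
  \<theta>.\<close>

lemma branch_density_exp:
  assumes h [measurable]: "h \<in> borel_measurable borel" and h0: "\<And>s. 0 \<le> h s"
  shows "(\<integral>\<^sup>+q. ennreal (branch_density q * (h (fst q) * exp (\<theta> * snd q))) \<partial>(lborel \<Otimes>\<^sub>M lborel)) =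
    (\<integral>\<^sup>+s. ennreal (exponential_density 1 s * (h s * exp (\<theta>\<^sup>2 * s / 2))) \<partial>lborel)"
proof -
  have "(\<integral>\<^sup>+q. ennreal (branch_density q * (h (fst q) * exp (\<theta> * snd q))) \<partial>(lborel \<Otimes>\<^sub>M lborel)) =
     (\<integral>\<^sup>+s. (\<integral>\<^sup>+y. ennreal (branch_density (s, y) * (h s * exp (\<theta> * y))) \<partial>lborel) \<partial>lborel)"
    by (subst lborel.nn_integral_fst[symmetric]) (simp_all add: borel_measurable_lborel_pair)
  also have "\<dots> = (\<integral>\<^sup>+s. ennreal (exponential_density 1 s * (h s * exp (\<theta>\<^sup>2 * s / 2))) \<partial>lborel)"
  proof (rule nn_integral_cong_AE)
    have "AE s in lborel. s \<noteq> (0::real)" by (rule AE_lborel_singleton)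
    then show "AE s in lborel. (\<integral>\<^sup>+y. ennreal (branch_density (s, y) * (h s * exp (\<theta> * y))) \<partial>lborel) =
       ennreal (exponential_density 1 s * (h s * exp (\<theta>\<^sup>2 * s / 2)))"
    proof eventually_elim
      case (elim s)
      show ?case
      proof (cases "0 < s")
        case True
        have bd: "branch_density (s, y) * (h s * exp (\<theta> * y)) =
          (exponential_density 1 s * (h s * exp (\<theta>\<^sup>2 * s / 2))) * normal_density (\<theta> * s) (sqrt s) y" for y
        proof -
          have "- y\<^sup>2 / (2 * s) + \<theta> * y = \<theta>\<^sup>2 * s / 2 + (- (y - \<theta> * s)\<^sup>2 / (2 * s))"
            using True by (simp add: field_simps power2_eq_square)
          then have "exp (- y\<^sup>2 / (2 * s)) * exp (\<theta> * y) = exp (\<theta>\<^sup>2 * s / 2) * exp (- (y - \<theta> * s)\<^sup>2 / (2 * s))"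
            unfolding exp_add[symmetric] by simp
          then show ?thesis using True by (simp add: branch_density_def normal_density_def)
        qed
        have "(\<integral>\<^sup>+y. ennreal (branch_density (s, y) * (h s * exp (\<theta> * y))) \<partial>lborel) =
           (\<integral>\<^sup>+y. ennreal (exponential_density 1 s * (h s * exp (\<theta>\<^sup>2 * s / 2))) * ennreal (normal_density (\<theta> * s) (sqrt s) y) \<partial>lborel)"
          unfolding bd using h0[of s] by (simp add: ennreal_mult normal_density_nonneg exponential_density_nonneg)
        also have "\<dots> = ennreal (exponential_density 1 s * (h s * exp (\<theta>\<^sup>2 * s / 2))) * (\<integral>\<^sup>+y. ennreal (normal_density (\<theta> * s) (sqrt s) y) \<partial>lborel)"
          by (rule nn_integral_cmult) simp
        also have "(\<integral>\<^sup>+y. ennreal (normal_density (\<theta> * s) (sqrt s) y) \<partial>lborel) = 1"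
          using prob_space.emeasure_space_1[OF prob_space_normal_density[of "sqrt s" "\<theta> * s"]] True by (simp add: emeasure_density)
        finally show ?thesis by simp
      next
        case False
        with elim show ?thesis by (simp add: branch_density_def exponential_density_def)
      qed
    qed
  qed
  finally show ?thesis .
qed

lemma nn_integral_exponential: "0 < l \<Longrightarrow> (\<integral>\<^sup>+s. ennreal (exponential_density l s) \<partial>lborel) = 1"
  using prob_space.emeasure_space_1[OF prob_space_exponential_density[of l]] by (simp add: emeasure_density)

text \<open>The mean of exp (sqrt 2 / 2 \<tau> - X / 2) at the branching, 1 / (1 - sqrt 2 / 2 -
  1/8): the factor by which the bound e^(-y/2) is multiplied in one step of the recursion.\<close>

definition kappa :: real where "kappa = 1 / (7/8 - sqrt 2 / 2)"

lemma kappa_pos: "0 < kappa"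
proof -
  have "sqrt 2 < 7/4" by (rule real_less_lsqrt) (auto simp: power2_eq_square)
  then show ?thesis by (simp add: kappa_def)
qed

lemma has_bochner_integral_nonnegI:
  assumes "f \<in> borel_measurable M" "\<And>x. 0 \<le> f x" "(\<integral>\<^sup>+x. ennreal (f x) \<partial>M) = ennreal c" "0 \<le> c"
  shows "integrable M f \<and> (\<integral>x. f x \<partial>M) = c"
proof -
  have "has_bochner_integral M f c" using assms by (intro has_bochner_integral_nn_integral) auto
  then show ?thesis by (simp add: has_bochner_integral_iff)
qed

lemma branch_density_drift_integral:
  "integrable (lborel \<Otimes>\<^sub>M lborel) (\<lambda>q. branch_density q * exp (sqrt 2 / 2 * fst q - snd q / 2)) \<and>
   (\<integral>q. branch_density q * exp (sqrt 2 / 2 * fst q - snd q / 2) \<partial>(lborel \<Otimes>\<^sub>M lborel)) = kappa"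
proof (rule has_bochner_integral_nonnegI)
  have "(\<integral>\<^sup>+q. ennreal (branch_density q * exp (sqrt 2 / 2 * fst q - snd q / 2)) \<partial>(lborel \<Otimes>\<^sub>M lborel)) =
     (\<integral>\<^sup>+q. ennreal (branch_density q * (exp (sqrt 2 / 2 * fst q) * exp ((- 1/2) * snd q))) \<partial>(lborel \<Otimes>\<^sub>M lborel))"
    by (intro nn_integral_cong) (simp add: exp_add[symmetric])
  also have "\<dots> = (\<integral>\<^sup>+s. ennreal (exponential_density 1 s * (exp (sqrt 2 / 2 * s) * exp ((-1/2)\<^sup>2 * s / 2))) \<partial>lborel)"
    by (rule branch_density_exp) auto
  also have "\<dots> = (\<integral>\<^sup>+s. ennreal kappa * ennreal (exponential_density (1 / kappa) s) \<partial>lborel)"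
  proof (rule nn_integral_cong)
    fix s :: real
    have "exp (- s) * (exp (sqrt 2 / 2 * s) * exp ((-1/2)\<^sup>2 * s / 2)) = exp (- s * (1 / kappa))"
      unfolding exp_add[symmetric] by (simp add: kappa_def power2_eq_square algebra_simps)
    then show "ennreal (exponential_density 1 s * (exp (sqrt 2 / 2 * s) * exp ((-1/2)\<^sup>2 * s / 2))) =
        ennreal kappa * ennreal (exponential_density (1 / kappa) s)"
      using kappa_pos by (simp add: exponential_density_def ennreal_mult[symmetric])
  qed
  also have "\<dots> = ennreal kappa"
    using kappa_pos by (subst nn_integral_cmult) (simp_all add: nn_integral_exponential)
  finally show "(\<integral>\<^sup>+q. ennreal (branch_density q * exp (sqrt 2 / 2 * fst q - snd q / 2)) \<partial>(lborel \<Otimes>\<^sub>M lborel)) = ennreal kappa" .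
qed (use kappa_pos in \<open>auto simp: branch_density_nonneg\<close>)

text \<open>Pays for the squared boundary term e^(-(t - s)/2) and for short remaining times t - s.
  The outcome t e^(-t) is negligible against exp (- sqrt 2 \<gamma> a) when a = o(t).\<close>

lemma branch_density_early_integral:
  assumes t: "0 \<le> t"
  shows "integrable (lborel \<Otimes>\<^sub>M lborel) (\<lambda>q. branch_density q * (of_bool (fst q \<le> t) * exp (- (t - fst q)))) \<and>
   (\<integral>q. branch_density q * (of_bool (fst q \<le> t) * exp (- (t - fst q))) \<partial>(lborel \<Otimes>\<^sub>M lborel)) = t * exp (- t)"
proof (rule has_bochner_integral_nonnegI)
  have "(\<integral>\<^sup>+q. ennreal (branch_density q * (of_bool (fst q \<le> t) * exp (- (t - fst q)))) \<partial>(lborel \<Otimes>\<^sub>M lborel)) =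
     (\<integral>\<^sup>+q. ennreal (branch_density q * ((of_bool (fst q \<le> t) * exp (- (t - fst q))) * exp (0 * snd q))) \<partial>(lborel \<Otimes>\<^sub>M lborel))"
    by simp
  also have "\<dots> = (\<integral>\<^sup>+s. ennreal (exponential_density 1 s * ((of_bool (s \<le> t) * exp (- (t - s))) * exp (0\<^sup>2 * s / 2))) \<partial>lborel)"
    by (rule branch_density_exp) auto
  also have "\<dots> = (\<integral>\<^sup>+s. ennreal (exp (- t)) * indicator {0..t} s \<partial>lborel)"
    by (intro nn_integral_cong) (auto simp: exponential_density_def indicator_def exp_add[symmetric])
  also have "\<dots> = ennreal (t * exp (- t))" using t by (simp add: nn_integral_cmult ennreal_mult[symmetric] mult.commute)
  finally show "(\<integral>\<^sup>+q. ennreal (branch_density q * (of_bool (fst q \<le> t) * exp (- (t - fst q)))) \<partial>(lborel \<Otimes>\<^sub>M lborel)) = ennreal (t * exp (- t))" .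
qed (use t in \<open>auto simp: branch_density_nonneg\<close>)

lemma branch_density_half_integral:
  "integrable (lborel \<Otimes>\<^sub>M lborel) (\<lambda>q. branch_density q * exp (- (t - fst q) / 2)) \<and>
   (\<integral>q. branch_density q * exp (- (t - fst q) / 2) \<partial>(lborel \<Otimes>\<^sub>M lborel)) = 2 * exp (- t / 2)"
proof (rule has_bochner_integral_nonnegI)
  have "(\<integral>\<^sup>+q. ennreal (branch_density q * exp (- (t - fst q) / 2)) \<partial>(lborel \<Otimes>\<^sub>M lborel)) =
     (\<integral>\<^sup>+q. ennreal (branch_density q * (exp (- (t - fst q) / 2) * exp (0 * snd q))) \<partial>(lborel \<Otimes>\<^sub>M lborel))"
    by simp
  also have "\<dots> = (\<integral>\<^sup>+s. ennreal (exponential_density 1 s * (exp (- (t - s) / 2) * exp (0\<^sup>2 * s / 2))) \<partial>lborel)"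
    by (rule branch_density_exp) auto
  also have "\<dots> = (\<integral>\<^sup>+s. ennreal (2 * exp (- t / 2)) * ennreal (exponential_density (1/2) s) \<partial>lborel)"
  proof (intro nn_integral_cong)
    fix s :: real
    have "exp (- s) * exp (- (t - s) / 2) = exp (- t / 2) * exp (- s * (1/2))"
      unfolding exp_add[symmetric] by (simp add: field_simps)
    then show "ennreal (exponential_density 1 s * (exp (- (t - s) / 2) * exp (0\<^sup>2 * s / 2))) =
       ennreal (2 * exp (- t / 2)) * ennreal (exponential_density (1/2) s)"
      by (simp add: exponential_density_def ennreal_mult[symmetric])
  qed
  also have "\<dots> = ennreal (2 * exp (- t / 2))"
    by (subst nn_integral_cmult) (simp_all add: nn_integral_exponential)
  finally show "(\<integral>\<^sup>+q. ennreal (branch_density q * exp (- (t - fst q) / 2)) \<partial>(lborel \<Otimes>\<^sub>M lborel)) = ennreal (2 * exp (- t / 2))" .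
qed (auto simp: branch_density_nonneg)

lemma branch_density_integral:
  "integrable (lborel \<Otimes>\<^sub>M lborel) branch_density \<and> (\<integral>q. branch_density q \<partial>(lborel \<Otimes>\<^sub>M lborel)) = 1"
proof (rule has_bochner_integral_nonnegI)
  have "(\<integral>\<^sup>+q. ennreal (branch_density q) \<partial>(lborel \<Otimes>\<^sub>M lborel)) =
     (\<integral>\<^sup>+q. ennreal (branch_density q * (1 * exp (0 * snd q))) \<partial>(lborel \<Otimes>\<^sub>M lborel))" by simp
  also have "\<dots> = (\<integral>\<^sup>+s. ennreal (exponential_density 1 s * (1 * exp (0\<^sup>2 * s / 2))) \<partial>lborel)"
    by (rule branch_density_exp) auto
  also have "\<dots> = ennreal 1" by (simp add: nn_integral_exponential)
  finally show "(\<integral>\<^sup>+q. ennreal (branch_density q) \<partial>(lborel \<Otimes>\<^sub>M lborel)) = ennreal 1" .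
qed (auto simp: branch_density_nonneg)

text \<open>Coordinates \<sigma> = (s - d) / c and z = sqrt 2 s - a - y: in the second variable a
  shear and a reflection, so only the factor c remains as Jacobian.\<close>

lemma lborel_pair_affine:
  fixes a c d :: real
  assumes c: "0 < c"
  defines "\<Psi> \<equiv> \<lambda>q. (d + c * fst q, sqrt 2 * (d + c * fst q) - a - snd q)"
  shows "(lborel \<Otimes>\<^sub>M lborel :: (real \<times> real) measure) = density (distr (lborel \<Otimes>\<^sub>M lborel) (lborel \<Otimes>\<^sub>M lborel) \<Psi>) (\<lambda>_. ennreal c)"
proof (rule measure_eqI)
  have [measurable]: "\<Psi> \<in> measurable (lborel \<Otimes>\<^sub>M lborel) (lborel \<Otimes>\<^sub>M lborel)" unfolding \<Psi>_def by measurable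
  fix A assume A [measurable]: "A \<in> sets (lborel \<Otimes>\<^sub>M lborel :: (real \<times> real) measure)"
  have [measurable]: "A \<in> sets (borel \<Otimes>\<^sub>M borel)"
    using A sets_pair_measure_cong[of lborel borel lborel borel] by simp
  have "emeasure (lborel \<Otimes>\<^sub>M lborel) A = (\<integral>\<^sup>+s. (\<integral>\<^sup>+y. indicator A (s, y) \<partial>lborel) \<partial>lborel)"
    by (subst nn_integral_indicator[symmetric, OF A], subst lborel.nn_integral_fst[symmetric]) measurable
  also have "\<dots> = (\<integral>\<^sup>+s. (\<integral>\<^sup>+z. indicator A (s, sqrt 2 * s - a - z) \<partial>lborel) \<partial>lborel)"
  proof (rule nn_integral_cong)
    fix s :: real
    have "(\<lambda>y. indicator A (s, y) :: ennreal) \<in> borel_measurable lborel" by measurable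
    then show "(\<integral>\<^sup>+y. indicator A (s, y) \<partial>lborel) = (\<integral>\<^sup>+z. indicator A (s, sqrt 2 * s - a - z) \<partial>lborel :: ennreal)"
      by (subst nn_integral_real_affine[where c="-1" and t="sqrt 2 * s - a"]) simp_all
  qed
  also have "\<dots> = ennreal c * (\<integral>\<^sup>+x. (\<integral>\<^sup>+z. indicator A (\<Psi> (x, z)) \<partial>lborel) \<partial>lborel)"
  proof -
    have m: "(\<lambda>s. \<integral>\<^sup>+z. indicator A (s, sqrt 2 * s - a - z) \<partial>lborel :: ennreal) \<in> borel_measurable borel"
      by measurable
    show ?thesis using nn_integral_real_affine[OF m, of c d] c by (simp add: \<Psi>_def)
  qed
  also have "\<dots> = ennreal c * (\<integral>\<^sup>+q. indicator A (\<Psi> q) \<partial>(lborel \<Otimes>\<^sub>M lborel))"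
    by (subst lborel.nn_integral_fst[symmetric]) measurable
  also have "\<dots> = emeasure (density (distr (lborel \<Otimes>\<^sub>M lborel) (lborel \<Otimes>\<^sub>M lborel) \<Psi>) (\<lambda>_. ennreal c)) A"
    using nn_integral_distr[of \<Psi> "lborel \<Otimes>\<^sub>M lborel" "lborel \<Otimes>\<^sub>M lborel" "indicator A"]
    by (subst emeasure_density) (simp_all add: nn_integral_cmult)
  finally show "emeasure (lborel \<Otimes>\<^sub>M lborel) A = emeasure (density (distr (lborel \<Otimes>\<^sub>M lborel) (lborel \<Otimes>\<^sub>M lborel) \<Psi>) (\<lambda>_. ennreal c)) A" .
qed simp

lemma integral_lborel_pair_affine:
  fixes a c d :: real and F :: "real \<times> real \<Rightarrow> real"
  assumes c: "0 < c" and F [measurable]: "F \<in> borel_measurable (lborel \<Otimes>\<^sub>M lborel)"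
  defines "\<Psi> \<equiv> \<lambda>q. (d + c * fst q, sqrt 2 * (d + c * fst q) - a - snd q)"
  shows "(\<integral>q. F q \<partial>(lborel \<Otimes>\<^sub>M lborel)) = (\<integral>q. c * F (\<Psi> q) \<partial>(lborel \<Otimes>\<^sub>M lborel))"
    and "integrable (lborel \<Otimes>\<^sub>M lborel) F \<Longrightarrow> integrable (lborel \<Otimes>\<^sub>M lborel) (\<lambda>q. c * F (\<Psi> q))"
proof -
  have m [measurable]: "\<Psi> \<in> measurable (lborel \<Otimes>\<^sub>M lborel) (lborel \<Otimes>\<^sub>M lborel)" unfolding \<Psi>_def by measurable
  let ?D = "density (distr (lborel \<Otimes>\<^sub>M lborel) (lborel \<Otimes>\<^sub>M lborel) \<Psi>) (\<lambda>_. ennreal c)"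
  have eq: "(lborel \<Otimes>\<^sub>M lborel :: (real \<times> real) measure) = ?D" unfolding \<Psi>_def by (rule lborel_pair_affine[OF c])
  have "(\<integral>q. F q \<partial>?D) = (\<integral>q. c * F (\<Psi> q) \<partial>(lborel \<Otimes>\<^sub>M lborel))"
    using c by (subst integral_density) (simp_all add: integral_distr)
  then show "(\<integral>q. F q \<partial>(lborel \<Otimes>\<^sub>M lborel)) = (\<integral>q. c * F (\<Psi> q) \<partial>(lborel \<Otimes>\<^sub>M lborel))" using eq by simp
  assume "integrable (lborel \<Otimes>\<^sub>M lborel) F"
  then have "integrable ?D F" using eq by simp
  then have "integrable (distr (lborel \<Otimes>\<^sub>M lborel) (lborel \<Otimes>\<^sub>M lborel) \<Psi>) (\<lambda>q. c * F q)"
    using c by (subst (asm) integrable_density) simp_all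
  then show "integrable (lborel \<Otimes>\<^sub>M lborel) (\<lambda>q. c * F (\<Psi> q))"
    by (subst (asm) integrable_distr_eq) simp_all
qed

section \<open>The distribution function of the recentred maximum\<close>

abbreviation state_topology :: "(real measure \<times> real) topology" where
  "state_topology \<equiv> prod_topology vague_topology euclideanreal"

lemma induced_by_state: "induced_by state_topology (map_prod tents (\<lambda>x. x))"
  by (intro induced_by_prod induced_by_vague induced_by_euclidean)

lemma sets_state_topology: "sets (borel_of state_topology) = sets state_space"
proof -
  have "sets (borel_of state_topology) = sets (vague_borel \<Otimes>\<^sub>M borel_of euclideanreal)"
    by (rule sets_borel_of_prod[OF induced_by_vague induced_by_euclidean])
  also have "\<dots> = sets state_space" by (intro sets_pair_measure_cong refl sets_borel_of_euclidean)
  finally show ?thesis .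
qed

text \<open>Point masses allow a moving deterministic threshold to be adjoined as a further
  coordinate of a weak limit.\<close>

lemma converges_in_law_return:
  fixes x :: "nat \<Rightarrow> real"
  assumes "x \<longlonglongrightarrow> x0"
  shows "converges_in_law euclideanreal (\<lambda>n. return borel (x n)) (return borel x0) sequentially"
  unfolding converges_in_law_def
proof (intro conjI allI impI always_eventually)
  fix g :: "real \<Rightarrow> real"
  assume g: "continuous_map euclideanreal euclideanreal g \<and> bounded (g ` topspace euclideanreal)"
  then have c: "continuous_on UNIV g" by simp
  then have m: "g \<in> borel_measurable borel" by (rule borel_measurable_continuous_onI)
  have "(\<lambda>n. g (x n)) \<longlonglongrightarrow> g x0"
    using c assms by (intro isCont_tendsto_compose[of x0 g]) (auto simp: continuous_on_eq_continuous_at)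
  then show "(\<lambda>n. \<integral>y. g y \<partial>return borel (x n)) \<longlonglongrightarrow> (\<integral>y. g y \<partial>return borel x0)"
    using m by (simp add: integral_return)
qed (auto intro: prob_space_return simp: sets_borel_of_euclidean)

text \<open>Only the joint limit of configuration and maximum is assumed here; that the second
  coordinate is the largest atom of the first enters in \<open>bbm_limit\<close>.\<close>

locale canonical_limit = canonical_bbm W for W +
  fixes LL :: "(real measure \<times> real) measure"
  assumes law_conv: "converges_in_law state_topology law LL at_top"
begin

lemma LL_prob: "prob_space LL" and sets_LL': "sets LL = sets (borel_of state_topology)"
  using law_conv by (auto simp: converges_in_law_def)

lemma sets_LL [measurable_cong]: "sets LL = sets state_space"
  using sets_LL' sets_state_topology by simp

sublocale LL: prob_space LL by (rule LL_prob)
sublocale LL2: pair_prob_space LL LL ..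

abbreviation triple_topology :: "(((real measure \<times> real) \<times> (real measure \<times> real)) \<times> real) topology" where
  "triple_topology \<equiv> prod_topology (prod_topology state_topology state_topology) euclideanreal"

lemma law_law_prob: "prob_space (law r \<Otimes>\<^sub>M law r)"
  by (intro prob_space_pair law_prob)

lemma triple_conv:
  assumes r: "filterlim r at_top sequentially" and x: "x \<longlonglongrightarrow> x0"
  shows "converges_in_law triple_topology (\<lambda>n. (law (r n) \<Otimes>\<^sub>M law (r n)) \<Otimes>\<^sub>M return borel (x n))
     ((LL \<Otimes>\<^sub>M LL) \<Otimes>\<^sub>M return borel x0) sequentially"
  using converges_in_law_compose[OF law_conv r]
  by (intro converges_in_law_pair[OF induced_by_prod[OF induced_by_state induced_by_state] induced_by_euclidean]
      converges_in_law_pair[OF induced_by_state induced_by_state] converges_in_law_return x)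

lemma integral_pair_return:
  fixes f :: "_ \<Rightarrow> real"
  assumes M: "prob_space M" and f: "f \<in> borel_measurable (M \<Otimes>\<^sub>M borel)" and C: "\<And>z. z \<in> space (M \<Otimes>\<^sub>M borel) \<Longrightarrow> \<bar>f z\<bar> \<le> C"
  shows "(\<integral>z. f z \<partial>(M \<Otimes>\<^sub>M return borel x)) = (\<integral>p. f (p, x) \<partial>M)"
proof -
  interpret M: prob_space M by fact
  interpret R: prob_space "return borel x" by (rule prob_space_return) simp
  interpret MR: pair_prob_space M "return borel x" ..
  have fm: "f \<in> borel_measurable (M \<Otimes>\<^sub>M return borel x)"
    using f by (simp cong: measurable_cong_sets sets_pair_measure_cong)
  have "integrable (M \<Otimes>\<^sub>M return borel x) f"
    using C by (intro MR.P.integrable_const_bound[where B=C] fm) (auto simp: space_pair_measure)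
  from MR.integral_fst'[OF this]
  have "(\<integral>z. f z \<partial>(M \<Otimes>\<^sub>M return borel x)) = (\<integral>p. (\<integral>y. f (p, y) \<partial>return borel x) \<partial>M)" by simp
  also have "\<dots> = (\<integral>p. f (p, x) \<partial>M)"
  proof (rule Bochner_Integration.integral_cong)
    fix p assume "p \<in> space M"
    then have "(\<lambda>y. f (p, y)) \<in> borel_measurable borel" by (rule measurable_compose[OF measurable_Pair1' f])
    then show "(\<integral>y. f (p, y) \<partial>return borel x) = f (p, x)" by (simp add: integral_return)
  qed simp
  finally show ?thesis .
qed

text \<open>The threshold x n varies with n, while the mapping theorem works with fixed functions.
  So the threshold becomes a coordinate under a point mass, and H and c are continuous in all
  coordinates.\<close>

lemma pair_limit:
  assumes r: "filterlim r at_top sequentially" and x: "x \<longlonglongrightarrow> x0"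
    and H: "continuous_map triple_topology euclideanreal H" "\<And>z. z \<in> topspace triple_topology \<Longrightarrow> \<bar>H z\<bar> \<le> C"
    and c: "continuous_map triple_topology euclideanreal c" and c0: "AE p in LL \<Otimes>\<^sub>M LL. c (p, x0) \<noteq> 0"
  shows "(\<lambda>n. \<integral>p. H (p, x n) * of_bool (c (p, x n) \<le> 0) \<partial>(law (r n) \<Otimes>\<^sub>M law (r n))) \<longlonglongrightarrow>
    (\<integral>p. H (p, x0) * of_bool (c (p, x0) \<le> (0::real)) \<partial>(LL \<Otimes>\<^sub>M LL))"
proof -
  have bH: "bounded (H ` topspace triple_topology)"
    unfolding bounded_iff by (intro exI[of _ C] ballI) (use H(2) in \<open>elim imageE, simp only: real_norm_def\<close>)
  have st: "sets (borel_of triple_topology) = sets ((state_space \<Otimes>\<^sub>M state_space) \<Otimes>\<^sub>M borel)"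
  proof -
    have "sets (borel_of triple_topology) = sets (borel_of (prod_topology state_topology state_topology) \<Otimes>\<^sub>M borel_of euclideanreal)"
      by (rule sets_borel_of_prod[OF induced_by_prod[OF induced_by_state induced_by_state] induced_by_euclidean])
    also have "\<dots> = sets ((borel_of state_topology \<Otimes>\<^sub>M borel_of state_topology) \<Otimes>\<^sub>M borel)"
      by (intro sets_pair_measure_cong sets_borel_of_prod[OF induced_by_state induced_by_state] sets_borel_of_euclidean)
    also have "\<dots> = sets ((state_space \<Otimes>\<^sub>M state_space) \<Otimes>\<^sub>M borel)"
      by (intro sets_pair_measure_cong sets_state_topology refl)
    finally show ?thesis .
  qed
  have [measurable]: "H \<in> borel_measurable ((state_space \<Otimes>\<^sub>M state_space) \<Otimes>\<^sub>M borel)"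
     "c \<in> borel_measurable ((state_space \<Otimes>\<^sub>M state_space) \<Otimes>\<^sub>M borel)"
    using continuous_map_borel_measurable[OF H(1)] continuous_map_borel_measurable[OF c]
    by (simp_all add: measurable_cong_sets[OF st refl])
  have fm: "(\<lambda>z. H z * of_bool (c z \<le> 0)) \<in> borel_measurable ((state_space \<Otimes>\<^sub>M state_space) \<Otimes>\<^sub>M borel)" by measurable
  have sp: "space ((state_space \<Otimes>\<^sub>M state_space) \<Otimes>\<^sub>M borel) = topspace triple_topology"
    using sets_eq_imp_space_eq[OF st] by (simp add: space_borel_of)
  have "C \<ge> 0"
  proof -
    obtain p where "p \<in> space LL" using LL.not_empty by blast
    then have "((p, p), 0) \<in> topspace triple_topology"
      unfolding sp[symmetric] using sets_eq_imp_space_eq[OF sets_LL] by (simp add: space_pair_measure)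
    from H(2)[OF this] show ?thesis by linarith
  qed
  then have bd: "\<bar>H z * of_bool (c z \<le> 0)\<bar> \<le> C" if "z \<in> topspace triple_topology" for z
    using H(2)[OF that] by (simp add: of_bool_def)
  have red: "(\<integral>z. H z * of_bool (c z \<le> 0) \<partial>(M \<Otimes>\<^sub>M return borel u)) = (\<integral>p. H (p, u) * of_bool (c (p, u) \<le> 0) \<partial>M)"
    if "prob_space M" "sets M = sets (state_space \<Otimes>\<^sub>M state_space)" for M u
  proof (rule integral_pair_return[OF that(1)])
    have s: "sets (M \<Otimes>\<^sub>M borel) = sets ((state_space \<Otimes>\<^sub>M state_space) \<Otimes>\<^sub>M borel)"
      by (intro sets_pair_measure_cong that refl)
    show "(\<lambda>z. H z * of_bool (c z \<le> 0)) \<in> borel_measurable (M \<Otimes>\<^sub>M borel)" using fm by (simp add: measurable_cong_sets[OF s refl])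
    show "z \<in> space (M \<Otimes>\<^sub>M borel) \<Longrightarrow> \<bar>H z * of_bool (c z \<le> 0)\<bar> \<le> C" for z
      using bd sp sets_eq_imp_space_eq[OF s] by blast
  qed
  have s1: "sets (law (r n) \<Otimes>\<^sub>M law (r n)) = sets (state_space \<Otimes>\<^sub>M state_space)" for n
    by (intro sets_pair_measure_cong sets_law)
  have s2: "sets (LL \<Otimes>\<^sub>M LL) = sets (state_space \<Otimes>\<^sub>M state_space)" by (intro sets_pair_measure_cong sets_LL)
  have ae: "AE z in (LL \<Otimes>\<^sub>M LL) \<Otimes>\<^sub>M return borel x0. c z \<noteq> 0"
  proof -
    interpret R: prob_space "return borel x0" by (rule prob_space_return) simp
    interpret MR: pair_prob_space "LL \<Otimes>\<^sub>M LL" "return borel x0" ..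
    show ?thesis
    proof (rule MR.AE_pair_measure)
      show "{z \<in> space ((LL \<Otimes>\<^sub>M LL) \<Otimes>\<^sub>M return borel x0). c z \<noteq> 0} \<in> sets ((LL \<Otimes>\<^sub>M LL) \<Otimes>\<^sub>M return borel x0)"
      proof -
        have s3: "sets ((LL \<Otimes>\<^sub>M LL) \<Otimes>\<^sub>M return borel x0) = sets ((state_space \<Otimes>\<^sub>M state_space) \<Otimes>\<^sub>M borel)"
          by (intro sets_pair_measure_cong s2) simp
        have "{z \<in> space ((state_space \<Otimes>\<^sub>M state_space) \<Otimes>\<^sub>M borel). c z \<noteq> 0} \<in> sets ((state_space \<Otimes>\<^sub>M state_space) \<Otimes>\<^sub>M borel)"
          by measurable
        then show ?thesis unfolding s3 sets_eq_imp_space_eq[OF s3] .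
      qed
      show "AE p in LL \<Otimes>\<^sub>M LL. AE y in return borel x0. c (p, y) \<noteq> 0"
        using c0 AE_space
      proof eventually_elim
        case (elim p)
        then have "p \<in> space (state_space \<Otimes>\<^sub>M state_space)" using sets_eq_imp_space_eq[OF s2] by simp
        then have "(\<lambda>y. c (p, y)) \<in> borel_measurable borel"
          by (rule measurable_compose[OF measurable_Pair1' \<open>c \<in> borel_measurable _\<close>])
        then show ?case using elim by (subst AE_return) (auto simp: pred_def)
      qed
    qed
  qed
  show ?thesis
    using converges_in_law_integral_le0[OF triple_conv[OF r x] H(1) bH c ae]
    unfolding red[OF law_law_prob s1] red[OF LL2.P.prob_space_axioms s2] .
qed

definition cdf_max :: "real \<Rightarrow> real \<Rightarrow> real" where
  "cdf_max r z = measure (law r) {p \<in> space (law r). snd p \<le> z}"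

definition cdf_lim :: "real \<Rightarrow> real" where
  "cdf_lim z = measure LL {p \<in> space LL. snd p \<le> z}"

lemma pair_cdf:
  assumes M: "prob_space M" and [measurable_cong]: "sets M = sets state_space"
  shows "(\<integral>p. of_bool (max (snd (fst p)) (snd (snd p)) \<le> x) \<partial>(M \<Otimes>\<^sub>M M) :: real) = (measure M {p \<in> space M. snd p \<le> x})\<^sup>2"
proof -
  interpret M: prob_space M by fact
  interpret MM: pair_prob_space M M ..
  let ?S = "{p \<in> space M. snd p \<le> x}"
  have S: "?S \<in> sets M" by measurable
  have "(\<integral>p. of_bool (max (snd (fst p)) (snd (snd p)) \<le> x) \<partial>(M \<Otimes>\<^sub>M M) :: real) = (\<integral>p. indicator (?S \<times> ?S) p \<partial>(M \<Otimes>\<^sub>M M) :: real)"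
    by (intro Bochner_Integration.integral_cong) (auto simp: space_pair_measure indicator_def)
  also have "\<dots> = measure (M \<Otimes>\<^sub>M M) (?S \<times> ?S)"
    using S sets.sets_into_space[OF S] by (simp add: space_pair_measure Int_absorb2 Sigma_mono)
  also have "\<dots> = measure M ?S * measure M ?S" using S by (simp add: measure_def M.emeasure_pair_measure_Times enn2real_mult)
  finally show ?thesis by (simp add: power2_eq_square)
qed

lemma cdf_max_bounds: "0 \<le> cdf_max r z" "cdf_max r z \<le> 1"
  unfolding cdf_max_def using prob_space.prob_le_1[OF law_prob] by auto

lemma cdf_lim_bounds: "0 \<le> cdf_lim z" "cdf_lim z \<le> 1"
  unfolding cdf_lim_def using LL.prob_le_1 by auto

lemma cdf_max_mono: "z \<le> z' \<Longrightarrow> cdf_max r z \<le> cdf_max r z'"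
proof -
  interpret L: prob_space "law r" by (rule law_prob)
  assume "z \<le> z'"
  then show ?thesis unfolding cdf_max_def by (intro L.finite_measure_mono) (auto, measurable)
qed

lemma cdf_lim_mono: "z \<le> z' \<Longrightarrow> cdf_lim z \<le> cdf_lim z'"
  unfolding cdf_lim_def by (intro LL.finite_measure_mono) (auto, measurable)

lemma AE_pair_max_neq:
  assumes x: "measure LL {p \<in> space LL. snd p = x} = 0"
  shows "AE p in LL \<Otimes>\<^sub>M LL. max (snd (fst p)) (snd (snd p)) \<noteq> x"
proof (rule LL2.AE_pair_measure)
  show "{p \<in> space (LL \<Otimes>\<^sub>M LL). max (snd (fst p)) (snd (snd p)) \<noteq> x} \<in> sets (LL \<Otimes>\<^sub>M LL)" by measurable
  have m: "{p \<in> space LL. snd p = x} \<in> sets LL" by measurable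
  then have ae: "AE p in LL. snd p \<noteq> x"
    using x by (intro AE_I'[of "{p \<in> space LL. snd p = x}"]) (auto simp: null_sets_def LL.emeasure_eq_measure)
  show "AE p in LL. AE q in LL. max (snd (fst (p, q))) (snd (snd (p, q))) \<noteq> x"
    using ae by eventually_elim (use ae in \<open>auto elim!: eventually_mono simp: max_def\<close>)
qed

lemma continuous_map_triple_gap:
  "continuous_map triple_topology euclideanreal (\<lambda>z. max (snd (fst (fst z))) (snd (snd (fst z))) - snd z)"
proof -
  have 1: "continuous_map triple_topology euclideanreal snd" by (rule continuous_map_snd)
  have 2: "continuous_map triple_topology euclideanreal (\<lambda>z. snd (fst (fst z)))"
    using continuous_map_compose[OF continuous_map_compose[OF continuous_map_fst continuous_map_fst] continuous_map_snd]
    by (simp add: comp_def)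
  have 3: "continuous_map triple_topology euclideanreal (\<lambda>z. snd (snd (fst z)))"
    using continuous_map_compose[OF continuous_map_compose[OF continuous_map_fst continuous_map_snd] continuous_map_snd]
    by (simp add: comp_def)
  show ?thesis using 1 2 3 by (intro continuous_intros)
qed

lemma cdf_max_sq_limit:
  assumes r: "filterlim r at_top sequentially" and x: "x \<longlonglongrightarrow> x0"
    and x0: "measure LL {p \<in> space LL. snd p = x0} = 0"
  shows "(\<lambda>n. (cdf_max (r n) (x n))\<^sup>2) \<longlonglongrightarrow> (cdf_lim x0)\<^sup>2"
proof -
  have "(\<lambda>n. \<integral>p. (1::real) * of_bool (max (snd (fst p)) (snd (snd p)) - x n \<le> 0) \<partial>(law (r n) \<Otimes>\<^sub>M law (r n))) \<longlonglongrightarrow>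
    (\<integral>p. (1::real) * of_bool (max (snd (fst p)) (snd (snd p)) - x0 \<le> 0) \<partial>(LL \<Otimes>\<^sub>M LL))"
    using pair_limit[OF r x, of "\<lambda>_. 1" 1 "\<lambda>z. max (snd (fst (fst z))) (snd (snd (fst z))) - snd z"]
      continuous_map_triple_gap AE_pair_max_neq[OF x0] by simp
  then show ?thesis
    unfolding mult_1 diff_le_0_iff_le pair_cdf[OF law_prob sets_law] pair_cdf[OF LL_prob sets_LL] cdf_max_def cdf_lim_def .
qed

lemma cdf_max_limit:
  assumes "filterlim r at_top sequentially" "x \<longlonglongrightarrow> x0" "measure LL {p \<in> space LL. snd p = x0} = 0"
  shows "(\<lambda>n. cdf_max (r n) (x n)) \<longlonglongrightarrow> cdf_lim x0"
  using tendsto_real_sqrt[OF cdf_max_sq_limit[OF assms]] cdf_max_bounds cdf_lim_bounds by simp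

text \<open>The integral form of the F-KPP equation, the square coming from the two independent
  subtrees. It is \<open>graft_formula\<close> for the indicator of a nonpositive maximum seen from
  m t + z, and the change of centring enters as m t - m (t - s).\<close>

lemma recursion_measurable:
  "(\<lambda>q. of_bool (fst q \<le> t) * (cdf_max (t - fst q) (m t - m (t - fst q) + z - snd q))\<^sup>2) \<in> borel_measurable (borel \<Otimes>\<^sub>M borel)"
  and cdf_max_recursion: "0 \<le> t \<Longrightarrow>
    \<bar>cdf_max t z - (\<integral>q. branch_density q * (of_bool (fst q \<le> t) *
       (cdf_max (t - fst q) (m t - m (t - fst q) + z - snd q))\<^sup>2) \<partial>(lborel \<Otimes>\<^sub>M lborel))\<bar> \<le> exp (- t)"
proof -
  define g :: "real \<Rightarrow> real \<Rightarrow> real measure \<times> real \<Rightarrow> real" where "g = (\<lambda>s y p. of_bool (snd p \<le> 0))"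
  have gm: "(\<lambda>z. g (fst z) (fst (snd z)) (snd (snd z))) \<in> borel_measurable (borel \<Otimes>\<^sub>M (borel \<Otimes>\<^sub>M state_space))"
    unfolding g_def by measurable
  have gC: "\<bar>g s y p\<bar> \<le> 1" for s y p by (simp add: g_def)
  define H where "H = (\<lambda>q. \<integral>p. g (fst q) (snd q) (merge (m t + z) (t - fst q) (snd q) p) \<partial>(law (t - fst q) \<Otimes>\<^sub>M law (t - fst q)))"
  have H: "H q = (cdf_max (t - fst q) (m t - m (t - fst q) + z - snd q))\<^sup>2" for q
  proof -
    have "g (fst q) (snd q) (merge (m t + z) (t - fst q) (snd q) p) =
        of_bool (max (snd (fst p)) (snd (snd p)) \<le> m t - m (t - fst q) + z - snd q)" for p
      unfolding g_def merge_def by (auto simp: algebra_simps)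
    then show ?thesis unfolding H_def cdf_max_def using pair_cdf[OF law_prob sets_law] by simp
  qed
  have Hm: "H \<in> borel_measurable (borel \<Otimes>\<^sub>M borel)"
  proof (cases "0 \<le> t")
    case True
    show ?thesis unfolding H_def by (rule graft_formula(1)[OF gm gC True])
  next
    case False
    show ?thesis unfolding H_def g_def by (intro measurable_integral_law_pair) measurable
  qed
  then show "(\<lambda>q. of_bool (fst q \<le> t) * (cdf_max (t - fst q) (m t - m (t - fst q) + z - snd q))\<^sup>2) \<in> borel_measurable (borel \<Otimes>\<^sub>M borel)"
    unfolding H by measurable
  assume t: "0 \<le> t"
  have "(\<integral>\<eta>. g (life [] \<eta>) (disp [] (life [] \<eta>) \<eta>) (particles_from life disp t (m t + z) \<eta>, maximum life disp t \<eta> - (m t + z)) \<partial>tree_law)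
    = cdf_max t z"
  proof -
    have e: "(\<integral>\<eta>. g (life [] \<eta>) (disp [] (life [] \<eta>) \<eta>) (particles_from life disp t (m t + z) \<eta>, maximum life disp t \<eta> - (m t + z)) \<partial>tree_law)
       = (\<integral>\<eta>. indicator {p \<in> space (law t). snd p \<le> z} (state t \<eta>) \<partial>tree_law)"
    proof (rule Bochner_Integration.integral_cong)
      fix \<eta> assume \<eta>: "\<eta> \<in> space tree_law"
      have "state t \<in> measurable tree_law (law t)"
        by (subst measurable_cong_sets[OF refl sets_law]) measurable
      from measurable_space[OF this \<eta>]
      show "g (life [] \<eta>) (disp [] (life [] \<eta>) \<eta>) (particles_from life disp t (m t + z) \<eta>, maximum life disp t \<eta> - (m t + z)) =
          indicator {p \<in> space (law t). snd p \<le> z} (state t \<eta>)"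
        by (simp add: g_def indicator_def) (simp add: state_def algebra_simps)
    qed simp
    have S: "{p \<in> space (law t). snd p \<le> z} \<in> sets state_space"
      unfolding sets_law[of t, symmetric] by measurable
    have "(\<integral>\<eta>. indicator {p \<in> space (law t). snd p \<le> z} (state t \<eta>) \<partial>tree_law) = (\<integral>p. indicator {p \<in> space (law t). snd p \<le> z} p \<partial>law t :: real)"
      unfolding law_def[of t] by (subst integral_distr) (use S in \<open>simp_all add: law_def\<close>)
    also have "\<dots> = cdf_max t z" unfolding cdf_max_def by (simp add: Int_absorb2 subsetI)
    finally show ?thesis unfolding e .
  qed
  with graft_formula(3)[OF gm gC t, where c="m t + z"] show "\<bar>cdf_max t z - (\<integral>q. branch_density q * (of_bool (fst q \<le> t) *
       (cdf_max (t - fst q) (m t - m (t - fst q) + z - snd q))\<^sup>2) \<partial>(lborel \<Otimes>\<^sub>M lborel))\<bar> \<le> exp (- t)"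
    using H[unfolded H_def] by simp
qed

end

text \<open>The linear parts cancel and the logarithmic parts leave a multiple of ln (1 - s / t); so
  the correction in m is invisible on time scales o(t).\<close>

lemma m_diff_limit:
  fixes s t :: "nat \<Rightarrow> real"
  assumes t: "filterlim t at_top sequentially" and st: "(\<lambda>n. s n / t n) \<longlonglongrightarrow> 0"
  shows "(\<lambda>n. m (t n) - m (t n - s n) - sqrt 2 * s n) \<longlonglongrightarrow> 0"
proof -
  have "(\<lambda>n. ln (1 - s n / t n)) \<longlonglongrightarrow> ln (1 - 0)" using st by (intro tendsto_intros) auto
  from tendsto_mult_left[OF this, of "3 / (2 * sqrt 2)"] have 1: "(\<lambda>n. 3 / (2 * sqrt 2) * ln (1 - s n / t n)) \<longlonglongrightarrow> 0" by simp
  have ev: "\<forall>\<^sub>F n in sequentially. s n / t n < 1" using st by (rule order_tendstoD) simp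
  have "\<forall>\<^sub>F n in sequentially. 0 < t n" using t by (simp add: filterlim_at_top_dense)
  with ev have "\<forall>\<^sub>F n in sequentially. 3 / (2 * sqrt 2) * ln (1 - s n / t n) = m (t n) - m (t n - s n) - sqrt 2 * s n"
  proof eventually_elim
    case (elim n)
    then have "s n < t n" by simp
    have "1 - s n / t n = (t n - s n) / t n" using elim by (simp add: diff_divide_distrib)
    then have l: "ln (1 - s n / t n) = ln (t n - s n) - ln (t n)" using elim \<open>s n < t n\<close> by (simp add: ln_div)
    have "c * (x - y) = (r * t n - c * y) - (r * (t n - s n) - c * x) - r * s n" for c r x y :: real
      by (simp add: algebra_simps)
    then show ?case unfolding m_def l .
  qed
  with 1 show ?thesis by (rule Lim_transform_eventually)
qed

lemma m_diff_le: "0 < s \<Longrightarrow> s < t \<Longrightarrow> m t - m (t - s) \<le> sqrt 2 * s"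
proof -
  assume s: "0 < s" "s < t"
  then have "3 / (2 * sqrt 2) * ln (t - s) \<le> 3 / (2 * sqrt 2) * ln t" by (intro mult_left_mono) auto
  then show ?thesis unfolding m_def right_diff_distrib by linarith
qed

context canonical_limit
begin

section \<open>Absence of atoms in the limit law of the maximum\<close>

definition atoms :: "real set" where
  "atoms = {x. measure LL {p \<in> space LL. snd p = x} \<noteq> 0}"

lemma countable_atoms: "countable atoms"
proof -
  have snd: "snd \<in> borel_measurable LL" by measurable
  interpret D: prob_space "distr LL borel snd" by (rule LL.prob_space_distr[OF snd])
  have "measure (distr LL borel snd) {x} = measure LL {p \<in> space LL. snd p = x}" for x
    using snd by (simp add: measure_distr vimage_def Int_def conj_commute)
  then show ?thesis using D.countable_support unfolding atoms_def by simp
qed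

lemma AE_not_atom: "AE q in lborel \<Otimes>\<^sub>M lborel. sqrt 2 * fst q + z - snd q \<notin> atoms"
proof (rule lborel_pair.AE_pair_measure)
  have [measurable]: "atoms \<in> sets borel" by (rule sets.countable[OF _ countable_atoms]) simp
  have "{q \<in> space (borel \<Otimes>\<^sub>M borel). sqrt 2 * fst q + z - snd q \<notin> atoms} \<in> sets (borel \<Otimes>\<^sub>M borel)"
    by measurable
  then show "{q \<in> space (lborel \<Otimes>\<^sub>M lborel). sqrt 2 * fst q + z - snd q \<notin> atoms} \<in> sets (lborel \<Otimes>\<^sub>M lborel)"
    by (simp add: space_pair_measure sets_pair_measure_cong[of lborel borel lborel borel])
  show "AE s in lborel. AE y in lborel. sqrt 2 * fst (s, y) + z - snd (s, y) \<notin> atoms"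
  proof (rule AE_I2)
    fix s :: real assume "s \<in> space lborel"
    have "countable ((\<lambda>x. sqrt 2 * s + z - x) ` atoms)" using countable_atoms by simp
    then have "AE y in lborel. y \<notin> (\<lambda>x. sqrt 2 * s + z - x) ` atoms"
      by (intro AE_not_in countable_imp_null_set_lborel)
    then show "AE y in lborel. sqrt 2 * fst (s, y) + z - snd (s, y) \<notin> atoms"
      by eventually_elim (auto simp: image_iff)
  qed
qed

text \<open>Right-hand side of the recursion in the limit. For fixed z the threshold sqrt 2 s + z -
  y meets the countable set \<open>atoms\<close> for almost no (s, y), so \<open>cdf_max\<close>
  converges to this expression at every z, a possible atom included.\<close>

definition w_lim :: "real \<Rightarrow> real" where
  "w_lim z = (\<integral>q. branch_density q * (cdf_lim (sqrt 2 * fst q + z - snd q))\<^sup>2 \<partial>(lborel \<Otimes>\<^sub>M lborel))"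

lemma measurable_cdf_lim [measurable]: "cdf_lim \<in> borel_measurable borel"
  by (rule borel_measurable_mono) (simp add: mono_def cdf_lim_mono)

lemma sq_bounds: "0 \<le> (x::real) \<Longrightarrow> x \<le> 1 \<Longrightarrow> x\<^sup>2 \<le> 1"
  by (simp add: power_le_one)

lemma cdf_max_tendsto_w_lim: "((\<lambda>t. cdf_max t z) \<longlongrightarrow> w_lim z) at_top"
proof (rule tendsto_at_topI_sequentially)
  fix t :: "nat \<Rightarrow> real" assume t: "filterlim t at_top sequentially"
  define f where "f = (\<lambda>n q. branch_density q * (of_bool (fst q \<le> t n) *
       (cdf_max (t n - fst q) (m (t n) - m (t n - fst q) + z - snd q))\<^sup>2))"
  have "(\<lambda>n. \<integral>q. f n q \<partial>(lborel \<Otimes>\<^sub>M lborel)) \<longlonglongrightarrow> w_lim z"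
    unfolding w_lim_def
  proof (rule integral_dominated_convergence[where w=branch_density])
    show "integrable (lborel \<Otimes>\<^sub>M lborel) branch_density" using branch_density_integral by simp
    show "f n \<in> borel_measurable (lborel \<Otimes>\<^sub>M lborel)" for n
      unfolding f_def borel_measurable_lborel_pair
      by (intro borel_measurable_times measurable_branch_density recursion_measurable)
    show "(\<lambda>q. branch_density q * (cdf_lim (sqrt 2 * fst q + z - snd q))\<^sup>2) \<in> borel_measurable (lborel \<Otimes>\<^sub>M lborel)"
      unfolding borel_measurable_lborel_pair by measurable
    show "AE q in lborel \<Otimes>\<^sub>M lborel. norm (f n q) \<le> branch_density q" for n
    proof (intro AE_I2)
      fix q
      have "of_bool (fst q \<le> t n) * (cdf_max (t n - fst q) (m (t n) - m (t n - fst q) + z - snd q))\<^sup>2 \<le> 1"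
        using sq_bounds[OF cdf_max_bounds] by (auto simp: of_bool_def)
      from mult_left_mono[OF this branch_density_nonneg[of q]]
      show "norm (f n q) \<le> branch_density q" by (simp add: f_def abs_mult branch_density_nonneg)
    qed
    show "AE q in lborel \<Otimes>\<^sub>M lborel. (\<lambda>n. f n q) \<longlonglongrightarrow> branch_density q * (cdf_lim (sqrt 2 * fst q + z - snd q))\<^sup>2"
      using AE_not_atom[of z]
    proof eventually_elim
      case (elim q)
      have st: "(\<lambda>n. fst q / t n) \<longlonglongrightarrow> 0" using t by (intro tendsto_divide_0[OF tendsto_const] filterlim_at_top_imp_at_infinity)
      have "(\<lambda>n. (m (t n) - m (t n - fst q) - sqrt 2 * fst q) + (sqrt 2 * fst q + z - snd q)) \<longlonglongrightarrow> 0 + (sqrt 2 * fst q + z - snd q)"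
        using m_diff_limit[OF t st] by (intro tendsto_intros)
      then have x: "(\<lambda>n. m (t n) - m (t n - fst q) + z - snd q) \<longlonglongrightarrow> sqrt 2 * fst q + z - snd q"
        by (simp add: algebra_simps)
      have r: "filterlim (\<lambda>n. t n - fst q) at_top sequentially"
        using filterlim_tendsto_add_at_top[OF tendsto_const[of "- fst q"] t] by (simp add: algebra_simps)
      have ev: "\<forall>\<^sub>F n in sequentially. 1 = (of_bool (fst q \<le> t n) :: real)"
        using filterlim_at_top[THEN iffD1, OF t, rule_format, of "fst q"] by eventually_elim simp
      have ob: "(\<lambda>n. of_bool (fst q \<le> t n)) \<longlonglongrightarrow> (1::real)"
        by (rule Lim_transform_eventually[OF tendsto_const ev])
      have "measure LL {p \<in> space LL. snd p = sqrt 2 * fst q + z - snd q} = 0" using elim by (simp add: atoms_def)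
      from cdf_max_sq_limit[OF r x this]
      have "(\<lambda>n. f n q) \<longlonglongrightarrow> branch_density q * (1 * (cdf_lim (sqrt 2 * fst q + z - snd q))\<^sup>2)"
        unfolding f_def by (intro tendsto_mult tendsto_const ob)
      then show ?case by simp
    qed
  qed
  moreover have "(\<lambda>n. cdf_max (t n) z - (\<integral>q. f n q \<partial>(lborel \<Otimes>\<^sub>M lborel))) \<longlonglongrightarrow> 0"
  proof (rule Lim_null_comparison)
    show "\<forall>\<^sub>F n in sequentially. norm (cdf_max (t n) z - (\<integral>q. f n q \<partial>(lborel \<Otimes>\<^sub>M lborel))) \<le> exp (- t n)"
      using filterlim_at_top[THEN iffD1, OF t, rule_format, of 0]
      by eventually_elim (use cdf_max_recursion in \<open>simp add: f_def\<close>)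
    show "(\<lambda>n. exp (- t n)) \<longlonglongrightarrow> 0"
      by (rule filterlim_compose[OF exp_at_bot]) (use t in \<open>simp add: filterlim_uminus_at_bot\<close>)
  qed
  ultimately have "(\<lambda>n. (cdf_max (t n) z - (\<integral>q. f n q \<partial>(lborel \<Otimes>\<^sub>M lborel))) + (\<integral>q. f n q \<partial>(lborel \<Otimes>\<^sub>M lborel))) \<longlonglongrightarrow> 0 + w_lim z"
    by (intro tendsto_add)
  then show "(\<lambda>n. cdf_max (t n) z) \<longlonglongrightarrow> w_lim z" by simp
qed

lemma cdf_lim_continuous_at:
  assumes "measure LL {p \<in> space LL. snd p = x} = 0"
  shows "isCont cdf_lim x"
proof -
  have snd: "snd \<in> borel_measurable LL" by measurable
  interpret D: prob_space "distr LL borel snd" by (rule LL.prob_space_distr[OF snd])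
  interpret D: real_distribution "distr LL borel snd" by unfold_locales simp_all
  have "cdf (distr LL borel snd) = cdf_lim"
    using snd by (simp add: fun_eq_iff cdf_def cdf_lim_def measure_distr vimage_def Int_def conj_commute)
  moreover have "measure (distr LL borel snd) {x} = 0"
    using assms snd by (simp add: measure_distr vimage_def Int_def conj_commute)
  ultimately show ?thesis using D.isCont_cdf[of x] by simp
qed

text \<open>Continuity comes from averaging over the branching place: for almost every (s, y) the
  threshold is a continuity point of \<open>cdf_lim\<close>.\<close>

lemma isCont_w_lim: "isCont w_lim z"
proof (rule continuous_at_sequentiallyI)
  fix x :: "nat \<Rightarrow> real" assume x: "x \<longlonglongrightarrow> z"
  show "(\<lambda>n. w_lim (x n)) \<longlonglongrightarrow> w_lim z"
    unfolding w_lim_def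
  proof (rule integral_dominated_convergence[where w=branch_density])
    show "integrable (lborel \<Otimes>\<^sub>M lborel) branch_density" using branch_density_integral by simp
    show "(\<lambda>q. branch_density q * (cdf_lim (sqrt 2 * fst q + z' - snd q))\<^sup>2) \<in> borel_measurable (lborel \<Otimes>\<^sub>M lborel)" for z'
      unfolding borel_measurable_lborel_pair by measurable
    then show "(\<lambda>q. branch_density q * (cdf_lim (sqrt 2 * fst q + x n - snd q))\<^sup>2) \<in> borel_measurable (lborel \<Otimes>\<^sub>M lborel)" for n .
    show "AE q in lborel \<Otimes>\<^sub>M lborel. norm (branch_density q * (cdf_lim (sqrt 2 * fst q + x n - snd q))\<^sup>2) \<le> branch_density q" for n
    proof (intro AE_I2)
      fix q
      have "(cdf_lim (sqrt 2 * fst q + x n - snd q))\<^sup>2 \<le> 1" using sq_bounds[OF cdf_lim_bounds] .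
      from mult_left_mono[OF this branch_density_nonneg[of q]]
      show "norm (branch_density q * (cdf_lim (sqrt 2 * fst q + x n - snd q))\<^sup>2) \<le> branch_density q"
        by (simp add: abs_mult branch_density_nonneg)
    qed
    show "AE q in lborel \<Otimes>\<^sub>M lborel. (\<lambda>n. branch_density q * (cdf_lim (sqrt 2 * fst q + x n - snd q))\<^sup>2) \<longlonglongrightarrow>
       branch_density q * (cdf_lim (sqrt 2 * fst q + z - snd q))\<^sup>2"
      using AE_not_atom[of z]
    proof eventually_elim
      case (elim q)
      then have "isCont cdf_lim (sqrt 2 * fst q + z - snd q)" by (intro cdf_lim_continuous_at) (simp add: atoms_def)
      then have "(\<lambda>n. cdf_lim (sqrt 2 * fst q + x n - snd q)) \<longlonglongrightarrow> cdf_lim (sqrt 2 * fst q + z - snd q)"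
        by (rule isCont_tendsto_compose) (intro tendsto_intros x)
      then show ?case by (intro tendsto_intros)
    qed
  qed
qed

lemma cdf_lim_eq_w_lim_aux: "x \<notin> atoms \<Longrightarrow> cdf_lim x = w_lim x"
proof -
  assume x: "x \<notin> atoms"
  have r: "filterlim real at_top sequentially" by (rule filterlim_real_sequentially)
  have "(\<lambda>n. cdf_max (real n) x) \<longlonglongrightarrow> cdf_lim x"
    by (rule cdf_max_limit[OF r tendsto_const]) (use x in \<open>simp add: atoms_def\<close>)
  moreover have "(\<lambda>n. cdf_max (real n) x) \<longlonglongrightarrow> w_lim x"
    by (rule filterlim_compose[OF cdf_max_tendsto_w_lim r])
  ultimately show ?thesis by (rule LIMSEQ_unique)
qed

text \<open>Outside \<open>atoms\<close> the monotone \<open>cdf_lim\<close> equals the continuous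
  \<open>w_lim\<close>; compared at two such points close to z on either side, it has no room for a
  positive jump.\<close>

lemma no_atom: "measure LL {p \<in> space LL. snd p = z} = 0"
proof (rule ccontr)
  let ?\<mu> = "measure LL {p \<in> space LL. snd p = z}"
  assume "?\<mu> \<noteq> 0"
  then have pos: "0 < ?\<mu>" using measure_nonneg[of LL "{p \<in> space LL. snd p = z}"] by linarith
  have "\<exists>d>0. \<forall>x. norm (x - z) < d \<longrightarrow> norm (w_lim x - w_lim z) < ?\<mu> / 2"
  proof -
    have "w_lim \<midarrow>z\<rightarrow> w_lim z" using isCont_w_lim[of z] by (simp add: isCont_def)
    from LIM_D[OF this half_gt_zero[OF pos]] obtain d where
      d: "d > 0" "\<And>x. x \<noteq> z \<Longrightarrow> norm (x - z) < d \<Longrightarrow> norm (w_lim x - w_lim z) < ?\<mu> / 2" by blast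
    then have "norm (w_lim x - w_lim z) < ?\<mu> / 2" if "norm (x - z) < d" for x
      using that pos by (cases "x = z") auto
    with d(1) show ?thesis by blast
  qed
  then obtain d where d: "d > 0" "\<And>x. \<bar>x - z\<bar> < d \<Longrightarrow> \<bar>w_lim x - w_lim z\<bar> < ?\<mu> / 2"
    unfolding real_norm_def by auto
  obtain u where u: "u \<in> {z - d<..<z}" "u \<notin> atoms"
    using open_minus_countable[OF countable_atoms, of "{z - d<..<z}"] d(1) by auto
  obtain v where v: "v \<in> {z<..<z + d}" "v \<notin> atoms"
    using open_minus_countable[OF countable_atoms, of "{z<..<z + d}"] d(1) by auto
  have m: "{p \<in> space LL. snd p \<le> x} \<in> sets LL" "{p \<in> space LL. snd p = x} \<in> sets LL" for x by measurable
  have "?\<mu> + cdf_lim u = measure LL ({p \<in> space LL. snd p = z} \<union> {p \<in> space LL. snd p \<le> u})"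
    unfolding cdf_lim_def using u m by (intro LL.finite_measure_Union[symmetric]) auto
  also have "\<dots> \<le> cdf_lim v"
    unfolding cdf_lim_def using u v m by (intro LL.finite_measure_mono) auto
  finally have "?\<mu> \<le> w_lim v - w_lim u" using u v by (simp add: cdf_lim_eq_w_lim_aux)
  moreover have "\<bar>w_lim v - w_lim z\<bar> < ?\<mu> / 2" by (rule d(2)) (use v in auto)
  moreover have "\<bar>w_lim u - w_lim z\<bar> < ?\<mu> / 2" by (rule d(2)) (use u in auto)
  ultimately show False by linarith
qed

lemma cdf_lim_eq_w_lim: "cdf_lim = w_lim"
  using cdf_lim_eq_w_lim_aux no_atom by (auto simp: atoms_def)

lemma cdf_max_tendsto: "((\<lambda>t. cdf_max t z) \<longlongrightarrow> cdf_lim z) at_top"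
  using cdf_max_tendsto_w_lim by (simp add: cdf_lim_eq_w_lim)

lemma cdf_lim_at_bot: "(cdf_lim \<longlongrightarrow> 0) at_bot" and cdf_lim_at_top: "(cdf_lim \<longlongrightarrow> 1) at_top"
proof -
  have snd: "snd \<in> borel_measurable LL" by measurable
  interpret D: prob_space "distr LL borel snd" by (rule LL.prob_space_distr[OF snd])
  interpret D: real_distribution "distr LL borel snd" by unfold_locales simp_all
  have "cdf (distr LL borel snd) = cdf_lim"
    using snd by (simp add: fun_eq_iff cdf_def cdf_lim_def measure_distr vimage_def Int_def conj_commute)
  then show "(cdf_lim \<longlongrightarrow> 0) at_bot" "(cdf_lim \<longlongrightarrow> 1) at_top"
    using D.cdf_lim_at_bot D.cdf_lim_at_top_prob by simp_all
qed

text \<open>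
  Bootstrapping: in the recursion the probability enters squared, and it is at most a small
  \<open>\<epsilon>\<close> far to the left by tightness, so iterating gains a factor \<open>\<epsilon>\<close> each time while
  the exponential \<open>e\<^bsup>-y/2\<^esup>\<close> is only multiplied by \<^const>\<open>kappa\<close>.
\<close>

lemma a_priori_bound:
  "\<exists>A\<ge>0. \<forall>t\<ge>0. \<forall>y. cdf_max t (- y) \<le> A * (exp (- y / 2) + exp (- t / 2))"
proof -
  \<comment> \<open>The bound \<open>1 / (2 * kappa)\<close> makes \<epsilon> A kappa at most half
    of A in the e^(-y/2) term; 1/4 does the same for 2 \<epsilon> A in the e^(-t/2) term, the factor
    2 being the constant of \<open>branch_density_half_integral\<close>.\<close>
  define \<epsilon> where "\<epsilon> = min (1/4) (1 / (2 * kappa))"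
  have \<epsilon>: "0 < \<epsilon>" "\<epsilon> \<le> 1/4" "\<epsilon> * kappa \<le> 1/2"
  proof -
    show "0 < \<epsilon>" "\<epsilon> \<le> 1/4" using kappa_pos by (auto simp: \<epsilon>_def)
    have "\<epsilon> * kappa \<le> (1 / (2 * kappa)) * kappa" using kappa_pos by (intro mult_right_mono) (auto simp: \<epsilon>_def)
    then show "\<epsilon> * kappa \<le> 1/2" using kappa_pos by simp
  qed
  have "\<forall>\<^sub>F z in at_bot. cdf_lim z < \<epsilon>" using cdf_lim_at_bot \<epsilon>(1) by (rule order_tendstoD)
  then obtain z0 where z0: "cdf_lim z0 < \<epsilon>" by (auto simp: eventually_at_bot_linorder)
  have "\<forall>\<^sub>F t in at_top. cdf_max t z0 < \<epsilon>" using cdf_max_tendsto z0 by (rule order_tendstoD)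
  then obtain R where R: "\<And>t. t \<ge> R \<Longrightarrow> cdf_max t z0 < \<epsilon>" by (auto simp: eventually_at_top_linorder)
  define y0 where "y0 = - z0"
  \<comment> \<open>Convergence at the single point z0 suffices, since monotonicity covers
    everything to its left.\<close>
  have small: "cdf_max r (- Y) \<le> \<epsilon>" if "r \<ge> R" "Y \<ge> y0" for r Y
    using cdf_max_mono[of "- Y" z0 r] R[OF that(1)] that(2) by (simp add: y0_def)
  \<comment> \<open>Twice the constants that arise without the induction hypothesis; together with
    the halves gained from \<epsilon>, the constant A reproduces itself.\<close>
  define A where "A = max (2 * (1 + exp R)) (2 * (exp (y0 / 2) * kappa))"
  have A0: "0 \<le> A" using kappa_pos by (auto simp: A_def max_def)
  \<comment> \<open>The remainder \<epsilon> ^ n starts from the trivial bound 1 and disappears in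
    the limit, while A stays the same for all n.\<close>
  have step: "\<forall>t\<ge>0. \<forall>y. cdf_max t (- y) \<le> A * (exp (- y / 2) + exp (- t / 2)) + \<epsilon> ^ n" for n
  proof (induction n)
    case 0
    show ?case
    proof (intro allI impI)
      fix t y :: real
      have "0 \<le> A * (exp (- y / 2) + exp (- t / 2))" using A0 by (intro mult_nonneg_nonneg) auto
      then show "cdf_max t (- y) \<le> A * (exp (- y / 2) + exp (- t / 2)) + \<epsilon> ^ 0" using cdf_max_bounds(2)[of t "- y"] by simp
    qed
  next
    case (Suc n)
    show ?case
    proof (intro allI impI)
      fix t a :: real assume t: "0 \<le> t"
      define E where "E = (\<lambda>q :: real \<times> real. exp (sqrt 2 / 2 * fst q - snd q / 2))"
      \<comment> \<open>One term for each way to bound the square: for remaining times below R and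
        for levels up to y0 it is at most 1, and elsewhere it is at most \<epsilon> times the
        induction hypothesis, whose parts give the other contributions.\<close>
      define U where "U = (\<lambda>q. branch_density q * (of_bool (fst q \<le> t) * exp (- (t - fst q))) * exp R +
          (branch_density q * E q) * ((exp (y0 / 2) + \<epsilon> * A) * exp (- a / 2)) +
          (branch_density q * exp (- (t - fst q) / 2)) * (\<epsilon> * A) + branch_density q * \<epsilon> ^ Suc n)"
      note I1 = branch_density_early_integral[OF t] and I2 = branch_density_drift_integral
        and I3 = branch_density_half_integral[of t] and I4 = branch_density_integral
      have Ui: "integrable (lborel \<Otimes>\<^sub>M lborel) U"
        unfolding U_def E_def using I1 I2 I3 I4 by (intro Bochner_Integration.integrable_add integrable_mult_left) auto
      have UI: "(\<integral>q. U q \<partial>(lborel \<Otimes>\<^sub>M lborel)) = t * exp (- t) * exp R + kappa * ((exp (y0 / 2) + \<epsilon> * A) * exp (- a / 2)) +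
          2 * exp (- t / 2) * (\<epsilon> * A) + \<epsilon> ^ Suc n"
        unfolding U_def E_def using I1 I2 I3 I4 by simp
      let ?f = "\<lambda>q. branch_density q * (of_bool (fst q \<le> t) * (cdf_max (t - fst q) (m t - m (t - fst q) + - a - snd q))\<^sup>2)"
      have fm: "?f \<in> borel_measurable (lborel \<Otimes>\<^sub>M lborel)"
        unfolding borel_measurable_lborel_pair by (intro borel_measurable_times measurable_branch_density recursion_measurable)
      have ae: "AE q in (lborel \<Otimes>\<^sub>M lborel :: (real \<times> real) measure). fst q \<noteq> 0 \<and> fst q \<noteq> t"
      proof (rule lborel_pair.AE_pair_measure)
        have "{q \<in> space (borel \<Otimes>\<^sub>M (borel :: real measure)). fst q \<noteq> 0 \<and> fst q \<noteq> t} \<in> sets (borel \<Otimes>\<^sub>M (borel :: real measure))" by measurable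
        then show "{q \<in> space (lborel \<Otimes>\<^sub>M (lborel :: real measure)). fst q \<noteq> 0 \<and> fst q \<noteq> t} \<in> sets (lborel \<Otimes>\<^sub>M (lborel :: real measure))"
          by (simp add: space_pair_measure sets_pair_measure_cong[of lborel borel lborel borel])
        have "AE s in lborel. s \<noteq> 0 \<and> s \<noteq> t" using AE_lborel_singleton[of 0] AE_lborel_singleton[of t] by eventually_elim simp
        then show "AE s in lborel. AE y in (lborel :: real measure). fst (s, y) \<noteq> 0 \<and> fst (s, y) \<noteq> t" by eventually_elim simp
      qed
      have le: "AE q in lborel \<Otimes>\<^sub>M lborel. \<bar>?f q\<bar> \<le> U q"
        using ae
      proof eventually_elim
        case (elim q)
        define s y where "s = fst q" and "y = snd q"
        \<comment> \<open>The level seen by the children when m t - m (t - s) is replaced by its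
          upper bound sqrt 2 s.\<close>
        define Y where "Y = a + y - sqrt 2 * s"
        have q: "q = (s, y)" by (simp add: s_def y_def)
        have bd0: "0 \<le> branch_density q" by (rule branch_density_nonneg)
        have EY: "E q * exp (- a / 2) = exp (- Y / 2)"
          unfolding E_def Y_def q by (simp add: exp_add[symmetric] field_simps)
        define V where "V = of_bool (s \<le> t) * exp (- (t - s)) * exp R + E q * ((exp (y0 / 2) + \<epsilon> * A) * exp (- a / 2)) +
            exp (- (t - s) / 2) * (\<epsilon> * A) + \<epsilon> ^ Suc n"
        have V0: "0 \<le> V" unfolding V_def E_def using A0 \<epsilon>(1)
          by (intro add_nonneg_nonneg mult_nonneg_nonneg) auto
        have UV: "U q = branch_density q * V" unfolding U_def V_def s_def by (simp add: algebra_simps)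
        show ?case
        proof (cases "0 < s \<and> s < t")
          case False
          have "?f q = 0"
          proof (cases "s < 0")
            case True
            then show ?thesis by (simp add: branch_density_def exponential_density_def s_def)
          next
            case neg: False
            then have "\<not> s \<le> t" using elim False by (auto simp: s_def)
            then show ?thesis by (simp add: s_def)
          qed
          then show ?thesis unfolding UV using mult_nonneg_nonneg[OF bd0 V0] by (simp only: abs_zero)
        next
          case True
          define c where "c = cdf_max (t - s) (m t - m (t - s) + - a - y)"
          have c: "0 \<le> c" "c \<le> 1" unfolding c_def by (rule cdf_max_bounds)+
          have cY: "c \<le> cdf_max (t - s) (- Y)" unfolding c_def
            by (rule cdf_max_mono) (use m_diff_le[of s t] True in \<open>simp add: Y_def\<close>)
          have "c\<^sup>2 \<le> V"
          proof (cases "t - s < R")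
            case True': True
            have "1 \<le> exp (- (t - s)) * exp R" unfolding exp_add[symmetric] using True' by simp
            moreover have "0 \<le> E q * ((exp (y0 / 2) + \<epsilon> * A) * exp (- a / 2)) + exp (- (t - s) / 2) * (\<epsilon> * A) + \<epsilon> ^ Suc n"
              unfolding E_def using A0 \<epsilon>(1) by (intro add_nonneg_nonneg mult_nonneg_nonneg) auto
            ultimately show ?thesis unfolding V_def using sq_bounds[OF c] True by simp
          next
            case nR: False
            have Vsplit: "V = exp (- (t - s)) * exp R + exp (y0 / 2) * exp (- Y / 2) + \<epsilon> * (A * (exp (- Y / 2) + exp (- (t - s) / 2)) + \<epsilon> ^ n)"
              unfolding V_def EY[symmetric] using True by (simp add: algebra_simps)
            have p1: "0 \<le> exp (- (t - s)) * exp R" by simp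
            have p2: "0 \<le> \<epsilon> * (A * (exp (- Y / 2) + exp (- (t - s) / 2)) + \<epsilon> ^ n)"
              using A0 \<epsilon>(1) by (intro mult_nonneg_nonneg add_nonneg_nonneg) auto
            show ?thesis
            proof (cases "Y \<le> y0")
              case True
              then have "1 \<le> exp (y0 / 2) * exp (- Y / 2)" unfolding exp_add[symmetric] by simp
              then show ?thesis unfolding Vsplit using p1 p2 sq_bounds[OF c] by linarith
            next
              case False
              have ce: "c \<le> \<epsilon>" using cY small[of "t - s" Y] nR False by simp
              have IH: "c \<le> A * (exp (- Y / 2) + exp (- (t - s) / 2)) + \<epsilon> ^ n"
                using Suc.IH[rule_format, of "t - s" Y] cY True by simp
              have "c\<^sup>2 = c * c" by (simp add: power2_eq_square)
              also have "\<dots> \<le> \<epsilon> * (A * (exp (- Y / 2) + exp (- (t - s) / 2)) + \<epsilon> ^ n)"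
                using ce IH c \<epsilon>(1) by (intro mult_mono) auto
              finally show ?thesis unfolding Vsplit by (rule order_trans) simp
            qed
          qed
          then have "branch_density q * c\<^sup>2 \<le> branch_density q * V" using bd0 by (rule mult_left_mono)
          then show ?thesis unfolding UV using True bd0 by (simp add: abs_mult c_def s_def y_def)
        qed
      qed
      have fi: "integrable (lborel \<Otimes>\<^sub>M lborel) ?f"
        by (rule Bochner_Integration.integrable_bound[OF Ui fm]) (use le in \<open>auto elim!: eventually_mono\<close>)
      have "(\<integral>q. ?f q \<partial>(lborel \<Otimes>\<^sub>M lborel)) \<le> (\<integral>q. U q \<partial>(lborel \<Otimes>\<^sub>M lborel))"
        by (rule integral_mono_AE[OF fi Ui]) (use le in \<open>auto elim!: eventually_mono\<close>)
      then have 1: "cdf_max t (- a) \<le> exp (- t) + (t * exp (- t) * exp R + kappa * ((exp (y0 / 2) + \<epsilon> * A) * exp (- a / 2)) +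
          2 * exp (- t / 2) * (\<epsilon> * A) + \<epsilon> ^ Suc n)"
        using cdf_max_recursion[OF t, of "- a"] unfolding UI by simp
      \<comment> \<open>Absorbs the linear factor of \<open>branch_density_early_integral\<close> at
        the price of half the rate.\<close>
      have tt: "t \<le> exp (t / 2)"
      proof -
        have "1 + t / 4 \<le> exp (t / 4)" by (rule exp_ge_add_one_self)
        then have "(1 + t / 4)\<^sup>2 \<le> (exp (t / 4))\<^sup>2" using t by (intro power_mono) auto
        also have "(exp (t / 4))\<^sup>2 = exp (t / 2)" by (simp add: power2_eq_square exp_add[symmetric])
        finally have "(1 + t / 4)\<^sup>2 \<le> exp (t / 2)" .
        moreover have "t \<le> (1 + t / 4)\<^sup>2"
          using zero_le_power2[of "1 - t / 4"] by (simp add: power2_eq_square algebra_simps)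
        ultimately show ?thesis by linarith
      qed
      have "t * exp (- t) \<le> exp (t / 2) * exp (- t)" using tt by (intro mult_right_mono) auto
      also have "\<dots> = exp (- t / 2)" by (simp add: exp_add[symmetric])
      finally have 2: "t * exp (- t) * exp R \<le> exp (- t / 2) * exp R" by (intro mult_right_mono) auto
      have 3: "exp (- t) \<le> exp (- t / 2)" using t by simp
      have 4: "kappa * (exp (y0 / 2) + \<epsilon> * A) \<le> A"
      proof -
        have "\<epsilon> * kappa * A \<le> 1/2 * A" using \<epsilon>(3) A0 by (rule mult_right_mono)
        moreover have "2 * (exp (y0 / 2) * kappa) \<le> A" by (simp add: A_def)
        ultimately show ?thesis by (simp add: algebra_simps)
      qed
      have 5: "1 + exp R + 2 * (\<epsilon> * A) \<le> A"
      proof -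
        have "\<epsilon> * A \<le> 1/4 * A" using \<epsilon>(2) A0 by (rule mult_right_mono)
        moreover have "2 * (1 + exp R) \<le> A" by (simp add: A_def)
        ultimately show ?thesis by simp
      qed
      have "cdf_max t (- a) \<le> (1 + exp R + 2 * (\<epsilon> * A)) * exp (- t / 2) + (kappa * (exp (y0 / 2) + \<epsilon> * A)) * exp (- a / 2) + \<epsilon> ^ Suc n"
      proof -
        have "(1 + exp R + 2 * (\<epsilon> * A)) * exp (- t / 2) + (kappa * (exp (y0 / 2) + \<epsilon> * A)) * exp (- a / 2) + \<epsilon> ^ Suc n =
          exp (- t / 2) + (exp (- t / 2) * exp R + kappa * ((exp (y0 / 2) + \<epsilon> * A) * exp (- a / 2)) +
          2 * exp (- t / 2) * (\<epsilon> * A) + \<epsilon> ^ Suc n)"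
          by (simp add: algebra_simps)
        with 1 2 3 show ?thesis by linarith
      qed
      also have "\<dots> \<le> A * exp (- t / 2) + A * exp (- a / 2) + \<epsilon> ^ Suc n"
        using 4 5 by (intro add_mono mult_right_mono) auto
      finally show "cdf_max t (- a) \<le> A * (exp (- a / 2) + exp (- t / 2)) + \<epsilon> ^ Suc n" by (simp add: algebra_simps)
    qed
  qed
  show ?thesis
  proof (intro exI[of _ A] conjI A0 allI impI)
    fix t y :: real assume t: "0 \<le> t"
    have "(\<lambda>n. A * (exp (- y / 2) + exp (- t / 2)) + \<epsilon> ^ n) \<longlonglongrightarrow> A * (exp (- y / 2) + exp (- t / 2)) + 0"
      using \<epsilon> by (intro tendsto_intros LIMSEQ_power_zero) auto
    then show "cdf_max t (- y) \<le> A * (exp (- y / 2) + exp (- t / 2))"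
      using step t by (intro LIMSEQ_le_const) auto
  qed
qed

end

section \<open>The joint limit\<close>

text \<open>A local limit theorem. With s = a / 2 + \<sigma> sqrt (a / 8) the exponent (a + z - 2
  s)^2 / (2 s) tends to \<sigma>^2 / 2, which explains the scale a / 8, and sqrt (a / 8) / sqrt (2
  \<pi> s) tends to 1 / (2 sqrt (2 \<pi>)). The factor 1/2 is the total mass of the kernel.\<close>

lemma passage_density_limit:
  "((\<lambda>a. sqrt (a / 8) * passage_density (a + z) (a / 2 + sqrt (a / 8) * \<sigma>)) \<longlongrightarrow> std_normal_density \<sigma> / 2) at_top"
proof -
  have 1: "((\<lambda>a::real. (a / 8) / (2 * pi * (a / 2 + sqrt (a / 8) * \<sigma>))) \<longlongrightarrow> 1 / (8 * pi)) at_top"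
    by real_asymp (simp add: field_simps)
  have 2: "((\<lambda>a::real. (a + z - 2 * (a / 2 + sqrt (a / 8) * \<sigma>))\<^sup>2 / (2 * (a / 2 + sqrt (a / 8) * \<sigma>))) \<longlongrightarrow> \<sigma>\<^sup>2 / 2) at_top"
  proof -
    have l: "((\<lambda>v::real. k / v) \<longlongrightarrow> 0) at_top" for k :: real
      by (intro tendsto_divide_0[OF tendsto_const] filterlim_at_top_imp_at_infinity filterlim_ident)
    \<comment> \<open>The same quotient in the variable v = sqrt (a / 8), with numerator and
      denominator divided by v^2.\<close>
    have "((\<lambda>v. (z / v - 2 * \<sigma>)\<^sup>2 / (8 + 2 * \<sigma> / v)) \<longlongrightarrow> (0 - 2 * \<sigma>)\<^sup>2 / (8 + 0)) at_top"
      by (intro tendsto_divide tendsto_power tendsto_diff tendsto_add tendsto_const l) simp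
    moreover have "filterlim (\<lambda>a::real. sqrt (a / 8)) at_top at_top" by real_asymp
    ultimately have "((\<lambda>a. (z / sqrt (a / 8) - 2 * \<sigma>)\<^sup>2 / (8 + 2 * \<sigma> / sqrt (a / 8))) \<longlongrightarrow> (0 - 2 * \<sigma>)\<^sup>2 / (8 + 0)) at_top"
      by (rule filterlim_compose)
    moreover have "\<forall>\<^sub>F a in at_top. (z / sqrt (a / 8) - 2 * \<sigma>)\<^sup>2 / (8 + 2 * \<sigma> / sqrt (a / 8)) =
        (a + z - 2 * (a / 2 + sqrt (a / 8) * \<sigma>))\<^sup>2 / (2 * (a / 2 + sqrt (a / 8) * \<sigma>))"
      using eventually_gt_at_top[of 0]
    proof eventually_elim
      case (elim a)
      define v where "v = sqrt (a / 8)"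
      have v: "0 < v" "a = 8 * v\<^sup>2" using elim by (auto simp: v_def)
      have "(z / v - 2 * \<sigma>)\<^sup>2 / (8 + 2 * \<sigma> / v) = (v * (z / v - 2 * \<sigma>))\<^sup>2 / (v\<^sup>2 * (8 + 2 * \<sigma> / v))"
        using v(1) by (simp add: power_mult_distrib)
      also have "v * (z / v - 2 * \<sigma>) = z - 2 * v * \<sigma>" using v(1) by (simp add: right_diff_distrib)
      also have "v\<^sup>2 * (8 + 2 * \<sigma> / v) = 8 * v\<^sup>2 + 2 * v * \<sigma>" using v(1) by (simp add: distrib_left power2_eq_square)
      finally show ?case unfolding v_def[symmetric] by (simp add: v(2) mult.assoc)
    qed
    ultimately have "((\<lambda>a::real. (a + z - 2 * (a / 2 + sqrt (a / 8) * \<sigma>))\<^sup>2 / (2 * (a / 2 + sqrt (a / 8) * \<sigma>))) \<longlongrightarrow> (0 - 2 * \<sigma>)\<^sup>2 / (8 + 0)) at_top"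
      by (rule Lim_transform_eventually)
    then show ?thesis by (simp add: power_mult_distrib)
  qed
  have "((\<lambda>a. sqrt ((a / 8) / (2 * pi * (a / 2 + sqrt (a / 8) * \<sigma>))) *
      exp (- ((a + z - 2 * (a / 2 + sqrt (a / 8) * \<sigma>))\<^sup>2 / (2 * (a / 2 + sqrt (a / 8) * \<sigma>))))) \<longlongrightarrow> sqrt (1 / (8 * pi)) * exp (- (\<sigma>\<^sup>2 / 2))) at_top"
    by (intro tendsto_intros 1 2)
  also have "sqrt (1 / (8 * pi)) * exp (- (\<sigma>\<^sup>2 / 2)) = std_normal_density \<sigma> / 2"
  proof -
    have "sqrt (8 * pi) = 2 * sqrt (2 * pi)" using real_sqrt_mult[of 4 "2 * pi"] by simp
    then show ?thesis by (simp add: std_normal_density_def real_sqrt_divide)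
  qed
  finally have L: "((\<lambda>a. sqrt ((a / 8) / (2 * pi * (a / 2 + sqrt (a / 8) * \<sigma>))) *
      exp (- ((a + z - 2 * (a / 2 + sqrt (a / 8) * \<sigma>))\<^sup>2 / (2 * (a / 2 + sqrt (a / 8) * \<sigma>))))) \<longlongrightarrow> std_normal_density \<sigma> / 2) at_top" .
  have e: "sqrt (k / (2 * pi * s)) * exp (- ((b - 2 * s)\<^sup>2 / (2 * s))) = sqrt k * passage_density b s" for k b s
    unfolding passage_density_def real_sqrt_divide[of k "2 * pi * s"] by simp
  show ?thesis using L unfolding e .
qed

section \<open>Integrable envelopes and their masses\<close>

definition tilt :: "real \<Rightarrow> real" where
  "tilt z = exp (- sqrt 2 * \<gamma> * z)"

text \<open>Up to a constant, min 1 (exp z) majorises the square of the limiting distribution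
  function. As 0 < \<open>sqrt 2 * \<gamma>\<close> < 1, its product with the tilt decays
  exponentially at both ends.\<close>

definition tilt_bound :: "real \<Rightarrow> real" where
  "tilt_bound z = tilt z * min 1 (exp z)"

lemma tilt_pos: "0 < tilt z" by (simp add: tilt_def)

lemma measurable_tilt [measurable]: "tilt \<in> borel_measurable borel"
  unfolding tilt_def by measurable

lemma beta_bounds: "0 < sqrt 2 * \<gamma>" "sqrt 2 * \<gamma> < 1"
  unfolding sqrt2_gamma using sqrt2_less_2 by (auto simp: real_less_rsqrt)

lemma integrable_exp_decay:
  assumes b: "0 < b"
  shows "integrable lborel (\<lambda>z. exponential_density b z)"
proof -
  have "has_bochner_integral lborel (exponential_density b) 1"
    using b by (intro has_bochner_integral_nn_integral) (auto simp: exponential_density_nonneg nn_integral_exponential)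
  then show ?thesis by (simp add: has_bochner_integral_iff)
qed

lemma integrable_tilt_bound: "integrable lborel tilt_bound"
proof -
  define b where "b = sqrt 2 * \<gamma>"
  have b: "0 < b" "b < 1" using beta_bounds by (auto simp: b_def)
  have "integrable lborel (\<lambda>z. exponential_density (1 - b) (0 + (- 1) * z))"
    using b by (subst lborel_integrable_real_affine_iff) (auto intro: integrable_exp_decay)
  then have "integrable lborel (\<lambda>z. (1 / b) * exponential_density b z + (1 / (1 - b)) * exponential_density (1 - b) (- z))"
    using integrable_exp_decay[OF b(1)] by (intro Bochner_Integration.integrable_add integrable_mult_right) auto
  then show ?thesis
  proof (rule Bochner_Integration.integrable_bound)
    show "tilt_bound \<in> borel_measurable lborel" unfolding tilt_bound_def by simp
    show "AE z in lborel. norm (tilt_bound z) \<le> norm ((1 / b) * exponential_density b z + (1 / (1 - b)) * exponential_density (1 - b) (- z))"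
    proof (intro AE_I2)
      fix z :: real
      have t: "tilt z = exp (- z * b)" by (simp add: tilt_def b_def mult.commute mult.left_commute)
      have n: "0 \<le> (1 / b) * exponential_density b z" "0 \<le> (1 / (1 - b)) * exponential_density (1 - b) (- z)"
        using b by (auto intro!: mult_nonneg_nonneg exponential_density_nonneg)
      have "tilt_bound z \<le> (1 / b) * exponential_density b z + (1 / (1 - b)) * exponential_density (1 - b) (- z)"
      proof (cases "0 \<le> z")
        case True
        have "tilt_bound z \<le> tilt z * 1" unfolding tilt_bound_def using tilt_pos by (intro mult_left_mono) (auto intro: less_imp_le)
        also have "\<dots> = (1 / b) * exponential_density b z" using True b by (simp add: t exponential_density_def)
        finally show ?thesis using n by linarith
      next
        case False
        have "tilt_bound z \<le> tilt z * exp z" unfolding tilt_bound_def using tilt_pos by (intro mult_left_mono) (auto intro: less_imp_le)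
        also have "\<dots> = exp (z * (1 - b))" unfolding t exp_add[symmetric] by (simp add: algebra_simps)
        also have "\<dots> = (1 / (1 - b)) * exponential_density (1 - b) (- z)" using False b by (simp add: exponential_density_def)
        finally show ?thesis using n by linarith
      qed
      moreover have "0 \<le> tilt_bound z" unfolding tilt_bound_def using tilt_pos[of z] by simp
      ultimately show "norm (tilt_bound z) \<le> norm ((1 / b) * exponential_density b z + (1 / (1 - b)) * exponential_density (1 - b) (- z))"
        using n by simp
    qed
  qed
qed

lemma tilt_bound_nonneg: "0 \<le> tilt_bound z"
  unfolding tilt_bound_def using tilt_pos[of z] by simp

definition passage_weight :: "real \<Rightarrow> real" where
  "passage_weight a = exp (sqrt 2 * \<gamma> * a)"

text \<open>The mass of the main part of the majorant is computed exactly, not merely bounded,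
  because generalised dominated convergence asks for convergence of the masses.\<close>

lemma spatial_integral:
  fixes a :: real
  defines "F \<equiv> \<lambda>q. passage_weight a * (branch_density q * min 1 (exp (sqrt 2 * fst q - a - snd q)))"
  shows "integrable (lborel \<Otimes>\<^sub>M lborel) F"
    and "(\<integral>q. F q \<partial>(lborel \<Otimes>\<^sub>M lborel)) = (\<integral>z. tilt_bound z * enn2real (passage_mass (a + z)) \<partial>lborel)"
proof -
  have F0: "0 \<le> F q" for q unfolding F_def passage_weight_def using branch_density_nonneg[of q] by simp
  have Fm: "F \<in> borel_measurable (lborel \<Otimes>\<^sub>M lborel)" unfolding F_def borel_measurable_lborel_pair by measurable
  have am: "AE z in lborel. a + z \<noteq> 0" using AE_lborel_singleton[of "- a"] by eventually_elim auto
  have pm: "enn2real (passage_mass (a + z)) \<le> 1/2 \<and> ennreal (enn2real (passage_mass (a + z))) = passage_mass (a + z)"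
    if "a + z \<noteq> 0" for z
  proof -
    have le: "passage_mass (a + z) \<le> ennreal (1/2)" by (rule passage_mass_le[OF that])
    then have "passage_mass (a + z) \<noteq> \<top>" by (metis ennreal_neq_top top.extremum_uniqueI)
    then have "passage_mass (a + z) < \<top>" by (simp add: top.not_eq_extremum)
    moreover have "enn2real (passage_mass (a + z)) \<le> 1/2" using le by (intro enn2real_leI) auto
    ultimately show ?thesis by simp
  qed
  have i: "integrable lborel (\<lambda>z. tilt_bound z * enn2real (passage_mass (a + z)))"
  proof (rule Bochner_Integration.integrable_bound[OF integrable_tilt_bound])
    show "(\<lambda>z. tilt_bound z * enn2real (passage_mass (a + z))) \<in> borel_measurable lborel"
      unfolding tilt_bound_def by measurable
    show "AE z in lborel. norm (tilt_bound z * enn2real (passage_mass (a + z))) \<le> norm (tilt_bound z)"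
      using am
    proof eventually_elim
      case (elim z)
      have "tilt_bound z * enn2real (passage_mass (a + z)) \<le> tilt_bound z * 1"
        using pm[OF elim] tilt_bound_nonneg[of z] by (intro mult_left_mono) auto
      then show ?case using tilt_bound_nonneg[of z] by (simp add: abs_mult)
    qed
  qed
  have "(\<integral>\<^sup>+q. ennreal (F q) \<partial>(lborel \<Otimes>\<^sub>M lborel)) = (\<integral>\<^sup>+q. ennreal (branch_density q * (passage_weight a * min 1 (exp (sqrt 2 * fst q - a - snd q)))) \<partial>(lborel \<Otimes>\<^sub>M lborel))"
    unfolding F_def by (simp add: ac_simps)
  also have "\<dots> = (\<integral>\<^sup>+z. ennreal (exp (- sqrt 2 * \<gamma> * (a + z)) * (passage_weight a * min 1 (exp z))) * passage_mass (a + z) \<partial>lborel)"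
    using branch_density_spatial[of "\<lambda>z. passage_weight a * min 1 (exp z)" a] by (simp add: passage_weight_def)
  also have "\<dots> = (\<integral>\<^sup>+z. ennreal (tilt_bound z * enn2real (passage_mass (a + z))) \<partial>lborel)"
  proof (rule nn_integral_cong_AE)
    show "AE z in lborel. ennreal (exp (- sqrt 2 * \<gamma> * (a + z)) * (passage_weight a * min 1 (exp z))) * passage_mass (a + z) =
        ennreal (tilt_bound z * enn2real (passage_mass (a + z)))"
      using am
    proof eventually_elim
      case (elim z)
      have "exp (- sqrt 2 * \<gamma> * (a + z)) * (passage_weight a * min 1 (exp z)) = tilt_bound z"
        unfolding tilt_bound_def tilt_def passage_weight_def mult.assoc[symmetric] exp_add[symmetric] by (simp add: algebra_simps)
      then show ?case using pm[OF elim] tilt_bound_nonneg[of z] by (simp add: ennreal_mult)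
    qed
  qed
  also have "\<dots> = ennreal (\<integral>z. tilt_bound z * enn2real (passage_mass (a + z)) \<partial>lborel)"
    using tilt_bound_nonneg by (intro nn_integral_eq_integral i) auto
  finally have nn: "(\<integral>\<^sup>+q. ennreal (F q) \<partial>(lborel \<Otimes>\<^sub>M lborel)) = ennreal (\<integral>z. tilt_bound z * enn2real (passage_mass (a + z)) \<partial>lborel)" .
  have "0 \<le> (\<integral>z. tilt_bound z * enn2real (passage_mass (a + z)) \<partial>lborel)"
    using tilt_bound_nonneg by (intro integral_nonneg_AE) auto
  from has_bochner_integral_nonnegI[OF Fm F0 nn this]
  show "integrable (lborel \<Otimes>\<^sub>M lborel) F"
    and "(\<integral>q. F q \<partial>(lborel \<Otimes>\<^sub>M lborel)) = (\<integral>z. tilt_bound z * enn2real (passage_mass (a + z)) \<partial>lborel)" by auto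
qed

text \<open>For fixed z eventually a + z > 0, where the Green function is exactly 1/2.\<close>

lemma spatial_integral_limit:
  assumes a: "filterlim a at_top sequentially"
  shows "(\<lambda>n. \<integral>z. tilt_bound z * enn2real (passage_mass (a n + z)) \<partial>lborel) \<longlonglongrightarrow> (\<integral>z. tilt_bound z / 2 \<partial>lborel)"
proof (rule integral_dominated_convergence[where w="tilt_bound"])
  show "(\<lambda>z. tilt_bound z * enn2real (passage_mass (a n + z))) \<in> borel_measurable lborel" for n
    unfolding tilt_bound_def by measurable
  show "AE z in lborel. norm (tilt_bound z * enn2real (passage_mass (a n + z))) \<le> tilt_bound z" for n
    using AE_lborel_singleton[of "- a n"]
  proof eventually_elim
    case (elim z)
    then have "passage_mass (a n + z) \<le> ennreal (1/2)" by (intro passage_mass_le) auto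
    then have "enn2real (passage_mass (a n + z)) \<le> 1/2" by (intro enn2real_leI) auto
    then have "tilt_bound z * enn2real (passage_mass (a n + z)) \<le> tilt_bound z * 1"
      using tilt_bound_nonneg[of z] by (intro mult_left_mono) auto
    then show ?case using tilt_bound_nonneg[of z] by (simp add: abs_mult)
  qed
  show "AE z in lborel. (\<lambda>n. tilt_bound z * enn2real (passage_mass (a n + z))) \<longlonglongrightarrow> tilt_bound z / 2"
  proof (intro AE_I2)
    fix z :: real
    have "\<forall>\<^sub>F n in sequentially. - z < a n" using a by (simp add: filterlim_at_top_dense)
    then have "\<forall>\<^sub>F n in sequentially. tilt_bound z / 2 = tilt_bound z * enn2real (passage_mass (a n + z))"
    proof eventually_elim
      case (elim n)
      then have "passage_mass (a n + z) = ennreal (1/2)" by (intro passage_mass_pos) simp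
      then have "enn2real (passage_mass (a n + z)) = 1/2" by (simp only: enn2real_ennreal)
      then show ?case by simp
    qed
    then show "(\<lambda>n. tilt_bound z * enn2real (passage_mass (a n + z))) \<longlonglongrightarrow> tilt_bound z / 2"
      by (rule Lim_transform_eventually[OF tendsto_const])
  qed
qed (use integrable_tilt_bound in \<open>auto simp: tilt_bound_def\<close>)

section \<open>Convergence of the weighted observables\<close>

abbreviation obs_topology :: "((real \<times> real \<times> real) \<times> real measure) topology" where
  "obs_topology \<equiv> prod_topology euclidean vague_topology"

lemma sets_obs_topology: "sets (borel_of obs_topology) = sets (borel \<Otimes>\<^sub>M vague_borel)"
proof -
  have "sets (borel_of obs_topology) = sets (borel_of euclidean \<Otimes>\<^sub>M vague_borel)"
    by (rule sets_borel_of_prod[OF induced_by_euclidean induced_by_vague])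
  also have "\<dots> = sets (borel \<Otimes>\<^sub>M vague_borel)" by (intro sets_pair_measure_cong refl sets_borel_of_euclidean)
  finally show ?thesis .
qed

text \<open>\<open>snd p\<close> is the threshold of the children, which only tends to z before the
  limit is taken: the branching place is exactly - z in these coordinates, while maximum and
  configuration are seen from the threshold.\<close>

definition observe :: "real \<Rightarrow> real \<Rightarrow> ((real measure \<times> real) \<times> (real measure \<times> real)) \<times> real \<Rightarrow> (real \<times> real \<times> real) \<times> real measure" where
  "observe \<sigma> z p = ((\<sigma>, - z, max (snd (fst (fst p))) (snd (snd (fst p))) - snd p),
     shift_left (snd p) (superposition (fst (fst (fst p))) (fst (snd (fst p)))))"

context canonical_limit
begin

lemma continuous_map_observe: "continuous_map triple_topology obs_topology (observe \<sigma> z)"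
  unfolding observe_def
proof (intro continuous_map_pairedI)
  have "continuous_map euclideanreal (euclidean :: (real \<times> real \<times> real) topology) (\<lambda>u. (\<sigma>, - z, u))"
    by (auto intro!: continuous_intros)
  from continuous_map_compose[OF continuous_map_triple_gap this]
  show "continuous_map triple_topology euclidean
    (\<lambda>x. (\<sigma>, - z, max (snd (fst (fst x))) (snd (snd (fst x))) - snd x))" by (simp add: comp_def)
  have 1: "continuous_map triple_topology euclideanreal snd" by (rule continuous_map_snd)
  have 2: "continuous_map triple_topology vague_topology (\<lambda>z. fst (fst (fst z)))"
    using continuous_map_compose[OF continuous_map_compose[OF continuous_map_fst continuous_map_fst] continuous_map_fst]
    by (simp add: comp_def)
  have 3: "continuous_map triple_topology vague_topology (\<lambda>z. fst (snd (fst z)))"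
    using continuous_map_compose[OF continuous_map_compose[OF continuous_map_fst continuous_map_snd] continuous_map_fst]
    by (simp add: comp_def)
  have 4: "continuous_map triple_topology vague_topology (\<lambda>x. superposition (fst (fst (fst x))) (fst (snd (fst x))))"
    using continuous_map_compose[OF continuous_map_pairedI[OF 2 3] continuous_map_superposition] by (simp add: comp_def)
  show "continuous_map triple_topology vague_topology
    (\<lambda>x. shift_left (snd x) (superposition (fst (fst (fst x))) (fst (snd (fst x)))))"
    using continuous_map_compose[OF continuous_map_pairedI[OF 1 4] continuous_map_shift_left] by (simp add: comp_def)
qed

definition limit_integrand :: "((real \<times> real \<times> real) \<times> real measure \<Rightarrow> real) \<Rightarrow> real \<times> real \<Rightarrow> real" where
  "limit_integrand g q = (\<integral>p. g (observe (fst q) (snd q) (p, snd q)) *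
     of_bool (max (snd (fst p)) (snd (snd p)) - snd q \<le> 0) \<partial>(LL \<Otimes>\<^sub>M LL))"

lemma measurable_observe [measurable (raw)]:
  assumes [measurable]: "s \<in> borel_measurable M" "z \<in> borel_measurable M" "x \<in> borel_measurable M"
    "p \<in> measurable M (state_space \<Otimes>\<^sub>M state_space)"
  shows "(\<lambda>w. observe (s w) (z w) (p w, x w)) \<in> measurable M (borel \<Otimes>\<^sub>M vague_borel)"
  unfolding observe_def by (simp add: borel_prod[symmetric]) measurable

definition snapshot :: "real \<Rightarrow> real \<Rightarrow> (bool list \<Rightarrow> real \<times> (real \<Rightarrow> real)) \<Rightarrow> (real \<times> real \<times> real) \<times> real measure" where
  "snapshot a t \<eta> = (((life [] \<eta> - a / 2) / sqrt (a / 8), disp [] (life [] \<eta>) \<eta> - (sqrt 2 * life [] \<eta> - a),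
     maximum life disp t \<eta> - (m t - a)), particles_from life disp t (m t - a) \<eta>)"

lemma measurable_snapshot [measurable]: "snapshot a t \<in> measurable tree_space (borel \<Otimes>\<^sub>M vague_borel)"
  unfolding snapshot_def by (simp add: borel_prod[symmetric])

definition observable :: "((real \<times> real \<times> real) \<times> real measure \<Rightarrow> real) \<Rightarrow> real \<Rightarrow> real \<Rightarrow>
    (bool list \<Rightarrow> real \<times> (real \<Rightarrow> real)) \<Rightarrow> real" where
  "observable g a t \<eta> = g (snapshot a t \<eta>) * of_bool (maximum life disp t \<eta> \<le> m t - a)"

text \<open>Contains both assertions at once: g = 1 gives the asymptotic probability, and general g,
  divided by it, the conditional law. It is stated along sequences to match the dominated
  convergence theorems.\<close>

lemma main_limit:
  fixes a t :: "nat \<Rightarrow> real"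
  assumes t: "filterlim t at_top sequentially" and a: "filterlim a at_top sequentially"
    and at: "(\<lambda>n. a n / t n) \<longlonglongrightarrow> 0" and pos: "\<And>n. 0 < a n" "\<And>n. 0 < t n"
    and g: "continuous_map obs_topology euclideanreal g" and C: "\<And>x. \<bar>g x\<bar> \<le> C"
  shows "(\<lambda>n. passage_weight (a n) * (\<integral>\<eta>. observable g (a n) (t n) \<eta> \<partial>tree_law)) \<longlonglongrightarrow>
    (\<integral>q. std_normal_density (fst q) / 2 * tilt (snd q) * limit_integrand g q \<partial>(lborel \<Otimes>\<^sub>M lborel))"
proof -
  have gm [measurable]: "g \<in> borel_measurable (borel \<Otimes>\<^sub>M vague_borel)"
    using continuous_map_borel_measurable[OF g] by (simp add: measurable_cong_sets[OF sets_obs_topology refl])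
  have C0: "0 \<le> C" using C[of undefined] by linarith
  obtain A where A: "A \<ge> 0" "\<And>t y. t \<ge> 0 \<Longrightarrow> cdf_max t (- y) \<le> A * (exp (- y / 2) + exp (- t / 2))"
    using a_priori_bound by blast
  \<comment> \<open>Squaring a sum of two terms costs the factor 2 in 2 A^2; the 1 covers positive
    z, where the trivial bound is used.\<close>
  define K where "K = max 1 (2 * A\<^sup>2)"
  have K1: "1 \<le> K" "2 * A\<^sup>2 \<le> K" by (auto simp: K_def)
  have cdf_sq: "(cdf_max r z)\<^sup>2 \<le> K * (min 1 (exp z) + exp (- r))" if "0 \<le> r" for r z
  proof (cases "exp z \<le> 1")
    case True
    have "cdf_max r z \<le> A * (exp (z / 2) + exp (- r / 2))" using A(2)[OF that, of "- z"] by simp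
    then have "(cdf_max r z)\<^sup>2 \<le> (A * (exp (z / 2) + exp (- r / 2)))\<^sup>2" using cdf_max_bounds by (intro power_mono)
    also have "\<dots> = A\<^sup>2 * (exp (z / 2) + exp (- r / 2))\<^sup>2" by (rule power_mult_distrib)
    also have "\<dots> \<le> A\<^sup>2 * (2 * ((exp (z / 2))\<^sup>2 + (exp (- r / 2))\<^sup>2))"
      using zero_le_power2[of "exp (z / 2) - exp (- r / 2)"] by (intro mult_left_mono) (auto simp: power2_eq_square algebra_simps)
    also have "(exp (z / 2))\<^sup>2 = exp z" by (simp add: power2_eq_square exp_add[symmetric])
    also have "(exp (- r / 2))\<^sup>2 = exp (- r)" by (simp add: power2_eq_square exp_add[symmetric])
    also have "A\<^sup>2 * (2 * (exp z + exp (- r))) = (2 * A\<^sup>2) * (min 1 (exp z) + exp (- r))" using True by (simp add: min_def)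
    also have "\<dots> \<le> K * (min 1 (exp z) + exp (- r))" using K1(2) by (rule mult_right_mono) (simp add: add_nonneg_nonneg)
    finally show ?thesis .
  next
    case False
    have "(cdf_max r z)\<^sup>2 \<le> 1" by (rule sq_bounds[OF cdf_max_bounds])
    also have "1 \<le> K * (1 + exp (- r))" using K1(1) mult_mono[of 1 K 1 "1 + exp (- r)"] by simp
    finally show ?thesis using False by (simp add: min_def)
  qed
  define g' where "g' = (\<lambda>n s y p. g (((s - a n / 2) / sqrt (a n / 8), y - (sqrt 2 * s - a n), snd p), fst p :: real measure) * of_bool (snd p \<le> (0::real)))"
  have g'm: "(\<lambda>z. g' n (fst z) (fst (snd z)) (snd (snd z))) \<in> borel_measurable (borel \<Otimes>\<^sub>M (borel \<Otimes>\<^sub>M state_space))" for n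
  proof -
    have [measurable]: "(\<lambda>z :: real \<times> real \<times> (real measure \<times> real). ((fst z - a n / 2) / sqrt (a n / 8), fst (snd z) - (sqrt 2 * fst z - a n), snd (snd (snd z)))) \<in>
        measurable (borel \<Otimes>\<^sub>M (borel \<Otimes>\<^sub>M state_space)) borel"
      by (simp add: borel_prod[symmetric]) measurable
    show ?thesis unfolding g'_def by measurable
  qed
  have g'C: "\<bar>g' n s y p\<bar> \<le> C" for n s y p using C C0 by (simp add: g'_def abs_mult of_bool_def)
  define H where "H = (\<lambda>n q. \<integral>p. g' n (fst q) (snd q) (merge (m (t n) - a n) (t n - fst q) (snd q) p) \<partial>(law (t n - fst q) \<Otimes>\<^sub>M law (t n - fst q)))"
  have Hm [measurable]: "H n \<in> borel_measurable (borel \<Otimes>\<^sub>M borel)" for n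
    unfolding H_def by (rule graft_formula(1)[OF g'm g'C less_imp_le[OF pos(2)]])
  define Ft where "Ft = (\<lambda>n q. branch_density q * (of_bool (fst q \<le> t n) * H n q))"
  have err: "\<bar>(\<integral>\<eta>. observable g (a n) (t n) \<eta> \<partial>tree_law) - (\<integral>q. Ft n q \<partial>(lborel \<Otimes>\<^sub>M lborel))\<bar> \<le> C * exp (- t n)" for n
    using graft_formula(3)[OF g'm[of n] g'C[of n] less_imp_le[OF pos(2)[of n]], where c="m (t n) - a n"]
    unfolding Ft_def H_def observable_def snapshot_def g'_def by simp
  define c where "c = (\<lambda>n. sqrt (a n / 8))"
  have c: "0 < c n" for n using pos(1)[of n] by (simp add: c_def)
  \<comment> \<open>Coordinates in which the limit is visible: \<sigma> is the normalised branching
    time and z the negative of the recentred branching place.\<close>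
  define \<Psi> where "\<Psi> = (\<lambda>n q. (a n / 2 + c n * fst q, sqrt 2 * (a n / 2 + c n * fst q) - a n - snd q))"
  have \<Psi>m [measurable]: "\<Psi> n \<in> measurable (borel \<Otimes>\<^sub>M borel) (borel \<Otimes>\<^sub>M borel)" for n unfolding \<Psi>_def by measurable
  have Ftm [measurable]: "Ft n \<in> borel_measurable (borel \<Otimes>\<^sub>M borel)" for n unfolding Ft_def by measurable
  define f where "f = (\<lambda>n q. passage_weight (a n) * (c n * Ft n (\<Psi> n q)))"
  have f_int: "(\<integral>q. f n q \<partial>(lborel \<Otimes>\<^sub>M lborel)) = passage_weight (a n) * (\<integral>q. Ft n q \<partial>(lborel \<Otimes>\<^sub>M lborel))" for n
    unfolding f_def \<Psi>_def using integral_lborel_pair_affine(1)[OF c[of n], of "Ft n" "a n / 2" "a n"]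
    by (simp add: borel_measurable_lborel_pair)
  \<comment> \<open>Threshold for the recentred maximum of the children; it is z up to the error of
    replacing m t - m (t - s) by sqrt 2 s.\<close>
  define x where "x = (\<lambda>n q. snd q + (m (t n) - m (t n - fst (\<Psi> n q)) - sqrt 2 * fst (\<Psi> n q)))"
  have H\<Psi>: "H n (\<Psi> n q) = (\<integral>p. g (observe (fst q) (snd q) (p, x n q)) * of_bool (max (snd (fst p)) (snd (snd p)) - x n q \<le> 0)
      \<partial>(law (t n - fst (\<Psi> n q)) \<Otimes>\<^sub>M law (t n - fst (\<Psi> n q))))" for n q
  proof -
    have e1: "(fst (\<Psi> n q) - a n / 2) / sqrt (a n / 8) = fst q" using c[of n] by (simp add: \<Psi>_def c_def)
    have e2: "snd (\<Psi> n q) - (sqrt 2 * fst (\<Psi> n q) - a n) = - snd q" by (simp add: \<Psi>_def)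
    have e3: "m (t n) - a n - m (t n - fst (\<Psi> n q)) - snd (\<Psi> n q) = x n q"
      by (simp add: x_def \<Psi>_def algebra_simps)
    have e4: "u + m (t n - fst (\<Psi> n q)) + snd (\<Psi> n q) - (m (t n) - a n) = u - x n q" for u
      using e3 by linarith
    show ?thesis unfolding H_def g'_def merge_def observe_def fst_conv snd_conv e1 e2 e3 e4 ..
  qed
  define K' where "K' = C * K"
  have K'0: "0 \<le> K'" using C0 K1 by (simp add: K'_def)
  have H_bound: "\<bar>H n (\<Psi> n q)\<bar> \<le> K' * (min 1 (exp (snd q)) + exp (- (t n - fst (\<Psi> n q))))"
    if s: "0 < fst (\<Psi> n q)" "fst (\<Psi> n q) < t n" for n q
  proof -
    let ?r = "t n - fst (\<Psi> n q)"
    interpret L: prob_space "law ?r \<Otimes>\<^sub>M law ?r" by (rule law_law_prob)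
    have sm: "sets (law ?r \<Otimes>\<^sub>M law ?r) = sets (state_space \<Otimes>\<^sub>M state_space)" by (intro sets_pair_measure_cong sets_law)
    have m1: "(\<lambda>p. of_bool (max (snd (fst p)) (snd (snd p)) \<le> x n q) :: real) \<in> borel_measurable (state_space \<Otimes>\<^sub>M state_space)"
      by measurable
    have m2: "(\<lambda>p. g (observe (fst q) (snd q) (p, x n q)) * of_bool (max (snd (fst p)) (snd (snd p)) - x n q \<le> 0)) \<in> borel_measurable (state_space \<Otimes>\<^sub>M state_space)"
      by measurable
    have i1: "integrable (law ?r \<Otimes>\<^sub>M law ?r) (\<lambda>p. of_bool (max (snd (fst p)) (snd (snd p)) \<le> x n q) :: real)"
      by (intro L.integrable_const_bound[where B=1]) (use m1 in \<open>auto simp: measurable_cong_sets[OF sm refl]\<close>)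
    have i2: "integrable (law ?r \<Otimes>\<^sub>M law ?r) (\<lambda>p. g (observe (fst q) (snd q) (p, x n q)) * of_bool (max (snd (fst p)) (snd (snd p)) - x n q \<le> 0))"
      by (intro L.integrable_const_bound[where B=C]) (use m2 C C0 in \<open>auto simp: measurable_cong_sets[OF sm refl] of_bool_def\<close>)
    have "\<bar>H n (\<Psi> n q)\<bar> \<le> (\<integral>p. \<bar>g (observe (fst q) (snd q) (p, x n q)) * of_bool (max (snd (fst p)) (snd (snd p)) - x n q \<le> 0)\<bar> \<partial>(law ?r \<Otimes>\<^sub>M law ?r))"
      unfolding H\<Psi> by (rule integral_abs_bound)
    also have "\<dots> \<le> (\<integral>p. C * of_bool (max (snd (fst p)) (snd (snd p)) \<le> x n q) \<partial>(law ?r \<Otimes>\<^sub>M law ?r))"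
      using i1 i2 C C0 by (intro integral_mono integrable_abs integrable_mult_right) (auto simp: of_bool_def)
    also have "\<dots> = C * (cdf_max ?r (x n q))\<^sup>2"
      using i1 pair_cdf[OF law_prob sets_law, of ?r "x n q"] by (simp add: cdf_max_def)
    \<comment> \<open>By \<open>m_diff_le\<close> the threshold is at most z for every n, so the
      logarithmic correction does not enter the majorant.\<close>
    also have "\<dots> \<le> C * (cdf_max ?r (snd q))\<^sup>2"
      using m_diff_le[OF s] C0 by (intro mult_left_mono power_mono cdf_max_mono cdf_max_bounds) (auto simp: x_def)
    also have "\<dots> \<le> C * (K * (min 1 (exp (snd q)) + exp (- ?r)))" using cdf_sq[of ?r "snd q"] s C0 by (intro mult_left_mono) auto
    finally show ?thesis by (simp add: K'_def)
  qed
  \<comment> \<open>The majorant before the change of variables. The part with min 1 (exp z) has a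
    mass given by the Green function, and the part with e^(-(t - s)) has a mass proportional to t
    e^(-t).\<close>
  define F where "F = (\<lambda>n q. passage_weight (a n) * (branch_density q * min 1 (exp (sqrt 2 * fst q - a n - snd q))) * K' +
      passage_weight (a n) * (branch_density q * (of_bool (fst q \<le> t n) * exp (- (t n - fst q)))) * K')"
  have Fi: "integrable (lborel \<Otimes>\<^sub>M lborel) (F n)" for n
    unfolding F_def using spatial_integral(1)[of "a n"] branch_density_early_integral[OF less_imp_le[OF pos(2)[of n]]]
    by (intro Bochner_Integration.integrable_add integrable_mult_left integrable_mult_right) auto
  have FI: "(\<integral>q. F n q \<partial>(lborel \<Otimes>\<^sub>M lborel)) = (\<integral>z. tilt_bound z * enn2real (passage_mass (a n + z)) \<partial>lborel) * K' +
     passage_weight (a n) * (t n * exp (- t n)) * K'" for n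
    unfolding F_def using spatial_integral[of "a n"] branch_density_early_integral[OF less_imp_le[OF pos(2)[of n]]]
    by (subst Bochner_Integration.integral_add) (auto intro!: integrable_mult_left integrable_mult_right)
  define G where "G = (\<lambda>n q. c n * F n (\<Psi> n q))"
  have Gi: "integrable (lborel \<Otimes>\<^sub>M lborel) (G n)" for n
    unfolding G_def \<Psi>_def by (rule integral_lborel_pair_affine(2)[OF c _ Fi]) (use Fi in auto)
  have GI: "(\<integral>q. G n q \<partial>(lborel \<Otimes>\<^sub>M lborel)) = (\<integral>q. F n q \<partial>(lborel \<Otimes>\<^sub>M lborel))" for n
    unfolding G_def \<Psi>_def by (rule integral_lborel_pair_affine(1)[OF c, symmetric]) (use Fi in auto)
  define G' where "G' = (\<lambda>q. std_normal_density (fst q) * (tilt_bound (snd q) / 2 * K'))"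
  have N: "integrable lborel std_normal_density" "(\<integral>\<sigma>. std_normal_density \<sigma> \<partial>lborel) = 1"
    by (auto intro: integrable_normal_density integral_normal_density)
  have tb: "integrable lborel (\<lambda>z. tilt_bound z / 2 * K')" using integrable_tilt_bound by auto
  have G'm: "G' \<in> borel_measurable (lborel \<Otimes>\<^sub>M lborel)" unfolding G'_def borel_measurable_lborel_pair tilt_bound_def by measurable
  have G'i: "integrable (lborel \<Otimes>\<^sub>M lborel) G'"
  proof (rule lborel_pair.Fubini_integrable[OF G'm])
    have "(\<lambda>s. \<integral>y. norm (G' (s, y)) \<partial>lborel) = (\<lambda>s. std_normal_density s * (\<integral>y. tilt_bound y / 2 * K' \<partial>lborel))"
      using tilt_bound_nonneg K'0 by (simp add: G'_def abs_mult normal_density_nonneg)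
    then show "integrable lborel (\<lambda>s. \<integral>y. norm (G' (s, y)) \<partial>lborel)" using N by simp
    show "AE s in lborel. integrable lborel (\<lambda>y. G' (s, y))" unfolding G'_def fst_conv snd_conv by (intro AE_I2 integrable_mult_right tb)
  qed
  have G'I: "(\<integral>q. G' q \<partial>(lborel \<Otimes>\<^sub>M lborel)) = (\<integral>z. tilt_bound z / 2 \<partial>lborel) * K'"
    using lborel_pair.integral_fst'[OF G'i] N tb by (simp add: G'_def)
  \<comment> \<open>The weight itself tends to infinity. Since \<open>sqrt 2 * \<gamma>\<close> < 1
    and eventually a < t / 4, it is at most e^(t/4), and the factor e^(-t) wins.\<close>
  have sqa: "(\<lambda>n. passage_weight (a n) * (t n * exp (- t n))) \<longlonglongrightarrow> 0"
  proof (rule Lim_null_comparison)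
    have "\<forall>\<^sub>F n in sequentially. a n / t n < 1/4" using at by (rule order_tendstoD) simp
    then show "\<forall>\<^sub>F n in sequentially. norm (passage_weight (a n) * (t n * exp (- t n))) \<le> t n * exp (- (t n / 2))"
    proof eventually_elim
      case (elim n)
      have "a n \<le> t n / 4" using elim pos(2)[of n] by (simp add: field_simps)
      then have "sqrt 2 * \<gamma> * a n \<le> 1 * (t n / 4)" using beta_bounds pos[of n] by (intro mult_mono) (auto intro: less_imp_le)
      then have "passage_weight (a n) * exp (- t n) \<le> exp (- (t n / 2))"
        unfolding passage_weight_def exp_add[symmetric] using pos(2)[of n] by simp
      then have "t n * (passage_weight (a n) * exp (- t n)) \<le> t n * exp (- (t n / 2))" using pos(2)[of n] by (intro mult_left_mono) auto
      then show ?case using pos(2)[of n] by (simp add: passage_weight_def abs_mult ac_simps)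
    qed
    have "((\<lambda>t::real. t * exp (- (t / 2))) \<longlongrightarrow> 0) at_top" by real_asymp
    then show "(\<lambda>n. t n * exp (- (t n / 2))) \<longlonglongrightarrow> 0" using t by (rule filterlim_compose)
  qed
  have sqa': "(\<lambda>n. passage_weight (a n) * exp (- t n)) \<longlonglongrightarrow> 0"
  proof (rule Lim_null_comparison[OF _ sqa])
    have "\<forall>\<^sub>F n in sequentially. 1 < t n" using t by (simp add: filterlim_at_top_dense)
    then show "\<forall>\<^sub>F n in sequentially. norm (passage_weight (a n) * exp (- t n)) \<le> passage_weight (a n) * (t n * exp (- t n))"
      by eventually_elim (simp add: passage_weight_def)
  qed
  have G_tot: "(\<lambda>n. \<integral>q. G n q \<partial>(lborel \<Otimes>\<^sub>M lborel)) \<longlonglongrightarrow> (\<integral>q. G' q \<partial>(lborel \<Otimes>\<^sub>M lborel))"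
  proof -
    have "(\<lambda>n. (\<integral>z. tilt_bound z * enn2real (passage_mass (a n + z)) \<partial>lborel) * K' + passage_weight (a n) * (t n * exp (- t n)) * K')
       \<longlonglongrightarrow> (\<integral>z. tilt_bound z / 2 \<partial>lborel) * K' + 0 * K'"
      by (intro tendsto_add tendsto_mult_right spatial_integral_limit[OF a] sqa)
    then show ?thesis unfolding GI FI G'I by simp
  qed
  define D where "D = (\<lambda>n q. passage_weight (a n) * (c n * branch_density (\<Psi> n q)))"
  have s_top: "filterlim (\<lambda>n. fst (\<Psi> n q)) at_top sequentially" for q
  proof -
    have "filterlim (\<lambda>a::real. a / 2 + sqrt (a / 8) * fst q) at_top at_top" by real_asymp
    from filterlim_compose[OF this a] show ?thesis by (simp add: \<Psi>_def c_def)
  qed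
  have s_t: "(\<lambda>n. fst (\<Psi> n q) / t n) \<longlonglongrightarrow> 0" for q
  proof -
    have L: "(\<lambda>n. (a n / t n) * (1/2 + sqrt (1 / (8 * a n)) * fst q)) \<longlonglongrightarrow> 0 * (1/2 + 0 * fst q)"
    proof (intro tendsto_intros at)
      have "((\<lambda>a::real. sqrt (1 / (8 * a))) \<longlongrightarrow> 0) at_top" by real_asymp
      from filterlim_compose[OF this a] show "(\<lambda>n. sqrt (1 / (8 * a n))) \<longlonglongrightarrow> 0" .
    qed
    have E: "(a n / t n) * (1/2 + sqrt (1 / (8 * a n)) * fst q) = fst (\<Psi> n q) / t n" for n
    proof -
      have "a n * sqrt (1 / (8 * a n)) = sqrt (a n * a n) * sqrt (1 / (8 * a n))" using pos(1)[of n] by simp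
      also have "\<dots> = sqrt (a n / 8)" unfolding real_sqrt_mult[symmetric] using pos(1)[of n] by (simp add: field_simps)
      finally have e: "a n * sqrt (1 / (8 * a n)) = sqrt (a n / 8)" .
      have "(a n / t n) * (1/2 + sqrt (1 / (8 * a n)) * fst q) = (a n / 2 + (a n * sqrt (1 / (8 * a n))) * fst q) / t n"
        by (simp add: field_simps)
      then show ?thesis unfolding e by (simp add: \<Psi>_def c_def)
    qed
    show ?thesis using L unfolding E by simp
  qed
  have r_top: "filterlim (\<lambda>n. t n - fst (\<Psi> n q)) at_top sequentially" for q
  proof -
    have "(\<lambda>n. 1 - fst (\<Psi> n q) / t n) \<longlonglongrightarrow> 1 - 0" by (intro tendsto_intros s_t)
    then have L: "filterlim (\<lambda>n. (1 - fst (\<Psi> n q) / t n) * t n) at_top sequentially"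
      by (intro filterlim_tendsto_pos_mult_at_top[OF _ _ t]) auto
    have E: "(1 - fst (\<Psi> n q) / t n) * t n = t n - fst (\<Psi> n q)" for n using pos(2)[of n] by (simp add: field_simps)
    show ?thesis using L unfolding E .
  qed
  have x_lim: "(\<lambda>n. x n q) \<longlonglongrightarrow> snd q" for q
  proof -
    have "(\<lambda>n. snd q + (m (t n) - m (t n - fst (\<Psi> n q)) - sqrt 2 * fst (\<Psi> n q))) \<longlonglongrightarrow> snd q + 0"
      by (intro tendsto_intros m_diff_limit[OF t s_t])
    then show ?thesis by (simp add: x_def)
  qed
  have ev_s: "\<forall>\<^sub>F n in sequentially. 0 < fst (\<Psi> n q) \<and> fst (\<Psi> n q) < t n" for q
  proof -
    have "\<forall>\<^sub>F n in sequentially. 0 < fst (\<Psi> n q)" "\<forall>\<^sub>F n in sequentially. 0 < t n - fst (\<Psi> n q)"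
      using s_top[of q] r_top[of q] unfolding filterlim_at_top_dense by blast+
    then show ?thesis by eventually_elim simp
  qed
  \<comment> \<open>The weight cancels exp (- sqrt 2 \<gamma> a) exactly, leaving the tilt in z
    times the kernel of \<open>passage_density_limit\<close>.\<close>
  have D_lim: "(\<lambda>n. D n q) \<longlonglongrightarrow> std_normal_density (fst q) / 2 * tilt (snd q)" for q
  proof -
    have "(\<lambda>n. tilt (snd q) * (sqrt (a n / 8) * passage_density (a n + snd q) (a n / 2 + sqrt (a n / 8) * fst q))) \<longlonglongrightarrow>
      tilt (snd q) * (std_normal_density (fst q) / 2)"
      by (intro tendsto_mult_left filterlim_compose[OF passage_density_limit a])
    moreover have "\<forall>\<^sub>F n in sequentially. tilt (snd q) * (sqrt (a n / 8) * passage_density (a n + snd q) (a n / 2 + sqrt (a n / 8) * fst q)) = D n q"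
      using ev_s[of q]
    proof eventually_elim
      case (elim n)
      let ?s = "fst (\<Psi> n q)"
      have "\<Psi> n q = (?s, sqrt 2 * ?s - (a n + snd q))" by (simp add: \<Psi>_def)
      then have b1: "branch_density (\<Psi> n q) = exp (- sqrt 2 * \<gamma> * (a n + snd q)) * passage_density (a n + snd q) ?s"
        using branch_density_passage[of ?s "a n + snd q"] elim by simp
      have b2: "passage_weight (a n) * exp (- sqrt 2 * \<gamma> * (a n + snd q)) = tilt (snd q)"
        unfolding passage_weight_def tilt_def exp_add[symmetric] by (simp add: algebra_simps)
      have b3: "?s = a n / 2 + sqrt (a n / 8) * fst q" by (simp add: \<Psi>_def c_def)
      have "D n q = (passage_weight (a n) * exp (- sqrt 2 * \<gamma> * (a n + snd q))) * (c n * passage_density (a n + snd q) ?s)"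
        unfolding D_def b1 by (simp only: ac_simps)
      then show ?case unfolding b2 b3 c_def by simp
    qed
    ultimately have "(\<lambda>n. D n q) \<longlonglongrightarrow> tilt (snd q) * (std_normal_density (fst q) / 2)" by (rule Lim_transform_eventually)
    then show ?thesis by (simp add: ac_simps)
  qed
  have f_D: "f n q = D n q * (of_bool (fst (\<Psi> n q) \<le> t n) * H n (\<Psi> n q))" for n q
    by (simp add: f_def D_def Ft_def)
  have D0: "0 \<le> D n q" for n q unfolding D_def passage_weight_def using c[of n] branch_density_nonneg by (auto intro: less_imp_le)
  have G_D: "G n q = D n q * (K' * (min 1 (exp (snd q)) + of_bool (fst (\<Psi> n q) \<le> t n) * exp (- (t n - fst (\<Psi> n q)))))" for n q
  proof -
    have "sqrt 2 * fst (\<Psi> n q) - a n - snd (\<Psi> n q) = snd q" by (simp add: \<Psi>_def)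
    then show ?thesis unfolding G_def F_def D_def by (simp add: algebra_simps)
  qed
  have ob: "(\<lambda>n. of_bool (fst (\<Psi> n q) \<le> t n)) \<longlonglongrightarrow> (1::real)" for q
  proof (rule Lim_transform_eventually[OF tendsto_const])
    show "\<forall>\<^sub>F n in sequentially. 1 = (of_bool (fst (\<Psi> n q) \<le> t n) :: real)"
      using ev_s[of q] by eventually_elim simp
  qed
  have "(\<lambda>n. \<integral>q. f n q \<partial>(lborel \<Otimes>\<^sub>M lborel)) \<longlonglongrightarrow>
    (\<integral>q. std_normal_density (fst q) / 2 * tilt (snd q) * limit_integrand g q \<partial>(lborel \<Otimes>\<^sub>M lborel))"
  proof (rule generalized_dominated_convergence[where G=G and G'=G'])
    show "f n \<in> borel_measurable (lborel \<Otimes>\<^sub>M lborel)" for n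
      unfolding f_def borel_measurable_lborel_pair
      by (intro borel_measurable_times borel_measurable_const measurable_compose[OF \<Psi>m Ftm])
    have "limit_integrand g \<in> borel_measurable (borel \<Otimes>\<^sub>M borel)"
      unfolding limit_integrand_def
    proof (rule LL2.borel_measurable_lebesgue_integral)
      show "(\<lambda>(q, p). g (observe (fst q) (snd q) (p, snd q)) * of_bool (max (snd (fst p)) (snd (snd p)) - snd q \<le> 0))
        \<in> borel_measurable ((borel \<Otimes>\<^sub>M borel) \<Otimes>\<^sub>M (LL \<Otimes>\<^sub>M LL))"
        unfolding split_beta' by measurable
    qed
    then show "(\<lambda>q. std_normal_density (fst q) / 2 * tilt (snd q) * limit_integrand g q) \<in> borel_measurable (lborel \<Otimes>\<^sub>M lborel)"
      unfolding borel_measurable_lborel_pair by measurable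
    show "integrable (lborel \<Otimes>\<^sub>M lborel) (G n)" for n by (rule Gi)
    show "integrable (lborel \<Otimes>\<^sub>M lborel) G'" by (rule G'i)
    show "(\<lambda>n. \<integral>q. G n q \<partial>(lborel \<Otimes>\<^sub>M lborel)) \<longlonglongrightarrow> (\<integral>q. G' q \<partial>(lborel \<Otimes>\<^sub>M lborel))" by (rule G_tot)
    show "AE q in lborel \<Otimes>\<^sub>M lborel. \<bar>f n q\<bar> \<le> G n q" for n
    proof -
      \<comment> \<open>Gives the values of \<sigma> that correspond to s = 0 and s = t, a null set
        not covered by \<open>H_bound\<close>.\<close>
      define u where "u = (\<lambda>s. (s - a n / 2) / c n)"
      have "AE q in (lborel \<Otimes>\<^sub>M lborel :: (real \<times> real) measure). fst q \<noteq> u 0 \<and> fst q \<noteq> u (t n)"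
      proof (rule lborel_pair.AE_pair_measure)
        have "{q \<in> space (borel \<Otimes>\<^sub>M (borel :: real measure)). fst q \<noteq> u 0 \<and> fst q \<noteq> u (t n)} \<in> sets (borel \<Otimes>\<^sub>M (borel :: real measure))" by measurable
        then show "{q \<in> space (lborel \<Otimes>\<^sub>M (lborel :: real measure)). fst q \<noteq> u 0 \<and> fst q \<noteq> u (t n)} \<in> sets (lborel \<Otimes>\<^sub>M (lborel :: real measure))"
          by (simp add: space_pair_measure sets_pair_measure_cong[of lborel borel lborel borel])
        have "AE s in lborel. s \<noteq> u 0 \<and> s \<noteq> u (t n)" using AE_lborel_singleton[of "u 0"] AE_lborel_singleton[of "u (t n)"] by eventually_elim simp
        then show "AE s in lborel. AE y in (lborel :: real measure). fst (s, y) \<noteq> u 0 \<and> fst (s, y) \<noteq> u (t n)" by eventually_elim simp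
      qed
      then show ?thesis
      proof eventually_elim
        case (elim q)
        let ?s = "fst (\<Psi> n q)"
        have us: "fst q = u ?s" using c[of n] by (simp add: u_def \<Psi>_def)
        with elim have s: "?s \<noteq> 0" "?s \<noteq> t n" by auto
        consider "?s < 0" | "t n < ?s" | "0 < ?s" "?s < t n" using s by linarith
        then show ?case
        proof cases
          case 1
          then have "D n q = 0" by (simp add: D_def branch_density_def exponential_density_def)
          then show ?thesis by (simp add: f_D G_D)
        next
          case 2
          then have "f n q = 0" by (simp add: f_D)
          moreover have "0 \<le> G n q" unfolding G_D using D0 K'0 by (intro mult_nonneg_nonneg add_nonneg_nonneg) auto
          ultimately show ?thesis by simp
        next
          case 3
          have "\<bar>f n q\<bar> = D n q * \<bar>H n (\<Psi> n q)\<bar>" using 3 D0[of n q] by (simp add: f_D abs_mult)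
          also have "\<dots> \<le> D n q * (K' * (min 1 (exp (snd q)) + exp (- (t n - ?s))))"
            by (rule mult_left_mono[OF H_bound[OF 3] D0])
          finally show ?thesis using 3 by (simp add: G_D)
        qed
      qed
    qed
    show "AE q in lborel \<Otimes>\<^sub>M lborel. (\<lambda>n. f n q) \<longlonglongrightarrow> std_normal_density (fst q) / 2 * tilt (snd q) * limit_integrand g q"
    proof (intro AE_I2)
      fix q :: "real \<times> real"
      have "(\<lambda>n. \<integral>p. g (observe (fst q) (snd q) (p, x n q)) * of_bool (max (snd (fst (fst (p, x n q)))) (snd (snd (fst (p, x n q)))) - snd (p, x n q) \<le> 0)
          \<partial>(law (t n - fst (\<Psi> n q)) \<Otimes>\<^sub>M law (t n - fst (\<Psi> n q)))) \<longlonglongrightarrow>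
        (\<integral>p. g (observe (fst q) (snd q) (p, snd q)) * of_bool (max (snd (fst (fst (p, snd q)))) (snd (snd (fst (p, snd q)))) - snd (p, snd q) \<le> 0) \<partial>(LL \<Otimes>\<^sub>M LL))"
      proof (rule pair_limit[OF r_top x_lim])
        show "continuous_map triple_topology euclideanreal (\<lambda>z. g (observe (fst q) (snd q) z))"
          using continuous_map_compose[OF continuous_map_observe g] by (simp add: comp_def)
        show "\<bar>g (observe (fst q) (snd q) z)\<bar> \<le> C" for z by (rule C)
        show "continuous_map triple_topology euclideanreal (\<lambda>z. max (snd (fst (fst z))) (snd (snd (fst z))) - snd z)"
          by (rule continuous_map_triple_gap)
        show "AE p in LL \<Otimes>\<^sub>M LL. max (snd (fst (fst (p, snd q)))) (snd (snd (fst (p, snd q)))) - snd (p, snd q) \<noteq> 0"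
          using AE_pair_max_neq[OF no_atom, of "snd q"] by eventually_elim simp
      qed
      then have Hl: "(\<lambda>n. H n (\<Psi> n q)) \<longlonglongrightarrow> limit_integrand g q"
        unfolding H\<Psi> limit_integrand_def by simp
      have "(\<lambda>n. D n q * (of_bool (fst (\<Psi> n q) \<le> t n) * H n (\<Psi> n q))) \<longlonglongrightarrow>
         std_normal_density (fst q) / 2 * tilt (snd q) * (1 * limit_integrand g q)"
        by (intro tendsto_mult D_lim ob Hl)
      then show "(\<lambda>n. f n q) \<longlonglongrightarrow> std_normal_density (fst q) / 2 * tilt (snd q) * limit_integrand g q" by (simp add: f_D)
    qed
    show "AE q in lborel \<Otimes>\<^sub>M lborel. (\<lambda>n. G n q) \<longlonglongrightarrow> G' q"
    proof (intro AE_I2)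
      fix q :: "real \<times> real"
      have "(\<lambda>n. exp (- (t n - fst (\<Psi> n q)))) \<longlonglongrightarrow> 0"
        by (rule filterlim_compose[OF exp_at_bot]) (use r_top[of q] in \<open>simp add: filterlim_uminus_at_top[symmetric] filterlim_uminus_at_bot\<close>)
      then have "(\<lambda>n. D n q * (K' * (min 1 (exp (snd q)) + of_bool (fst (\<Psi> n q) \<le> t n) * exp (- (t n - fst (\<Psi> n q)))))) \<longlonglongrightarrow>
         std_normal_density (fst q) / 2 * tilt (snd q) * (K' * (min 1 (exp (snd q)) + 1 * 0))"
        by (intro tendsto_mult tendsto_add tendsto_const D_lim ob)
      moreover have "std_normal_density (fst q) / 2 * tilt (snd q) * (K' * (min 1 (exp (snd q)) + 1 * 0)) = G' q"
        by (simp add: G'_def tilt_bound_def)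
      ultimately show "(\<lambda>n. G n q) \<longlonglongrightarrow> G' q" by (simp only: G_D)
    qed
  qed
  then have 1: "(\<lambda>n. passage_weight (a n) * (\<integral>q. Ft n q \<partial>(lborel \<Otimes>\<^sub>M lborel))) \<longlonglongrightarrow>
    (\<integral>q. std_normal_density (fst q) / 2 * tilt (snd q) * limit_integrand g q \<partial>(lborel \<Otimes>\<^sub>M lborel))"
    unfolding f_int .
  have "(\<lambda>n. passage_weight (a n) * ((\<integral>\<eta>. observable g (a n) (t n) \<eta> \<partial>tree_law) - (\<integral>q. Ft n q \<partial>(lborel \<Otimes>\<^sub>M lborel)))) \<longlonglongrightarrow> 0"
  proof (rule Lim_null_comparison)
    show "\<forall>\<^sub>F n in sequentially. norm (passage_weight (a n) * ((\<integral>\<eta>. observable g (a n) (t n) \<eta> \<partial>tree_law) - (\<integral>q. Ft n q \<partial>(lborel \<Otimes>\<^sub>M lborel))))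
      \<le> C * (passage_weight (a n) * exp (- t n))"
    proof (intro always_eventually allI)
      fix n
      have pw: "0 \<le> passage_weight (a n)" by (simp add: passage_weight_def)
      from mult_left_mono[OF err[of n] pw]
      show "norm (passage_weight (a n) * ((\<integral>\<eta>. observable g (a n) (t n) \<eta> \<partial>tree_law) - (\<integral>q. Ft n q \<partial>(lborel \<Otimes>\<^sub>M lborel))))
        \<le> C * (passage_weight (a n) * exp (- t n))"
        using pw by (simp add: abs_mult ac_simps)
    qed
    show "(\<lambda>n. C * (passage_weight (a n) * exp (- t n))) \<longlonglongrightarrow> 0"
      using tendsto_mult_left[OF sqa', of C] by simp
  qed
  from tendsto_add[OF this 1] show ?thesis by (simp add: algebra_simps)
qed

end

section \<open>The limiting variables\<close>

definition top_atom :: "real measure \<times> real measure \<Rightarrow> real" where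
  "top_atom N = max (max_atom (fst N)) (max_atom (snd N))"

locale bbm_limit = canonical_limit W "distr L (borel_of state_topology) (\<lambda>\<mu>. (\<mu>, max_atom \<mu>))" for W L +
  assumes L_prob: "prob_space L" and L_sets: "sets L = sets vague_borel"
begin

abbreviation "LL \<equiv> distr L (borel_of state_topology) (\<lambda>\<mu>. (\<mu>, max_atom \<mu>))"

sublocale L: prob_space L by (rule L_prob)
sublocale L2: pair_prob_space L L ..

lemma sets_L [measurable_cong]: "sets L = sets vague_borel" by (rule L_sets)

lemma space_L: "space L = point_measures"
  using sets_eq_imp_space_eq[OF L_sets] by (simp add: space_vague_borel)

text \<open>Measurability of \<open>max_atom\<close> is not derived from its definition: the assumed
  convergence has the image law as its limit, so the image law is a probability measure, and this
  forces measurability.\<close>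

lemma measurable_pair_max_atom: "(\<lambda>\<mu>. (\<mu>, max_atom \<mu>)) \<in> measurable L (borel_of state_topology)"
  by (rule measurable_of_prob_space_distr[OF L_prob LL_prob]) (auto simp: space_L space_borel_of topspace_vague)

lemma measurable_pair_max_atom' [measurable]: "(\<lambda>\<mu>. (\<mu>, max_atom \<mu>)) \<in> measurable L state_space"
  using measurable_pair_max_atom by (simp add: measurable_cong_sets[OF refl sets_state_topology])

lemma measurable_max_atom: "max_atom \<in> borel_measurable L"
  using measurable_compose[OF measurable_pair_max_atom' measurable_snd] by simp

lemma measurable_max_atom_vague [measurable]: "max_atom \<in> borel_measurable vague_borel"
  using measurable_max_atom by (simp add: measurable_cong_sets[OF L_sets refl])

lemma measure_L_max: "Measurable.pred borel Q \<Longrightarrow> measure L {\<mu> \<in> space L. Q (max_atom \<mu>)} = measure LL {p \<in> space LL. Q (snd p)}"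
proof -
  assume Q [measurable]: "Measurable.pred borel Q"
  have S: "{p \<in> space LL. Q (snd p)} \<in> sets (borel_of state_topology)"
    unfolding sets_state_topology sets_LL[symmetric] by measurable
  have "(\<lambda>\<mu>. (\<mu>, max_atom \<mu>)) -` {p \<in> space LL. Q (snd p)} \<inter> space L = {\<mu> \<in> space L. Q (max_atom \<mu>)}"
    using measurable_space[OF measurable_pair_max_atom] by auto
  then show ?thesis using measure_distr[OF measurable_pair_max_atom S] by simp
qed

lemma cdf_lim_L: "cdf_lim z = measure L {\<mu> \<in> space L. max_atom \<mu> \<le> z}"
  unfolding cdf_lim_def by (rule measure_L_max[symmetric]) measurable

lemma no_atom_L: "measure L {\<mu> \<in> space L. max_atom \<mu> = z} = 0"
  using no_atom[of z] measure_L_max[of "\<lambda>x. x = z"] by simp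

lemma AE_max_atom_neq: "AE \<mu> in L. max_atom \<mu> \<noteq> z"
proof (rule AE_I')
  show "{\<mu> \<in> space L. max_atom \<mu> = z} \<in> null_sets L"
    using no_atom_L[of z] by (auto simp: null_sets_def L.emeasure_eq_measure)
qed auto

lemma measurable_top_atom [measurable]: "top_atom \<in> borel_measurable (vague_borel \<Otimes>\<^sub>M vague_borel)"
  unfolding top_atom_def by measurable

text \<open>Both maxima must lie below u, whence the square. Strict and weak inequality agree as the
  law has no atoms; the weak form serves the joint law of \<chi> and E, the strict one the tail of
  E.\<close>

lemma emeasure_top_atom:
  "emeasure (L \<Otimes>\<^sub>M L) {N \<in> space (L \<Otimes>\<^sub>M L). top_atom N \<le> u} = ennreal ((cdf_lim u)\<^sup>2)"
  "emeasure (L \<Otimes>\<^sub>M L) {N \<in> space (L \<Otimes>\<^sub>M L). top_atom N < u} = ennreal ((cdf_lim u)\<^sup>2)"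
proof -
  have 1: "{N \<in> space (L \<Otimes>\<^sub>M L). top_atom N \<le> u} = {\<mu> \<in> space L. max_atom \<mu> \<le> u} \<times> {\<mu> \<in> space L. max_atom \<mu> \<le> u}"
    "{N \<in> space (L \<Otimes>\<^sub>M L). top_atom N < u} = {\<mu> \<in> space L. max_atom \<mu> < u} \<times> {\<mu> \<in> space L. max_atom \<mu> < u}"
    by (auto simp: space_pair_measure top_atom_def)
  have s: "{\<mu> \<in> space L. max_atom \<mu> \<le> u} \<in> sets L" "{\<mu> \<in> space L. max_atom \<mu> < u} \<in> sets L" by measurable
  have "emeasure L {\<mu> \<in> space L. max_atom \<mu> < u} = emeasure L {\<mu> \<in> space L. max_atom \<mu> \<le> u}"
    using AE_max_atom_neq[of u] s by (intro emeasure_eq_AE) (auto elim!: eventually_mono)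
  then show "emeasure (L \<Otimes>\<^sub>M L) {N \<in> space (L \<Otimes>\<^sub>M L). top_atom N \<le> u} = ennreal ((cdf_lim u)\<^sup>2)"
     "emeasure (L \<Otimes>\<^sub>M L) {N \<in> space (L \<Otimes>\<^sub>M L). top_atom N < u} = ennreal ((cdf_lim u)\<^sup>2)"
    unfolding 1 using s
    by (simp_all add: L.emeasure_pair_measure_Times L.emeasure_eq_measure cdf_lim_L ennreal_mult[symmetric] power2_eq_square)
qed

section \<open>The constant and the explicit limit law\<close>

definition c1 :: real where
  "c1 = 1 / 2 * (\<integral>z. tilt z * (cdf_lim z)\<^sup>2 \<partial>lborel)"

text \<open>In the a priori bound the second term disappears as t tends to infinity, and the square
  of the first is a constant times exp z; \<open>tilt_bound\<close> then dominates.\<close>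

lemma integrable_tilt_cdf: "integrable lborel (\<lambda>z. tilt z * (cdf_lim z)\<^sup>2)"
proof -
  obtain A where A: "A \<ge> 0" "\<And>t y. t \<ge> 0 \<Longrightarrow> cdf_max t (- y) \<le> A * (exp (- y / 2) + exp (- t / 2))"
    using a_priori_bound by blast
  have lim: "cdf_lim z \<le> A * exp (z / 2)" for z
  proof (rule tendsto_le[OF _ _ cdf_max_tendsto])
    have "((\<lambda>t::real. A * (exp (z / 2) + exp (- t / 2))) \<longlongrightarrow> A * (exp (z / 2) + 0)) at_top"
    proof (intro tendsto_mult_left tendsto_add tendsto_const)
      show "((\<lambda>t::real. exp (- t / 2)) \<longlongrightarrow> 0) at_top" by real_asymp
    qed
    then show "((\<lambda>t::real. A * (exp (z / 2) + exp (- t / 2))) \<longlongrightarrow> A * exp (z / 2)) at_top" by simp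
    show "\<forall>\<^sub>F t in at_top. cdf_max t z \<le> A * (exp (z / 2) + exp (- t / 2))"
      using eventually_ge_at_top[of 0] by eventually_elim (use A(2)[of _ "- z"] in simp)
  qed simp
  have b: "(cdf_lim z)\<^sup>2 \<le> max 1 (A\<^sup>2) * min 1 (exp z)" for z
  proof (cases "exp z \<le> 1")
    case True
    have "(cdf_lim z)\<^sup>2 \<le> (A * exp (z / 2))\<^sup>2" using lim cdf_lim_bounds by (intro power_mono)
    also have "\<dots> = A\<^sup>2 * exp z" by (simp add: power_mult_distrib power2_eq_square exp_add[symmetric])
    also have "\<dots> \<le> max 1 (A\<^sup>2) * exp z" by (intro mult_right_mono) auto
    also have "exp z = min 1 (exp z)" using True by (rule min.absorb2[symmetric])
    finally show ?thesis .
  next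
    case False
    have "(cdf_lim z)\<^sup>2 \<le> 1" by (rule sq_bounds[OF cdf_lim_bounds])
    then show ?thesis using False by (auto simp: min_def intro: order_trans)
  qed
  have "integrable lborel (\<lambda>z. max 1 (A\<^sup>2) * tilt_bound z)" by (intro integrable_mult_right integrable_tilt_bound)
  then show ?thesis
  proof (rule Bochner_Integration.integrable_bound)
    show "(\<lambda>z. tilt z * (cdf_lim z)\<^sup>2) \<in> borel_measurable lborel" by measurable
    show "AE z in lborel. norm (tilt z * (cdf_lim z)\<^sup>2) \<le> norm (max 1 (A\<^sup>2) * tilt_bound z)"
    proof (intro AE_I2)
      fix z
      have "tilt z * (cdf_lim z)\<^sup>2 \<le> tilt z * (max 1 (A\<^sup>2) * min 1 (exp z))"
        using b[of z] tilt_pos[of z] by (intro mult_left_mono) auto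
      then show "norm (tilt z * (cdf_lim z)\<^sup>2) \<le> norm (max 1 (A\<^sup>2) * tilt_bound z)"
        using tilt_pos[of z] by (simp add: tilt_bound_def abs_mult ac_simps)
    qed
  qed
qed

text \<open>The limiting distribution function tends to 1, so the integrand is bounded below on a
  unit interval far to the right.\<close>

lemma c1_pos: "0 < c1"
proof -
  have "\<forall>\<^sub>F z in at_top. 1/2 < cdf_lim z" using cdf_lim_at_top by (rule order_tendstoD) simp
  then obtain z0 where z0: "\<And>z. z \<ge> z0 \<Longrightarrow> 1/2 < cdf_lim z" by (auto simp: eventually_at_top_linorder)
  have "(\<integral>z. (tilt (z0 + 1) / 4) * indicator {z0..z0 + 1} z \<partial>lborel) \<le> (\<integral>z. tilt z * (cdf_lim z)\<^sup>2 \<partial>lborel)"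
  proof (rule integral_mono[OF _ integrable_tilt_cdf])
    show "integrable lborel (\<lambda>z. (tilt (z0 + 1) / 4) * indicator {z0..z0 + 1} z)"
      by (intro integrable_mult_right integrable_real_indicator) auto
    fix z
    show "(tilt (z0 + 1) / 4) * indicator {z0..z0 + 1} z \<le> tilt z * (cdf_lim z)\<^sup>2"
    proof (cases "z \<in> {z0..z0 + 1}")
      case True
      have "tilt (z0 + 1) \<le> tilt z"
        unfolding tilt_def using True beta_bounds(1) by (simp add: mult_left_mono)
      moreover have "(1/2)\<^sup>2 \<le> (cdf_lim z)\<^sup>2" using z0[of z] True by (intro power_mono) auto
      ultimately have "tilt (z0 + 1) * (1/2)\<^sup>2 \<le> tilt z * (cdf_lim z)\<^sup>2"
        using tilt_pos[of z] by (intro mult_mono) auto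
      then show ?thesis using True by (simp add: power2_eq_square)
    qed (use tilt_pos[of z] in simp)
  qed
  also have "(\<integral>z. (tilt (z0 + 1) / 4) * indicator {z0..z0 + 1} z \<partial>lborel) = tilt (z0 + 1) / 4" by simp
  finally show ?thesis unfolding c1_def using tilt_pos[of "z0 + 1"] by simp
qed

lemma nn_integral_tilt_cdf: "(\<integral>\<^sup>+z. ennreal (tilt z / (2 * c1) * (cdf_lim z)\<^sup>2) \<partial>lborel) = 1"
proof -
  have "(\<integral>\<^sup>+z. ennreal (tilt z / (2 * c1) * (cdf_lim z)\<^sup>2) \<partial>lborel) = (\<integral>\<^sup>+z. ennreal (1 / (2 * c1) * (tilt z * (cdf_lim z)\<^sup>2)) \<partial>lborel)"
    by (simp add: ac_simps)
  also have "\<dots> = ennreal (\<integral>z. 1 / (2 * c1) * (tilt z * (cdf_lim z)\<^sup>2) \<partial>lborel)"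
    using integrable_tilt_cdf c1_pos less_imp_le[OF tilt_pos]
    by (intro nn_integral_eq_integral AE_I2 mult_nonneg_nonneg) auto
  also have "(\<integral>z. 1 / (2 * c1) * (tilt z * (cdf_lim z)\<^sup>2) \<partial>lborel) = 1"
    using c1_pos unfolding c1_def by (simp only: integral_mult_right_zero) simp
  finally show ?thesis by simp
qed

text \<open>Density of \<xi>, \<chi> and the two configurations against Lebesgue measure and two
  copies of the extremal law. Keeping both configurations below z leaves the mass
  \<open>(cdf_lim z)\<^sup>2\<close>, which makes the marginal of \<chi> proportional to the
  integrand of \<open>c1\<close>.\<close>

definition base_density :: "(real \<times> real) \<times> (real measure \<times> real measure) \<Rightarrow> ennreal" where
  "base_density v = ennreal (std_normal_density (fst (fst v)) * (tilt (snd (fst v)) / (2 * c1))) *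
     indicator {v. top_atom (snd v) \<le> snd (fst v)} v"

text \<open>E is not drawn separately: it is the gap between \<chi> and the larger of the two
  maxima, as the required identity for - E demands.\<close>

definition limit_point :: "(real \<times> real) \<times> (real measure \<times> real measure) \<Rightarrow>
    real \<times> real \<times> real \<times> real measure \<times> real measure" where
  "limit_point v = (fst (fst v), snd (fst v), snd (fst v) - top_atom (snd v), snd v)"

abbreviation target_space :: "(real \<times> real \<times> real \<times> real measure \<times> real measure) measure" where
  "target_space \<equiv> borel \<Otimes>\<^sub>M (borel \<Otimes>\<^sub>M (borel \<Otimes>\<^sub>M (vague_borel \<Otimes>\<^sub>M vague_borel)))"

definition limit_measure :: "(real \<times> real \<times> real \<times> real measure \<times> real measure) measure" where
  "limit_measure = distr (density ((lborel \<Otimes>\<^sub>M lborel) \<Otimes>\<^sub>M (L \<Otimes>\<^sub>M L)) base_density) target_space limit_point"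

lemma sets_limit_measure [measurable_cong]: "sets limit_measure = sets target_space"
  by (simp add: limit_measure_def)

lemma measurable_base_density [measurable]: "base_density \<in> borel_measurable ((borel \<Otimes>\<^sub>M borel) \<Otimes>\<^sub>M (L \<Otimes>\<^sub>M L))"
  unfolding base_density_def by measurable

lemma sets_base: "sets ((lborel \<Otimes>\<^sub>M lborel) \<Otimes>\<^sub>M (L \<Otimes>\<^sub>M L)) = sets ((borel \<Otimes>\<^sub>M borel) \<Otimes>\<^sub>M (L \<Otimes>\<^sub>M L))"
  by (intro sets_pair_measure_cong) simp_all

lemma measurable_limit_point [measurable]: "limit_point \<in> measurable ((borel \<Otimes>\<^sub>M borel) \<Otimes>\<^sub>M (L \<Otimes>\<^sub>M L)) target_space"
  unfolding limit_point_def by measurable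

lemma nn_integral_limit_measure:
  assumes f [measurable]: "f \<in> borel_measurable target_space"
  shows "(\<integral>\<^sup>+x. f x \<partial>limit_measure) =
    (\<integral>\<^sup>+\<sigma>. (\<integral>\<^sup>+z. ennreal (std_normal_density \<sigma> * (tilt z / (2 * c1))) *
       (\<integral>\<^sup>+N. f (\<sigma>, z, z - top_atom N, N) * indicator {N. top_atom N \<le> z} N \<partial>(L \<Otimes>\<^sub>M L)) \<partial>lborel) \<partial>lborel)"
proof -
  interpret ll: pair_sigma_finite "lborel \<Otimes>\<^sub>M lborel" "L \<Otimes>\<^sub>M L" ..
  note lb = measurable_cong_sets[OF sets_base refl]
  have fl: "(\<lambda>w. f (limit_point w)) \<in> borel_measurable ((borel \<Otimes>\<^sub>M borel) \<Otimes>\<^sub>M (L \<Otimes>\<^sub>M L))" by measurable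
  have "(\<integral>\<^sup>+x. f x \<partial>limit_measure) = (\<integral>\<^sup>+w. base_density w * f (limit_point w) \<partial>((lborel \<Otimes>\<^sub>M lborel) \<Otimes>\<^sub>M (L \<Otimes>\<^sub>M L)))"
    unfolding limit_measure_def using fl
    by (subst nn_integral_distr) (simp_all add: lb nn_integral_density measurable_limit_point measurable_base_density)
  also have "\<dots> = (\<integral>\<^sup>+q. (\<integral>\<^sup>+N. base_density (q, N) * f (limit_point (q, N)) \<partial>(L \<Otimes>\<^sub>M L)) \<partial>(lborel \<Otimes>\<^sub>M lborel))"
    using fl by (subst L2.P.nn_integral_fst[symmetric]) (simp_all add: lb)
  also have "\<dots> = (\<integral>\<^sup>+q. ennreal (std_normal_density (fst q) * (tilt (snd q) / (2 * c1))) *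
       (\<integral>\<^sup>+N. f (fst q, snd q, snd q - top_atom N, N) * indicator {N. top_atom N \<le> snd q} N \<partial>(L \<Otimes>\<^sub>M L)) \<partial>(lborel \<Otimes>\<^sub>M lborel))"
  proof (rule nn_integral_cong)
    fix q :: "real \<times> real"
    have "(\<lambda>N. f (fst q, snd q, snd q - top_atom N, N) * indicator {N. top_atom N \<le> snd q} N) \<in> borel_measurable (L \<Otimes>\<^sub>M L)"
      by measurable
    then show "(\<integral>\<^sup>+N. base_density (q, N) * f (limit_point (q, N)) \<partial>(L \<Otimes>\<^sub>M L)) =
      ennreal (std_normal_density (fst q) * (tilt (snd q) / (2 * c1))) *
       (\<integral>\<^sup>+N. f (fst q, snd q, snd q - top_atom N, N) * indicator {N. top_atom N \<le> snd q} N \<partial>(L \<Otimes>\<^sub>M L))"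
      by (subst nn_integral_cmult[symmetric]) (auto simp: base_density_def limit_point_def indicator_def intro!: nn_integral_cong)
  qed
  also have "\<dots> = (\<integral>\<^sup>+\<sigma>. (\<integral>\<^sup>+z. ennreal (std_normal_density \<sigma> * (tilt z / (2 * c1))) *
       (\<integral>\<^sup>+N. f (\<sigma>, z, z - top_atom N, N) * indicator {N. top_atom N \<le> z} N \<partial>(L \<Otimes>\<^sub>M L)) \<partial>lborel) \<partial>lborel)"
  proof -
    have "(\<lambda>q. \<integral>\<^sup>+N. f (fst q, snd q, snd q - top_atom N, N) * indicator {N. top_atom N \<le> snd q} N \<partial>(L \<Otimes>\<^sub>M L)) \<in> borel_measurable (borel \<Otimes>\<^sub>M borel)"
      by measurable
    then have "(\<lambda>q. ennreal (std_normal_density (fst q) * (tilt (snd q) / (2 * c1))) *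
       (\<integral>\<^sup>+N. f (fst q, snd q, snd q - top_atom N, N) * indicator {N. top_atom N \<le> snd q} N \<partial>(L \<Otimes>\<^sub>M L))) \<in> borel_measurable (lborel \<Otimes>\<^sub>M lborel)"
      unfolding borel_measurable_lborel_pair by measurable
    from lborel.nn_integral_fst[OF this] show ?thesis by simp
  qed
  finally show ?thesis .
qed

lemma std_normal_mass: "(\<integral>\<^sup>+\<sigma>. ennreal (std_normal_density \<sigma>) \<partial>lborel) = 1"
  using prob_space.emeasure_space_1[OF prob_space_normal_density[of 1 0]] by (simp add: emeasure_density)

text \<open>The weight factorises between \<sigma> and the rest; independence of \<xi> and all
  marginal laws are read off from this product.\<close>

lemma nn_integral_limit_measure_split:
  assumes u [measurable]: "u \<in> borel_measurable borel"
    and v [measurable]: "v \<in> borel_measurable (borel \<Otimes>\<^sub>M (borel \<Otimes>\<^sub>M (vague_borel \<Otimes>\<^sub>M vague_borel)))"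
  shows "(\<integral>\<^sup>+x. u (fst x) * v (snd x) \<partial>limit_measure) =
    (\<integral>\<^sup>+\<sigma>. ennreal (std_normal_density \<sigma>) * u \<sigma> \<partial>lborel) *
    (\<integral>\<^sup>+z. ennreal (tilt z / (2 * c1)) *
       (\<integral>\<^sup>+N. v (z, z - top_atom N, N) * indicator {N. top_atom N \<le> z} N \<partial>(L \<Otimes>\<^sub>M L)) \<partial>lborel)"
proof -
  define J where "J = (\<lambda>z. \<integral>\<^sup>+N. v (z, z - top_atom N, N) * indicator {N. top_atom N \<le> z} N \<partial>(L \<Otimes>\<^sub>M L))"
  have Jm [measurable]: "J \<in> borel_measurable borel" unfolding J_def by measurable
  have tn: "0 \<le> tilt z / (2 * c1)" for z using tilt_pos[of z] c1_pos by simp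
  have "(\<integral>\<^sup>+x. u (fst x) * v (snd x) \<partial>limit_measure) =
    (\<integral>\<^sup>+\<sigma>. (\<integral>\<^sup>+z. ennreal (std_normal_density \<sigma> * (tilt z / (2 * c1))) *
       (\<integral>\<^sup>+N. u \<sigma> * v (z, z - top_atom N, N) * indicator {N. top_atom N \<le> z} N \<partial>(L \<Otimes>\<^sub>M L)) \<partial>lborel) \<partial>lborel)"
    by (subst nn_integral_limit_measure) simp_all
  also have "\<dots> = (\<integral>\<^sup>+\<sigma>. (\<integral>\<^sup>+z. (ennreal (std_normal_density \<sigma>) * u \<sigma>) * (ennreal (tilt z / (2 * c1)) * J z) \<partial>lborel) \<partial>lborel)"
  proof (intro nn_integral_cong)
    fix \<sigma> z :: real
    have uJ: "(\<integral>\<^sup>+N. u \<sigma> * v (z, z - top_atom N, N) * indicator {N. top_atom N \<le> z} N \<partial>(L \<Otimes>\<^sub>M L)) = u \<sigma> * J z"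
      unfolding J_def mult.assoc by (rule nn_integral_cmult) measurable
    show "ennreal (std_normal_density \<sigma> * (tilt z / (2 * c1))) *
       (\<integral>\<^sup>+N. u \<sigma> * v (z, z - top_atom N, N) * indicator {N. top_atom N \<le> z} N \<partial>(L \<Otimes>\<^sub>M L)) =
       (ennreal (std_normal_density \<sigma>) * u \<sigma>) * (ennreal (tilt z / (2 * c1)) * J z)"
      unfolding uJ ennreal_mult[OF normal_density_nonneg tn] by (simp only: ac_simps)
  qed
  also have "\<dots> = (\<integral>\<^sup>+\<sigma>. (ennreal (std_normal_density \<sigma>) * u \<sigma>) * (\<integral>\<^sup>+z. ennreal (tilt z / (2 * c1)) * J z \<partial>lborel) \<partial>lborel)"
    by (intro nn_integral_cong nn_integral_cmult) measurable
  also have "\<dots> = (\<integral>\<^sup>+\<sigma>. ennreal (std_normal_density \<sigma>) * u \<sigma> \<partial>lborel) * (\<integral>\<^sup>+z. ennreal (tilt z / (2 * c1)) * J z \<partial>lborel)"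
    by (rule nn_integral_multc) measurable
  finally show ?thesis unfolding J_def .
qed

lemma ennreal_tilt_shift:
  "ennreal (tilt (y + z) / (2 * c1)) * ennreal ((cdf_lim z)\<^sup>2) = ennreal (tilt y) * ennreal (tilt z / (2 * c1) * (cdf_lim z)\<^sup>2)"
proof -
  have tn: "0 \<le> tilt z / (2 * c1)" using tilt_pos[of z] c1_pos by simp
  have e: "tilt (y + z) / (2 * c1) = tilt y * (tilt z / (2 * c1))"
    by (simp add: tilt_def exp_add[symmetric] algebra_simps)
  show ?thesis
    unfolding e ennreal_mult[OF less_imp_le[OF tilt_pos] tn] ennreal_mult[OF tn zero_le_power2] by (simp only: ac_simps)
qed

text \<open>A shift of z by y multiplies the tilt by \<open>tilt y\<close>. This is the source of
  the factor exp (- sqrt 2 \<gamma> y) in the joint law; the same shift yields the exponential tail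
  of E.\<close>

lemma nn_integral_limit_tail:
  assumes "0 \<le> y"
  shows "(\<integral>\<^sup>+z. ennreal (tilt z / (2 * c1)) * indicator {..x} z * ennreal ((cdf_lim (z - y))\<^sup>2) \<partial>lborel) =
    ennreal (tilt y) * (\<integral>\<^sup>+z. ennreal (tilt z / (2 * c1) * (cdf_lim z)\<^sup>2) * indicator {..x - y} z \<partial>lborel)"
proof -
  have "(\<integral>\<^sup>+z. ennreal (tilt z / (2 * c1)) * indicator {..x} z * ennreal ((cdf_lim (z - y))\<^sup>2) \<partial>lborel) =
     (\<integral>\<^sup>+z. ennreal (tilt (y + z) / (2 * c1)) * indicator {..x} (y + z) * ennreal ((cdf_lim z)\<^sup>2) \<partial>lborel)"
    by (subst nn_integral_real_affine[where c=1 and t=y]) simp_all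
  also have "\<dots> = (\<integral>\<^sup>+z. ennreal (tilt y) * (ennreal (tilt z / (2 * c1) * (cdf_lim z)\<^sup>2) * indicator {..x - y} z) \<partial>lborel)"
  proof (intro nn_integral_cong)
    fix z :: real
    show "ennreal (tilt (y + z) / (2 * c1)) * indicator {..x} (y + z) * ennreal ((cdf_lim z)\<^sup>2) =
        ennreal (tilt y) * (ennreal (tilt z / (2 * c1) * (cdf_lim z)\<^sup>2) * indicator {..x - y} z)"
      using ennreal_tilt_shift[of y z] by (cases "y + z \<le> x") (auto simp: indicator_def)
  qed
  also have "\<dots> = ennreal (tilt y) * (\<integral>\<^sup>+z. ennreal (tilt z / (2 * c1) * (cdf_lim z)\<^sup>2) * indicator {..x - y} z \<partial>lborel)"
    by (rule nn_integral_cmult) measurable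
  finally show ?thesis .
qed

lemma limit_measure_prob: "prob_space limit_measure"
proof
  have "emeasure limit_measure (space limit_measure) = (\<integral>\<^sup>+x. 1 * 1 \<partial>limit_measure)" by simp
  also have "\<dots> = 1 * (\<integral>\<^sup>+z. ennreal (tilt z / (2 * c1)) * (\<integral>\<^sup>+N. indicator {N. top_atom N \<le> z} N \<partial>(L \<Otimes>\<^sub>M L)) \<partial>lborel)"
    by (subst nn_integral_limit_measure_split[of "\<lambda>_. 1" "\<lambda>_. 1"]) (simp_all add: std_normal_mass)
  also have "\<dots> = (\<integral>\<^sup>+z. ennreal (tilt z / (2 * c1) * (cdf_lim z)\<^sup>2) \<partial>lborel)"
    unfolding mult_1
  proof (intro nn_integral_cong)
    fix z :: real
    have s: "{N \<in> space (L \<Otimes>\<^sub>M L). top_atom N \<le> z} \<in> sets (L \<Otimes>\<^sub>M L)" by measurable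
    have "(\<integral>\<^sup>+N. indicator {N. top_atom N \<le> z} N \<partial>(L \<Otimes>\<^sub>M L)) = (\<integral>\<^sup>+N. indicator {N \<in> space (L \<Otimes>\<^sub>M L). top_atom N \<le> z} N \<partial>(L \<Otimes>\<^sub>M L))"
      by (intro nn_integral_cong) (simp add: indicator_def)
    also have "\<dots> = ennreal ((cdf_lim z)\<^sup>2)" using s by (simp add: emeasure_top_atom)
    finally have I: "(\<integral>\<^sup>+N. indicator {N. top_atom N \<le> z} N \<partial>(L \<Otimes>\<^sub>M L)) = ennreal ((cdf_lim z)\<^sup>2)" .
    show "ennreal (tilt z / (2 * c1)) * (\<integral>\<^sup>+N. indicator {N. top_atom N \<le> z} N \<partial>(L \<Otimes>\<^sub>M L)) = ennreal (tilt z / (2 * c1) * (cdf_lim z)\<^sup>2)"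
      unfolding I using tilt_pos[of z] c1_pos by (intro ennreal_mult[symmetric]) auto
  qed
  finally show "emeasure limit_measure (space limit_measure) = 1" unfolding nn_integral_tilt_cdf .
qed

sublocale Q: prob_space limit_measure by (rule limit_measure_prob)

abbreviation "xi \<equiv> (fst :: real \<times> real \<times> real \<times> real measure \<times> real measure \<Rightarrow> real)"
abbreviation "chi x \<equiv> fst (snd (x :: real \<times> real \<times> real \<times> real measure \<times> real measure))"
abbreviation "gap x \<equiv> fst (snd (snd (x :: real \<times> real \<times> real \<times> real measure \<times> real measure)))"
abbreviation "conf x \<equiv> snd (snd (snd (x :: real \<times> real \<times> real \<times> real measure \<times> real measure)))"

lemma emeasure_limit_measure_split:
  assumes A: "A \<in> sets borel" and B: "B \<in> sets (borel \<Otimes>\<^sub>M (borel \<Otimes>\<^sub>M (vague_borel \<Otimes>\<^sub>M vague_borel)))"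
  shows "emeasure limit_measure {x \<in> space limit_measure. xi x \<in> A \<and> snd x \<in> B} =
    emeasure std_normal_distribution A * (\<integral>\<^sup>+z. ennreal (tilt z / (2 * c1)) *
       (\<integral>\<^sup>+N. indicator B (z, z - top_atom N, N) * indicator {N. top_atom N \<le> z} N \<partial>(L \<Otimes>\<^sub>M L)) \<partial>lborel)"
proof -
  note [measurable] = A B
  have s: "{x \<in> space limit_measure. xi x \<in> A \<and> snd x \<in> B} \<in> sets limit_measure" by measurable
  have "emeasure limit_measure {x \<in> space limit_measure. xi x \<in> A \<and> snd x \<in> B} = (\<integral>\<^sup>+x. indicator A (fst x) * indicator B (snd x) \<partial>limit_measure)"
    unfolding nn_integral_indicator[OF s, symmetric] by (intro nn_integral_cong) (simp add: indicator_def)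
  also have "\<dots> = (\<integral>\<^sup>+\<sigma>. ennreal (std_normal_density \<sigma>) * indicator A \<sigma> \<partial>lborel) * (\<integral>\<^sup>+z. ennreal (tilt z / (2 * c1)) *
       (\<integral>\<^sup>+N. indicator B (z, z - top_atom N, N) * indicator {N. top_atom N \<le> z} N \<partial>(L \<Otimes>\<^sub>M L)) \<partial>lborel)"
    by (rule nn_integral_limit_measure_split) measurable
  also have "(\<integral>\<^sup>+\<sigma>. ennreal (std_normal_density \<sigma>) * indicator A \<sigma> \<partial>lborel) = emeasure std_normal_distribution A"
    by (subst emeasure_density) simp_all
  finally show ?thesis .
qed

lemma emeasure_std_normal_UNIV: "emeasure std_normal_distribution UNIV = 1"
  using std_normal_mass by (simp add: emeasure_density)

lemma emeasure_limit_measure_rest: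
  assumes B: "B \<in> sets (borel \<Otimes>\<^sub>M (borel \<Otimes>\<^sub>M (vague_borel \<Otimes>\<^sub>M vague_borel)))"
  shows "emeasure limit_measure {x \<in> space limit_measure. snd x \<in> B} = (\<integral>\<^sup>+z. ennreal (tilt z / (2 * c1)) *
       (\<integral>\<^sup>+N. indicator B (z, z - top_atom N, N) * indicator {N. top_atom N \<le> z} N \<partial>(L \<Otimes>\<^sub>M L)) \<partial>lborel)"
  using emeasure_limit_measure_split[of UNIV B] B by (simp add: emeasure_std_normal_UNIV)

text \<open>For y \<ge> 0 the restriction top \<le> z follows from y \<le> z - top, so the inner
  integral is the squared distribution function at z - y.\<close>

lemma limit_joint:
  assumes y: "0 \<le> y"
  shows "emeasure limit_measure {x \<in> space limit_measure. chi x \<le> c \<and> y \<le> gap x} =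
     ennreal (tilt y) * (\<integral>\<^sup>+z. ennreal (tilt z / (2 * c1) * (cdf_lim z)\<^sup>2) * indicator {..c - y} z \<partial>lborel)"
    and limit_gap: "emeasure limit_measure {x \<in> space limit_measure. y < gap x} = ennreal (tilt y)"
proof -
  have m: "{N \<in> space (L \<Otimes>\<^sub>M L). top_atom N \<le> u} \<in> sets (L \<Otimes>\<^sub>M L)" "{N \<in> space (L \<Otimes>\<^sub>M L). top_atom N < u} \<in> sets (L \<Otimes>\<^sub>M L)" for u
    by measurable
  let ?B = "{p \<in> space (borel \<Otimes>\<^sub>M (borel \<Otimes>\<^sub>M (vague_borel \<Otimes>\<^sub>M vague_borel))). fst p \<le> c \<and> y \<le> fst (snd p)}"
  have B: "?B \<in> sets (borel \<Otimes>\<^sub>M (borel \<Otimes>\<^sub>M (vague_borel \<Otimes>\<^sub>M vague_borel)))" by measurable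
  note spL = sets_eq_imp_space_eq[OF L_sets]
  have sp: "space limit_measure = space target_space" by (rule sets_eq_imp_space_eq[OF sets_limit_measure])
  have "{x \<in> space limit_measure. chi x \<le> c \<and> y \<le> gap x} = {x \<in> space limit_measure. snd x \<in> ?B}"
    by (auto simp: sp space_pair_measure)
  then have "emeasure limit_measure {x \<in> space limit_measure. chi x \<le> c \<and> y \<le> gap x} =
     (\<integral>\<^sup>+z. ennreal (tilt z / (2 * c1)) * (\<integral>\<^sup>+N. indicator ?B (z, z - top_atom N, N) * indicator {N. top_atom N \<le> z} N \<partial>(L \<Otimes>\<^sub>M L)) \<partial>lborel)"
    using emeasure_limit_measure_rest[OF B] by simp
  also have "\<dots> = (\<integral>\<^sup>+z. ennreal (tilt z / (2 * c1)) * indicator {..c} z * ennreal ((cdf_lim (z - y))\<^sup>2) \<partial>lborel)"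
  proof (intro nn_integral_cong)
    fix z :: real
    have "(\<integral>\<^sup>+N. indicator ?B (z, z - top_atom N, N) * indicator {N. top_atom N \<le> z} N \<partial>(L \<Otimes>\<^sub>M L)) =
       (\<integral>\<^sup>+N. indicator {..c} z * indicator {N \<in> space (L \<Otimes>\<^sub>M L). top_atom N \<le> z - y} N \<partial>(L \<Otimes>\<^sub>M L))"
      using y by (intro nn_integral_cong) (auto simp: indicator_def space_pair_measure spL)
    also have "\<dots> = indicator {..c} z * ennreal ((cdf_lim (z - y))\<^sup>2)"
      using m by (simp add: nn_integral_cmult emeasure_top_atom)
    finally show "ennreal (tilt z / (2 * c1)) * (\<integral>\<^sup>+N. indicator ?B (z, z - top_atom N, N) * indicator {N. top_atom N \<le> z} N \<partial>(L \<Otimes>\<^sub>M L)) =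
       ennreal (tilt z / (2 * c1)) * indicator {..c} z * ennreal ((cdf_lim (z - y))\<^sup>2)" by (simp add: mult.assoc)
  qed
  finally show "emeasure limit_measure {x \<in> space limit_measure. chi x \<le> c \<and> y \<le> gap x} =
     ennreal (tilt y) * (\<integral>\<^sup>+z. ennreal (tilt z / (2 * c1) * (cdf_lim z)\<^sup>2) * indicator {..c - y} z \<partial>lborel)"
    unfolding nn_integral_limit_tail[OF y] .
  let ?C = "{p \<in> space (borel \<Otimes>\<^sub>M (borel \<Otimes>\<^sub>M (vague_borel \<Otimes>\<^sub>M vague_borel))). y < fst (snd p)}"
  have C: "?C \<in> sets (borel \<Otimes>\<^sub>M (borel \<Otimes>\<^sub>M (vague_borel \<Otimes>\<^sub>M vague_borel)))" by measurable
  have "{x \<in> space limit_measure. y < gap x} = {x \<in> space limit_measure. snd x \<in> ?C}"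
    by (auto simp: sp space_pair_measure)
  then have "emeasure limit_measure {x \<in> space limit_measure. y < gap x} =
     (\<integral>\<^sup>+z. ennreal (tilt z / (2 * c1)) * (\<integral>\<^sup>+N. indicator ?C (z, z - top_atom N, N) * indicator {N. top_atom N \<le> z} N \<partial>(L \<Otimes>\<^sub>M L)) \<partial>lborel)"
    using emeasure_limit_measure_rest[OF C] by simp
  also have "\<dots> = (\<integral>\<^sup>+z. ennreal (tilt (y + z) / (2 * c1)) * ennreal ((cdf_lim z)\<^sup>2) \<partial>lborel)"
  proof -
    have "(\<integral>\<^sup>+N. indicator ?C (z, z - top_atom N, N) * indicator {N. top_atom N \<le> z} N \<partial>(L \<Otimes>\<^sub>M L)) = ennreal ((cdf_lim (z - y))\<^sup>2)" for z
    proof -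
      have "(\<integral>\<^sup>+N. indicator ?C (z, z - top_atom N, N) * indicator {N. top_atom N \<le> z} N \<partial>(L \<Otimes>\<^sub>M L)) =
         (\<integral>\<^sup>+N. indicator {N \<in> space (L \<Otimes>\<^sub>M L). top_atom N < z - y} N \<partial>(L \<Otimes>\<^sub>M L))"
        using y by (intro nn_integral_cong) (auto simp: indicator_def space_pair_measure spL)
      also have "\<dots> = ennreal ((cdf_lim (z - y))\<^sup>2)" using m by (simp add: emeasure_top_atom)
      finally show ?thesis .
    qed
    then show ?thesis by (simp, subst nn_integral_real_affine[where c=1 and t=y]) simp_all
  qed
  also have "\<dots> = (\<integral>\<^sup>+z. ennreal (tilt y) * ennreal (tilt z / (2 * c1) * (cdf_lim z)\<^sup>2) \<partial>lborel)"
    by (simp only: ennreal_tilt_shift)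
  also have "\<dots> = ennreal (tilt y) * (\<integral>\<^sup>+z. ennreal (tilt z / (2 * c1) * (cdf_lim z)\<^sup>2) \<partial>lborel)"
    by (rule nn_integral_cmult) measurable
  also have "\<dots> = ennreal (tilt y)" unfolding nn_integral_tilt_cdf by simp
  finally show "emeasure limit_measure {x \<in> space limit_measure. y < gap x} = ennreal (tilt y)" .
qed

lemma emeasure_extremal_law_below_pair:
  assumes A [measurable]: "A \<in> sets (vague_borel \<Otimes>\<^sub>M vague_borel)"
  shows "emeasure (extremal_law_below L z \<Otimes>\<^sub>M extremal_law_below L z) A =
    (\<integral>\<^sup>+N. indicator A N * indicator {N. top_atom N \<le> z} N \<partial>(L \<Otimes>\<^sub>M L)) / ennreal (cdf_lim z) / ennreal (cdf_lim z)"
proof -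
  define S where "S = {\<mu> \<in> space L. max_atom \<mu> \<le> z}"
  define U where "U = uniform_measure L S"
  have S [measurable]: "S \<in> sets L" unfolding S_def by measurable
  have eS: "emeasure L S = ennreal (cdf_lim z)" by (simp add: S_def cdf_lim_L L.emeasure_eq_measure)
  have sU [measurable_cong]: "sets U = sets vague_borel" by (simp add: U_def sets_L)
  \<comment> \<open>If the conditioning event is null, 0 / 0 = 0 makes the conditioned law the zero
    measure, so finiteness holds for every z.\<close>
  have "emeasure U (space U) \<noteq> \<infinity>"
    using S by (cases "cdf_lim z = 0") (auto simp: U_def eS sets.Int_space_eq2 ennreal_divide_eq_top_iff ennreal_eq_0_iff cdf_lim_bounds order.antisym)
  then interpret U: finite_measure U by (rule finite_measureI)
  have sec: "(\<lambda>y. indicator A (x, y) :: ennreal) \<in> borel_measurable L" if "x \<in> space L" for x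
    using that by measurable
  have sec': "(\<lambda>x. \<integral>\<^sup>+y. indicator A (x, y) * indicator S y \<partial>L) \<in> borel_measurable L" by measurable
  have "emeasure (extremal_law_below L z \<Otimes>\<^sub>M extremal_law_below L z) A = (\<integral>\<^sup>+x. \<integral>\<^sup>+y. indicator A (x, y) \<partial>U \<partial>U)"
    unfolding extremal_law_below_def S_def[symmetric] U_def[symmetric]
    by (rule U.emeasure_pair_measure) measurable
  also have "\<dots> = (\<integral>\<^sup>+x. (\<integral>\<^sup>+y. indicator A (x, y) * indicator S y \<partial>L) / ennreal (cdf_lim z) \<partial>U)"
    unfolding U_def eS[symmetric]
    by (intro nn_integral_cong nn_integral_uniform_measure sec S) simp
  also have "\<dots> = (\<integral>\<^sup>+x. (\<integral>\<^sup>+y. indicator A (x, y) * indicator S y \<partial>L) \<partial>U) / ennreal (cdf_lim z)"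
    by (rule nn_integral_divide) (use sec' in \<open>simp add: U_def\<close>)
  also have "(\<integral>\<^sup>+x. (\<integral>\<^sup>+y. indicator A (x, y) * indicator S y \<partial>L) \<partial>U) =
     (\<integral>\<^sup>+x. (\<integral>\<^sup>+y. indicator A (x, y) * indicator S y \<partial>L) * indicator S x \<partial>L) / ennreal (cdf_lim z)"
    unfolding U_def eS[symmetric] by (intro nn_integral_uniform_measure sec' S)
  also have "(\<integral>\<^sup>+x. (\<integral>\<^sup>+y. indicator A (x, y) * indicator S y \<partial>L) * indicator S x \<partial>L) =
     (\<integral>\<^sup>+x. (\<integral>\<^sup>+y. indicator A (x, y) * indicator S y * indicator S x \<partial>L) \<partial>L)"
    by (intro nn_integral_cong nn_integral_multc[symmetric] borel_measurable_times_ennreal sec borel_measurable_indicator S)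
  also have "\<dots> = (\<integral>\<^sup>+x. (\<integral>\<^sup>+y. indicator A (x, y) * indicator {N. top_atom N \<le> z} (x, y) \<partial>L) \<partial>L)"
    by (intro nn_integral_cong) (auto simp: indicator_def S_def top_atom_def)
  also have "\<dots> = (\<integral>\<^sup>+N. indicator A N * indicator {N. top_atom N \<le> z} N \<partial>(L \<Otimes>\<^sub>M L))"
    by (rule L.nn_integral_fst) measurable
  finally show ?thesis .
qed

text \<open>In product form the identity also covers those z with \<open>cdf_lim z = 0\<close>,
  where both sides vanish, so it can be integrated over all z.\<close>

lemma emeasure_extremal_law_below_pair_cdf:
  assumes A [measurable]: "A \<in> sets (vague_borel \<Otimes>\<^sub>M vague_borel)"
  shows "emeasure (extremal_law_below L z \<Otimes>\<^sub>M extremal_law_below L z) A * ennreal ((cdf_lim z)\<^sup>2) =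
    (\<integral>\<^sup>+N. indicator A N * indicator {N. top_atom N \<le> z} N \<partial>(L \<Otimes>\<^sub>M L))"
    (is "_ = ?K")
proof -
  have le: "?K \<le> ennreal ((cdf_lim z)\<^sup>2)"
  proof -
    have s: "{N \<in> space (L \<Otimes>\<^sub>M L). top_atom N \<le> z} \<in> sets (L \<Otimes>\<^sub>M L)" by measurable
    have "?K \<le> (\<integral>\<^sup>+N. indicator {N \<in> space (L \<Otimes>\<^sub>M L). top_atom N \<le> z} N \<partial>(L \<Otimes>\<^sub>M L))"
      by (intro nn_integral_mono) (auto simp: indicator_def)
    then show ?thesis using s by (simp add: emeasure_top_atom)
  qed
  show ?thesis
  proof (cases "cdf_lim z = 0")
    case True
    then show ?thesis using le by simp
  next
    case False
    define c where "c = ennreal (cdf_lim z)"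
    have c: "c \<noteq> 0" "c \<noteq> \<top>" using False cdf_lim_bounds(1)[of z] by (auto simp: c_def ennreal_eq_0_iff)
    have cancel: "k / c * c = k" for k
      using c unfolding ennreal_divide_times by (simp add: less_top)
    have "?K / c / c * (c * c) = ?K / c / c * c * c" by (simp only: mult.assoc)
    also have "\<dots> = ?K" unfolding cancel ..
    finally have "?K / c / c * (c * c) = ?K" .
    moreover have "ennreal ((cdf_lim z)\<^sup>2) = c * c"
      unfolding c_def power2_eq_square by (rule ennreal_mult) (rule cdf_lim_bounds)+
    ultimately show ?thesis unfolding emeasure_extremal_law_below_pair[OF A] c_def by simp
  qed
qed

lemma measurable_extremal_law_below_pair:
  assumes A [measurable]: "A \<in> sets (vague_borel \<Otimes>\<^sub>M vague_borel)"
  shows "(\<lambda>z. emeasure (extremal_law_below L z \<Otimes>\<^sub>M extremal_law_below L z) A) \<in> borel_measurable borel"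
  unfolding emeasure_extremal_law_below_pair[OF A] by measurable

lemma AE_greatest_atom_pair:
  "AE N in L \<Otimes>\<^sub>M L. max_atom (fst N) \<noteq> x \<and> max_atom (snd N) \<noteq> x"
proof (rule L2.AE_pair_measure)
  show "{N \<in> space (L \<Otimes>\<^sub>M L). max_atom (fst N) \<noteq> x \<and> max_atom (snd N) \<noteq> x} \<in> sets (L \<Otimes>\<^sub>M L)" by measurable
  show "AE \<mu> in L. AE \<nu> in L. max_atom (fst (\<mu>, \<nu>)) \<noteq> x \<and> max_atom (snd (\<mu>, \<nu>)) \<noteq> x"
    using AE_max_atom_neq[of x] by eventually_elim (use AE_max_atom_neq[of x] in simp)
qed

lemma max_atom_merged:
  assumes "\<mu> \<in> point_measures" "\<nu> \<in> point_measures" "max_atom \<mu> \<noteq> (THE x. False)" "max_atom \<nu> \<noteq> (THE x. False)"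
  shows "max_atom (shift_left c (superposition \<mu> \<nu>)) = top_atom (\<mu>, \<nu>) - c"
proof -
  have g: "greatest_atom \<rho> (max_atom \<rho>)" if "max_atom \<rho> \<noteq> (THE x. False)" for \<rho>
    using that max_atom_no_greatest[of \<rho>] max_atom_eq[of \<rho>] by metis
  show ?thesis
    unfolding top_atom_def fst_conv snd_conv
    by (intro max_atom_eq greatest_atom_shift_left greatest_atom_superposition superposition_point_measures g assms)
qed

text \<open>The default value of \<open>max_atom\<close> is a single real number, and the law of the
  maximum has no atom there. Hence almost surely both configurations have a greatest atom, for which
  superposition and shift act as expected.\<close>

lemma AE_max_atom_limit:
  "AE x in limit_measure. - gap x = max_atom (shift_left (chi x) (superposition (fst (conf x)) (snd (conf x))))"
proof -
  let ?d = "THE x::real. False"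
  have sp: "space limit_measure = space target_space" by (rule sets_eq_imp_space_eq[OF sets_limit_measure])
  have good: "AE x in limit_measure. gap x = chi x - top_atom (conf x) \<and> max_atom (fst (conf x)) \<noteq> ?d \<and> max_atom (snd (conf x)) \<noteq> ?d"
    (is "AE x in limit_measure. ?G x")
  proof -
    have Gm [measurable]: "Measurable.pred target_space ?G" by measurable
    have bad: "{x \<in> space limit_measure. \<not> ?G x} \<in> sets limit_measure" unfolding sets_limit_measure sp by measurable
    have 0: "(\<integral>\<^sup>+N. of_bool (\<not> ?G (\<sigma>, z, z - top_atom N, N)) * indicator {N. top_atom N \<le> z} N \<partial>(L \<Otimes>\<^sub>M L)) = 0" for \<sigma> z
    proof -
      have "AE N in L \<Otimes>\<^sub>M L. of_bool (\<not> ?G (\<sigma>, z, z - top_atom N, N)) * indicator {N. top_atom N \<le> z} N = (0 :: ennreal)"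
        using AE_greatest_atom_pair[of ?d] by eventually_elim simp
      from nn_integral_cong_AE[OF this] show ?thesis by simp
    qed
    have "emeasure limit_measure {x \<in> space limit_measure. \<not> ?G x} = (\<integral>\<^sup>+x. of_bool (\<not> ?G x) \<partial>limit_measure)"
      unfolding nn_integral_indicator[OF bad, symmetric] by (intro nn_integral_cong) (simp add: indicator_def)
    also have "\<dots> = 0"
      by (subst nn_integral_limit_measure) (measurable, simp only: 0 mult_zero_right nn_integral_0_iff_AE nn_integral_const mult_zero_left)
    finally show ?thesis using bad by (intro AE_I[where N="{x \<in> space limit_measure. \<not> ?G x}"]) auto
  qed
  have pm: "fst (conf x) \<in> point_measures \<and> snd (conf x) \<in> point_measures" if "x \<in> space limit_measure" for x
    using that by (auto simp: sp space_pair_measure space_vague_borel)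
  show ?thesis
    using good AE_space
  proof eventually_elim
    case (elim x)
    then show ?case using pm[of x] by (subst max_atom_merged) auto
  qed
qed

text \<open>For fixed z, integrating the indicator of A over the restricted pairs gives the same as
  integrating the constant \<kappa> z, since both yield \<kappa> z times
  \<open>(cdf_lim z)\<^sup>2\<close>.\<close>

lemma conditional_law_limit:
  "has_conditional_law limit_measure (\<lambda>x. chi x) (vague_borel \<Otimes>\<^sub>M vague_borel) (\<lambda>x. (fst (conf x), snd (conf x)))
     (\<lambda>z. extremal_law_below L z \<Otimes>\<^sub>M extremal_law_below L z)"
  unfolding has_conditional_law_def
proof (intro conjI ballI)
  let ?B = "borel \<Otimes>\<^sub>M (borel \<Otimes>\<^sub>M (vague_borel \<Otimes>\<^sub>M vague_borel)) :: (real \<times> real \<times> real measure \<times> real measure) measure"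
  show "(\<lambda>x. chi x) \<in> borel_measurable limit_measure" by measurable
  show "(\<lambda>x. (fst (conf x), snd (conf x))) \<in> measurable limit_measure (vague_borel \<Otimes>\<^sub>M vague_borel)" by measurable
  fix A :: "(real measure \<times> real measure) set" assume A [measurable]: "A \<in> sets (vague_borel \<Otimes>\<^sub>M vague_borel)"
  define \<kappa> where "\<kappa> = (\<lambda>z. emeasure (extremal_law_below L z \<Otimes>\<^sub>M extremal_law_below L z) A)"
  have \<kappa>m [measurable]: "\<kappa> \<in> borel_measurable borel" unfolding \<kappa>_def by (rule measurable_extremal_law_below_pair[OF A])
  show "(\<lambda>z. emeasure (extremal_law_below L z \<Otimes>\<^sub>M extremal_law_below L z) A) \<in> borel_measurable (distr limit_measure borel (\<lambda>x. chi x))"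
    using \<kappa>m by (simp add: \<kappa>_def)
  fix C :: "real set" assume C [measurable]: "C \<in> sets borel"
  have S: "{x \<in> space limit_measure. chi x \<in> C \<and> (fst (conf x), snd (conf x)) \<in> A} \<in> sets limit_measure" by measurable
  have "emeasure limit_measure {x \<in> space limit_measure. chi x \<in> C \<and> (fst (conf x), snd (conf x)) \<in> A} =
     (\<integral>\<^sup>+x. 1 * (indicator C (fst (snd x)) * indicator A (snd (snd (snd x)))) \<partial>limit_measure)"
    unfolding nn_integral_indicator[OF S, symmetric] by (intro nn_integral_cong) (simp add: indicator_def)
  also have "\<dots> = 1 * (\<integral>\<^sup>+z. ennreal (tilt z / (2 * c1)) *
      (\<integral>\<^sup>+N. indicator C z * indicator A N * indicator {N. top_atom N \<le> z} N \<partial>(L \<Otimes>\<^sub>M L)) \<partial>lborel)"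
    by (subst nn_integral_limit_measure_split) (measurable, simp add: std_normal_mass)
  also have "\<dots> = 1 * (\<integral>\<^sup>+z. ennreal (tilt z / (2 * c1)) *
      (\<integral>\<^sup>+N. indicator C z * \<kappa> z * indicator {N. top_atom N \<le> z} N \<partial>(L \<Otimes>\<^sub>M L)) \<partial>lborel)"
  proof -
    have "(\<integral>\<^sup>+N. indicator C z * indicator A N * indicator {N. top_atom N \<le> z} N \<partial>(L \<Otimes>\<^sub>M L)) =
        (\<integral>\<^sup>+N. indicator C z * \<kappa> z * indicator {N. top_atom N \<le> z} N \<partial>(L \<Otimes>\<^sub>M L))" for z
    proof -
      have s: "{N \<in> space (L \<Otimes>\<^sub>M L). top_atom N \<le> z} \<in> sets (L \<Otimes>\<^sub>M L)" by measurable
      have "(\<integral>\<^sup>+N. indicator C z * \<kappa> z * indicator {N. top_atom N \<le> z} N \<partial>(L \<Otimes>\<^sub>M L)) =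
          (\<integral>\<^sup>+N. indicator C z * \<kappa> z * indicator {N \<in> space (L \<Otimes>\<^sub>M L). top_atom N \<le> z} N \<partial>(L \<Otimes>\<^sub>M L))"
        by (intro nn_integral_cong) (simp add: indicator_def)
      also have "\<dots> = indicator C z * (\<kappa> z * ennreal ((cdf_lim z)\<^sup>2))"
        using s by (simp add: nn_integral_cmult emeasure_top_atom mult.assoc)
      also have "\<dots> = indicator C z * (\<integral>\<^sup>+N. indicator A N * indicator {N. top_atom N \<le> z} N \<partial>(L \<Otimes>\<^sub>M L))"
        unfolding \<kappa>_def emeasure_extremal_law_below_pair_cdf[OF A] ..
      also have "\<dots> = (\<integral>\<^sup>+N. indicator C z * indicator A N * indicator {N. top_atom N \<le> z} N \<partial>(L \<Otimes>\<^sub>M L))"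
        unfolding mult.assoc by (rule nn_integral_cmult[symmetric]) measurable
      finally show ?thesis by simp
    qed
    then show ?thesis by simp
  qed
  also have "\<dots> = (\<integral>\<^sup>+x. 1 * (indicator C (fst (snd x)) * \<kappa> (fst (snd x))) \<partial>limit_measure)"
    by (subst nn_integral_limit_measure_split) (measurable, simp add: std_normal_mass)
  finally show "emeasure limit_measure {x \<in> space limit_measure. chi x \<in> C \<and> (fst (conf x), snd (conf x)) \<in> A} =
     (\<integral>\<^sup>+x. indicator C (chi x) * emeasure (extremal_law_below L (chi x) \<Otimes>\<^sub>M extremal_law_below L (chi x)) A \<partial>limit_measure)"
    by (simp add: \<kappa>_def)
qed

lemma emeasure_xi:
  assumes A: "A \<in> sets borel"
  shows "emeasure limit_measure {x \<in> space limit_measure. xi x \<in> A} = emeasure std_normal_distribution A"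
proof -
  let ?B = "borel \<Otimes>\<^sub>M (borel \<Otimes>\<^sub>M (vague_borel \<Otimes>\<^sub>M vague_borel)) :: (real \<times> real \<times> real measure \<times> real measure) measure"
  have sq: "space limit_measure = space target_space" by (rule sets_eq_imp_space_eq[OF sets_limit_measure])
  have sp: "snd x \<in> space ?B" if "x \<in> space limit_measure" for x
    using that unfolding sq by (simp add: space_pair_measure mem_Times_iff)
  then have "{x \<in> space limit_measure. xi x \<in> A} = {x \<in> space limit_measure. xi x \<in> A \<and> snd x \<in> space ?B}"
    by blast
  then have "emeasure limit_measure {x \<in> space limit_measure. xi x \<in> A} =
      emeasure std_normal_distribution A * emeasure limit_measure {x \<in> space limit_measure. snd x \<in> space ?B}"
    by (simp only: emeasure_limit_measure_split[OF A sets.top] emeasure_limit_measure_rest[OF sets.top])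
  also have "{x \<in> space limit_measure. snd x \<in> space ?B} = space limit_measure"
    using sp by (intro equalityI subsetI CollectI) blast+
  finally show ?thesis by (simp add: Q.emeasure_space_1)
qed

lemma distributed_xi: "distributed limit_measure lborel xi std_normal_density"
  unfolding distributed_def
proof (intro conjI measure_eqI)
  show "xi \<in> measurable limit_measure lborel" by measurable
  show "(\<lambda>x. ennreal (std_normal_density x)) \<in> borel_measurable lborel" by measurable
  fix A assume "A \<in> sets (distr limit_measure lborel xi)"
  then have A: "A \<in> sets borel" by simp
  have m: "xi \<in> measurable limit_measure lborel" by measurable
  have "xi -` A \<inter> space limit_measure = {x \<in> space limit_measure. xi x \<in> A}" by auto
  then show "emeasure (distr limit_measure lborel xi) A = emeasure (density lborel (\<lambda>x. ennreal (std_normal_density x))) A"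
    unfolding emeasure_xi[OF A, symmetric] using A by (simp add: emeasure_distr[OF m])
qed simp

lemma indep_xi:
  "indep_rv limit_measure borel xi (borel \<Otimes>\<^sub>M borel \<Otimes>\<^sub>M vague_borel \<Otimes>\<^sub>M vague_borel) (\<lambda>x. (chi x, gap x, fst (conf x), snd (conf x)))"
  unfolding indep_rv_def
proof (intro conjI Q.indep_setI)
  let ?B = "borel \<Otimes>\<^sub>M borel \<Otimes>\<^sub>M vague_borel \<Otimes>\<^sub>M vague_borel :: (real \<times> real \<times> real measure \<times> real measure) measure"
  have s: "(\<lambda>x. (chi x, gap x, fst (conf x), snd (conf x))) = snd" by simp
  show m1: "xi \<in> measurable limit_measure borel" by measurable
  show m2: "(\<lambda>x. (chi x, gap x, fst (conf x), snd (conf x))) \<in> measurable limit_measure ?B" unfolding s by measurable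
  show "{xi -` A \<inter> space limit_measure | A. A \<in> sets borel} \<subseteq> Q.events" using measurable_sets[OF m1] by auto
  show "{(\<lambda>x. (chi x, gap x, fst (conf x), snd (conf x))) -` A \<inter> space limit_measure | A. A \<in> sets ?B} \<subseteq> Q.events"
    using measurable_sets[OF m2] by auto
  fix a b assume "a \<in> {xi -` A \<inter> space limit_measure | A. A \<in> sets borel}"
    "b \<in> {(\<lambda>x. (chi x, gap x, fst (conf x), snd (conf x))) -` A \<inter> space limit_measure | A. A \<in> sets ?B}"
  then obtain A B where A: "A \<in> sets borel" "a = {x \<in> space limit_measure. xi x \<in> A}"
    and B: "B \<in> sets ?B" "b = {x \<in> space limit_measure. snd x \<in> B}" by (auto simp: s)
  have ea: "emeasure limit_measure a = emeasure std_normal_distribution A" unfolding A(2) by (rule emeasure_xi[OF A(1)])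
  have "a \<inter> b = {x \<in> space limit_measure. xi x \<in> A \<and> snd x \<in> B}" unfolding A(2) B(2) by auto
  then have "emeasure limit_measure (a \<inter> b) = emeasure limit_measure a * emeasure limit_measure b"
    unfolding ea B(2) by (simp only: emeasure_limit_measure_split[OF A(1) B(1)] emeasure_limit_measure_rest[OF B(1)])
  then show "Q.prob (a \<inter> b) = Q.prob a * Q.prob b"
    by (simp add: measure_def enn2real_mult)
qed

lemma distributed_gap: "distributed limit_measure lborel (\<lambda>x. gap x) (exponential_density (sqrt 2 * \<gamma>))"
proof (rule exponential_distributedI)
  show "(\<lambda>x. gap x) \<in> borel_measurable limit_measure" by measurable
  show "0 < sqrt 2 * \<gamma>" by (rule beta_bounds)
  fix c :: real assume c: "0 \<le> c"
  have s: "{x \<in> space limit_measure. c < gap x} \<in> sets limit_measure" by measurable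
  have "{x \<in> space limit_measure. gap x \<le> c} = space limit_measure - {x \<in> space limit_measure. c < gap x}" by auto
  then have "emeasure limit_measure {x \<in> space limit_measure. gap x \<le> c} = 1 - ennreal (tilt c)"
    using s by (simp add: emeasure_compl limit_gap[OF c] Q.emeasure_space_1)
  also have "tilt c = exp (- c * (sqrt 2 * \<gamma>))" by (simp add: tilt_def ac_simps)
  finally show "emeasure limit_measure {x \<in> space limit_measure. gap x \<le> c} = 1 - ennreal (exp (- c * (sqrt 2 * \<gamma>)))" .
qed

lemma joint_law_limit:
  assumes y: "0 \<le> y"
  shows "measure limit_measure {\<omega> \<in> space limit_measure. chi \<omega> \<le> c \<and> y \<le> gap \<omega>} =
    1 / (2 * c1) * tilt y * (LINT z:{..c - y}|lborel. tilt z * (cdf_lim z)\<^sup>2)"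
proof -
  have i: "integrable lborel (\<lambda>z. indicator {..c - y} z *\<^sub>R (tilt z * (cdf_lim z)\<^sup>2))"
    by (intro integrable_mult_indicator integrable_tilt_cdf) simp
  have p: "0 \<le> tilt z * (cdf_lim z)\<^sup>2" for z using tilt_pos[of z] by simp
  have "(\<integral>\<^sup>+z. ennreal (tilt z / (2 * c1) * (cdf_lim z)\<^sup>2) * indicator {..c - y} z \<partial>lborel) =
    (\<integral>\<^sup>+z. ennreal (1 / (2 * c1) * (indicator {..c - y} z *\<^sub>R (tilt z * (cdf_lim z)\<^sup>2))) \<partial>lborel)"
    by (intro nn_integral_cong) (simp add: indicator_def ac_simps)
  also have "\<dots> = ennreal (\<integral>z. 1 / (2 * c1) * (indicator {..c - y} z *\<^sub>R (tilt z * (cdf_lim z)\<^sup>2)) \<partial>lborel)"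
    using i c1_pos p by (intro nn_integral_eq_integral integrable_mult_right AE_I2 mult_nonneg_nonneg) (auto simp: indicator_def)
  also have "(\<integral>z. 1 / (2 * c1) * (indicator {..c - y} z *\<^sub>R (tilt z * (cdf_lim z)\<^sup>2)) \<partial>lborel) =
     1 / (2 * c1) * (LINT z:{..c - y}|lborel. tilt z * (cdf_lim z)\<^sup>2)"
    unfolding set_lebesgue_integral_def by (rule integral_mult_right_zero)
  finally have I: "(\<integral>\<^sup>+z. ennreal (tilt z / (2 * c1) * (cdf_lim z)\<^sup>2) * indicator {..c - y} z \<partial>lborel) =
     ennreal (1 / (2 * c1) * (LINT z:{..c - y}|lborel. tilt z * (cdf_lim z)\<^sup>2))" .
  have n: "0 \<le> (LINT z:{..c - y}|lborel. tilt z * (cdf_lim z)\<^sup>2)"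
    unfolding set_lebesgue_integral_def by (intro integral_nonneg_AE AE_I2) (use p in \<open>auto simp: indicator_def\<close>)
  have "emeasure limit_measure {\<omega> \<in> space limit_measure. chi \<omega> \<le> c \<and> y \<le> gap \<omega>} =
     ennreal (tilt y * (1 / (2 * c1) * (LINT z:{..c - y}|lborel. tilt z * (cdf_lim z)\<^sup>2)))"
    unfolding limit_joint[OF y] I using n c1_pos tilt_pos[of y] by (intro ennreal_mult[symmetric]) auto
  then show ?thesis
    using n c1_pos tilt_pos[of y] by (simp add: measure_def ac_simps)
qed

lemma limit_variables_limit:
  assumes w: "\<And>z. w P T B z = cdf_lim z"
  shows "limit_variables P T B L limit_measure xi (\<lambda>x. chi x) (\<lambda>x. gap x) (\<lambda>x. fst (conf x)) (\<lambda>x. snd (conf x))"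
proof -
  have C: "C1 P T B = c1" unfolding C1_def c1_def w tilt_def ..
  show ?thesis
    unfolding limit_variables_def Let_def C w
    using limit_measure_prob distributed_xi distributed_gap joint_law_limit[unfolded tilt_def] conditional_law_limit indep_xi AE_max_atom_limit
    by simp
qed

section \<open>Identification of the limit with an expectation\<close>

definition limit_observation ::
    "real \<times> real \<times> real \<times> real measure \<times> real measure \<Rightarrow> (real \<times> real \<times> real) \<times> real measure" where
  "limit_observation x = ((xi x, - chi x, - gap x), shift_left (chi x) (superposition (fst (conf x)) (snd (conf x))))"

lemma measurable_limit_observation [measurable]:
  "limit_observation \<in> measurable target_space (borel \<Otimes>\<^sub>M vague_borel)"
proof -
  have "limit_observation = (\<lambda>x. observe (xi x) (chi x) (((fst (conf x), chi x - gap x), (snd (conf x), chi x - gap x)), chi x))"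
    by (simp add: fun_eq_iff limit_observation_def observe_def)
  also have "\<dots> \<in> measurable target_space (borel \<Otimes>\<^sub>M vague_borel)" by measurable
  finally show ?thesis .
qed

text \<open>Replaces the pair of joint limit laws by two copies of the extremal law, on which the
  maxima are functions of the configurations.\<close>

lemma limit_integrand_L:
  assumes g [measurable]: "g \<in> borel_measurable (borel \<Otimes>\<^sub>M vague_borel)"
  shows "limit_integrand g q = (\<integral>N. g (limit_observation (limit_point (q, N))) * of_bool (top_atom N \<le> snd q) \<partial>(L \<Otimes>\<^sub>M L))"
proof -
  let ?f = "\<lambda>\<mu>. (\<mu>, max_atom \<mu>)"
  let ?S = "borel_of state_topology"
  have sS: "sets (?S \<Otimes>\<^sub>M ?S) = sets (state_space \<Otimes>\<^sub>M state_space)"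
    by (intro sets_pair_measure_cong sets_state_topology)
  have d: "LL \<Otimes>\<^sub>M LL = distr (L \<Otimes>\<^sub>M L) (?S \<Otimes>\<^sub>M ?S) (\<lambda>(\<mu>, \<nu>). (?f \<mu>, ?f \<nu>))"
    by (rule pair_measure_distr[OF measurable_pair_max_atom measurable_pair_max_atom]) unfold_locales
  have f: "(\<lambda>(\<mu>, \<nu>). (?f \<mu>, ?f \<nu>)) \<in> measurable (L \<Otimes>\<^sub>M L) (?S \<Otimes>\<^sub>M ?S)"
    unfolding measurable_cong_sets[OF refl sS] by measurable
  have h: "(\<lambda>p. g (observe (fst q) (snd q) (p, snd q)) * of_bool (max (snd (fst p)) (snd (snd p)) - snd q \<le> 0))
      \<in> borel_measurable (?S \<Otimes>\<^sub>M ?S)"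
    unfolding measurable_cong_sets[OF sS refl] by measurable
  show ?thesis
    unfolding limit_integrand_def d integral_distr[OF f h]
    by (intro Bochner_Integration.integral_cong refl)
      (simp add: split_beta observe_def limit_observation_def limit_point_def top_atom_def)
qed

text \<open>The weight in \<open>main_limit\<close> is c1 times the density of the limit law; the
  constant of the asymptotics appears in this way.\<close>

lemma integral_limit_observation:
  fixes g :: "(real \<times> real \<times> real) \<times> real measure \<Rightarrow> real"
  assumes g [measurable]: "g \<in> borel_measurable (borel \<Otimes>\<^sub>M vague_borel)" and C: "\<And>x. \<bar>g x\<bar> \<le> C"
  shows "(\<integral>q. std_normal_density (fst q) / 2 * tilt (snd q) * limit_integrand g q \<partial>(lborel \<Otimes>\<^sub>M lborel)) =
    c1 * (\<integral>x. g (limit_observation x) \<partial>limit_measure)"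
proof -
  interpret ll: pair_sigma_finite "lborel \<Otimes>\<^sub>M lborel :: (real \<times> real) measure" "L \<Otimes>\<^sub>M L" ..
  let ?M = "(lborel \<Otimes>\<^sub>M lborel) \<Otimes>\<^sub>M (L \<Otimes>\<^sub>M L)"
  note lb = measurable_cong_sets[OF sets_base refl]
  define D where "D = (\<lambda>v :: (real \<times> real) \<times> (real measure \<times> real measure).
    std_normal_density (fst (fst v)) * (tilt (snd (fst v)) / (2 * c1)) * of_bool (top_atom (snd v) \<le> snd (fst v)))"
  define h where "h = (\<lambda>v. g (limit_observation (limit_point v)))"
  have D: "base_density = (\<lambda>v. ennreal (D v))"
    using tilt_pos c1_pos by (simp add: fun_eq_iff base_density_def D_def indicator_def)
  have Dn: "0 \<le> D v" for v unfolding D_def using tilt_pos[of "snd (fst v)"] c1_pos by simp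
  have Dm: "D \<in> borel_measurable ?M" unfolding lb D_def by measurable
  have hm: "h \<in> borel_measurable ?M" unfolding lb h_def by measurable
  have lp: "limit_point \<in> measurable (density ?M base_density) target_space"
    unfolding measurable_cong_sets[OF sets_density refl] lb by (rule measurable_limit_point)
  note lp = lp[unfolded D]
  have gl: "(\<lambda>x. g (limit_observation x)) \<in> borel_measurable target_space" by measurable
  have "integrable limit_measure (\<lambda>x. g (limit_observation x))"
    using C gl by (intro Q.integrable_const_bound[where B=C]) (auto simp: measurable_cong_sets[OF sets_limit_measure refl])
  then have "integrable (density ?M (\<lambda>v. ennreal (D v))) h"
    unfolding limit_measure_def h_def D integrable_distr_eq[OF lp gl] .
  then have i: "integrable ?M (\<lambda>v. D v *\<^sub>R h v)"
    using integrable_density[OF hm Dm] Dn by simp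
  have "(\<integral>x. g (limit_observation x) \<partial>limit_measure) = (\<integral>v. h v \<partial>density ?M (\<lambda>v. ennreal (D v)))"
    unfolding limit_measure_def h_def D integral_distr[OF lp gl] ..
  also have "\<dots> = (\<integral>v. D v *\<^sub>R h v \<partial>?M)" by (rule integral_density[OF hm Dm]) (simp add: Dn)
  also have "\<dots> = (\<integral>q. (\<integral>N. D (q, N) *\<^sub>R h (q, N) \<partial>(L \<Otimes>\<^sub>M L)) \<partial>(lborel \<Otimes>\<^sub>M lborel))"
    by (rule ll.integral_fst'[OF i, symmetric])
  also have "\<dots> = (\<integral>q. 1 / c1 * (std_normal_density (fst q) / 2 * tilt (snd q) * limit_integrand g q) \<partial>(lborel \<Otimes>\<^sub>M lborel))"
  proof (intro Bochner_Integration.integral_cong refl)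
    fix q :: "real \<times> real"
    have "(\<integral>N. D (q, N) *\<^sub>R h (q, N) \<partial>(L \<Otimes>\<^sub>M L)) =
      (\<integral>N. (std_normal_density (fst q) * (tilt (snd q) / (2 * c1))) *
        (g (limit_observation (limit_point (q, N))) * of_bool (top_atom N \<le> snd q)) \<partial>(L \<Otimes>\<^sub>M L))"
      by (intro Bochner_Integration.integral_cong refl) (simp add: D_def h_def)
    also have "\<dots> = (std_normal_density (fst q) * (tilt (snd q) / (2 * c1))) * limit_integrand g q"
      unfolding limit_integrand_L[OF g] by (rule integral_mult_right_zero)
    finally show "(\<integral>N. D (q, N) *\<^sub>R h (q, N) \<partial>(L \<Otimes>\<^sub>M L)) =
      1 / c1 * (std_normal_density (fst q) / 2 * tilt (snd q) * limit_integrand g q)" by simp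
  qed
  also have "\<dots> = 1 / c1 * (\<integral>q. std_normal_density (fst q) / 2 * tilt (snd q) * limit_integrand g q \<partial>(lborel \<Otimes>\<^sub>M lborel))"
    by (rule integral_mult_right_zero)
  finally show ?thesis using c1_pos by simp
qed

lemma snapshot_limit:
  fixes a :: "real \<Rightarrow> real"
  assumes a0: "((\<lambda>t. a t / t) \<longlongrightarrow> 0) at_top" and a: "filterlim a at_top at_top"
    and g: "continuous_map obs_topology euclideanreal g" and C: "\<And>x. \<bar>g x\<bar> \<le> C"
  shows "((\<lambda>t. passage_weight (a t) * (\<integral>\<eta>. g (snapshot (a t) t \<eta>) * of_bool (maximum life disp t \<eta> \<le> m t - a t) \<partial>tree_law))
    \<longlongrightarrow> c1 * (\<integral>x. g (limit_observation x) \<partial>limit_measure)) at_top"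
proof (rule tendsto_at_topI_sequentially)
  fix T :: "nat \<Rightarrow> real" assume T: "filterlim T at_top sequentially"
  have aT: "filterlim (\<lambda>n. a (T n)) at_top sequentially" by (rule filterlim_compose[OF a T])
  have "\<forall>\<^sub>F n in sequentially. 0 < a (T n) \<and> 0 < T n"
    using aT T by (auto simp: filterlim_at_top_dense eventually_conj_iff)
  \<comment> \<open>\<open>main_limit\<close> asks for positivity at every n, so the sequence is
    shifted by N and the limit is shifted back by \<open>LIMSEQ_offset\<close>.\<close>
  then obtain N where N: "\<And>n. N \<le> n \<Longrightarrow> 0 < a (T n) \<and> 0 < T n" by (auto simp: eventually_sequentially)
  have sh: "filterlim (\<lambda>n. n + N) at_top sequentially" by (rule filterlim_add_const_nat_at_top)
  have gm: "g \<in> borel_measurable (borel \<Otimes>\<^sub>M vague_borel)"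
    using continuous_map_borel_measurable[OF g] by (simp add: measurable_cong_sets[OF sets_obs_topology refl])
  have "(\<lambda>n. passage_weight (a (T (n + N))) * (\<integral>\<eta>. observable g (a (T (n + N))) (T (n + N)) \<eta> \<partial>tree_law)) \<longlonglongrightarrow>
    (\<integral>q. std_normal_density (fst q) / 2 * tilt (snd q) * limit_integrand g q \<partial>(lborel \<Otimes>\<^sub>M lborel))"
    using N by (intro main_limit[where C=C] g C filterlim_compose[OF T sh] filterlim_compose[OF aT sh]
      filterlim_compose[OF filterlim_compose[OF a0 T] sh]) auto
  then have "(\<lambda>n. passage_weight (a (T n)) * (\<integral>\<eta>. observable g (a (T n)) (T n) \<eta> \<partial>tree_law)) \<longlonglongrightarrow>
    c1 * (\<integral>x. g (limit_observation x) \<partial>limit_measure)"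
    unfolding integral_limit_observation[OF gm C] by (rule LIMSEQ_offset)
  then show "(\<lambda>n. passage_weight (a (T n)) * (\<integral>\<eta>. g (snapshot (a (T n)) (T n) \<eta>) *
      of_bool (maximum life disp (T n) \<eta> \<le> m (T n) - a (T n)) \<partial>tree_law)) \<longlonglongrightarrow>
    c1 * (\<integral>x. g (limit_observation x) \<partial>limit_measure)"
    unfolding observable_def .
qed

end

section \<open>Conditioning on a low maximum\<close>

lemma integral_uniform_measure:
  fixes f :: "'a \<Rightarrow> real"
  assumes M: "prob_space M" and A: "A \<in> sets M" "0 < measure M A" and f: "f \<in> borel_measurable M"
  shows "(\<integral>x. f x \<partial>uniform_measure M A) = (\<integral>x. f x * of_bool (x \<in> A) \<partial>M) / measure M A"
proof -
  interpret prob_space M by fact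
  have u: "uniform_measure M A = density M (\<lambda>x. ennreal (of_bool (x \<in> A) / prob A))"
    unfolding uniform_measure_def using A(2)
    by (intro arg_cong[where f="density M"])
      (auto simp: fun_eq_iff indicator_def emeasure_eq_measure divide_ennreal ennreal_1[symmetric] simp del: ennreal_1)
  have "(\<integral>x. f x \<partial>uniform_measure M A) = (\<integral>x. (of_bool (x \<in> A) / prob A) *\<^sub>R f x \<partial>M)"
    unfolding u
  proof (rule integral_density[OF f])
    show "(\<lambda>x. of_bool (x \<in> A) / prob A) \<in> borel_measurable M" using A(1) by measurable
  qed simp
  also have "\<dots> = (\<integral>x. (f x * of_bool (x \<in> A)) / prob A \<partial>M)"
    by (intro Bochner_Integration.integral_cong refl) simp
  also have "\<dots> = (\<integral>x. f x * of_bool (x \<in> A) \<partial>M) / prob A" by (rule integral_divide_zero)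
  finally show ?thesis .
qed

lemma converges_in_law_cong:
  assumes "converges_in_law X \<mu> \<nu> F" "\<forall>\<^sub>F i in F. \<mu> i = \<mu>' i"
  shows "converges_in_law X \<mu>' \<nu> F"
  unfolding converges_in_law_def
proof (intro conjI allI impI)
  show "\<forall>\<^sub>F i in F. prob_space (\<mu>' i) \<and> sets (\<mu>' i) = sets (borel_of X)"
    using assms(2) conjunct1[OF assms(1)[unfolded converges_in_law_def]] by eventually_elim simp
  fix g assume g: "continuous_map X euclideanreal g \<and> bounded (g ` topspace X)"
  have "((\<lambda>i. \<integral>x. g x \<partial>\<mu> i) \<longlongrightarrow> (\<integral>x. g x \<partial>\<nu>)) F" using assms(1) g unfolding converges_in_law_def by simp
  then show "((\<lambda>i. \<integral>x. g x \<partial>\<mu>' i) \<longlongrightarrow> (\<integral>x. g x \<partial>\<nu>)) F"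
    by (rule Lim_transform_eventually) (use assms(2) in \<open>auto elim: eventually_mono\<close>)
qed (use assms(1) in \<open>auto simp: converges_in_law_def\<close>)

theorem theorem1p8:
  fixes P :: "'w measure"
    and T :: "bool list \<Rightarrow> 'w \<Rightarrow> real"
    and B :: "bool list \<Rightarrow> real \<Rightarrow> 'w \<Rightarrow> real"
    and \<L> :: "real measure measure"
    and a :: "real \<Rightarrow> real"
  assumes "branching_brownian_motion P T B"
    and "extremal_process_law P T B \<L>"
    and "((\<lambda>t. a t / t) \<longlongrightarrow> 0) at_top"
    and "filterlim a at_top at_top"
  shows "((\<lambda>t. measure P {\<omega> \<in> space P. maximum T B t \<omega> \<le> m t - a t} /
              (C1 P T B * exp (- sqrt 2 * \<gamma> * a t))) \<longlongrightarrow> 1) at_top \<and>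
    (\<exists>(Q :: (real \<times> real \<times> real \<times> real measure \<times> real measure) measure) \<xi> chi E \<E>\<^sub>1 \<E>\<^sub>2.
       limit_variables P T B \<L> Q \<xi> chi E \<E>\<^sub>1 \<E>\<^sub>2 \<and>
       (let X = prod_topology (euclidean :: (real \<times> real \<times> real) topology) vague_topology in
        converges_in_law X
          (\<lambda>t. distr
             (uniform_measure P {\<omega> \<in> space P. maximum T B t \<omega> \<le> m t - a t})
             (borel_of X)
             (\<lambda>\<omega>. let \<tau> = first_branching T \<omega> in
                (((\<tau> - a t / 2) / sqrt (a t / 8),
                  position T B [] \<tau> \<omega> - (sqrt 2 * \<tau> - a t),
                  maximum T B t \<omega> - (m t - a t)),
                 particles_from T B t (m t - a t) \<omega>)))
          (distr Q (borel_of X)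
             (\<lambda>\<omega>. ((\<xi> \<omega>, - chi \<omega>, - E \<omega>),
                   shift_left (chi \<omega>) (superposition (\<E>\<^sub>1 \<omega>) (\<E>\<^sub>2 \<omega>)))))
          at_top))"
proof -
  have P: "prob_space P" and pos: "\<And>u \<omega>. \<omega> \<in> space P \<Longrightarrow> 0 < T u \<omega>"
    and cont: "\<And>u \<omega>. \<omega> \<in> space P \<Longrightarrow> continuous_on {0..} (\<lambda>s. B u s \<omega>)"
    using assms(1) by (simp_all add: branching_brownian_motion_def brownian_motion_def)
  obtain W where W: "canonical_bbm W" and enc [measurable]: "encode T B \<in> measurable P tree_space"
    and tree: "distr P tree_space (encode T B) = canonical_bbm.tree_law W"
    using bbm_canonical[OF assms(1)] by blast
  interpret P: prob_space P by (rule P)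
  interpret canonical_bbm W by (rule W)
  have max: "maximum T B t \<omega> = maximum life disp t (encode T B \<omega>)" if "0 \<le> t" "\<omega> \<in> space P" for t \<omega>
    using maximum_encode[of B \<omega> T t] cont pos that by simp
  have part: "particles_from T B t c \<omega> = particles_from life disp t c (encode T B \<omega>)" if "0 \<le> t" "\<omega> \<in> space P" for t c \<omega>
    using particles_from_encode[of B \<omega> T t c] cont pos that by simp
  have transfer: "(\<integral>\<omega>. f (encode T B \<omega>) \<partial>P) = (\<integral>\<eta>. f \<eta> \<partial>tree_law)" if "f \<in> borel_measurable tree_space" for f :: "_ \<Rightarrow> real"
    unfolding tree[symmetric] by (rule integral_distr[OF enc that, symmetric])
  have law_P: "law t = distr P state_space (\<lambda>\<omega>. state t (encode T B \<omega>))" for t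
    unfolding law_def tree[symmetric] by (subst distr_distr) (measurable, simp add: comp_def)
  have law_eq: "distr P (borel_of state_topology) (\<lambda>\<omega>. (particles_from T B t (m t) \<omega>, maximum T B t \<omega> - m t)) = law t"
    if t: "0 \<le> t" for t
  proof -
    have "law t = distr P (borel_of state_topology) (\<lambda>\<omega>. (particles_from T B t (m t) \<omega>, maximum T B t \<omega> - m t))"
      unfolding law_P by (rule distr_cong) (simp_all add: sets_state_topology state_def max[OF t] part[OF t])
    then show ?thesis ..
  qed
  have L: "prob_space \<L>" "sets \<L> = sets vague_borel"
    and L_conv: "converges_in_law state_topology
      (\<lambda>t. distr P (borel_of state_topology) (\<lambda>\<omega>. (particles_from T B t (m t) \<omega>, maximum T B t \<omega> - m t)))
      (distr \<L> (borel_of state_topology) (\<lambda>\<mu>. (\<mu>, max_atom \<mu>))) at_top"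
    using assms(2) by (simp_all add: extremal_process_law_def Let_def)
  \<comment> \<open>The assumed convergence is carried over to the canonical laws. Encoding
    preserves positions at nonnegative times, so the laws are compared for t \<ge> 0.\<close>
  have "converges_in_law state_topology law (distr \<L> (borel_of state_topology) (\<lambda>\<mu>. (\<mu>, max_atom \<mu>))) at_top"
    by (rule converges_in_law_cong[OF L_conv]) (rule eventually_mono[OF eventually_ge_at_top[of 0]], rule law_eq)
  then interpret bbm_limit W \<L>
    by (intro bbm_limit.intro canonical_limit.intro canonical_limit_axioms.intro bbm_limit_axioms.intro W L)
  have cdf: "measure P {\<omega> \<in> space P. maximum T B t \<omega> \<le> m t + z} = cdf_max t z" if t: "0 \<le> t" for t z
  proof -
    have S: "{p \<in> space state_space. snd p \<le> z} \<in> sets state_space" by measurable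
    have st: "(\<lambda>\<omega>. state t (encode T B \<omega>)) \<in> measurable P state_space" by measurable
    have "cdf_max t z = measure (distr P state_space (\<lambda>\<omega>. state t (encode T B \<omega>))) {p \<in> space state_space. snd p \<le> z}"
      unfolding cdf_max_def law_P by simp
    also have "\<dots> = measure P ((\<lambda>\<omega>. state t (encode T B \<omega>)) -` {p \<in> space state_space. snd p \<le> z} \<inter> space P)"
      by (rule measure_distr[OF st S])
    also have "(\<lambda>\<omega>. state t (encode T B \<omega>)) -` {p \<in> space state_space. snd p \<le> z} \<inter> space P = {\<omega> \<in> space P. maximum T B t \<omega> \<le> m t + z}"
      using measurable_space[OF st] max[OF t] by (auto simp: state_def)
    finally show ?thesis ..
  qed
  have w_eq: "w P T B z = cdf_lim z" for z
    unfolding w_def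
  proof (rule tendsto_Lim)
    show "((\<lambda>t. measure P {\<omega> \<in> space P. maximum T B t \<omega> \<le> m t + z}) \<longlongrightarrow> cdf_lim z) at_top"
      by (rule Lim_transform_eventually[OF cdf_max_tendsto])
        (rule eventually_mono[OF eventually_ge_at_top[of 0]], rule cdf[symmetric])
  qed simp
  have C1_eq: "C1 P T B = c1" unfolding C1_def c1_def w_eq tilt_def ..
  define A where "A = (\<lambda>t. {\<omega> \<in> space P. maximum T B t \<omega> \<le> m t - a t})"
  define F where "F = (\<lambda>t \<omega>. let \<tau> = first_branching T \<omega> in
                (((\<tau> - a t / 2) / sqrt (a t / 8),
                  position T B [] \<tau> \<omega> - (sqrt 2 * \<tau> - a t),
                  maximum T B t \<omega> - (m t - a t)),
                 particles_from T B t (m t - a t) \<omega>))"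
  have A_eq: "A t = {\<omega> \<in> space P. maximum life disp t (encode T B \<omega>) \<le> m t - a t}" if "0 \<le> t" for t
    unfolding A_def using max[OF that] by auto
  have A_sets: "A t \<in> sets P" if "0 \<le> t" for t
    unfolding A_eq[OF that] by measurable
  have F_eq: "F t \<omega> = snapshot (a t) t (encode T B \<omega>)" if "0 \<le> t" "\<omega> \<in> space P" for t \<omega>
  proof -
    have 1: "first_branching T \<omega> = life [] (encode T B \<omega>)"
      using first_branching_eq[of T \<omega>] pos[OF that(2)] by (simp add: life_def encode_def)
    have 2: "position T B [] (T [] \<omega>) \<omega> = disp [] (T [] \<omega>) (encode T B \<omega>)"
      using disp_encode[of B "[]" \<omega> "T [] \<omega>" T] cont[OF that(2)] pos[OF that(2), of "[]"] by simp
    have 3: "life [] (encode T B \<omega>) = T [] \<omega>" by (simp add: life_def encode_def)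
    show ?thesis unfolding F_def snapshot_def Let_def 1 unfolding 3 2 max[OF that] part[OF that] ..
  qed
  have F_m: "F t \<in> measurable P (borel \<Otimes>\<^sub>M vague_borel)" if "0 \<le> t" for t
  proof -
    have "(\<lambda>\<omega>. snapshot (a t) t (encode T B \<omega>)) \<in> measurable P (borel \<Otimes>\<^sub>M vague_borel)" by measurable
    then show ?thesis by (subst measurable_cong[OF F_eq[OF that]])
  qed
  have lim: "((\<lambda>t. passage_weight (a t) * (\<integral>\<omega>. g (F t \<omega>) * of_bool (\<omega> \<in> A t) \<partial>P)) \<longlongrightarrow>
      c1 * (\<integral>x. g (limit_observation x) \<partial>limit_measure)) at_top"
    if g: "continuous_map obs_topology euclideanreal g" and C: "\<And>x. \<bar>g x\<bar> \<le> C" for g C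
  proof -
    have gm [measurable]: "g \<in> borel_measurable (borel \<Otimes>\<^sub>M vague_borel)"
      using continuous_map_borel_measurable[OF g] by (simp add: measurable_cong_sets[OF sets_obs_topology refl])
    show ?thesis
    proof (rule Lim_transform_eventually[OF snapshot_limit[OF assms(3,4) g C]])
      show "\<forall>\<^sub>F t in at_top. passage_weight (a t) * (\<integral>\<eta>. g (snapshot (a t) t \<eta>) * of_bool (maximum life disp t \<eta> \<le> m t - a t) \<partial>tree_law) =
        passage_weight (a t) * (\<integral>\<omega>. g (F t \<omega>) * of_bool (\<omega> \<in> A t) \<partial>P)"
        using eventually_ge_at_top[of 0]
      proof eventually_elim
        case (elim t)
        have "(\<lambda>\<eta>. g (snapshot (a t) t \<eta>) * of_bool (maximum life disp t \<eta> \<le> m t - a t)) \<in> borel_measurable tree_space"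
          by measurable
        from transfer[OF this, symmetric] show ?case
          by (simp only:) (intro arg_cong[where f="\<lambda>x. passage_weight (a t) * x"] Bochner_Integration.integral_cong refl,
            simp add: F_eq[OF elim] A_eq[OF elim])
      qed
    qed
  qed
  \<comment> \<open>The case g = 1, in which the expectation under the limit law is 1.\<close>
  have prob_lim: "((\<lambda>t. passage_weight (a t) * measure P (A t)) \<longlongrightarrow> c1) at_top"
  proof -
    have "\<forall>\<^sub>F t in at_top. (\<integral>\<omega>. (1::real) * of_bool (\<omega> \<in> A t) \<partial>P) = measure P (A t)"
      using eventually_ge_at_top[of 0]
    proof eventually_elim
      case (elim t)
      have "(\<integral>\<omega>. (1::real) * of_bool (\<omega> \<in> A t) \<partial>P) = (\<integral>\<omega>. indicator (A t) \<omega> \<partial>P)"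
        by (intro Bochner_Integration.integral_cong refl) (simp add: indicator_def)
      then show ?case using A_sets[OF elim] by simp
    qed
    moreover have "((\<lambda>t. passage_weight (a t) * (\<integral>\<omega>. (1::real) * of_bool (\<omega> \<in> A t) \<partial>P)) \<longlongrightarrow> c1) at_top"
      using lim[of "\<lambda>_. 1" 1] by (simp add: Q.prob_space)
    ultimately show ?thesis by (rule_tac Lim_transform_eventually) (auto elim: eventually_mono)
  qed
  have pw: "0 < passage_weight x" for x by (simp add: passage_weight_def)
  \<comment> \<open>Positivity of c1 makes the conditioning meaningful for all large t.\<close>
  have A_pos: "\<forall>\<^sub>F t in at_top. 0 < measure P (A t)"
    using order_tendstoD(1)[OF prob_lim c1_pos] by eventually_elim (use pw in \<open>auto simp: zero_less_mult_iff not_less measure_nonneg\<close>)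
  show ?thesis
  proof (intro conjI exI)
    have "((\<lambda>t. passage_weight (a t) * measure P (A t) / c1) \<longlongrightarrow> c1 / c1) at_top"
      by (intro tendsto_divide prob_lim tendsto_const) (use c1_pos in simp)
    then have "((\<lambda>t. passage_weight (a t) * measure P (A t) / c1) \<longlongrightarrow> 1) at_top" using c1_pos by simp
    moreover have "passage_weight x * q / c1 = q / (c1 * exp (- sqrt 2 * \<gamma> * x))" for x q
      by (simp add: passage_weight_def exp_minus field_simps)
    ultimately show "((\<lambda>t. measure P {\<omega> \<in> space P. maximum T B t \<omega> \<le> m t - a t} /
              (C1 P T B * exp (- sqrt 2 * \<gamma> * a t))) \<longlongrightarrow> 1) at_top"
      unfolding C1_eq A_def by simp
    show "limit_variables P T B \<L> limit_measure xi (\<lambda>x. chi x) (\<lambda>x. gap x) (\<lambda>x. fst (conf x)) (\<lambda>x. snd (conf x))"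
      by (rule limit_variables_limit[OF w_eq])
    have lo: "limit_observation \<in> measurable limit_measure (borel_of obs_topology)"
      unfolding measurable_cong_sets[OF sets_limit_measure sets_obs_topology] by measurable
    have Fm': "F t \<in> measurable P (borel_of obs_topology)" if "0 \<le> t" for t
      unfolding measurable_cong_sets[OF refl sets_obs_topology] by (rule F_m[OF that])
    have "converges_in_law obs_topology (\<lambda>t. distr (uniform_measure P (A t)) (borel_of obs_topology) (F t))
       (distr limit_measure (borel_of obs_topology) limit_observation) at_top"
      unfolding converges_in_law_def
    proof (intro conjI allI impI)
      show "\<forall>\<^sub>F t in at_top. prob_space (distr (uniform_measure P (A t)) (borel_of obs_topology) (F t)) \<and>
         sets (distr (uniform_measure P (A t)) (borel_of obs_topology) (F t)) = sets (borel_of obs_topology)"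
        using A_pos eventually_ge_at_top[of 0]
      proof eventually_elim
        case (elim t)
        have "prob_space (uniform_measure P (A t))"
          using elim by (intro prob_space_uniform_measure) (simp_all add: P.emeasure_eq_measure)
        then show ?case using Fm'[OF elim(2)] by (auto intro!: prob_space.prob_space_distr)
      qed
      show "prob_space (distr limit_measure (borel_of obs_topology) limit_observation)" by (rule Q.prob_space_distr[OF lo])
      show "sets (distr limit_measure (borel_of obs_topology) limit_observation) = sets (borel_of obs_topology)" by simp
      fix g assume g: "continuous_map obs_topology euclideanreal g \<and> bounded (g ` topspace obs_topology)"
      then obtain C where "\<forall>y\<in>g ` topspace obs_topology. norm y \<le> C" unfolding bounded_iff by blast
      then have C: "\<bar>g x\<bar> \<le> C" if "x \<in> topspace obs_topology" for x
        using bspec[OF _ imageI[OF that], of g "\<lambda>y. norm y \<le> C"] by (simp only: real_norm_def)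
      \<comment> \<open>g is bounded on the topological space only, while the limit above asks for a
        bound everywhere; h is zero outside and agrees with g where the measures live.\<close>
      define h where "h = (\<lambda>x. if x \<in> topspace obs_topology then g x else 0)"
      have hg: "h x = g x" if "x \<in> space (borel_of obs_topology)" for x using that by (simp add: h_def space_borel_of)
      have hc: "continuous_map obs_topology euclideanreal h"
        using g by (auto intro: continuous_map_eq simp: h_def)
      have hb: "\<bar>h x\<bar> \<le> \<bar>C\<bar>" for x using C[of x] by (auto simp: h_def)
      have gm: "g \<in> borel_measurable (borel_of obs_topology)" by (rule continuous_map_borel_measurable) (use g in blast)
      have hm: "h \<in> borel_measurable (borel_of obs_topology)" by (rule continuous_map_borel_measurable[OF hc])
      \<comment> \<open>The common weight cancels in the quotient, which leaves the conditional
        expectation on one side and the expectation under the limit law on the other.\<close>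
      have "((\<lambda>t. (passage_weight (a t) * (\<integral>\<omega>. h (F t \<omega>) * of_bool (\<omega> \<in> A t) \<partial>P)) / (passage_weight (a t) * measure P (A t))) \<longlongrightarrow>
          (c1 * (\<integral>x. h (limit_observation x) \<partial>limit_measure)) / c1) at_top"
        by (intro tendsto_divide lim[OF hc hb] prob_lim) (use c1_pos in simp)
      moreover have "(c1 * (\<integral>x. h (limit_observation x) \<partial>limit_measure)) / c1 =
         (\<integral>x. g x \<partial>distr limit_measure (borel_of obs_topology) limit_observation)"
      proof -
        have "(\<integral>x. g x \<partial>distr limit_measure (borel_of obs_topology) limit_observation) = (\<integral>x. h x \<partial>distr limit_measure (borel_of obs_topology) limit_observation)"
          by (intro Bochner_Integration.integral_cong refl) (simp add: hg)
        then show ?thesis using c1_pos by (simp add: integral_distr[OF lo hm])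
      qed
      moreover have "\<forall>\<^sub>F t in at_top. (passage_weight (a t) * (\<integral>\<omega>. h (F t \<omega>) * of_bool (\<omega> \<in> A t) \<partial>P)) / (passage_weight (a t) * measure P (A t)) =
         (\<integral>x. g x \<partial>distr (uniform_measure P (A t)) (borel_of obs_topology) (F t))"
        using A_pos eventually_ge_at_top[of 0]
      proof eventually_elim
        case (elim t)
        have Fu: "F t \<in> measurable (uniform_measure P (A t)) (borel_of obs_topology)"
          using Fm'[OF elim(2)] by simp
        have "(\<integral>x. g x \<partial>distr (uniform_measure P (A t)) (borel_of obs_topology) (F t)) =
          (\<integral>x. h x \<partial>distr (uniform_measure P (A t)) (borel_of obs_topology) (F t))"
          by (intro Bochner_Integration.integral_cong refl) (simp add: hg)
        also have "\<dots> = (\<integral>\<omega>. h (F t \<omega>) \<partial>uniform_measure P (A t))" by (rule integral_distr[OF Fu hm])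
        also have "\<dots> = (\<integral>\<omega>. h (F t \<omega>) * of_bool (\<omega> \<in> A t) \<partial>P) / measure P (A t)"
          by (rule integral_uniform_measure[OF P A_sets[OF elim(2)] elim(1) measurable_compose[OF Fm'[OF elim(2)] hm]])
        finally show ?case using pw[of "a t"] by simp
      qed
      ultimately show "((\<lambda>t. \<integral>x. g x \<partial>distr (uniform_measure P (A t)) (borel_of obs_topology) (F t)) \<longlongrightarrow>
         (\<integral>x. g x \<partial>distr limit_measure (borel_of obs_topology) limit_observation)) at_top"
        by (simp only: Lim_transform_eventually)
    qed
    then show "let X = prod_topology (euclidean :: (real \<times> real \<times> real) topology) vague_topology in
        converges_in_law X
          (\<lambda>t. distr
             (uniform_measure P {\<omega> \<in> space P. maximum T B t \<omega> \<le> m t - a t})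
             (borel_of X)
             (\<lambda>\<omega>. let \<tau> = first_branching T \<omega> in
                (((\<tau> - a t / 2) / sqrt (a t / 8),
                  position T B [] \<tau> \<omega> - (sqrt 2 * \<tau> - a t),
                  maximum T B t \<omega> - (m t - a t)),
                 particles_from T B t (m t - a t) \<omega>)))
          (distr limit_measure (borel_of X)
             (\<lambda>\<omega>. ((xi \<omega>, - chi \<omega>, - gap \<omega>),
                   shift_left (chi \<omega>) (superposition (fst (conf \<omega>)) (snd (conf \<omega>))))))
          at_top"
      unfolding A_def F_def limit_observation_def[abs_def] by (simp add: Let_def)
  qed
qed

end
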